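(* Let $X$ be a normal toric affine variety over $\mathbf{k}$ with no torus factor, let $G=\langle U_1,\ldots,U_s\rangle\subset\mathrm{Aut}(X)$ be the subgroup generated by root subgroups $U_i=\{\exp(t\partial_i)\mid t\in\mathbf{k}\}$, $i=1,\dots,s$, where the $\partial_i$ are root derivations of $\mathcal{O}(X)$ associated with Demazure roots, let $L$ be the Lie algebra generated by $\partial_1,\ldots,\partial_s$, and let $\Gamma(L)$ be the associated directed graph. Then the following are equivalent: (i) $L$ has no $2$-cycle of root derivations; (ii) the graph $\Gamma(L)$ has no oriented cycle, in particular, no bidirected edge; (iii) $L$ is finite-dimensional and nilpotent; (iv) $G$ is a unipotent algebraic group acting regularly on $X$. In the latter case one has $L=\mathrm{Lie}(G)$.
   Context: $\mathbf{k}$ is an algebraically closed field of characteristic zero. Let $N$ be a lattice of finite rank, $N^\vee$ the dual lattice, $\langle\cdot,\cdot\rangle:N\times N^\vee\to\mathbb{Z}$ the pairing. $X=\mathrm{Spec}\,\bigoplus_{m\in\Delta^\vee}\mathbf{k}\chi^m$, where $\Delta^\vee$ is the set of lattice points of the cone dual to a pointed rational polyhedral cone $\Delta_{\mathbb{Q}}\subset N_{\mathbb{Q}}$; "no torus factor" means that $\Delta_{\mathbb{Q}}$ is full-dimensional. Let $\rho_1,\ldots,\rho_k\in N$ be the ray generators (primitive lattice vectors on the extremal rays of $\Delta_{\mathbb{Q}}$). For $j=1,\dots,k$ put $S_j=\{e\in N^\vee\mid\langle\rho_j,e\rangle=-1,\ \langle\rho_i,e\rangle\ge0\ \forall i\ne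 j\}$; elements of $\bigcup_jS_j$ are the Demazure roots. To $e\in S_j$ is associated the root derivation $\partial_{\rho_j,e}$ of $\mathcal{O}(X)$, $\partial_{\rho_j,e}(\chi^m)=\langle\rho_j,m\rangle\chi^{m+e}$, which is locally nilpotent, and the root subgroup $\{\exp(t\partial_{\rho_j,e})\mid t\in\mathbf{k}\}$. Let $R_i=\{e\in S_i\mid\partial_{\rho_i,e}\in L\}$ and let $L_i\subset L$ be the abelian Lie subalgebra generated by $\partial_{\rho_i,e}$, $e\in R_i$. The ray generators are numbered so that $R_i\neq\emptyset$ iff $i\le r$. A $2$-cycle of root derivations in $L$ is a pair $\partial_{\rho_i,e},\partial_{\rho_j,e'}$ with $e\in R_i$, $e'\in R_j$, $\langle\rho_j,e\rangle>0$ and $\langle\rho_i,e'\rangle>0$. The directed graph $\Gamma(L)$ has the $r$ vertices $L_1,\ldots,L_r$, with a directed edge $[L_j\to L_i]$ if and only if $\langle\rho_j,e\rangle>0$ for some $e\in R_i$; a bidirected edge is a pair of edges $[L_j\to L_i]$, $[L_i\to L_j]$. *)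

theory Defs
  imports
    "HOL-Library.Function_Algebras"
    "HOL-Library.Poly_Mapping"
    "HOL-Computational_Algebra.Polynomial"
    "HOL-Algebra.Bij"
    "HOL-Algebra.Generated_Groups"
    "Jordan_Normal_Form.Determinant"
    "Graph_Theory.Arc_Walk"
begin

section \<open>Lattices and cones\<close>

text \<open>
  A lattice of rank \<open>n\<close> and its dual are both represented by the integer sequences supported on
  \<open>{..<n}\<close> (so \<open>n = 0\<close> is allowed), paired by the standard bilinear form; \<open>N\<^sub>\<rat>\<close> is represented by
  the rational sequences supported on \<open>{..<n}\<close>.
\<close>

definition int_lattice :: "nat \<Rightarrow> (nat \<Rightarrow> int) set" where
  "int_lattice n = {v. \<forall>i\<ge>n. v i = 0}"

definition rat_space :: "nat \<Rightarrow> (nat \<Rightarrow> rat) set" where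
  "rat_space n = {x. \<forall>i\<ge>n. x i = 0}"

definition pairing :: "nat \<Rightarrow> (nat \<Rightarrow> int) \<Rightarrow> (nat \<Rightarrow> int) \<Rightarrow> int" where
  "pairing n v m = (\<Sum>i<n. v i * m i)"

definition to_rat :: "(nat \<Rightarrow> int) \<Rightarrow> nat \<Rightarrow> rat" where
  "to_rat v = (\<lambda>i. of_int (v i))"

definition rat_scale :: "rat \<Rightarrow> (nat \<Rightarrow> rat) \<Rightarrow> nat \<Rightarrow> rat" where
  "rat_scale c x = (\<lambda>i. c * x i)"

lemma vector_space_rat_scale: "vector_space rat_scale"
  by unfold_locales (auto simp: rat_scale_def fun_eq_iff algebra_simps)

definition rational_polyhedral_cone :: "nat \<Rightarrow> (nat \<Rightarrow> rat) set \<Rightarrow> bool" where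
  "rational_polyhedral_cone n \<sigma> \<longleftrightarrow>
     (\<exists>V. finite V \<and> V \<subseteq> int_lattice n \<and>
          \<sigma> = {\<Sum>v\<in>V. rat_scale (c v) (to_rat v) | c. \<forall>v\<in>V. 0 \<le> c v})"

definition pointed :: "(nat \<Rightarrow> rat) set \<Rightarrow> bool" where
  "pointed \<sigma> \<longleftrightarrow> (\<forall>x\<in>\<sigma>. - x \<in> \<sigma> \<longrightarrow> x = 0)"

definition full_dimensional :: "nat \<Rightarrow> (nat \<Rightarrow> rat) set \<Rightarrow> bool" where
  "full_dimensional n \<sigma> \<longleftrightarrow> module.span rat_scale \<sigma> = rat_space n"

definition dual_lattice_points :: "nat \<Rightarrow> (nat \<Rightarrow> rat) set \<Rightarrow> (nat \<Rightarrow> int) set" where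
  "dual_lattice_points n \<sigma> = {m \<in> int_lattice n. \<forall>x\<in>\<sigma>. 0 \<le> (\<Sum>i<n. x i * of_int (m i))}"

definition ray :: "(nat \<Rightarrow> rat) \<Rightarrow> (nat \<Rightarrow> rat) set" where
  "ray x = {rat_scale c x | c. 0 \<le> c}"

definition extremal_ray :: "(nat \<Rightarrow> rat) set \<Rightarrow> (nat \<Rightarrow> rat) set \<Rightarrow> bool" where
  "extremal_ray \<sigma> R \<longleftrightarrow> (\<exists>x. x \<noteq> 0 \<and> R = ray x) \<and> R \<subseteq> \<sigma> \<and>
     (\<forall>x\<in>\<sigma>. \<forall>y\<in>\<sigma>. x + y \<in> R \<longrightarrow> x \<in> R \<and> y \<in> R)"

definition primitive :: "nat \<Rightarrow> (nat \<Rightarrow> int) \<Rightarrow> bool" where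
  "primitive n v \<longleftrightarrow> v \<in> int_lattice n \<and> v \<noteq> 0 \<and>
     (\<forall>w\<in>int_lattice n. \<forall>c. v = (\<lambda>i. c * w i) \<longrightarrow> \<bar>c\<bar> = 1)"

definition ray_generators :: "nat \<Rightarrow> (nat \<Rightarrow> rat) set \<Rightarrow> (nat \<Rightarrow> int) set" where
  "ray_generators n \<sigma> = {v. primitive n v \<and> extremal_ray \<sigma> (ray (to_rat v))}"

text \<open>The set \<open>S\<^sub>j\<close>, for ray generators \<open>\<rho> 1, \<dots>, \<rho> k\<close>.\<close>

definition demazure_roots ::
  "nat \<Rightarrow> nat \<Rightarrow> (nat \<Rightarrow> nat \<Rightarrow> int) \<Rightarrow> nat \<Rightarrow> (nat \<Rightarrow> int) set" where
  "demazure_roots n k \<rho> j = {e \<in> int_lattice n. pairing n (\<rho> j) e = -1 \<and>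
     (\<forall>i\<in>{1..k}. i \<noteq> j \<longrightarrow> 0 \<le> pairing n (\<rho> i) e)}"


section \<open>The coordinate ring, its derivations and automorphisms\<close>

text \<open>
  Finitely supported functions with convolution product: the character \<open>\<chi>\<^sup>m\<close> is
  \<open>Poly_Mapping.single m 1\<close>.
\<close>

type_synonym 'k laurent = "(nat \<Rightarrow> int) \<Rightarrow>\<^sub>0 'k"

definition toric_ring :: "nat \<Rightarrow> (nat \<Rightarrow> rat) set \<Rightarrow> 'k::field laurent set" where
  "toric_ring n \<sigma> = {f. Poly_Mapping.keys f \<subseteq> dual_lattice_points n \<sigma>}"

definition const :: "'k::field \<Rightarrow> 'k laurent" where
  "const c = Poly_Mapping.single 0 c"

text \<open>
  A linear endomorphism of a subalgebra \<open>A\<close> is encoded as a function that vanishes outside \<open>A\<close>, so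
  that equality and linear combinations of endomorphisms are those of functions.
\<close>

type_synonym 'k endo = "'k laurent \<Rightarrow> 'k laurent"

definition endo_scale :: "'k::field \<Rightarrow> 'k endo \<Rightarrow> 'k endo" where
  "endo_scale c D = (\<lambda>f. const c * D f)"

lemma vector_space_endo_scale: "vector_space endo_scale"
  by unfold_locales
    (auto simp: endo_scale_def const_def fun_eq_iff algebra_simps single_add mult_single
          simp flip: mult.assoc)

definition derivations :: "'k::field laurent set \<Rightarrow> 'k endo set" where
  "derivations A = {D. (\<forall>f. f \<notin> A \<longrightarrow> D f = 0) \<and> (\<forall>f\<in>A. D f \<in> A) \<and>
     (\<forall>f\<in>A. \<forall>g\<in>A. D (f + g) = D f + D g) \<and>
     (\<forall>c. \<forall>f\<in>A. D (const c * f) = const c * D f) \<and>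
     (\<forall>f\<in>A. \<forall>g\<in>A. D (f * g) = D f * g + f * D g)}"

definition root_derivation ::
  "nat \<Rightarrow> 'k::field laurent set \<Rightarrow> (nat \<Rightarrow> int) \<Rightarrow> (nat \<Rightarrow> int) \<Rightarrow> 'k endo" where
  "root_derivation n A \<rho> e = (\<lambda>f. if f \<in> A
     then \<Sum>m\<in>Poly_Mapping.keys f.
            Poly_Mapping.single (m + e) (of_int (pairing n \<rho> m) * Poly_Mapping.lookup f m)
     else 0)"

text \<open>
  \<open>Aut(X)\<close> is represented by the group of \<open>\<k>\<close>-algebra automorphisms of \<open>O(X)\<close>: the automorphism
  \<open>g\<close> of \<open>X\<close> corresponds to \<open>f \<mapsto> f \<circ> g\<inverse>\<close>.
\<close>

definition algebra_autos :: "'k::field laurent set \<Rightarrow> 'k endo set" where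
  "algebra_autos A = {\<phi> \<in> Bij A.
     (\<forall>f\<in>A. \<forall>g\<in>A. \<phi> (f + g) = \<phi> f + \<phi> g \<and> \<phi> (f * g) = \<phi> f * \<phi> g) \<and>
     (\<forall>c. \<phi> (const c) = const c)}"

definition aut_group :: "'k::field laurent set \<Rightarrow> 'k endo monoid" where
  "aut_group A = BijGroup A \<lparr>carrier := algebra_autos A\<rparr>"

text \<open>
  \<open>Sum_any\<close> sums over the indices with a nonzero term; these are finitely many for each \<open>f\<close> when
  \<open>D\<close> is locally nilpotent.
\<close>

definition exp_derivation ::
  "'k::field_char_0 laurent set \<Rightarrow> 'k \<Rightarrow> 'k endo \<Rightarrow> 'k endo" where
  "exp_derivation A t D = (\<lambda>f\<in>A. Sum_any (\<lambda>i. const (t ^ i / fact i) * (D ^^ i) f))"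

definition root_subgroup :: "'k::field_char_0 laurent set \<Rightarrow> 'k endo \<Rightarrow> 'k endo set" where
  "root_subgroup A D = range (\<lambda>t. exp_derivation A t D)"


section \<open>Lie algebras of derivations\<close>

definition bracket :: "'k::field endo \<Rightarrow> 'k endo \<Rightarrow> 'k endo" where
  "bracket D E = (\<lambda>f. D (E f) - E (D f))"

definition lie_subalgebra :: "'k::field laurent set \<Rightarrow> 'k endo set \<Rightarrow> bool" where
  "lie_subalgebra A V \<longleftrightarrow> V \<subseteq> derivations A \<and> module.subspace endo_scale V \<and>
     (\<forall>D\<in>V. \<forall>E\<in>V. bracket D E \<in> V)"

definition lie_generated :: "'k::field laurent set \<Rightarrow> 'k endo set \<Rightarrow> 'k endo set" where
  "lie_generated A S = lie_subalgebra A hull S"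

definition finite_dimensional :: "'k::field endo set \<Rightarrow> bool" where
  "finite_dimensional V \<longleftrightarrow> (\<exists>B. finite B \<and> V = module.span endo_scale B)"

fun lower_central :: "'k::field endo set \<Rightarrow> nat \<Rightarrow> 'k endo set" where
  "lower_central V 0 = V"
| "lower_central V (Suc i) =
     module.span endo_scale {bracket D E | D E. D \<in> V \<and> E \<in> lower_central V i}"

definition lie_nilpotent :: "'k::field endo set \<Rightarrow> bool" where
  "lie_nilpotent V \<longleftrightarrow> (\<exists>i. lower_central V i = {0})"


section \<open>The graph of root derivations\<close>

text \<open>The sets \<open>R\<^sub>i\<close>, the subalgebras \<open>L\<^sub>i\<close>, and the graph \<open>\<Gamma>(L)\<close> with vertices \<open>L\<^sub>1, \<dots>, L\<^sub>r\<close>.\<close>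

definition roots_in :: "nat \<Rightarrow> nat \<Rightarrow> (nat \<Rightarrow> nat \<Rightarrow> int) \<Rightarrow> 'k::field laurent set \<Rightarrow>
    'k endo set \<Rightarrow> nat \<Rightarrow> (nat \<Rightarrow> int) set" where
  "roots_in n k \<rho> A L i = {e \<in> demazure_roots n k \<rho> i. root_derivation n A (\<rho> i) e \<in> L}"

definition root_subalgebra :: "nat \<Rightarrow> nat \<Rightarrow> (nat \<Rightarrow> nat \<Rightarrow> int) \<Rightarrow> 'k::field laurent set \<Rightarrow>
    'k endo set \<Rightarrow> nat \<Rightarrow> 'k endo set" where
  "root_subalgebra n k \<rho> A L i =
     lie_generated A (root_derivation n A (\<rho> i) ` roots_in n k \<rho> A L i)"

definition has_two_cycle :: "nat \<Rightarrow> nat \<Rightarrow> (nat \<Rightarrow> nat \<Rightarrow> int) \<Rightarrow> 'k::field laurent set \<Rightarrow>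
    'k endo set \<Rightarrow> bool" where
  "has_two_cycle n k \<rho> A L \<longleftrightarrow>
     (\<exists>i\<in>{1..k}. \<exists>j\<in>{1..k}. \<exists>e\<in>roots_in n k \<rho> A L i. \<exists>e'\<in>roots_in n k \<rho> A L j.
        pairing n (\<rho> j) e > 0 \<and> pairing n (\<rho> i) e' > 0)"

definition root_graph :: "nat \<Rightarrow> nat \<Rightarrow> nat \<Rightarrow> (nat \<Rightarrow> nat \<Rightarrow> int) \<Rightarrow> 'k::field laurent set \<Rightarrow>
    'k endo set \<Rightarrow> ('k endo set, 'k endo set \<times> 'k endo set) pre_digraph" where
  "root_graph n k r \<rho> A L =
     \<lparr>verts = root_subalgebra n k \<rho> A L ` {1..r},
      arcs = {(root_subalgebra n k \<rho> A L j, root_subalgebra n k \<rho> A L i) | i j.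
                i \<in> {1..r} \<and> j \<in> {1..r} \<and> (\<exists>e\<in>roots_in n k \<rho> A L i. pairing n (\<rho> j) e > 0)},
      tail = fst, head = snd\<rparr>"

definition has_oriented_cycle :: "('v, 'v \<times> 'v) pre_digraph \<Rightarrow> bool" where
  "has_oriented_cycle \<Gamma> \<longleftrightarrow> (\<exists>p. pre_digraph.cycle \<Gamma> p)"

definition has_bidirected_edge :: "('v, 'v \<times> 'v) pre_digraph \<Rightarrow> bool" where
  "has_bidirected_edge \<Gamma> \<longleftrightarrow> (\<exists>u v. (u, v) \<in> arcs \<Gamma> \<and> (v, u) \<in> arcs \<Gamma>)"


section \<open>Unipotent algebraic groups and regular actions\<close>

definition GL :: "nat \<Rightarrow> 'k::field mat monoid" where
  "GL d = units_of (ring_mat TYPE('k) d ())"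

text \<open>The regular functions on \<open>GL\<^sub>d\<close>.\<close>

inductive_set regular_functions :: "nat \<Rightarrow> ('k::field mat \<Rightarrow> 'k) set" for d where
  scalar: "(\<lambda>_. c) \<in> regular_functions d"
| coordinate: "i < d \<Longrightarrow> j < d \<Longrightarrow> (\<lambda>h. h $$ (i, j)) \<in> regular_functions d"
| inverse_det: "(\<lambda>h. inverse (det h)) \<in> regular_functions d"
| add: "p \<in> regular_functions d \<Longrightarrow> q \<in> regular_functions d \<Longrightarrow>
          (\<lambda>h. p h + q h) \<in> regular_functions d"
| mult: "p \<in> regular_functions d \<Longrightarrow> q \<in> regular_functions d \<Longrightarrow>
          (\<lambda>h. p h * q h) \<in> regular_functions d"

definition linear_algebraic_group :: "nat \<Rightarrow> 'k::field mat set \<Rightarrow> bool" where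
  "linear_algebraic_group d H \<longleftrightarrow> subgroup H (GL d) \<and>
     (\<exists>P \<subseteq> regular_functions d. H = {h \<in> carrier (GL d). \<forall>p\<in>P. p h = 0})"

definition unipotent_group :: "nat \<Rightarrow> 'k::field mat set \<Rightarrow> bool" where
  "unipotent_group d H \<longleftrightarrow> linear_algebraic_group d H \<and>
     (\<forall>h\<in>H. \<exists>i. (h - 1\<^sub>m d) ^\<^sub>m i = 0\<^sub>m d d)"

text \<open>
  Let \<open>H\<close> act on \<open>A = O(X)\<close> via \<open>\<phi>\<close>. The predicate says that the orbit map \<open>h \<mapsto> \<phi> h f\<close>
  is given by the element \<open>\<Sum>l<N. c l \<otimes> g l\<close> of \<open>\<k>[H] \<otimes> O(X)\<close>.
\<close>

definition coaction_expansion :: "nat \<Rightarrow> 'k::field mat set \<Rightarrow> ('k mat \<Rightarrow> 'k endo) \<Rightarrow>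
    'k laurent set \<Rightarrow> 'k laurent \<Rightarrow> nat \<Rightarrow> (nat \<Rightarrow> 'k mat \<Rightarrow> 'k) \<Rightarrow> (nat \<Rightarrow> 'k laurent) \<Rightarrow> bool" where
  "coaction_expansion d H \<phi> A f N c g \<longleftrightarrow>
     (\<forall>l<N. c l \<in> regular_functions d \<and> g l \<in> A) \<and>
     (\<forall>h\<in>H. \<phi> h f = (\<Sum>l<N. const (c l h) * g l))"

text \<open>
  The action is a morphism \<open>H \<times> X \<rightarrow> X\<close> iff it has a comorphism \<open>O(X) \<rightarrow> \<k>[H] \<otimes> O(X)\<close>.
\<close>

definition regular_action :: "nat \<Rightarrow> 'k::field mat set \<Rightarrow> ('k mat \<Rightarrow> 'k endo) \<Rightarrow>
    'k laurent set \<Rightarrow> bool" where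
  "regular_action d H \<phi> A \<longleftrightarrow> (\<forall>f\<in>A. \<exists>N c g. coaction_expansion d H \<phi> A f N c g)"

text \<open>
  \<open>(d, H, \<phi>)\<close> makes the subgroup \<open>G\<close> of \<open>Aut(X)\<close> a unipotent algebraic group acting regularly
  on \<open>X\<close>.
\<close>

definition unipotent_structure :: "nat \<Rightarrow> 'k::field mat set \<Rightarrow> ('k mat \<Rightarrow> 'k endo) \<Rightarrow>
    'k laurent set \<Rightarrow> 'k endo set \<Rightarrow> bool" where
  "unipotent_structure d H \<phi> A G \<longleftrightarrow> unipotent_group d H \<and>
     \<phi> \<in> iso (GL d \<lparr>carrier := H\<rparr>) (aut_group A \<lparr>carrier := G\<rparr>) \<and>
     regular_action d H \<phi> A"

text \<open>
  The tangent space of \<open>H\<close> at the identity, as point derivations of \<open>\<k>[H]\<close>; elements of \<open>\<k>[H]\<close> are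
  given by their lifts to regular functions on \<open>GL\<^sub>d\<close>, whence the last condition.
\<close>

definition tangent_vector :: "nat \<Rightarrow> 'k::field mat set \<Rightarrow> (('k mat \<Rightarrow> 'k) \<Rightarrow> 'k) \<Rightarrow> bool" where
  "tangent_vector d H v \<longleftrightarrow>
     (\<forall>p\<in>regular_functions d. \<forall>q\<in>regular_functions d.
        v (\<lambda>h. p h + q h) = v p + v q \<and>
        v (\<lambda>h. p h * q h) = p (1\<^sub>m d) * v q + v p * q (1\<^sub>m d)) \<and>
     (\<forall>a. \<forall>p\<in>regular_functions d. v (\<lambda>h. a * p h) = a * v p) \<and>
     (\<forall>p\<in>regular_functions d. (\<forall>h\<in>H. p h = 0) \<longrightarrow> v p = 0)"

text \<open>
  The image of the Lie algebra of \<open>H\<close> in \<open>Der O(X)\<close> under the differential of the action: a tangent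
  vector \<open>v\<close> acts by \<open>(v \<otimes> id)\<close> composed with the comorphism. The value does not depend on the
  expansion, and for a regular action an expansion exists for every \<open>f\<close>.
\<close>

definition lie_of_action :: "nat \<Rightarrow> 'k::field mat set \<Rightarrow> ('k mat \<Rightarrow> 'k endo) \<Rightarrow>
    'k laurent set \<Rightarrow> 'k endo set" where
  "lie_of_action d H \<phi> A = {D. (\<forall>f. f \<notin> A \<longrightarrow> D f = 0) \<and>
     (\<exists>v. tangent_vector d H v \<and>
        (\<forall>f\<in>A. \<forall>N c g. coaction_expansion d H \<phi> A f N c g \<longrightarrow>
           D f = (\<Sum>l<N. const (v (c l)) * g l)))}"

end

theory Submission
  imports Defs "Jordan_Normal_Form.Char_Poly"
begin

text \<open>
  Pick a lattice point \<open>m\<^sub>0\<close> pairing positively with every ray generator. Repeated bracketing along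
  a 2-cycle produces root derivations in every term of the lower central series of \<open>L\<close>; none of them
  kills \<open>\<chi>\<^bsup>m\<^sub>0\<^esup>\<close>, so \<open>L\<close> is not nilpotent. Without 2-cycles the bracket of two root derivations in
  \<open>L\<close> is a multiple of a root derivation in \<open>L\<close>, which makes the edge relation transitive and thus
  acyclic. An acyclic graph admits integer weights, growing fast along the edges, for which every root
  occurring in \<open>L\<close> has negative weight while the characters in \<open>O(X)\<close> have nonnegative weight; hence
  \<open>L\<close> is finite-dimensional, and it acts by operators that lower the resulting filtration of \<open>O(X)\<close>.

  For acyclic \<open>\<Gamma>(L)\<close> the group \<open>G\<close> is the ordered product of the exponentials of the abelian
  algebras \<open>L\<^sub>i\<close>. The coefficients of \<open>g \<chi>\<^bsup>m\<^sub>0\<^esup>\<close> recover the parameters of \<open>g\<close> triangularly, so the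
  action of \<open>G\<close> on a finite-dimensional space of Laurent polynomials containing \<open>\<chi>\<^bsup>m\<^sub>0\<^esup>\<close> realises \<open>G\<close> as
  a closed group of unipotent matrices. The same triangularity shows for an arbitrary unipotent
  structure on \<open>G\<close> that the parameters are regular functions, and differentiating them at the identity
  puts the image of every tangent vector in \<open>L\<close>.

  Conversely, by Kolchin's theorem sufficiently many differences in the group direction annihilate
  a regular function on a unipotent group. Hence every element of \<open>O(X)\<close> is annihilated by products
  of sufficiently many factors \<open>g - 1\<close> with \<open>g \<in> G\<close>, and \<open>L\<close> lowers the corresponding filtration; the
  nonvanishing on \<open>\<chi>\<^bsup>m\<^sub>0\<^esup>\<close> then rules out 2-cycles.
\<close>


section \<open>Exponentials of filtration-lowering operators\<close>

text \<open>The obstacle is that \<open>A\<close> is infinite-dimensional and that the matrix group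
  of a unipotent structure is given only abstractly, so neither matrix exponentials nor logarithms
  are at hand. Exponentials are therefore taken on filtered spaces whose bottom step is zero: an
  operator that lowers the filtration has a finite exponential series on each vector. The passage
  from group to Lie algebra is interpolation: if a polynomial in \<open>t\<close> takes all its
  values in a subspace, its coefficients lie there too. This recovers a bracket from conjugates and
  a derivation from its one-parameter group. The inclusion of \<open>L\<close> in the Lie algebra of
  the group needs tangent vectors of \<open>H\<close>. They come from the powers of a single matrix:
  by Kolchin's theorem a regular function along them is polynomial in the exponent, and its linear
  coefficient is a tangent vector. The point \<open>m0\<close> is positive on all ray generators, so
  every root derivation moves its character, and the coefficient at \<open>m0 + f\<close> isolates
  the root \<open>f\<close>, exactly for \<open>L\<close> and up to earlier parameters for
  \<open>G\<close>.\<close>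

locale char0_vector_space = vector_space scale
  for scale :: "'k::field_char_0 \<Rightarrow> 'v::ab_group_add \<Rightarrow> 'v"
begin

text \<open>Elimination in place of a Vandermonde determinant: subtracting \<open>2 ^ Suc q\<close>
  times the value at \<open>s\<close> from the value at \<open>2 * s\<close> removes the top
  coefficient and multiplies the others by \<open>2 ^ i - 2 ^ Suc q\<close>, which is invertible in
  characteristic zero.\<close>

lemma subspace_coefficients:
  fixes F :: "nat \<Rightarrow> 'v"
  assumes U: "subspace U"
    and "\<And>s. (\<Sum>m\<le>q. scale (s ^ m) (F m)) \<in> U" "m \<le> q"
  shows "F m \<in> U"
  using assms(2,3)
proof (induction q arbitrary: F m)
  case 0
  from "0.prems"(1)[of 1] "0.prems"(2) show ?case by simp
next
  case (Suc q)
  have pows: "(2 :: 'k) ^ i \<noteq> 2 ^ Suc q" if "i \<le> q" for i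
  proof
    assume "(2 :: 'k) ^ i = 2 ^ Suc q"
    hence "of_nat (2 ^ i) = (of_nat (2 ^ Suc q) :: 'k)" by (simp only: of_nat_power of_nat_numeral)
    hence "(2::nat) ^ i = 2 ^ Suc q" by (simp only: of_nat_eq_iff)
    thus False using that by (simp only: power_inject_exp)
  qed
  define F' where "F' = (\<lambda>i. scale (2 ^ i - 2 ^ Suc q) (F i))"
  have "(\<Sum>m\<le>q. scale (s ^ m) (F' m)) \<in> U" for s
  proof -
    have "(\<Sum>m\<le>Suc q. scale ((2 * s) ^ m) (F m)) - scale (2 ^ Suc q) (\<Sum>m\<le>Suc q. scale (s ^ m) (F m))
      = (\<Sum>m\<le>Suc q. scale (s ^ m) (F' m))"
      unfolding scale_sum_right sum_subtractf[symmetric]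
    proof (rule sum.cong[OF refl])
      fix m
      have "(2 * s) ^ m - 2 ^ Suc q * s ^ m = s ^ m * (2 ^ m - 2 ^ Suc q)"
        by (simp only: power_mult_distrib right_diff_distrib mult.commute)
      thus "scale ((2 * s) ^ m) (F m) - scale (2 ^ Suc q) (scale (s ^ m) (F m)) = scale (s ^ m) (F' m)"
        by (simp only: F'_def scale_scale scale_left_diff_distrib[symmetric])
    qed
    also have "\<dots> = (\<Sum>m\<le>q. scale (s ^ m) (F' m))" by (simp add: F'_def)
    finally show ?thesis using subspace_diff[OF U Suc.prems(1) subspace_scale[OF U Suc.prems(1)]] by (rule subst)
  qed
  from Suc.IH[OF this] have F'U: "F' i \<in> U" if "i \<le> q" for i using that by blast
  have FU: "F i \<in> U" if "i \<le> q" for i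
  proof -
    have "F i = scale (inverse (2 ^ i - 2 ^ Suc q)) (F' i)"
      using pows[OF that] by (simp add: F'_def del: power_Suc)
    thus ?thesis using subspace_scale[OF U F'U[OF that]] by (rule ssubst)
  qed
  show ?case
  proof (cases "m = Suc q")
    case True
    have "(\<Sum>m\<le>q. F m) \<in> U" using FU U by (intro subspace_sum) auto
    from subspace_diff[OF U Suc.prems(1)[of 1] this] show ?thesis by (simp add: True)
  next
    case False
    with Suc.prems(2) FU show ?thesis by simp
  qed
qed

text \<open>
  The identity common to the binomial theorem for commuting operators, the Leibniz rule for iterated
  derivations and the expansion of \<open>S\<^sup>k F\<close> in iterated commutators.
\<close>

lemma divided_leibniz:
  assumes y0: "y 0 = x 0 0" and yS: "\<And>k. scale (of_nat (Suc k)) (y (Suc k)) = U (y k)"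
    and U: "\<And>k. U (\<Sum>i\<le>k. x i (k - i)) = (\<Sum>i\<le>k. U (x i (k - i)))"
    and Ux: "\<And>i j. U (x i j) = scale (of_nat (Suc i)) (x (Suc i) j) + scale (of_nat (Suc j)) (x i (Suc j))"
  shows "y k = (\<Sum>i\<le>k. x i (k - i))"
proof (induction k)
  case 0 show ?case by (simp add: y0)
next
  case (Suc k)
  have "scale (of_nat (Suc k)) (y (Suc k)) = (\<Sum>i\<le>k. U (x i (k - i)))"
    by (simp only: yS Suc.IH U)
  also have "\<dots> = (\<Sum>i\<le>k. scale (of_nat (Suc i)) (x (Suc i) (k - i)))
      + (\<Sum>i\<le>k. scale (of_nat (Suc (k - i))) (x i (Suc (k - i))))"
    by (simp only: Ux sum.distrib)
  also have "(\<Sum>i\<le>k. scale (of_nat (Suc i)) (x (Suc i) (k - i)))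
      = (\<Sum>i\<le>Suc k. scale (of_nat i) (x i (Suc k - i)))"
    by (simp add: sum.atMost_Suc_shift del: sum.atMost_Suc)
  also have "(\<Sum>i\<le>k. scale (of_nat (Suc (k - i))) (x i (Suc (k - i))))
      = (\<Sum>i\<le>Suc k. scale (of_nat (Suc k - i)) (x i (Suc k - i)))"
    by (auto intro!: sum.cong simp: Suc_diff_le)
  also have "(\<Sum>i\<le>Suc k. scale (of_nat i) (x i (Suc k - i)))
      + (\<Sum>i\<le>Suc k. scale (of_nat (Suc k - i)) (x i (Suc k - i)))
      = (\<Sum>i\<le>Suc k. scale (of_nat (Suc k)) (x i (Suc k - i)))"
  proof (subst sum.distrib[symmetric], rule sum.cong[OF refl])
    fix i assume i: "i \<in> {..Suc k}"
    have "of_nat i + of_nat (Suc k - i) = (of_nat (Suc k) :: 'k)"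
      using i by (subst of_nat_add[symmetric]) simp
    thus "scale (of_nat i) (x i (Suc k - i)) + scale (of_nat (Suc k - i)) (x i (Suc k - i))
        = scale (of_nat (Suc k)) (x i (Suc k - i))"
      by (metis scale_left_distrib)
  qed
  finally have "scale (of_nat (Suc k)) (y (Suc k)) = scale (of_nat (Suc k)) (\<Sum>i\<le>Suc k. x i (Suc k - i))"
    by (simp only: scale_sum_right)
  thus ?case by (metis scale_left_imp_eq of_nat_neq_0)
qed

text \<open>Once the terms with \<open>n \<le> i + j\<close> vanish, the triangle of pairs may be
  completed to a square. This is how the exponential of a sum becomes a product of two exponential
  series.\<close>

lemma divided_leibniz_sum:
  fixes y :: "nat \<Rightarrow> 'v"
  assumes "\<And>k. y k = (\<Sum>i\<le>k. x i (k - i))" "\<And>i j. n \<le> i + j \<Longrightarrow> x i j = (0::'v)"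
  shows "(\<Sum>k<n. y k) = (\<Sum>i<n. \<Sum>j<n. x i j)"
proof -
  have "(\<Sum>k<n. y k) = (\<Sum>(i, j)\<in>{(i, j). i + j < n}. x i j)"
    unfolding assms(1) by (rule sum.triangle_reindex[symmetric])
  also have "\<dots> = (\<Sum>(i, j)\<in>{..<n} \<times> {..<n}. x i j)"
    by (rule sum.mono_neutral_left) (auto intro: ccontr assms(2))
  finally show ?thesis by (simp add: sum.cartesian_product)
qed

definition divided_power :: "('v \<Rightarrow> 'v) \<Rightarrow> nat \<Rightarrow> 'v \<Rightarrow> 'v" where
  "divided_power T i f = scale (inverse (fact i)) ((T ^^ i) f)"

lemma divided_power_0: "divided_power T 0 f = f"
  by (simp add: divided_power_def)

definition op_exp :: "('v \<Rightarrow> 'v) \<Rightarrow> 'v \<Rightarrow> 'v" where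
  "op_exp T f = Sum_any (\<lambda>i. divided_power T i f)"

lemma op_exp_eq_sum:
  assumes "\<And>i. N \<le> i \<Longrightarrow> (T ^^ i) f = 0"
  shows "op_exp T f = (\<Sum>i<N. divided_power T i f)"
  unfolding op_exp_def
  by (rule Sum_any.expand_superset) (auto simp: divided_power_def, metis assms not_le)

end

text \<open>The filtration is ascending and starts at zero, so an operator that strictly lowers it
  is nilpotent on every vector of the union \<open>carr\<close>, although \<open>carr\<close> may
  have infinite dimension.\<close>

locale filtered_space = char0_vector_space scale
  for scale :: "'k::field_char_0 \<Rightarrow> 'v::ab_group_add \<Rightarrow> 'v" +
  fixes V :: "nat \<Rightarrow> 'v set"
  assumes V_subspace: "subspace (V i)"
    and V_0: "V 0 = {0}"
    and V_Suc: "V i \<subseteq> V (Suc i)"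
begin

definition carr :: "'v set" where "carr = (\<Union>i. V i)"

definition endo_on :: "('v \<Rightarrow> 'v) \<Rightarrow> bool" where
  "endo_on T \<longleftrightarrow> (\<forall>f\<in>carr. T f \<in> carr) \<and> (\<forall>f\<in>carr. \<forall>g\<in>carr. T (f + g) = T f + T g) \<and>
     (\<forall>c. \<forall>f\<in>carr. T (scale c f) = scale c (T f))"

text \<open>The shift is required for every \<open>i\<close>; the case \<open>i = 0\<close> says
  that \<open>T\<close> kills \<open>V w\<close>. This is the source of the truncation bounds for
  exponentials.\<close>

definition lowering :: "nat \<Rightarrow> ('v \<Rightarrow> 'v) set" where
  "lowering w = {T. endo_on T \<and> (\<forall>i. \<forall>f\<in>V (i + w). T f \<in> V i)}"

lemma V_mono: "i \<le> j \<Longrightarrow> V i \<subseteq> V j"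
  by (rule lift_Suc_mono_le[of V]) (use V_Suc in auto)

lemma V_carr: "f \<in> V i \<Longrightarrow> f \<in> carr" by (auto simp: carr_def)

lemma carrE: assumes "f \<in> carr" obtains n where "f \<in> V n" using assms by (auto simp: carr_def)

lemma carr_subspace: "subspace carr"
proof (rule subspaceI)
  show "0 \<in> carr" using V_0 by (auto simp: carr_def)
  fix x y assume "x \<in> carr" "y \<in> carr"
  then obtain i j where "x \<in> V i" "y \<in> V j" by (auto simp: carr_def)
  hence "x \<in> V (max i j)" "y \<in> V (max i j)" using V_mono[of i "max i j"] V_mono[of j "max i j"] by auto
  thus "x + y \<in> carr" using V_subspace subspace_add V_carr by blast
next
  fix c x assume "x \<in> carr"
  then obtain i where "x \<in> V i" by (auto simp: carr_def)
  thus "scale c x \<in> carr" using subspace_scale[OF V_subspace] V_carr by blast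
qed

lemma endo_onD:
  assumes "endo_on T"
  shows "f \<in> carr \<Longrightarrow> T f \<in> carr" "f \<in> carr \<Longrightarrow> g \<in> carr \<Longrightarrow> T (f + g) = T f + T g"
    "f \<in> carr \<Longrightarrow> T (scale c f) = scale c (T f)" "T 0 = 0"
proof -
  show "f \<in> carr \<Longrightarrow> T f \<in> carr" "f \<in> carr \<Longrightarrow> g \<in> carr \<Longrightarrow> T (f + g) = T f + T g"
    and scale: "f \<in> carr \<Longrightarrow> T (scale c f) = scale c (T f)" for f g c
    using assms by (simp_all add: endo_on_def)
  show "T 0 = 0" using scale[OF subspace_0[OF carr_subspace], of 0] by simp
qed

lemma endo_on_sum:
  assumes "endo_on T" "\<And>i. i \<in> I \<Longrightarrow> x i \<in> carr"
  shows "T (\<Sum>i\<in>I. x i) = (\<Sum>i\<in>I. T (x i))"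
  using assms(2)
proof (induction I rule: infinite_finite_induct)
  case (insert a F)
  have "(\<Sum>i\<in>F. x i) \<in> carr" using insert.prems by (intro subspace_sum[OF carr_subspace]) auto
  with insert show ?case by (simp add: endo_onD(2)[OF assms(1)])
qed (auto simp: endo_onD(4)[OF assms(1)])

lemma endo_on_pow: "endo_on T \<Longrightarrow> endo_on (T ^^ i)"
  by (induction i) (auto simp: endo_on_def)

lemma lowering_endo: "T \<in> lowering w \<Longrightarrow> endo_on T" by (simp add: lowering_def)

lemma loweringI:
  assumes "\<And>f. f \<in> carr \<Longrightarrow> T f \<in> carr"
    "\<And>f g. f \<in> carr \<Longrightarrow> g \<in> carr \<Longrightarrow> T (f + g) = T f + T g"
    "\<And>c f. f \<in> carr \<Longrightarrow> T (scale c f) = scale c (T f)"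
    "\<And>i f. f \<in> V (i + w) \<Longrightarrow> T f \<in> V i"
  shows "T \<in> lowering w"
  using assms by (simp add: lowering_def endo_on_def)

lemma lowering_V: "T \<in> lowering w \<Longrightarrow> f \<in> V n \<Longrightarrow> n \<le> i + w \<Longrightarrow> T f \<in> V i"
  using V_mono[of n "i + w"] by (auto simp: lowering_def)

lemma lowering_mono: "T \<in> lowering w \<Longrightarrow> v \<le> w \<Longrightarrow> T \<in> lowering v"
  by (rule loweringI) (auto intro: endo_onD[OF lowering_endo] lowering_V[of T w])

lemma lowering_comp:
  assumes "S \<in> lowering v" "T \<in> lowering w"
  shows "(\<lambda>f. S (T f)) \<in> lowering (v + w)"
proof (rule loweringI)
  fix i f assume "f \<in> V (i + (v + w))"
  with assms(2) have "T f \<in> V (i + v)" by (rule lowering_V) simp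
  with assms(1) show "S (T f) \<in> V i" by (rule lowering_V) simp
qed (simp_all add: endo_onD[OF lowering_endo[OF assms(1)]] endo_onD[OF lowering_endo[OF assms(2)]])

lemma lowering_add:
  assumes "S \<in> lowering w" "T \<in> lowering w"
  shows "(\<lambda>f. S f + T f) \<in> lowering w"
proof (rule loweringI)
  fix i f assume "f \<in> V (i + w)"
  with assms have "S f \<in> V i" "T f \<in> V i" by (auto intro: lowering_V)
  thus "S f + T f \<in> V i" by (rule subspace_add[OF V_subspace])
qed (simp_all add: endo_onD[OF lowering_endo[OF assms(1)]] endo_onD[OF lowering_endo[OF assms(2)]]
  scale_right_distrib subspace_add[OF carr_subspace])

lemma lowering_scale:
  assumes "T \<in> lowering w"
  shows "(\<lambda>f. scale c (T f)) \<in> lowering w"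
proof (rule loweringI)
  fix i f assume "f \<in> V (i + w)"
  with assms have "T f \<in> V i" by (auto intro: lowering_V)
  thus "scale c (T f) \<in> V i" by (rule subspace_scale[OF V_subspace])
qed (simp_all add: endo_onD[OF lowering_endo[OF assms]]
  scale_right_distrib subspace_scale[OF carr_subspace] mult.commute)

lemma lowering_diff: "S \<in> lowering w \<Longrightarrow> T \<in> lowering w \<Longrightarrow> (\<lambda>f. S f - T f) \<in> lowering w"
  using lowering_add[OF _ lowering_scale[of T w "-1"], of S] by simp

lemma lowering_0: "(\<lambda>f. 0) \<in> lowering w"
  by (auto simp: lowering_def endo_on_def subspace_0[OF V_subspace] subspace_0[OF carr_subspace])

lemma lowering_sum: "(\<And>i. i \<in> I \<Longrightarrow> T i \<in> lowering w) \<Longrightarrow> (\<lambda>f. \<Sum>i\<in>I. T i f) \<in> lowering w"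
  by (induction I rule: infinite_finite_induct) (auto intro: lowering_0 lowering_add)

lemma lowering_pow: "T \<in> lowering w \<Longrightarrow> T ^^ i \<in> lowering (i * w)"
proof (induction i)
  case 0 show ?case by (auto simp: lowering_def endo_on_def)
next
  case (Suc i)
  from lowering_comp[OF Suc.prems Suc.IH[OF Suc.prems]] show ?case by (simp add: comp_def)
qed

lemma lowering_vanish: "T \<in> lowering w \<Longrightarrow> f \<in> V n \<Longrightarrow> n \<le> w \<Longrightarrow> T f = 0"
  using lowering_V[of T w f n 0] V_0 by auto

lemma lowering_pow_vanish: "T \<in> lowering 1 \<Longrightarrow> f \<in> V n \<Longrightarrow> n \<le> i \<Longrightarrow> (T ^^ i) f = 0"
  using lowering_vanish[OF lowering_pow[of T 1 i]] by simp

lemma op_exp_sum: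
  assumes "T \<in> lowering 1" "f \<in> V n" "n \<le> N"
  shows "op_exp T f = (\<Sum>i<N. divided_power T i f)"
  by (rule op_exp_eq_sum, rule lowering_pow_vanish[OF assms(1,2)]) (use assms(3) in simp)

lemma divided_power_lowering: "T \<in> lowering 1 \<Longrightarrow> divided_power T i \<in> lowering i"
  using lowering_scale[OF lowering_pow[of T 1 i]] by (simp add: divided_power_def[abs_def])

lemma divided_power_Suc:
  assumes "endo_on T" "f \<in> carr"
  shows "scale (of_nat (Suc i)) (divided_power T (Suc i) f) = T (divided_power T i f)"
  using endo_onD(1)[OF endo_on_pow[OF assms(1)] assms(2)]
  by (simp add: divided_power_def endo_onD(3)[OF assms(1)] del: of_nat_Suc)

lemma op_exp_V: "T \<in> lowering 1 \<Longrightarrow> f \<in> V n \<Longrightarrow> op_exp T f \<in> V n"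
  by (simp add: op_exp_sum[where n = n and N = n])
    (intro subspace_sum[OF V_subspace] lowering_V[OF divided_power_lowering], auto)

lemma op_exp_carr: "T \<in> lowering 1 \<Longrightarrow> f \<in> carr \<Longrightarrow> op_exp T f \<in> carr"
  using op_exp_V by (auto simp: carr_def)

lemma carr_common:
  assumes "f \<in> carr" "g \<in> carr" obtains n where "f \<in> V n" "g \<in> V n"
  using assms V_mono by (metis carrE max.cobounded1 max.cobounded2 subsetD)

lemma op_exp_endo: assumes T: "T \<in> lowering 1" shows "op_exp T \<in> lowering 0"
proof -
  note dp = lowering_endo[OF divided_power_lowering[OF T]]
  have "op_exp T (f + g) = op_exp T f + op_exp T g" if "f \<in> carr" "g \<in> carr" for f g
  proof -
    from that obtain n where n: "f \<in> V n" "g \<in> V n" by (rule carr_common)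
    hence "f + g \<in> V n" using subspace_add[OF V_subspace] by blast
    with n that show ?thesis
      by (simp add: op_exp_sum[OF T _ le_refl] endo_onD(2)[OF dp] sum.distrib)
  qed
  moreover have "op_exp T (scale c f) = scale c (op_exp T f)" if "f \<in> carr" for c f
  proof -
    from that obtain n where n: "f \<in> V n" by (rule carrE)
    hence "scale c f \<in> V n" using subspace_scale[OF V_subspace] by blast
    with n that show ?thesis
      by (simp add: op_exp_sum[OF T _ le_refl] endo_onD(3)[OF dp] scale_sum_right)
  qed
  ultimately show ?thesis
    using op_exp_V[OF T] op_exp_carr[OF T] by (auto simp: lowering_def endo_on_def)
qed

lemma op_exp_zero: "op_exp (\<lambda>_. 0) f = f"
proof -
  have "((\<lambda>_. 0 :: 'v) ^^ i) f = 0" if "1 \<le> i" for i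
    using that by (cases i) auto
  from op_exp_eq_sum[of 1, OF this] show ?thesis by (simp add: divided_power_def)
qed

lemma commute_pow:
  assumes "endo_on S" "endo_on T" "\<And>f. f \<in> carr \<Longrightarrow> S (T f) = T (S f)" "f \<in> carr"
  shows "T ((S ^^ i) f) = (S ^^ i) (T f)"
proof (induction i)
  case (Suc i)
  thus ?case using assms endo_onD(1)[OF endo_on_pow[OF assms(1)] assms(4)] by (simp add: assms(3)[symmetric])
qed auto

text \<open>\<open>divided_leibniz\<close> with \<open>x i j\<close> the \<open>i\<close>-th divided
  power of \<open>S\<close> applied to the \<open>j\<close>-th divided power of \<open>T\<close> at
  \<open>f\<close>. For \<open>f\<close> in \<open>V n\<close> these vanish as soon as
  \<open>i + j \<ge> n\<close>.\<close>

lemma op_exp_add: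
  assumes S: "S \<in> lowering 1" and T: "T \<in> lowering 1"
    and comm: "\<And>f. f \<in> carr \<Longrightarrow> S (T f) = T (S f)" and f: "f \<in> carr"
  shows "op_exp (\<lambda>f. S f + T f) f = op_exp S (op_exp T f)"
proof -
  define U where "U = (\<lambda>f. S f + T f)"
  have U: "U \<in> lowering 1" unfolding U_def by (rule lowering_add[OF S T])
  note eS = lowering_endo[OF S] and eT = lowering_endo[OF T] and eU = lowering_endo[OF U]
  note dS = lowering_endo[OF divided_power_lowering[OF S]] and dT = lowering_endo[OF divided_power_lowering[OF T]]
  obtain n where n: "f \<in> V n" using f by (rule carrE)
  define x where "x = (\<lambda>i j. divided_power S i (divided_power T j f))"
  have xc: "x i j \<in> carr" for i j unfolding x_def by (intro endo_onD(1)[OF dS] endo_onD(1)[OF dT] f)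
  have leib: "divided_power U k f = (\<Sum>i\<le>k. x i (k - i))" for k
  proof (rule divided_leibniz[where U = U])
    show "divided_power U 0 f = x 0 0" by (simp add: x_def divided_power_def)
    show "scale (of_nat (Suc k)) (divided_power U (Suc k) f) = U (divided_power U k f)" for k
      by (rule divided_power_Suc[OF eU f])
    show "U (\<Sum>i\<le>k. x i (k - i)) = (\<Sum>i\<le>k. U (x i (k - i)))" for k
      by (rule endo_on_sum[OF eU xc])
    fix i j
    have "T (x i j) = divided_power S i (T (divided_power T j f))"
      unfolding x_def using commute_pow[OF eS eT comm, of "divided_power T j f" i]
        endo_onD(1)[OF dT[of j] f] endo_onD(1)[OF endo_on_pow[OF eS, of i]]
      by (simp add: divided_power_def[of S] endo_onD(3)[OF eT])
    also have "\<dots> = divided_power S i (scale (of_nat (Suc j)) (divided_power T (Suc j) f))"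
      by (simp only: divided_power_Suc[OF eT f])
    also have "\<dots> = scale (of_nat (Suc j)) (x i (Suc j))"
      by (simp only: x_def endo_onD(3)[OF dS endo_onD(1)[OF dT f]])
    finally show "U (x i j) = scale (of_nat (Suc i)) (x (Suc i) j) + scale (of_nat (Suc j)) (x i (Suc j))"
      by (simp only: U_def) (simp only: x_def divided_power_Suc[OF eS endo_onD(1)[OF dT f]])
  qed
  have "op_exp U f = (\<Sum>k<n. divided_power U k f)" by (rule op_exp_sum[OF U n le_refl])
  also have "\<dots> = (\<Sum>i<n. \<Sum>j<n. x i j)"
  proof (rule divided_leibniz_sum[OF leib])
    fix i j assume "n \<le> i + j"
    with lowering_vanish[OF lowering_comp[OF divided_power_lowering[OF S, of i] divided_power_lowering[OF T, of j]] n]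
    show "x i j = 0" by (simp add: x_def)
  qed
  also have "\<dots> = (\<Sum>i<n. divided_power S i (op_exp T f))"
    unfolding x_def op_exp_sum[OF T n le_refl]
    by (intro sum.cong refl endo_on_sum[OF dS, symmetric] endo_onD(1)[OF dT f])
  also have "\<dots> = op_exp S (op_exp T f)" by (rule op_exp_sum[OF S op_exp_V[OF T n] le_refl, symmetric])
  finally show ?thesis by (simp add: U_def)
qed

definition commutator :: "('v \<Rightarrow> 'v) \<Rightarrow> ('v \<Rightarrow> 'v) \<Rightarrow> 'v \<Rightarrow> 'v" where
  "commutator S T = (\<lambda>f. S (T f) - T (S f))"

lemma commutator_lowering: "S \<in> lowering v \<Longrightarrow> T \<in> lowering w \<Longrightarrow> commutator S T \<in> lowering (v + w)"
  unfolding commutator_def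
  using lowering_diff[OF lowering_comp[of S v T w] lowering_comp[of T w S v, unfolded add.commute[of w]]] .

lemma commutator_pow_lowering:
  "S \<in> lowering 1 \<Longrightarrow> T \<in> lowering 1 \<Longrightarrow> (commutator S ^^ i) T \<in> lowering (Suc i)"
proof (induction i)
  case (Suc i)
  from commutator_lowering[OF Suc.prems(1) Suc.IH[OF Suc.prems]] show ?case by simp
qed simp

text \<open>The identity \<open>exp(S) F = exp(ad S)(F) exp(S)\<close>. With \<open>G i\<close> the
  \<open>i\<close>-th divided power of \<open>ad S\<close> at \<open>F\<close> one has
  \<open>S (G i) = (i + 1) G (i + 1) + (G i) S\<close>, the recursion of
  \<open>divided_leibniz\<close>. Each commutator with \<open>S\<close> lowers by one more step, so
  the series is finite on each \<open>V n\<close>.\<close>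

lemma op_exp_apply:
  assumes S: "S \<in> lowering 1" and F: "F \<in> lowering 1" and f: "f \<in> V n" and N: "n \<le> N"
  shows "op_exp S (F f) = (\<Sum>i<N. scale (inverse (fact i)) ((commutator S ^^ i) F (op_exp S f)))"
proof -
  note eS = lowering_endo[OF S] and eF = lowering_endo[OF F]
  note dS = lowering_endo[OF divided_power_lowering[OF S]]
  have fc: "f \<in> carr" using f by (rule V_carr)
  define G where "G = (\<lambda>i g. scale (inverse (fact i)) ((commutator S ^^ i) F g))"
  have G: "G i \<in> lowering (Suc i)" for i
    unfolding G_def by (rule lowering_scale[OF commutator_pow_lowering[OF S F]])
  note eG = lowering_endo[OF G]
  have GS: "S (G i g) = scale (of_nat (Suc i)) (G (Suc i) g) + G i (S g)" if "g \<in> carr" for i g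
  proof -
    have "(commutator S ^^ i) F g \<in> carr"
      using endo_onD(1)[OF lowering_endo[OF commutator_pow_lowering[OF S F]] that] .
    hence "S (G i g) = scale (inverse (fact i)) (S ((commutator S ^^ i) F g))"
      by (simp add: G_def endo_onD(3)[OF eS])
    also have "S ((commutator S ^^ i) F g) = (commutator S ^^ Suc i) F g + (commutator S ^^ i) F (S g)"
      by (simp add: commutator_def)
    finally show ?thesis
      by (simp add: G_def scale_right_distrib del: of_nat_Suc funpow.simps)
  qed
  define x where "x = (\<lambda>i j. G i (divided_power S j f))"
  have xc: "x i j \<in> carr" for i j unfolding x_def by (intro endo_onD(1)[OF eG] endo_onD(1)[OF dS] fc)
  have leib: "divided_power S k (F f) = (\<Sum>i\<le>k. x i (k - i))" for k
  proof (rule divided_leibniz[where U = S])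
    show "divided_power S 0 (F f) = x 0 0" by (simp add: x_def divided_power_def G_def)
    show "scale (of_nat (Suc k)) (divided_power S (Suc k) (F f)) = S (divided_power S k (F f))" for k
      by (rule divided_power_Suc[OF eS endo_onD(1)[OF eF fc]])
    show "S (\<Sum>i\<le>k. x i (k - i)) = (\<Sum>i\<le>k. S (x i (k - i)))" for k
      by (rule endo_on_sum[OF eS xc])
    fix i j
    show "S (x i j) = scale (of_nat (Suc i)) (x (Suc i) j) + scale (of_nat (Suc j)) (x i (Suc j))"
      unfolding x_def GS[OF endo_onD(1)[OF dS fc]] divided_power_Suc[OF eS fc, symmetric]
      by (simp only: endo_onD(3)[OF eG endo_onD(1)[OF dS fc]])
  qed
  have fN: "f \<in> V N" using f V_mono[OF N] by blast
  have "op_exp S (F f) = (\<Sum>k<N. divided_power S k (F f))"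
    by (rule op_exp_sum[OF S _ le_refl]) (rule lowering_V[OF F fN], simp)
  also have "\<dots> = (\<Sum>i<N. \<Sum>j<N. x i j)"
  proof (rule divided_leibniz_sum[OF leib])
    fix i j assume "N \<le> i + j"
    with lowering_vanish[OF lowering_comp[OF G[of i] divided_power_lowering[OF S, of j]] fN]
    show "x i j = 0" by (simp add: x_def)
  qed
  also have "\<dots> = (\<Sum>i<N. G i (op_exp S f))"
    unfolding x_def op_exp_sum[OF S fN le_refl]
    by (intro sum.cong refl endo_on_sum[OF eG, symmetric] endo_onD(1)[OF dS fc])
  finally show ?thesis by (simp add: G_def)
qed

text \<open>\<open>exp(ad S)\<close> applied to \<open>F\<close>, cut off after \<open>M\<close>
  terms; it is the conjugate of \<open>F\<close> by \<open>exp(S)\<close> when the omitted terms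
  vanish.\<close>

definition conjugate :: "nat \<Rightarrow> ('v \<Rightarrow> 'v) \<Rightarrow> ('v \<Rightarrow> 'v) \<Rightarrow> 'v \<Rightarrow> 'v" where
  "conjugate M S F = (\<lambda>f. \<Sum>i<M. scale (inverse (fact i)) ((commutator S ^^ i) F f))"

lemma conjugate_lowering: "S \<in> lowering 1 \<Longrightarrow> F \<in> lowering 1 \<Longrightarrow> conjugate M S F \<in> lowering 1"
  unfolding conjugate_def
  by (intro lowering_sum lowering_scale lowering_mono[OF commutator_pow_lowering]) auto

text \<open>Conjugation by \<open>exp(S)\<close> commutes with powers, hence with the exponential
  series. The bound \<open>M\<close> is uniform in \<open>g\<close>, since one operator
  \<open>conjugate M S F\<close> has to serve on all of \<open>carr\<close>.\<close>

lemma op_exp_conjugate: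
  assumes S: "S \<in> lowering 1" and F: "F \<in> lowering 1" and f: "f \<in> carr"
    and M: "\<And>i g. M \<le> i \<Longrightarrow> g \<in> carr \<Longrightarrow> (commutator S ^^ i) F g = 0"
  shows "op_exp S (op_exp F f) = op_exp (conjugate M S F) (op_exp S f)"
proof -
  define F' where "F' = conjugate M S F"
  have F': "F' \<in> lowering 1" unfolding F'_def by (rule conjugate_lowering[OF S F])
  have step: "op_exp S (F g) = F' (op_exp S g)" if g: "g \<in> carr" for g
  proof -
    obtain n where n: "g \<in> V n" using g by (rule carrE)
    have "op_exp S (F g) = (\<Sum>i<max n M. scale (inverse (fact i)) ((commutator S ^^ i) F (op_exp S g)))"
      by (rule op_exp_apply[OF S F n]) simp
    also have "\<dots> = F' (op_exp S g)" unfolding F'_def conjugate_def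
      by (rule sum.mono_neutral_right) (auto simp: M op_exp_carr[OF S g])
    finally show ?thesis .
  qed
  have pow: "op_exp S ((F ^^ i) f) = (F' ^^ i) (op_exp S f)" for i
    by (induction i) (auto simp: step endo_onD(1)[OF endo_on_pow[OF lowering_endo[OF F]] f])
  obtain n where n: "f \<in> V n" using f by (rule carrE)
  have "op_exp S (op_exp F f) = (\<Sum>i<n. op_exp S (divided_power F i f))"
    unfolding op_exp_sum[OF F n le_refl]
    by (rule endo_on_sum[OF lowering_endo[OF op_exp_endo[OF S]]])
      (rule endo_onD(1)[OF lowering_endo[OF divided_power_lowering[OF F]] f])
  also have "\<dots> = (\<Sum>i<n. divided_power F' i (op_exp S f))"
    unfolding divided_power_def
    by (simp add: endo_onD(3)[OF lowering_endo[OF op_exp_endo[OF S]]] pow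
      endo_onD(1)[OF endo_on_pow[OF lowering_endo[OF F]] f])
  also have "\<dots> = op_exp F' (op_exp S f)" by (rule op_exp_sum[OF F' op_exp_V[OF S n] le_refl, symmetric])
  finally show ?thesis by (simp add: F'_def)
qed

text \<open>The terms of order at least two lower by at least \<open>2 * w\<close>, hence by
  \<open>w + 1\<close>. Modulo \<open>lowering (w + 1)\<close> the exponential is therefore
  \<open>1 + T\<close>.\<close>

lemma op_exp_tail:
  assumes T: "T \<in> lowering w" and w: "1 \<le> w"
  shows "(\<lambda>f. op_exp T f - f - T f) \<in> lowering (w + 1)"
proof -
  have T1: "T \<in> lowering 1" using lowering_mono[OF T w] .
  have "endo_on (\<lambda>f. op_exp T f - f - T f)"
    using endo_onD[OF lowering_endo[OF T]] endo_onD[OF lowering_endo[OF op_exp_endo[OF T1]]]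
    by (auto simp: endo_on_def subspace_diff[OF carr_subspace] scale_right_diff_distrib)
  moreover have "op_exp T f - f - T f \<in> V i" if f: "f \<in> V (i + (w + 1))" for f i
  proof -
    define N where "N = i + (w + 1)"
    have N2: "N = Suc (Suc (N - 2))" unfolding N_def using w by simp
    have "op_exp T f = (\<Sum>j<Suc (Suc (N - 2)). divided_power T j f)"
      by (rule op_exp_sum[OF T1 f]) (use N2 N_def in simp)
    also have "\<dots> = f + T f + (\<Sum>j<N - 2. divided_power T (Suc (Suc j)) f)"
      by (simp only: sum.lessThan_Suc_shift) (simp add: divided_power_def add.assoc)
    finally have "op_exp T f - f - T f = (\<Sum>j<N - 2. divided_power T (Suc (Suc j)) f)" by simp
    moreover have "divided_power T (Suc (Suc j)) f \<in> V i" for j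
    proof -
      have "(T ^^ Suc (Suc j)) f \<in> V i"
      proof (rule lowering_V[OF lowering_pow[OF T] f])
        have "2 * w \<le> Suc (Suc j) * w" by (intro mult_right_mono) auto
        thus "i + (w + 1) \<le> i + Suc (Suc j) * w" using w by linarith
      qed
      thus ?thesis unfolding divided_power_def using subspace_scale[OF V_subspace] by blast
    qed
    ultimately show ?thesis using subspace_sum[OF V_subspace] by metis
  qed
  ultimately show ?thesis by (simp add: lowering_def)
qed

end

section \<open>Groups of unipotent matrices\<close>

definition mtrace :: "'a::comm_ring_1 mat \<Rightarrow> 'a" where
  "mtrace B = (\<Sum>i<dim_row B. B $$ (i, i))"

lemma mtrace_add: "A \<in> carrier_mat d d \<Longrightarrow> B \<in> carrier_mat d d \<Longrightarrow> mtrace (A + B) = mtrace A + mtrace B"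
  by (simp add: mtrace_def sum.distrib)

lemma mtrace_minus: "A \<in> carrier_mat d d \<Longrightarrow> B \<in> carrier_mat d d \<Longrightarrow> mtrace (A - B) = mtrace A - mtrace B"
  by (simp add: mtrace_def sum_subtractf)

lemma mtrace_smult: "A \<in> carrier_mat d d \<Longrightarrow> mtrace (c \<cdot>\<^sub>m A) = c * mtrace A"
  by (simp add: mtrace_def sum_distrib_left)

lemma pderiv_sum_set: "pderiv (\<Sum>i\<in>I. f i) = (\<Sum>i\<in>I. pderiv (f i))"
  by (induction I rule: infinite_finite_induct) (auto simp: pderiv_add)

lemma cofactor_cong:
  assumes "A \<in> carrier_mat d d" "B \<in> carrier_mat d d" "i < d" "j < d"
    and "\<And>i' j'. i' < d \<Longrightarrow> j' < d \<Longrightarrow> i' \<noteq> i \<Longrightarrow> A $$ (i', j') = B $$ (i', j')"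
  shows "cofactor A i j = cofactor B i j"
proof -
  have "mat_delete A i j = mat_delete B i j"
    using assms(1-4) by (auto simp: mat_delete_def intro!: eq_matI assms(5))
  thus ?thesis by (simp add: cofactor_def)
qed

text \<open>Differentiating the Leibniz formula gives one determinant for each row, in which only
  that row is differentiated. Expanding it along this row, whose cofactors do not involve it, yields
  Jacobi's formula.\<close>

lemma pderiv_det:
  fixes M :: "'a::field poly mat"
  assumes M: "M \<in> carrier_mat d d"
  shows "pderiv (det M) = (\<Sum>i<d. \<Sum>j<d. pderiv (M $$ (i, j)) * cofactor M i j)"
proof -
  define Mi where "Mi = (\<lambda>i. mat d d (\<lambda>(i', j). if i' = i then pderiv (M $$ (i, j)) else M $$ (i', j)))"
  have Mi: "Mi i \<in> carrier_mat d d" for i by (simp add: Mi_def)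
  let ?P = "{p. p permutes {0..<d}}"
  have row: "det (Mi i) = (\<Sum>j<d. pderiv (M $$ (i, j)) * cofactor M i j)" if i: "i < d" for i
  proof -
    have "det (Mi i) = (\<Sum>j<d. Mi i $$ (i, j) * cofactor (Mi i) i j)"
      by (rule laplace_expansion_row[OF Mi i])
    also have "\<dots> = (\<Sum>j<d. pderiv (M $$ (i, j)) * cofactor M i j)"
      by (intro sum.cong refl arg_cong2[of _ _ _ _ "(*)"] cofactor_cong[OF Mi M i])
        (use i in \<open>auto simp: Mi_def\<close>)
    finally show ?thesis .
  qed
  have "pderiv (det M) = (\<Sum>p\<in>?P. signof p * (\<Sum>i<d. pderiv (M $$ (i, p i)) * (\<Prod>i'\<in>{0..<d} - {i}. M $$ (i', p i'))))"
  proof -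
    have "pderiv (signof p * (\<Prod>i = 0..<d. M $$ (i, p i)))
      = signof p * (\<Sum>i<d. pderiv (M $$ (i, p i)) * (\<Prod>i'\<in>{0..<d} - {i}. M $$ (i', p i')))" for p
    proof -
      have "pderiv (signof p :: 'a poly) = 0" by (simp add: sign_def pderiv_minus)
      thus ?thesis by (simp add: pderiv_mult pderiv_prod atLeast0LessThan mult.commute)
    qed
    thus ?thesis by (simp add: det_def'[OF M] pderiv_sum_set)
  qed
  also have "\<dots> = (\<Sum>i<d. \<Sum>p\<in>?P. signof p * (pderiv (M $$ (i, p i)) * (\<Prod>i'\<in>{0..<d} - {i}. M $$ (i', p i'))))"
    unfolding sum_distrib_left by (rule sum.swap)
  also have "\<dots> = (\<Sum>i<d. det (Mi i))"
  proof (rule sum.cong[OF refl])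
    fix i assume "i \<in> {..<d}"
    hence i: "i \<in> {0..<d}" by simp
    have "(\<Prod>i' = 0..<d. Mi i $$ (i', p i')) = pderiv (M $$ (i, p i)) * (\<Prod>i'\<in>{0..<d} - {i}. M $$ (i', p i'))"
      if p: "p permutes {0..<d}" for p
    proof -
      have pd: "p i' < d" if "i' < d" for i' using permutes_in_image[OF p, of i'] that by simp
      have "(\<Prod>i' = 0..<d. Mi i $$ (i', p i'))
        = Mi i $$ (i, p i) * (\<Prod>i'\<in>{0..<d} - {i}. Mi i $$ (i', p i'))"
        using i by (subst prod.remove[of _ i]) auto
      also have "(\<Prod>i'\<in>{0..<d} - {i}. Mi i $$ (i', p i')) = (\<Prod>i'\<in>{0..<d} - {i}. M $$ (i', p i'))"
        by (rule prod.cong) (auto simp: Mi_def pd)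
      finally show ?thesis using i pd by (simp add: Mi_def)
    qed
    thus "(\<Sum>p\<in>?P. signof p * (pderiv (M $$ (i, p i)) * (\<Prod>i'\<in>{0..<d} - {i}. M $$ (i', p i')))) = det (Mi i)"
      unfolding det_def'[OF Mi] by (intro sum.cong) auto
  qed
  finally show ?thesis by (simp add: row)
qed

definition const_mat :: "'a::comm_ring_1 mat \<Rightarrow> 'a poly mat" where
  "const_mat = map_mat (\<lambda>a. [:a:])"

text \<open>The pencil \<open>1 - z B\<close>; its determinant is the reversed characteristic
  polynomial. It takes the value \<open>1\<close> at \<open>z = 0\<close>, and its logarithmic
  derivative is, up to sign, the generating series of the traces of the powers of
  \<open>B\<close>.\<close>

definition pencil :: "'a::comm_ring_1 mat \<Rightarrow> 'a poly mat" where
  "pencil B = 1\<^sub>m (dim_row B) - [:0, 1:] \<cdot>\<^sub>m const_mat B"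

lemma const_mat_carrier[simp]: "B \<in> carrier_mat d d \<Longrightarrow> const_mat B \<in> carrier_mat d d"
  by (simp add: const_mat_def)

lemma pencil_carrier[simp]: "B \<in> carrier_mat d d \<Longrightarrow> pencil B \<in> carrier_mat d d"
  unfolding pencil_def by (intro minus_carrier_mat) simp

interpretation const_poly: comm_ring_hom "\<lambda>a::'a::comm_ring_1. [:a:]"
  by unfold_locales auto

lemma const_mat_pow: "B \<in> carrier_mat d d \<Longrightarrow> const_mat (B ^\<^sub>m n) = const_mat B ^\<^sub>m n"
  unfolding const_mat_def by (rule const_poly.mat_hom_pow)

lemma mtrace_const_mat: "B \<in> carrier_mat d d \<Longrightarrow> mtrace (const_mat B) = [:mtrace B:]"
  by (auto simp: mtrace_def const_mat_def const_poly.hom_sum)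

lemma poly_det_pencil:
  assumes "B \<in> carrier_mat d d"
  shows "poly (det (pencil B)) a = det (1\<^sub>m d - a \<cdot>\<^sub>m B)"
proof -
  have "map_mat (\<lambda>p. poly p a) (pencil B) = 1\<^sub>m d - a \<cdot>\<^sub>m B"
    using assms by (auto simp: pencil_def const_mat_def)
  moreover have "comm_ring_hom (\<lambda>p. poly p a)" by unfold_locales auto
  hence "det (map_mat (\<lambda>p. poly p a) (pencil B)) = poly (det (pencil B)) a" by (rule comm_ring_hom.hom_det)
  ultimately show ?thesis by simp
qed

lemma smult_pow_mat:
  assumes A: "A \<in> carrier_mat d d"
  shows "(c \<cdot>\<^sub>m A) ^\<^sub>m n = (c::'a::comm_ring_1) ^ n \<cdot>\<^sub>m (A ^\<^sub>m n)"
proof (induction n)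
  case (Suc n)
  have P: "A ^\<^sub>m n \<in> carrier_mat d d" using A by simp
  have "(c ^ n \<cdot>\<^sub>m (A ^\<^sub>m n)) * (c \<cdot>\<^sub>m A) = c ^ n \<cdot>\<^sub>m (c \<cdot>\<^sub>m (A ^\<^sub>m n * A))"
    by (simp only: mult_smult_assoc_mat[OF P smult_carrier_mat[OF A]] mult_smult_distrib[OF P A])
  thus ?case using Suc by (auto simp: mult.commute mult.assoc intro!: eq_matI)
qed (use A in auto)

lemma one_minus_geometric:
  assumes A: "(A :: 'a::comm_ring_1 mat) \<in> carrier_mat d d"
  shows "\<exists>T\<in>carrier_mat d d. (1\<^sub>m d - A) * T = 1\<^sub>m d - A ^\<^sub>m n"
proof (induction n)
  case 0
  show ?case by (rule bexI[of _ "0\<^sub>m d d"]) (use A in auto)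
next
  case (Suc n)
  then obtain T where T: "T \<in> carrier_mat d d" "(1\<^sub>m d - A) * T = 1\<^sub>m d - A ^\<^sub>m n" by blast
  have P: "A ^\<^sub>m n \<in> carrier_mat d d" using A by simp
  have comm: "A * A ^\<^sub>m n = A ^\<^sub>m n * A"
    using A by (induction n) (auto simp: assoc_mult_mat[of _ d d _ d _ d, symmetric])
  have "(1\<^sub>m d - A) * (T + A ^\<^sub>m n) = (1\<^sub>m d - A ^\<^sub>m n) + (1\<^sub>m d - A) * A ^\<^sub>m n"
    using A T P by (simp add: mult_add_distrib_mat[OF minus_carrier_mat[OF A] T(1) P] T(2))
  also have "(1\<^sub>m d - A) * A ^\<^sub>m n = A ^\<^sub>m n - A ^\<^sub>m n * A"
    using A P by (simp add: minus_mult_distrib_mat[OF one_carrier_mat A P] comm)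
  also have "(1\<^sub>m d - A ^\<^sub>m n) + (A ^\<^sub>m n - A ^\<^sub>m n * A) = 1\<^sub>m d - A ^\<^sub>m Suc n"
    using A P by (auto intro!: eq_matI)
  finally show ?case using T(1) P by (intro bexI[of _ "T + A ^\<^sub>m n"]) auto
qed

text \<open>The finite geometric series inverts \<open>1 - z B\<close> over the polynomial ring, so
  the determinant is a unit there, hence constant, and its value at \<open>z = 0\<close> is
  \<open>1\<close>.\<close>

lemma det_pencil_nilpotent:
  fixes B :: "'a::field mat"
  assumes B: "B \<in> carrier_mat d d" and nil: "B ^\<^sub>m n = 0\<^sub>m d d"
  shows "det (pencil B) = 1"
proof -
  let ?A = "[:0, 1:] \<cdot>\<^sub>m const_mat B"
  have A: "?A \<in> carrier_mat d d" using B by simp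
  have "const_mat B ^\<^sub>m n = 0\<^sub>m d d"
    unfolding const_mat_pow[OF B, symmetric] nil by (auto simp: const_mat_def)
  hence An: "?A ^\<^sub>m n = 0\<^sub>m d d" by (simp add: smult_pow_mat[OF const_mat_carrier[OF B]])
  from one_minus_geometric[OF A, of n] obtain T where
    T: "T \<in> carrier_mat d d" "(1\<^sub>m d - ?A) * T = 1\<^sub>m d - ?A ^\<^sub>m n" by blast
  have "pencil B * T = 1\<^sub>m d" using B T(2) unfolding An by (auto simp: pencil_def)
  hence "det (pencil B) * det T = 1" using det_mult[OF pencil_carrier[OF B] T(1)] by simp
  hence "det (pencil B) dvd 1" by (metis dvdI)
  then obtain c where c: "det (pencil B) = [:c:]" using is_unit_poly_iff by blast
  have "poly (det (pencil B)) 0 = 1"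
    unfolding poly_det_pencil[OF B] using B by (simp add: det_one[of d, symmetric] del: det_one) (rule arg_cong[of _ _ det], auto)
  thus ?thesis using c by simp
qed

text \<open>Multiply \<open>(1 - z B) B ^ n = B ^ n - z B ^ (n + 1)\<close> by the adjugate and take
  traces. Iterating the relation expands the left-hand trace in powers of \<open>z\<close>, with the
  traces of the powers of \<open>B\<close> as ingredients.\<close>

lemma adj_pencil:
  assumes B: "B \<in> carrier_mat d d"
  shows "mtrace (adj_mat (pencil B) * const_mat B ^\<^sub>m n) =
    det (pencil B) * [:mtrace (B ^\<^sub>m n):] + [:0, 1:] * mtrace (adj_mat (pencil B) * const_mat B ^\<^sub>m Suc n)"
proof -
  let ?M = "pencil B" and ?C = "const_mat B"
  have C: "?C \<in> carrier_mat d d" and P: "?C ^\<^sub>m n \<in> carrier_mat d d" and J: "adj_mat ?M \<in> carrier_mat d d"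
    and M: "?M \<in> carrier_mat d d"
    using B adj_mat(1)[OF pencil_carrier[OF B]] by auto
  have "?M * ?C ^\<^sub>m n = ?C ^\<^sub>m n - [:0, 1:] \<cdot>\<^sub>m (?C * ?C ^\<^sub>m n)"
    using B by (simp add: pencil_def minus_mult_distrib_mat[OF one_carrier_mat smult_carrier_mat[OF C] P]
      mult_smult_assoc_mat[OF C P] left_mult_one_mat[OF P])
  also have "?C * ?C ^\<^sub>m n = ?C ^\<^sub>m Suc n"
    using C by (induction n) (auto simp: assoc_mult_mat[of _ d d _ d _ d, symmetric])
  finally have MC: "?M * ?C ^\<^sub>m n = ?C ^\<^sub>m n - [:0, 1:] \<cdot>\<^sub>m ?C ^\<^sub>m Suc n" .
  have S: "?C ^\<^sub>m Suc n \<in> carrier_mat d d" using C by (rule pow_carrier_mat)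
  have "det ?M \<cdot>\<^sub>m ?C ^\<^sub>m n = adj_mat ?M * ?M * ?C ^\<^sub>m n"
    by (simp add: adj_mat(3)[OF M] mult_smult_assoc_mat[OF one_carrier_mat P] left_mult_one_mat[OF P])
  also have "\<dots> = adj_mat ?M * (?C ^\<^sub>m n - [:0, 1:] \<cdot>\<^sub>m ?C ^\<^sub>m Suc n)"
    by (simp only: assoc_mult_mat[OF J M P] MC)
  also have "\<dots> = adj_mat ?M * ?C ^\<^sub>m n - [:0, 1:] \<cdot>\<^sub>m (adj_mat ?M * ?C ^\<^sub>m Suc n)"
    by (subst mult_minus_distrib_mat[OF J P smult_carrier_mat[OF S]]) (simp only: mult_smult_distrib[OF J S])
  finally have "mtrace (det ?M \<cdot>\<^sub>m ?C ^\<^sub>m n) =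
      mtrace (adj_mat ?M * ?C ^\<^sub>m n) - mtrace ([:0, 1:] \<cdot>\<^sub>m (adj_mat ?M * ?C ^\<^sub>m Suc n))"
    using mtrace_minus[OF mult_carrier_mat[OF J P] smult_carrier_mat[OF mult_carrier_mat[OF J S]]]
    by (simp only:)
  moreover have "mtrace (det ?M \<cdot>\<^sub>m ?C ^\<^sub>m n) = det ?M * [:mtrace (B ^\<^sub>m n):]"
    unfolding mtrace_smult[OF P] unfolding const_mat_pow[OF B, symmetric] mtrace_const_mat[OF pow_carrier_mat[OF B]] ..
  ultimately show ?thesis
    by (simp only: mtrace_smult[OF mult_carrier_mat[OF J S]]) (simp only: algebra_simps)
qed

lemma pderiv_det_pencil:
  fixes B :: "'a::field mat"
  assumes B: "B \<in> carrier_mat d d"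
  shows "pderiv (det (pencil B)) = - mtrace (adj_mat (pencil B) * const_mat B)"
proof -
  let ?M = "pencil B"
  have M: "?M \<in> carrier_mat d d" using B by simp
  have "pderiv (?M $$ (i, j)) = - [:B $$ (i, j):]" if "i < d" "j < d" for i j
    using that B by (auto simp: pencil_def const_mat_def pderiv_diff pderiv_pCons)
  hence "pderiv (det ?M) = (\<Sum>i<d. \<Sum>j<d. - (cofactor ?M i j * [:B $$ (i, j):]))"
    unfolding pderiv_det[OF M] by (intro sum.cong refl) (simp add: mult.commute)
  also have "\<dots> = - (\<Sum>j<d. \<Sum>i<d. cofactor ?M i j * [:B $$ (i, j):])"
    by (subst sum.swap) (simp add: sum_negf del: mult_pCons_left mult_pCons_right)
  also have "(\<Sum>j<d. \<Sum>i<d. cofactor ?M i j * [:B $$ (i, j):]) = mtrace (adj_mat ?M * const_mat B)"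
  proof -
    have dims: "dim_row ?M = d" "dim_col ?M = d" using M by auto
    show ?thesis
      using B by (auto simp: dims mtrace_def adj_mat_def const_mat_def scalar_prod_def atLeast0LessThan intro!: sum.cong
        simp del: mult_pCons_left mult_pCons_right)
  qed
  finally show ?thesis .
qed

text \<open>The determinant of the pencil is the constant \<open>1\<close>, so Jacobi's formula
  makes the trace of the adjugate times \<open>B\<close> vanish. The case \<open>n = 1\<close> of
  \<open>adj_pencil\<close> at \<open>z = 0\<close> then gives the claim.\<close>

lemma mtrace_nilpotent:
  fixes B :: "'a::field mat"
  assumes B: "B \<in> carrier_mat d d" and nil: "B ^\<^sub>m n = 0\<^sub>m d d"
  shows "mtrace B = 0"
proof -
  have "mtrace (adj_mat (pencil B) * const_mat B) = 0"
    using pderiv_det_pencil[OF B] det_pencil_nilpotent[OF B nil] by simp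
  moreover have "mtrace (adj_mat (pencil B) * const_mat B ^\<^sub>m 1) =
      det (pencil B) * [:mtrace (B ^\<^sub>m 1):] + [:0, 1:] * mtrace (adj_mat (pencil B) * const_mat B ^\<^sub>m Suc 1)"
    by (rule adj_pencil[OF B])
  moreover have "const_mat B ^\<^sub>m 1 = const_mat B" "B ^\<^sub>m 1 = B" using B by auto
  ultimately have "0 = [:mtrace B:] + [:0, 1:] * mtrace (adj_mat (pencil B) * const_mat B ^\<^sub>m Suc 1)"
    by (simp add: det_pencil_nilpotent[OF B nil])
  hence "poly 0 0 = poly ([:mtrace B:] + [:0, 1:] * mtrace (adj_mat (pencil B) * const_mat B ^\<^sub>m Suc 1)) 0"
    by (rule arg_cong)
  thus ?thesis by simp
qed

text \<open>
  By Jacobi's formula the vanishing of the traces of the powers of \<open>B\<close> makes \<open>det (1 - z B)\<close>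
  independent of \<open>z\<close>, so \<open>1\<close> is not an eigenvalue of \<open>B\<close>.
\<close>

lemma no_eigenvalue_1_if_traces_vanish:
  fixes B :: "'a::field_char_0 mat"
  assumes B: "B \<in> carrier_mat d d" and tr: "\<And>n. mtrace (B ^\<^sub>m Suc n) = 0"
    and v: "v \<in> carrier_vec d" "B *\<^sub>v v = v"
  shows "v = 0\<^sub>v d"
proof -
  let ?t = "\<lambda>n. mtrace (adj_mat (pencil B) * const_mat B ^\<^sub>m Suc n)"
  have step: "?t n = [:0, 1:] * ?t (Suc n)" for n
    using adj_pencil[OF B, of "Suc n"] by (simp only: tr) simp
  \<comment> \<open>As all traces vanish, every power of \<open>z\<close> divides this polynomial,
    which is possible only for zero.\<close>
  have "?t 0 = [:0, 1:] ^ n * ?t n" for n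
    by (induction n) (simp_all only: step[symmetric] power_Suc2 mult.assoc power_0 mult_1)
  hence dvd: "[:0, 1:] ^ n dvd ?t 0" for n by (metis dvd_triv_left)
  have "?t 0 = 0"
  proof (rule ccontr)
    assume nz: "?t 0 \<noteq> 0"
    have "Polynomial.degree ([:0, 1:] ^ Suc (Polynomial.degree (?t 0)) :: 'a poly) \<le> Polynomial.degree (?t 0)"
      by (rule dvd_imp_degree_le[OF dvd nz])
    thus False by (simp add: degree_power_eq del: power_Suc)
  qed
  hence "pderiv (det (pencil B)) = 0" using pderiv_det_pencil[OF B] B by simp
  then obtain c where c: "det (pencil B) = [:c:]"
    using pderiv_eq_0_iff degree_0_id by metis
  have "poly (det (pencil B)) 0 = 1"
    unfolding poly_det_pencil[OF B] using B by (simp add: det_one[of d, symmetric] del: det_one) (rule arg_cong[of _ _ det], auto)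
  with c have "poly (det (pencil B)) 1 \<noteq> 0" by simp
  moreover have "1 \<cdot>\<^sub>m B = B" by auto
  ultimately have "det (1\<^sub>m d - B) \<noteq> 0" unfolding poly_det_pencil[OF B] by simp
  moreover have "(1\<^sub>m d - B) *\<^sub>v v = 0\<^sub>v d"
    using B v by (auto simp: minus_mult_distrib_mat_vec[of _ d d])
  ultimately show ?thesis
    using det_0_iff_vec_prod_zero_field[OF minus_carrier_mat[OF B, of "1\<^sub>m d"]] v(1) by blast
qed

text \<open>\<open>h\<close> is the pencil of the nilpotent matrix \<open>1 - h\<close> at
  \<open>z = 1\<close>.\<close>

lemma det_unipotent:
  fixes h :: "'a::field mat"
  assumes h: "h \<in> carrier_mat d d" and nil: "(h - 1\<^sub>m d) ^\<^sub>m n = 0\<^sub>m d d"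
  shows "det h = 1" and "mtrace (h - 1\<^sub>m d) = 0"
proof -
  have N: "h - 1\<^sub>m d \<in> carrier_mat d d" by (intro minus_carrier_mat one_carrier_mat)
  have N': "(- 1) \<cdot>\<^sub>m (h - 1\<^sub>m d) \<in> carrier_mat d d" using N by (rule smult_carrier_mat)
  show "mtrace (h - 1\<^sub>m d) = 0" by (rule mtrace_nilpotent[OF N nil])
  have nil': "((- 1) \<cdot>\<^sub>m (h - 1\<^sub>m d)) ^\<^sub>m n = 0\<^sub>m d d"
    by (simp add: smult_pow_mat[OF N] nil)
  have "1\<^sub>m d - 1 \<cdot>\<^sub>m ((- 1) \<cdot>\<^sub>m (h - 1\<^sub>m d)) = h" using h by auto
  thus "det h = 1" using poly_det_pencil[OF N', of 1] det_pencil_nilpotent[OF N' nil'] by simp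
qed


text \<open>
  Kolchin's theorem: if \<open>a\<^sub>1 \<cdots> a\<^sub>d v \<noteq> 0\<close>, the \<open>d + 1\<close> vectors \<open>a\<^sub>k \<cdots> a\<^sub>d v\<close> are linearly dependent, which produces
  an element of the algebra spanned by the \<open>h - 1\<close> with eigenvalue \<open>1\<close>.
\<close>

inductive_set unipotent_algebra :: "nat \<Rightarrow> 'a::field mat set \<Rightarrow> 'a mat set" for d H where
  zero: "0\<^sub>m d d \<in> unipotent_algebra d H"
| gen: "h \<in> H \<Longrightarrow> h - 1\<^sub>m d \<in> unipotent_algebra d H"
| add: "a \<in> unipotent_algebra d H \<Longrightarrow> b \<in> unipotent_algebra d H \<Longrightarrow> a + b \<in> unipotent_algebra d H"
| smult: "a \<in> unipotent_algebra d H \<Longrightarrow> c \<cdot>\<^sub>m a \<in> unipotent_algebra d H"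

section \<open>Kolchin's theorem for semigroups of unipotent matrices\<close>

locale unipotent_matrices =
  fixes d :: nat and H :: "'a::field_char_0 mat set"
  assumes H_carrier: "H \<subseteq> carrier_mat d d"
    and H_mult: "\<And>g h. g \<in> H \<Longrightarrow> h \<in> H \<Longrightarrow> g * h \<in> H"
    and H_unipotent: "\<And>h. h \<in> H \<Longrightarrow> \<exists>n. (h - 1\<^sub>m d) ^\<^sub>m n = 0\<^sub>m d d"
begin

abbreviation "J \<equiv> unipotent_algebra d H"

lemma J_carrier: "a \<in> J \<Longrightarrow> a \<in> carrier_mat d d"
  by (induction rule: unipotent_algebra.induct) (use H_carrier in \<open>auto intro!: minus_carrier_mat\<close>)

text \<open>Only the generators \<open>h - 1\<close> are known to be nilpotent; linearity of the
  trace carries the vanishing to their span.\<close>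

lemma J_trace: "a \<in> J \<Longrightarrow> mtrace a = 0"
proof (induction rule: unipotent_algebra.induct)
  case zero show ?case by (simp add: mtrace_def)
next
  case (gen h)
  with H_unipotent H_carrier det_unipotent(2)[of h d] show ?case by blast
next
  case (add a b)
  thus ?case using mtrace_add[OF J_carrier J_carrier, of a b] by simp
next
  case (smult a c)
  thus ?case using mtrace_smult[OF J_carrier, of a] by simp
qed

text \<open>\<open>(h - 1) (g - 1) = (h g - 1) - (h - 1) - (g - 1)\<close>, so the linear span of
  the generators is already closed under products.\<close>

lemma J_mult_gen: "b \<in> J \<Longrightarrow> h \<in> H \<Longrightarrow> (h - 1\<^sub>m d) * b \<in> J"
proof (induction b rule: unipotent_algebra.induct)
  case zero
  have "(h - 1\<^sub>m d) * 0\<^sub>m d d = 0\<^sub>m d d"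
    by (rule right_mult_zero_mat[where nc = d]) (auto intro!: minus_carrier_mat)
  thus ?case by (simp add: unipotent_algebra.zero)
next
  case (gen g)
  have c: "h \<in> carrier_mat d d" "g \<in> carrier_mat d d" "h * g \<in> carrier_mat d d"
    using gen H_carrier H_mult by blast+
  have "(h - 1\<^sub>m d) * (g - 1\<^sub>m d) = (h * g - 1\<^sub>m d) + (- 1) \<cdot>\<^sub>m ((h - 1\<^sub>m d) + (g - 1\<^sub>m d))"
  proof -
    have "(h - 1\<^sub>m d) * (g - 1\<^sub>m d) = (h * g - h * 1\<^sub>m d) - (g - 1\<^sub>m d)"
      using c by (simp add: minus_mult_distrib_mat[OF c(1) one_carrier_mat minus_carrier_mat[OF one_carrier_mat]]
        mult_minus_distrib_mat[OF c(1) c(2) one_carrier_mat] left_mult_one_mat[OF minus_carrier_mat[OF one_carrier_mat]])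
    also have "\<dots> = (h * g - 1\<^sub>m d) + (- 1) \<cdot>\<^sub>m ((h - 1\<^sub>m d) + (g - 1\<^sub>m d))"
      using c by (auto simp: right_mult_one_mat[OF c(1)] intro!: eq_matI simp del: index_mult_mat(1))
    finally show ?thesis .
  qed
  thus ?case using gen H_mult by (auto intro!: unipotent_algebra.intros)
next
  case (add a b)
  have "(h - 1\<^sub>m d) * (a + b) = (h - 1\<^sub>m d) * a + (h - 1\<^sub>m d) * b"
    by (rule mult_add_distrib_mat[OF minus_carrier_mat[OF one_carrier_mat] J_carrier[OF add.hyps(1)] J_carrier[OF add.hyps(2)]])
  thus ?case using add by (auto intro: unipotent_algebra.add)
next
  case (smult a c)
  have "(h - 1\<^sub>m d) * (c \<cdot>\<^sub>m a) = c \<cdot>\<^sub>m ((h - 1\<^sub>m d) * a)"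
    by (rule mult_smult_distrib[OF minus_carrier_mat[OF one_carrier_mat] J_carrier[OF smult.hyps]])
  thus ?case using smult by (auto intro: unipotent_algebra.smult)
qed

lemma J_mult: "a \<in> J \<Longrightarrow> b \<in> J \<Longrightarrow> a * b \<in> J"
proof (induction a rule: unipotent_algebra.induct)
  case zero
  thus ?case using J_carrier[OF zero] by (simp add: left_mult_zero_mat unipotent_algebra.zero)
next
  case (gen h) thus ?case by (blast intro: J_mult_gen)
next
  case (add x y)
  thus ?case using add_mult_distrib_mat[OF J_carrier[OF add.hyps(1)] J_carrier[OF add.hyps(2)] J_carrier[OF add.prems]]
    by (auto intro: unipotent_algebra.add)
next
  case (smult x c)
  thus ?case using mult_smult_assoc_mat[OF J_carrier[OF smult.hyps] J_carrier[OF smult.prems]]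
    by (auto intro: unipotent_algebra.smult)
qed

text \<open>All positive powers of \<open>b\<close> lie in \<open>J\<close>, so all their traces
  vanish.\<close>

lemma J_no_eigenvalue_1: "b \<in> J \<Longrightarrow> v \<in> carrier_vec d \<Longrightarrow> b *\<^sub>v v = v \<Longrightarrow> v = 0\<^sub>v d"
proof (rule no_eigenvalue_1_if_traces_vanish[OF J_carrier])
  fix n assume b: "b \<in> J"
  have "b ^\<^sub>m Suc n \<in> J"
    by (induction n) (use b J_carrier[OF b] in \<open>auto intro: J_mult\<close>)
  thus "mtrace (b ^\<^sub>m Suc n) = 0" by (rule J_trace)
qed

lemma J_sum_mult_vec:
  assumes "finite I" "\<And>i. i \<in> I \<Longrightarrow> b i \<in> J" "v \<in> carrier_vec d"
  shows "\<exists>b'\<in>J. \<forall>r<d. (b' *\<^sub>v v) $ r = (\<Sum>i\<in>I. c i * (b i *\<^sub>v v) $ r)"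
  using assms(1,2)
proof (induction I)
  case empty
  show ?case using assms(3) by (intro bexI[OF _ unipotent_algebra.zero]) auto
next
  case (insert i I)
  then obtain b' where b': "b' \<in> J" "\<forall>r<d. (b' *\<^sub>v v) $ r = (\<Sum>i\<in>I. c i * (b i *\<^sub>v v) $ r)" by auto
  have bi: "b i \<in> J" using insert by simp
  have "((b' + c i \<cdot>\<^sub>m b i) *\<^sub>v v) $ r = (b' *\<^sub>v v) $ r + c i * (b i *\<^sub>v v) $ r" if "r < d" for r
    using that assms(3) J_carrier[OF b'(1)] J_carrier[OF bi]
    by (simp add: add_mult_distrib_mat_vec[of _ d d])
  thus ?case using insert.hyps b' bi
    by (intro bexI[of _ "b' + c i \<cdot>\<^sub>m b i"]) (auto simp: add.commute intro: unipotent_algebra.intros)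
qed

theorem kolchin:
  assumes v: "v \<in> carrier_vec d" and len: "length as = d" and as: "set as \<subseteq> J"
  shows "foldr (*\<^sub>v) as v = 0\<^sub>v d"
proof -
  \<comment> \<open>\<open>w d\<close> is \<open>v\<close> and \<open>w 0\<close> is the product
    that is to vanish; each step down applies one more matrix.\<close>
  define w where "w = (\<lambda>k. foldr (*\<^sub>v) (drop k as) v)"
  have car: "foldr (*\<^sub>v) bs v \<in> carrier_vec d" if "set bs \<subseteq> J" for bs
    using that by (induction bs) (auto simp: v intro!: mult_mat_vec_carrier J_carrier)
  have wc: "w k \<in> carrier_vec d" for k unfolding w_def by (rule car) (use as set_drop_subset[of k as] in blast)
  have w_step: "\<exists>b\<in>J. w l = b *\<^sub>v w k" if "l < k" "k \<le> d" for l k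
    using that
  proof (induction "k - l" arbitrary: l)
    case 0 thus ?case by simp
  next
    case (Suc n)
    have l: "l < length as" using Suc.prems len by simp
    hence al: "as ! l \<in> J" using as nth_mem by blast
    have wl: "w l = as ! l *\<^sub>v w (Suc l)"
      unfolding w_def using l by (simp add: Cons_nth_drop_Suc[symmetric])
    show ?case
    proof (cases "Suc l = k")
      case True with wl al show ?thesis by blast
    next
      case False
      with Suc obtain b where b: "b \<in> J" "w (Suc l) = b *\<^sub>v w k"
        by (metis Suc_lessI diff_Suc_Suc diff_Suc_eq_diff_pred Suc_diff_Suc old.nat.inject)
      have "w l = (as ! l * b) *\<^sub>v w k"
        unfolding wl b(2) by (rule assoc_mult_mat_vec[OF J_carrier[OF al] J_carrier[OF b(1)] wc, symmetric])
      with J_mult[OF al b(1)] show ?thesis by blast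
    qed
  qed
  \<comment> \<open>The \<open>d + 1\<close> vectors as columns, completed by a zero row to a
    singular square matrix; a kernel vector is a linear dependence.\<close>
  define W where "W = mat (Suc d) (Suc d) (\<lambda>(r, k). if r < d then w k $ r else 0)"
  have W: "W \<in> carrier_mat (Suc d) (Suc d)" by (simp add: W_def)
  have "det W = (\<Sum>j<Suc d. W $$ (d, j) * cofactor W d j)" by (rule laplace_expansion_row[OF W]) simp
  also have "\<dots> = 0" by (rule sum.neutral) (simp add: W_def)
  finally obtain c where c: "c \<in> carrier_vec (Suc d)" "c \<noteq> 0\<^sub>v (Suc d)" "W *\<^sub>v c = 0\<^sub>v (Suc d)"
    using det_0_iff_vec_prod_zero_field[OF W] by blast
  have rel: "(\<Sum>k<Suc d. c $ k * w k $ r) = 0" if "r < d" for r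
  proof -
    have "(W *\<^sub>v c) $ r = (\<Sum>k<Suc d. w k $ r * c $ k)"
      using that c(1) by (simp add: W_def scalar_prod_def atLeast0LessThan)
    with c(3) that show ?thesis by (simp add: mult.commute)
  qed
  \<comment> \<open>For the largest index occurring in the dependence, \<open>w k\<close> is a
    combination of the \<open>w l\<close> with \<open>l < k\<close>. Each of these lies in
    \<open>J\<close> applied to \<open>w k\<close>, so some \<open>b'\<close> in \<open>J\<close>
    fixes \<open>w k\<close>.\<close>
  define k where "k = Max {k. k < Suc d \<and> c $ k \<noteq> 0}"
  have fin: "finite {k. k < Suc d \<and> c $ k \<noteq> 0}" by simp
  have ne: "{k. k < Suc d \<and> c $ k \<noteq> 0} \<noteq> {}" using c(1,2) by (auto intro!: eq_vecI)
  have k: "k < Suc d" "c $ k \<noteq> 0" using Max_in[OF fin ne] by (auto simp: k_def)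
  have kmax: "c $ l = 0" if "k < l" "l < Suc d" for l
  proof (rule ccontr)
    assume "c $ l \<noteq> 0"
    hence "l \<le> k" unfolding k_def using that by (intro Max_ge[OF fin]) blast
    thus False using that by simp
  qed
  have wk: "w k $ r = (\<Sum>l<k. - (c $ l / c $ k) * w l $ r)" if "r < d" for r
  proof -
    have "(\<Sum>l<Suc d. c $ l * w l $ r) = (\<Sum>l\<in>{..<k} \<union> {k}. c $ l * w l $ r)"
      using k by (intro sum.mono_neutral_right) (auto intro: kmax)
    hence "c $ k * w k $ r = - (\<Sum>l<k. c $ l * w l $ r)"
      using rel[OF that] by (simp add: eq_neg_iff_add_eq_0 add.commute)
    hence "w k $ r = - (\<Sum>l<k. c $ l * w l $ r) / c $ k" using k(2) by (simp add: field_simps)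
    thus ?thesis by (simp add: sum_divide_distrib sum_negf)
  qed
  have "\<forall>l<k. \<exists>b\<in>J. w l = b *\<^sub>v w k" using w_step k(1) by auto
  then obtain b where b: "\<And>l. l < k \<Longrightarrow> b l \<in> J" "\<And>l. l < k \<Longrightarrow> w l = b l *\<^sub>v w k" by metis
  from J_sum_mult_vec[of "{..<k}" b "w k" "\<lambda>l. - (c $ l / c $ k)"] b(1) wc obtain b' where
    b': "b' \<in> J" "\<forall>r<d. (b' *\<^sub>v w k) $ r = (\<Sum>l<k. - (c $ l / c $ k) * (b l *\<^sub>v w k) $ r)" by auto
  have "b' *\<^sub>v w k = w k"
    using b'(2) wc[of k] J_carrier[OF b'(1)] by (intro eq_vecI) (auto simp: wk b(2)[symmetric])
  hence wk0: "w k = 0\<^sub>v d" by (rule J_no_eigenvalue_1[OF b'(1) wc])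
  have "w 0 = 0\<^sub>v d"
  proof (cases "k = 0")
    case False
    then obtain b where "b \<in> J" "w 0 = b *\<^sub>v w k" using w_step[of 0 k] k(1) by auto
    thus ?thesis using wk0 J_carrier[of b] by auto
  qed (use wk0 in simp)
  thus ?thesis by (simp add: w_def)
qed

end

section \<open>Pointed rational polyhedral cones\<close>

definition ip :: "nat \<Rightarrow> (nat \<Rightarrow> rat) \<Rightarrow> (nat \<Rightarrow> rat) \<Rightarrow> rat" where
  "ip n x y = (\<Sum>j<n. x j * y j)"

lemma ip_add_right: "ip n x (\<lambda>j. y j + c * z j) = ip n x y + c * ip n x z"
  by (simp add: ip_def algebra_simps sum.distrib sum_distrib_left)

lemma ip_add_left: "ip n (\<lambda>j. c * y j + b * z j) x = c * ip n y x + b * ip n z x"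
  by (simp add: ip_def algebra_simps sum.distrib sum_distrib_left)

lemma ip_self_pos: "j < n \<Longrightarrow> x j \<noteq> 0 \<Longrightarrow> 0 < ip n x x"
  unfolding ip_def by (intro sum_pos2[of _ j]) (auto simp: zero_less_mult_iff not_less less_le)

lemma small_perturbation:
  assumes "finite I" "\<And>i. i \<in> I \<Longrightarrow> 0 < (x i :: rat)"
  shows "\<exists>\<epsilon>>0. \<forall>i\<in>I. 0 < x i + \<epsilon> * y i"
  using assms
proof (induction I)
  case empty show ?case by (intro exI[of _ 1]) simp
next
  case (insert a I)
  then obtain \<epsilon> where e: "\<epsilon> > 0" "\<forall>i\<in>I. 0 < x i + \<epsilon> * y i" by auto
  \<comment> \<open>The bound \<open>x a / (1 + \<bar>y a\<bar>)\<close> keeps the new coordinate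
    positive; the summand \<open>1\<close> makes the estimate strict and covers
    \<open>y a = 0\<close>.\<close>
  define \<delta> where "\<delta> = min \<epsilon> (x a / (1 + \<bar>y a\<bar>))"
  have xa: "x a > 0" using insert.prems by simp
  have "\<delta> \<le> x a / (1 + \<bar>y a\<bar>)" by (simp add: \<delta>_def)
  hence "\<delta> * (1 + \<bar>y a\<bar>) \<le> x a" by (subst (asm) pos_le_divide_eq) auto
  moreover have "0 < \<delta>" using e(1) xa by (simp add: \<delta>_def add_pos_nonneg)
  ultimately have d: "0 < \<delta>" "\<delta> \<le> \<epsilon>" "\<delta> * (1 + \<bar>y a\<bar>) \<le> x a"
    by (simp_all add: \<delta>_def)
  have "0 < x i + \<delta> * y i" if "i \<in> I" for i
  proof (cases "y i \<ge> 0")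
    case True
    moreover have "x i > 0" using insert.prems that by simp
    ultimately show ?thesis using d(1) by (intro add_pos_nonneg mult_nonneg_nonneg) auto
  next
    case False
    hence "\<epsilon> * y i \<le> \<delta> * y i" using d(2) by (intro mult_right_mono_neg) auto
    with e(2) that show ?thesis by fastforce
  qed
  moreover have "0 < x a + \<delta> * y a"
  proof -
    have "- (\<delta> * y a) \<le> \<delta> * \<bar>y a\<bar>" using d(1) by (simp add: abs_if algebra_simps)
    thus ?thesis using d(1,3) by (simp add: algebra_simps)
  qed
  ultimately show ?case using d(1) by blast
qed

text \<open>Gordan's alternative, by eliminating one vector at a time.\<close>

lemma gordan:
  assumes "finite I"
    and "\<And>c. (\<forall>i\<in>I. 0 \<le> c i) \<Longrightarrow> (\<forall>j<n. (\<Sum>i\<in>I. c i * v i j) = 0) \<Longrightarrow> (\<forall>i\<in>I. c i = 0)"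
  shows "\<exists>m. \<forall>i\<in>I. 0 < ip n (v i) m"
  using assms
proof (induction I arbitrary: v)
  case empty show ?case by simp
next
  case (insert a I)
  have rel: "c i = 0" if "\<forall>i\<in>insert a I. 0 \<le> c i" "\<forall>j<n. c a * v a j + (\<Sum>i\<in>I. c i * v i j) = 0"
    "i \<in> insert a I" for c i
    using insert.prems[of c] insert.hyps that by auto
  have "\<exists>m'. \<forall>i\<in>I. 0 < ip n (v i) m'"
  proof (rule insert.IH)
    fix c assume c: "\<forall>i\<in>I. 0 \<le> c i" "\<forall>j<n. (\<Sum>i\<in>I. c i * v i j) = 0"
    have "(\<Sum>i\<in>I. (c(a := 0)) i * v i j) = (\<Sum>i\<in>I. c i * v i j)" for j
      using insert.hyps by (intro sum.cong) auto
    hence "(c(a := 0)) i = 0" if "i \<in> I" for i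
      using c that by (intro rel) auto
    thus "\<forall>i\<in>I. c i = 0" using insert.hyps by (metis fun_upd_other)
  qed
  then obtain m' where m': "\<And>i. i \<in> I \<Longrightarrow> 0 < ip n (v i) m'" by blast
  have "\<exists>m. (\<forall>i\<in>I. 0 < ip n (v i) m) \<and> 0 \<le> ip n (v a) m"
  proof (cases "0 \<le> ip n (v a) m'")
    case True with m' show ?thesis by blast
  next
    case False
    define \<alpha> where "\<alpha> = - ip n (v a) m'"
    have \<alpha>: "\<alpha> > 0" using False by (simp add: \<alpha>_def)
    \<comment> \<open>Up to the factor \<alpha> this is the projection of \<open>v i\<close> along
      \<open>v a\<close> to the hyperplane orthogonal to \<open>m'\<close>. A nonnegative relation
      among the projections lifts to one among the original vectors, with coefficients
      \<open>c'\<close>.\<close>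
    define v' where "v' = (\<lambda>i j. ip n (v i) m' * v a j + \<alpha> * v i j)"
    have "\<exists>m. \<forall>i\<in>I. 0 < ip n (v' i) m"
    proof (rule insert.IH)
      fix c assume c: "\<forall>i\<in>I. 0 \<le> c i" "\<forall>j<n. (\<Sum>i\<in>I. c i * v' i j) = 0"
      define c' where "c' = (\<lambda>i. if i = a then \<Sum>i\<in>I. c i * ip n (v i) m' else c i * \<alpha>)"
      have "(\<Sum>i\<in>I. c i * v' i j) = c' a * v a j + (\<Sum>i\<in>I. c' i * v i j)" for j
      proof -
        have "(\<Sum>i\<in>I. c' i * v i j) = (\<Sum>i\<in>I. c i * \<alpha> * v i j)"
          using insert.hyps by (intro sum.cong) (auto simp: c'_def)
        thus ?thesis by (simp add: v'_def c'_def algebra_simps sum.distrib sum_distrib_left)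
      qed
      moreover have "\<forall>i\<in>insert a I. 0 \<le> c' i"
        using c(1) m'[THEN less_imp_le] less_imp_le[OF \<alpha>] by (auto simp: c'_def intro!: sum_nonneg mult_nonneg_nonneg)
      ultimately have "c' i = 0" if "i \<in> I" for i using rel[of c' i] c(2) that by simp
      thus "\<forall>i\<in>I. c i = 0" using insert.hyps \<alpha> by (metis c'_def mult_eq_0_iff less_irrefl)
    qed
    then obtain m'' where m'': "\<And>i. i \<in> I \<Longrightarrow> 0 < ip n (v' i) m''" by blast
    \<comment> \<open>The multiple of \<open>m'\<close> is chosen so that \<open>m\<close> vanishes
      on \<open>v a\<close>; it does not change the values on the \<open>v' i\<close>, which are
      orthogonal to \<open>m'\<close>.\<close>
    define m where "m = (\<lambda>j. m'' j + ip n (v a) m'' / \<alpha> * m' j)"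
    have ipm: "ip n x m = ip n x m'' + ip n (v a) m'' / \<alpha> * ip n x m'" for x
      unfolding m_def by (rule ip_add_right)
    have "ip n (v a) m' = - \<alpha>" by (simp add: \<alpha>_def)
    with ipm[of "v a"] \<alpha> have "ip n (v a) m = 0" by simp
    moreover have "0 < ip n (v i) m" if "i \<in> I" for i
    proof -
      have "\<alpha> * ip n (v i) m = ip n (v' i) m''"
        using \<alpha> unfolding ipm v'_def ip_add_left by (simp add: field_simps)
      with m''[OF that] \<alpha> show ?thesis by (metis zero_less_mult_pos)
    qed
    ultimately show ?thesis by (intro exI[of _ m]) simp
  qed
  then obtain m where m: "\<And>i. i \<in> I \<Longrightarrow> 0 < ip n (v i) m" "0 \<le> ip n (v a) m" by blast
  \<comment> \<open>A small move in the direction of \<open>v a\<close> makes the value at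
    \<open>v a\<close> strictly positive and keeps the other values positive.\<close>
  obtain \<epsilon> where e: "\<epsilon> > 0" "\<And>i. i \<in> I \<Longrightarrow> 0 < ip n (v i) m + \<epsilon> * ip n (v i) (v a)"
    using small_perturbation[of I "\<lambda>i. ip n (v i) m" "\<lambda>i. ip n (v i) (v a)"] insert.hyps(1) m(1) by auto
  have "0 < ip n (v a) (v a)"
  proof (rule ccontr)
    assume "\<not> 0 < ip n (v a) (v a)"
    hence "v a j = 0" if "j < n" for j using ip_self_pos that by blast
    hence "\<forall>j<n. (if a = a then 1 else 0) * v a j + (\<Sum>i\<in>I. (if i = a then 1 else 0) * v i j) = 0"
      using insert.hyps by (auto intro!: sum.neutral)
    moreover have "\<forall>i\<in>insert a I. 0 \<le> (if i = a then 1 else (0::rat))" by simp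
    ultimately have "(if a = a then 1 else (0::rat)) = 0"
      using rel[of "\<lambda>i. if i = a then 1 else 0" a] by blast
    thus False by simp
  qed
  with m(2) e(1) have "0 < ip n (v a) m + \<epsilon> * ip n (v a) (v a)" by (intro add_nonneg_pos) auto
  with e(2) show ?case
    by (intro exI[of _ "\<lambda>j. m j + \<epsilon> * v a j"]) (auto simp: ip_add_right)
qed

lemma common_denominator: "\<exists>N>0. \<forall>j<(n::nat). \<exists>z. of_int N * (m j :: rat) = of_int z"
proof (induction n)
  case 0 show ?case by (intro exI[of _ 1]) simp
next
  case (Suc n)
  then obtain N where N: "N > 0" "\<And>j. j < n \<Longrightarrow> \<exists>z. of_int N * m j = of_int z" by blast
  obtain a b where ab: "m n = Rat.Fract a b" "b > 0" by (cases "m n") auto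
  have "\<exists>z. of_int (N * b) * m j = of_int z" if j: "j < Suc n" for j
  proof (cases "j = n")
    case True
    have "of_int (N * b) * m n = of_int (N * a)" using ab by (simp add: Rat.Fract_of_int_quotient)
    with True show ?thesis by blast
  next
    case False
    with N j obtain z where "of_int N * m j = of_int z" by (metis less_SucE)
    hence "of_int (N * b) * m j = of_int (z * b)" by (simp add: ac_simps)
    thus ?thesis by blast
  qed
  with N(1) ab(2) show ?case by (intro exI[of _ "N * b"]) auto
qed

lemma sum_fun_apply: "(\<Sum>v\<in>W. f v) j = (\<Sum>v\<in>W. f v j)" for f :: "'a \<Rightarrow> 'b \<Rightarrow> 'c::comm_monoid_add"
  by (induction W rule: infinite_finite_induct) auto

definition cone_of :: "(nat \<Rightarrow> int) set \<Rightarrow> (nat \<Rightarrow> rat) set" where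
  "cone_of V = {\<Sum>v\<in>V. rat_scale (c v) (to_rat v) | c. \<forall>v\<in>V. 0 \<le> c v}"

lemma cone_of_iff: "x \<in> cone_of V \<longleftrightarrow> (\<exists>c. (\<forall>v\<in>V. 0 \<le> c v) \<and> (\<forall>j. x j = (\<Sum>v\<in>V. c v * of_int (v j))))"
  by (auto simp: cone_of_def fun_eq_iff sum_fun_apply rat_scale_def to_rat_def)

lemma cone_of_add: assumes "x \<in> cone_of V" "y \<in> cone_of V" shows "x + y \<in> cone_of V"
proof -
  from assms obtain c d where "\<forall>v\<in>V. 0 \<le> c v" "\<forall>j. x j = (\<Sum>v\<in>V. c v * of_int (v j))"
    "\<forall>v\<in>V. 0 \<le> d v" "\<forall>j. y j = (\<Sum>v\<in>V. d v * of_int (v j))" by (auto simp: cone_of_iff)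
  thus ?thesis unfolding cone_of_iff
    by (intro exI[of _ "\<lambda>v. c v + d v"]) (auto simp: algebra_simps sum.distrib)
qed

lemma cone_of_scale: assumes "x \<in> cone_of V" "0 \<le> a" shows "rat_scale a x \<in> cone_of V"
proof -
  from assms obtain c where "\<forall>v\<in>V. 0 \<le> c v" "\<forall>j. x j = (\<Sum>v\<in>V. c v * of_int (v j))"
    by (auto simp: cone_of_iff)
  thus ?thesis unfolding cone_of_iff
    by (intro exI[of _ "\<lambda>v. a * c v"]) (use assms(2) in \<open>auto simp: rat_scale_def algebra_simps sum_distrib_left\<close>)
qed

lemma cone_of_0: "0 \<in> cone_of V"
  unfolding cone_of_iff by (intro exI[of _ "\<lambda>_. 0"]) simp

lemma cone_of_sum: "(\<And>i. i \<in> I \<Longrightarrow> x i \<in> cone_of V) \<Longrightarrow> (\<Sum>i\<in>I. x i) \<in> cone_of V"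
  by (induction I rule: infinite_finite_induct) (auto simp: cone_of_0 cone_of_add)

lemma cone_of_generator: assumes "finite V" "v \<in> V" shows "to_rat v \<in> cone_of V"
  unfolding cone_of_iff
proof (intro exI[of _ "\<lambda>w. if w = v then 1 else 0"] conjI allI ballI)
  fix j
  have "(\<Sum>w\<in>V. (if w = v then 1 else 0) * rat_of_int (w j)) = (\<Sum>w\<in>V. if w = v then of_int (v j) else 0)"
    by (intro sum.cong) auto
  thus "to_rat v j = (\<Sum>w\<in>V. (if w = v then 1 else 0) * rat_of_int (w j))"
    using assms by (simp add: to_rat_def)
qed simp

lemma cone_of_remove:
  assumes V: "finite V" "v \<in> V" and v: "to_rat v \<in> cone_of (V - {v})"
  shows "cone_of (V - {v}) = cone_of V"
proof (intro equalityI subsetI)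
  fix x assume "x \<in> cone_of V"
  then obtain c where c: "\<forall>v\<in>V. 0 \<le> c v" "x = (\<Sum>v\<in>V. rat_scale (c v) (to_rat v))"
    by (auto simp: cone_of_def)
  have "x = rat_scale (c v) (to_rat v) + (\<Sum>w\<in>V - {v}. rat_scale (c w) (to_rat w))"
    unfolding c(2) using V by (simp add: sum.remove)
  moreover have "(\<Sum>w\<in>V - {v}. rat_scale (c w) (to_rat w)) \<in> cone_of (V - {v})"
    using c(1) by (auto simp: cone_of_def)
  ultimately show "x \<in> cone_of (V - {v})"
    using cone_of_add[OF cone_of_scale[OF v]] c(1) V by auto
next
  fix x assume "x \<in> cone_of (V - {v})"
  then obtain c where c: "\<forall>v\<in>V - {v}. 0 \<le> c v" "\<forall>j. x j = (\<Sum>v\<in>V - {v}. c v * of_int (v j))"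
    by (auto simp: cone_of_iff)
  show "x \<in> cone_of V" unfolding cone_of_iff
  proof (intro exI[of _ "c(v := 0)"] conjI allI)
    fix j
    have "(\<Sum>w\<in>V. (c(v := 0)) w * of_int (w j)) = (\<Sum>w\<in>V - {v}. (c(v := 0)) w * of_int (w j))"
      using V by (simp add: sum.remove)
    also have "\<dots> = (\<Sum>w\<in>V - {v}. c w * of_int (w j))" by (intro sum.cong) auto
    finally show "x j = (\<Sum>w\<in>V. (c(v := 0)) w * of_int (w j))" using c(2) by simp
  qed (use c(1) in auto)
qed

lemma primitive_part:
  assumes v: "v \<in> int_lattice n" "v \<noteq> 0"
  obtains g w where "g > 0" "v = (\<lambda>j. g * w j)" "primitive n w"
proof -
  define g where "g = Gcd (v ` {..<n})"
  have "g \<noteq> 0"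
  proof
    assume "g = 0"
    hence "v j = 0" for j using v(1) by (cases "j < n") (auto simp: g_def int_lattice_def)
    thus False using v(2) by (auto simp: fun_eq_iff)
  qed
  moreover have "g \<ge> 0" by (simp add: g_def)
  ultimately have g: "g > 0" by simp
  define w where "w = (\<lambda>j. v j div g)"
  have vw: "v j = g * w j" for j
  proof (cases "j < n")
    case True
    hence "g dvd v j" by (auto simp: g_def)
    thus ?thesis by (simp add: w_def)
  qed (use v(1) in \<open>auto simp: w_def int_lattice_def\<close>)
  have "primitive n w"
    unfolding primitive_def
  proof (intro conjI ballI allI impI)
    show "w \<in> int_lattice n" using v(1) by (auto simp: w_def int_lattice_def)
    show "w \<noteq> 0" using vw v(2) by (auto simp: fun_eq_iff)
    fix u c assume "w = (\<lambda>j. c * u j)"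
    hence "v j = g * (c * u j)" for j using vw by metis
    hence "g * c dvd v j" for j by (metis dvd_triv_left mult.assoc)
    hence "g * c dvd Gcd (v ` {..<n})" by (intro Gcd_greatest) auto
    hence "g * c dvd g * 1" by (simp add: g_def)
    hence "c dvd 1" using g by (simp only: dvd_mult_cancel_left) simp
    thus "\<bar>c\<bar> = 1" by simp
  qed
  with g vw that show thesis by blast
qed

locale pointed_cone =
  fixes n :: nat and \<Delta> :: "(nat \<Rightarrow> rat) set"
  assumes polyhedral: "rational_polyhedral_cone n \<Delta>" and pointed: "pointed \<Delta>"
begin

text \<open>A generating set of least cardinality has no redundant member.\<close>

lemma minimal_generators:
  obtains V where "finite V" "V \<subseteq> int_lattice n" "\<Delta> = cone_of V"
    "\<And>v. v \<in> V \<Longrightarrow> to_rat v \<notin> cone_of (V - {v})"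
proof -
  define P where "P = (\<lambda>V. finite V \<and> V \<subseteq> int_lattice n \<and> \<Delta> = cone_of V)"
  have "\<exists>V. P V" using polyhedral by (auto simp: rational_polyhedral_cone_def P_def cone_of_def)
  then obtain V where V: "P V" "\<And>W. P W \<Longrightarrow> card V \<le> card W" using ex_has_least_nat[of P _ card] by metis
  have "to_rat v \<notin> cone_of (V - {v})" if v: "v \<in> V" for v
  proof
    assume "to_rat v \<in> cone_of (V - {v})"
    hence "P (V - {v})" using V(1) v cone_of_remove by (auto simp: P_def)
    hence "card V \<le> card (V - {v})" by (rule V(2))
    thus False using V(1) v by (metis P_def card_Diff1_less leD)
  qed
  with V(1) that show thesis by (auto simp: P_def)
qed

lemma sum_eq_0_imp_eq_0:
  assumes "finite I" "\<And>i. i \<in> I \<Longrightarrow> x i \<in> \<Delta>" "(\<Sum>i\<in>I. x i) = 0" "i \<in> I"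
  shows "x i = 0"
proof -
  obtain V where V: "\<Delta> = cone_of V" by (rule minimal_generators)
  have "(\<Sum>j\<in>I - {i}. x j) \<in> \<Delta>" using assms(2) V cone_of_sum[of "I - {i}" x V] by auto
  moreover have "- x i = (\<Sum>j\<in>I - {i}. x j)"
    using assms(1,3,4) by (simp add: sum.remove neg_eq_iff_add_eq_0)
  ultimately show ?thesis using pointed assms(2,4) by (auto simp: pointed_def)
qed

text \<open>Expand \<open>x + y = c v\<close> in the generators. If the coefficient of
  \<open>v\<close> on the left were below \<open>c\<close>, then \<open>v\<close> would lie in the
  cone of the others, against minimality. Otherwise subtracting \<open>c v\<close> leaves a
  vanishing sum of cone elements, and pointedness makes each of them zero.\<close>

lemma generator_extremal:
  assumes V: "finite V" "\<Delta> = cone_of V" and min: "\<And>v. v \<in> V \<Longrightarrow> to_rat v \<notin> cone_of (V - {v})"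
    and v: "v \<in> V"
  shows "extremal_ray \<Delta> (ray (to_rat v))"
proof -
  have nz: "to_rat w \<noteq> 0" if "w \<in> V" for w using min[OF that] cone_of_0 by auto
  have "rat_scale c (to_rat v) \<in> \<Delta>" if "c \<ge> 0" for c
    using cone_of_scale[OF cone_of_generator[OF V(1) v] that] V(2) by simp
  hence sub: "ray (to_rat v) \<subseteq> \<Delta>" by (auto simp: ray_def)
  have "x \<in> ray (to_rat v) \<and> y \<in> ray (to_rat v)"
    if x: "x \<in> \<Delta>" and y: "y \<in> \<Delta>" and xy: "x + y \<in> ray (to_rat v)" for x y
  proof -
    from x obtain a where a: "\<And>w. w \<in> V \<Longrightarrow> 0 \<le> a w" "x = (\<Sum>w\<in>V. rat_scale (a w) (to_rat w))"
      by (auto simp: V(2) cone_of_def)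
    from y obtain b where b: "\<And>w. w \<in> V \<Longrightarrow> 0 \<le> b w" "y = (\<Sum>w\<in>V. rat_scale (b w) (to_rat w))"
      by (auto simp: V(2) cone_of_def)
    from xy obtain c where c: "c \<ge> 0" "x + y = rat_scale c (to_rat v)" by (auto simp: ray_def)
    define s where "s = (\<lambda>w. a w + b w)"
    have s: "0 \<le> s w" if "w \<in> V" for w using a(1) b(1) that by (simp add: s_def)
    have sc: "(\<Sum>w\<in>V. rat_scale (s w) (to_rat w)) = rat_scale c (to_rat v)"
      unfolding c(2)[symmetric] a(2) b(2) by (auto simp: s_def fun_eq_iff sum_fun_apply rat_scale_def algebra_simps sum.distrib)
    have rest: "(\<Sum>w\<in>V - {v}. rat_scale (s w) (to_rat w)) = rat_scale (c - s v) (to_rat v)"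
    proof -
      have "(\<Sum>w\<in>V - {v}. rat_scale (s w) (to_rat w)) = rat_scale c (to_rat v) - rat_scale (s v) (to_rat v)"
        using sc V(1) v by (simp add: sum.remove[of V v] algebra_simps)
      thus ?thesis by (simp add: rat_scale_def fun_eq_iff algebra_simps)
    qed
    have cs: "c - s v \<le> 0"
    proof (rule ccontr)
      assume "\<not> c - s v \<le> 0"
      hence pos: "c - s v > 0" by simp
      have "rat_scale (c - s v) (to_rat v) \<in> cone_of (V - {v})"
        unfolding rest[symmetric] using s by (auto simp: cone_of_def)
      from cone_of_scale[OF this, of "inverse (c - s v)"] pos
      have "rat_scale (inverse (c - s v)) (rat_scale (c - s v) (to_rat v)) \<in> cone_of (V - {v})"
        by simp
      moreover have "rat_scale (inverse (c - s v)) (rat_scale (c - s v) (to_rat v)) = to_rat v"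
        using pos by (simp add: rat_scale_def fun_eq_iff)
      ultimately show False using min[OF v] by metis
    qed
    define t where "t = s(v := s v - c)"
    have tD: "rat_scale (t w) (to_rat w) \<in> \<Delta>" if "w \<in> V" for w
      unfolding V(2) using s that cs by (intro cone_of_scale cone_of_generator[OF V(1)]) (auto simp: t_def)
    have "(\<Sum>w\<in>V. rat_scale (t w) (to_rat w))
      = rat_scale (s v - c) (to_rat v) + (\<Sum>w\<in>V - {v}. rat_scale (t w) (to_rat w))"
      using V(1) v by (simp add: sum.remove t_def)
    also have "(\<Sum>w\<in>V - {v}. rat_scale (t w) (to_rat w)) = (\<Sum>w\<in>V - {v}. rat_scale (s w) (to_rat w))"
      by (intro sum.cong) (auto simp: t_def)
    finally have "(\<Sum>w\<in>V. rat_scale (t w) (to_rat w)) = 0"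
      unfolding rest by (simp add: rat_scale_def fun_eq_iff algebra_simps)
    from sum_eq_0_imp_eq_0[OF V(1) tD this] have "rat_scale (t w) (to_rat w) = 0" if "w \<in> V" for w
      using that by blast
    hence "s w = 0" if "w \<in> V" "w \<noteq> v" for w
    proof -
      have "rat_scale (s w) (to_rat w) = 0"
        using \<open>\<And>w. w \<in> V \<Longrightarrow> rat_scale (t w) (to_rat w) = 0\<close>[OF that(1)] that(2) by (simp add: t_def)
      thus ?thesis using nz[OF that(1)] by (auto simp: rat_scale_def fun_eq_iff)
    qed
    hence ab: "a w = 0" "b w = 0" if "w \<in> V" "w \<noteq> v" for w
      using \<open>\<And>w. w \<in> V \<Longrightarrow> w \<noteq> v \<Longrightarrow> s w = 0\<close>[OF that] a(1)[OF that(1)] b(1)[OF that(1)]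
      by (simp_all add: s_def add_nonneg_eq_0_iff)
    have "x = rat_scale (a v) (to_rat v)" "y = rat_scale (b v) (to_rat v)"
      using V(1) v unfolding a(2) b(2)
      by (auto simp: sum.remove[of V v] ab fun_eq_iff rat_scale_def sum_fun_apply)
    thus ?thesis using a(1)[OF v] b(1)[OF v] by (auto simp: ray_def)
  qed
  with sub nz[OF v] show ?thesis by (auto simp: extremal_ray_def)
qed

lemma ray_generator_in_cone: assumes "v \<in> ray_generators n \<Delta>" shows "to_rat v \<in> \<Delta>"
proof -
  have "to_rat v \<in> ray (to_rat v)" by (auto simp: ray_def rat_scale_def intro!: exI[of _ 1])
  thus ?thesis using assms by (auto simp: ray_generators_def extremal_ray_def)
qed

lemma ip_to_rat: "ip n (to_rat v) (to_rat m) = of_int (pairing n v m)"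
  by (simp add: ip_def pairing_def to_rat_def)

text \<open>The primitive vectors along a minimal generating set are ray generators, so the
  inequalities at the ray generators imply those on the whole cone.\<close>

lemma dual_lattice_points_eq:
  "dual_lattice_points n \<Delta> = {m \<in> int_lattice n. \<forall>v\<in>ray_generators n \<Delta>. 0 \<le> pairing n v m}"
proof (intro equalityI subsetI)
  fix m assume "m \<in> dual_lattice_points n \<Delta>"
  hence "m \<in> int_lattice n" "\<And>x. x \<in> \<Delta> \<Longrightarrow> 0 \<le> ip n x (to_rat m)"
    by (auto simp: dual_lattice_points_def ip_def to_rat_def)
  thus "m \<in> {m \<in> int_lattice n. \<forall>v\<in>ray_generators n \<Delta>. 0 \<le> pairing n v m}"
    using ray_generator_in_cone ip_to_rat by force
next
  fix m assume m: "m \<in> {m \<in> int_lattice n. \<forall>v\<in>ray_generators n \<Delta>. 0 \<le> pairing n v m}"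
  obtain V where V: "finite V" "V \<subseteq> int_lattice n" "\<Delta> = cone_of V"
    "\<And>v. v \<in> V \<Longrightarrow> to_rat v \<notin> cone_of (V - {v})" by (rule minimal_generators) blast
  have pos: "0 \<le> pairing n v m" if v: "v \<in> V" for v
  proof -
    have "to_rat v \<noteq> 0" using V(4)[OF v] cone_of_0[of "V - {v}"] by metis
    hence "v \<noteq> 0" by (auto simp: to_rat_def fun_eq_iff)
    with V(2) v obtain g w where gw: "g > 0" "v = (\<lambda>j. g * w j)" "primitive n w"
      using primitive_part by (metis subsetD)
    have "ray (to_rat w) = ray (to_rat v)"
    proof (intro equalityI subsetI)
      fix x assume "x \<in> ray (to_rat w)"
      then obtain c where "c \<ge> 0" "x = rat_scale c (to_rat w)" by (auto simp: ray_def)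
      thus "x \<in> ray (to_rat v)" unfolding ray_def using gw(1)
        by (intro CollectI exI[of _ "c / of_int g"]) (auto simp: gw(2) rat_scale_def to_rat_def)
    next
      fix x assume "x \<in> ray (to_rat v)"
      then obtain c where "c \<ge> 0" "x = rat_scale c (to_rat v)" by (auto simp: ray_def)
      thus "x \<in> ray (to_rat w)" unfolding ray_def using gw(1)
        by (intro CollectI exI[of _ "c * of_int g"]) (auto simp: gw(2) rat_scale_def to_rat_def)
    qed
    hence "w \<in> ray_generators n \<Delta>"
      using generator_extremal[OF V(1,3,4) v] gw(3) by (auto simp: ray_generators_def)
    hence "0 \<le> pairing n w m" using m by auto
    moreover have "pairing n v m = g * pairing n w m"
      by (simp add: pairing_def gw(2) sum_distrib_left mult.assoc)
    ultimately show ?thesis using gw(1) by simp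
  qed
  have "0 \<le> (\<Sum>i<n. x i * of_int (m i))" if "x \<in> \<Delta>" for x
  proof -
    from that obtain c where c: "\<forall>v\<in>V. 0 \<le> c v" "\<And>j. x j = (\<Sum>v\<in>V. c v * of_int (v j))"
      by (auto simp: V(3) cone_of_iff)
    have "(\<Sum>i<n. x i * of_int (m i)) = (\<Sum>v\<in>V. c v * of_int (pairing n v m))"
      unfolding c(2) pairing_def of_int_sum sum_distrib_left sum_distrib_right
      by (subst sum.swap) (simp add: mult.assoc)
    also have "\<dots> \<ge> 0" using c(1) pos by (intro sum_nonneg mult_nonneg_nonneg) auto
    finally show ?thesis .
  qed
  thus "m \<in> dual_lattice_points n \<Delta>" using m by (auto simp: dual_lattice_points_def)
qed

text \<open>A nonnegative relation among ray generators is a vanishing sum of cone elements, which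
  pointedness makes trivial. Gordan's alternative then gives a rational point that is positive on
  all of them; clearing denominators gives a lattice point.\<close>

lemma interior_dual_point:
  assumes "finite I" "v ` I \<subseteq> ray_generators n \<Delta>"
  obtains m where "m \<in> int_lattice n" "\<And>i. i \<in> I \<Longrightarrow> 0 < pairing n (v i) m"
proof -
  have "\<exists>m. \<forall>i\<in>I. 0 < ip n (to_rat (v i)) m"
  proof (rule gordan[OF assms(1)])
    fix c assume c: "\<forall>i\<in>I. 0 \<le> c i" "\<forall>j<n. (\<Sum>i\<in>I. c i * to_rat (v i) j) = 0"
    obtain V where V: "\<Delta> = cone_of V" by (rule minimal_generators)
    have lat: "v i j = 0" if "i \<in> I" "j \<ge> n" for i j
      using assms(2) that by (auto simp: ray_generators_def primitive_def int_lattice_def image_subset_iff)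
    have in\<Delta>: "rat_scale (c i) (to_rat (v i)) \<in> \<Delta>" if "i \<in> I" for i
      using c(1) that assms(2) ray_generator_in_cone unfolding V by (intro cone_of_scale) auto
    have "(\<Sum>i\<in>I. rat_scale (c i) (to_rat (v i))) j = 0" for j
      using c(2) lat by (cases "j < n") (auto simp: sum_fun_apply rat_scale_def to_rat_def intro!: sum.neutral)
    hence "(\<Sum>i\<in>I. rat_scale (c i) (to_rat (v i))) = 0" by (simp add: fun_eq_iff)
    from sum_eq_0_imp_eq_0[OF assms(1) in\<Delta> this] have 0: "rat_scale (c i) (to_rat (v i)) = 0" if "i \<in> I" for i
      using that by blast
    show "\<forall>i\<in>I. c i = 0"
    proof
      fix i assume i: "i \<in> I"
      hence "v i \<noteq> 0" using assms(2) by (auto simp: ray_generators_def primitive_def image_subset_iff)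
      then obtain j where "v i j \<noteq> 0" by (auto simp: fun_eq_iff)
      moreover have "c i * of_int (v i j) = 0" using fun_cong[OF 0[OF i], of j] by (simp add: rat_scale_def to_rat_def)
      ultimately show "c i = 0" by simp
    qed
  qed
  then obtain m where m: "\<And>i. i \<in> I \<Longrightarrow> 0 < ip n (to_rat (v i)) m" by blast
  obtain N where N: "N > 0" "\<And>j. j < n \<Longrightarrow> \<exists>z. of_int N * m j = of_int z"
    using common_denominator[of n m] by blast
  then obtain z where z: "\<And>j. j < n \<Longrightarrow> of_int N * m j = of_int (z j)" by metis
  define m' where "m' = (\<lambda>j. if j < n then z j else 0)"
  have "0 < pairing n (v i) m'" if "i \<in> I" for i
  proof -
    have "rat_of_int (pairing n (v i) m') = of_int N * ip n (to_rat (v i)) m"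
      unfolding ip_to_rat[symmetric] ip_def sum_distrib_left
      by (intro sum.cong) (auto simp: m'_def to_rat_def z[symmetric])
    thus ?thesis using m[OF that] N(1) by (metis of_int_0_less_iff zero_less_mult_iff)
  qed
  moreover have "m' \<in> int_lattice n" by (simp add: m'_def int_lattice_def)
  ultimately show thesis using that by blast
qed

end

section \<open>Root derivations\<close>

lemma pairing_add: "pairing n u (x + y) = pairing n u x + pairing n u y"
  and pairing_diff: "pairing n u (x - y) = pairing n u x - pairing n u y"
  and pairing_0: "pairing n u 0 = 0"
  by (simp_all add: pairing_def algebra_simps sum.distrib sum_subtractf)

lemma pairing_sum: "pairing n u (\<Sum>i\<in>I. x i) = (\<Sum>i\<in>I. pairing n u (x i))"
  by (induction I rule: infinite_finite_induct) (simp_all only: pairing_add pairing_0 sum.infinite sum.empty sum.insert not_False_eq_True)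

lemma pairing_scale: "pairing n u (\<lambda>j. c * x j) = c * pairing n u x"
  by (simp add: pairing_def sum_distrib_left mult.left_commute)

lemma pairing_left: "pairing n (\<lambda>j. c * u j - d * v j) x = c * pairing n u x - d * pairing n v x"
  by (simp add: pairing_def algebra_simps sum_subtractf sum_distrib_left)

lemma pairing_scale_left: "pairing n (\<lambda>j. c * u j) x = c * pairing n u x"
  by (simp add: pairing_def algebra_simps sum_distrib_left)

lemma int_lattice_add: "x \<in> int_lattice n \<Longrightarrow> y \<in> int_lattice n \<Longrightarrow> x + y \<in> int_lattice n"
  by (simp add: int_lattice_def)

lemma lookup_const_mult: "Poly_Mapping.lookup (const c * f) x = c * Poly_Mapping.lookup f x"
  by (simp add: const_def mult_map_scale_conv_mult[symmetric] Poly_Mapping.map.rep_eq when_def)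

interpretation laurent: char0_vector_space "\<lambda>(c::'k::field_char_0) (f::'k laurent). const c * f"
  by unfold_locales (auto simp: const_def single_add mult_single algebra_simps simp flip: mult.assoc)

interpretation endo: char0_vector_space "endo_scale :: 'k::field_char_0 \<Rightarrow> 'k endo \<Rightarrow> 'k endo"
  unfolding char0_vector_space_def by (rule vector_space_endo_scale)

lemma lookup_root_derivation:
  assumes "f \<in> A"
  shows "Poly_Mapping.lookup (root_derivation n A u e f) x
    = of_int (pairing n u (x - e)) * Poly_Mapping.lookup f (x - e)"
proof -
  have "Poly_Mapping.lookup (root_derivation n A u e f) x = (\<Sum>m\<in>Poly_Mapping.keys f.
      if m = x - e then of_int (pairing n u m) * Poly_Mapping.lookup f m else 0)"
    using assms unfolding root_derivation_def
    by (auto simp: lookup_sum lookup_single when_def eq_diff_eq intro!: sum.cong)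
  thus ?thesis by (simp add: in_keys_iff)
qed

lemma root_derivation_outside: "f \<notin> A \<Longrightarrow> root_derivation n A u e f = 0"
  by (simp add: root_derivation_def)

lemma root_derivation_scale_left:
  "root_derivation n A (\<lambda>j. c * u j) e = endo_scale (of_int c) (root_derivation n A u e)"
proof
  fix f show "root_derivation n A (\<lambda>j. c * u j) e f = endo_scale (of_int c) (root_derivation n A u e) f"
    by (cases "f \<in> A") (auto intro!: poly_mapping_eqI
      simp: endo_scale_def lookup_root_derivation lookup_const_mult root_derivation_outside pairing_scale_left)
qed

text \<open>Both sides are compared coefficientwise. Arbitrary directions \<open>u\<close> and
  \<open>v\<close> are allowed because iterated brackets of root derivations can have directions
  that are not multiples of one ray generator.\<close>

lemma bracket_root_derivation:
  assumes D: "root_derivation n A u e \<in> derivations A" and E: "root_derivation n A v f \<in> derivations A"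
  shows "bracket (root_derivation n A u e) (root_derivation n A v f)
    = root_derivation n A (\<lambda>j. pairing n u f * v j - pairing n v e * u j) (e + f)"
proof
  fix g
  show "bracket (root_derivation n A u e) (root_derivation n A v f) g
    = root_derivation n A (\<lambda>j. pairing n u f * v j - pairing n v e * u j) (e + f) g"
  proof (cases "g \<in> A")
    case True
    have DE: "root_derivation n A u e g \<in> A" "root_derivation n A v f g \<in> A"
      using D E True by (auto simp: derivations_def)
    show ?thesis
      by (rule poly_mapping_eqI)
        (simp add: bracket_def lookup_minus lookup_root_derivation DE True pairing_left pairing_add
          pairing_diff diff_diff_eq add.commute[of f], simp add: algebra_simps)
  next
    case False
    have "root_derivation n A u e 0 = 0" "root_derivation n A v f 0 = 0"
      by (simp_all add: root_derivation_def)
    with False show ?thesis by (simp add: bracket_def root_derivation_outside)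
  qed
qed

locale laurent_subalgebra =
  fixes A :: "'k::field_char_0 laurent set"
  assumes zero_closed: "0 \<in> A"
    and add_closed: "\<And>f g. f \<in> A \<Longrightarrow> g \<in> A \<Longrightarrow> f + g \<in> A"
    and const_mult_closed: "\<And>c f. f \<in> A \<Longrightarrow> const c * f \<in> A"
    and mult_closed: "\<And>f g. f \<in> A \<Longrightarrow> g \<in> A \<Longrightarrow> f * g \<in> A"
begin

lemma derivationD:
  assumes "D \<in> derivations A"
  shows "f \<notin> A \<Longrightarrow> D f = 0" "f \<in> A \<Longrightarrow> D f \<in> A" "f \<in> A \<Longrightarrow> g \<in> A \<Longrightarrow> D (f + g) = D f + D g"
    "f \<in> A \<Longrightarrow> D (const c * f) = const c * D f" "f \<in> A \<Longrightarrow> g \<in> A \<Longrightarrow> D (f * g) = D f * g + f * D g"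
    "D 0 = 0" "D f \<in> A"
proof -
  have D: "\<forall>f. f \<notin> A \<longrightarrow> D f = 0" "\<forall>f\<in>A. D f \<in> A" "\<forall>f\<in>A. \<forall>g\<in>A. D (f + g) = D f + D g"
    "\<forall>c. \<forall>f\<in>A. D (const c * f) = const c * D f" "\<forall>f\<in>A. \<forall>g\<in>A. D (f * g) = D f * g + f * D g"
    using assms by (simp_all add: derivations_def)
  show "f \<notin> A \<Longrightarrow> D f = 0" "f \<in> A \<Longrightarrow> D f \<in> A" "f \<in> A \<Longrightarrow> g \<in> A \<Longrightarrow> D (f + g) = D f + D g"
    "f \<in> A \<Longrightarrow> D (const c * f) = const c * D f" "f \<in> A \<Longrightarrow> g \<in> A \<Longrightarrow> D (f * g) = D f * g + f * D g"
    using D by auto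
  show "D f \<in> A" using D zero_closed by (cases "f \<in> A") auto
  have "D (0 + 0) = D 0 + D 0" using D(3) zero_closed by blast
  thus "D 0 = 0" by simp
qed

lemma uminus_closed: "f \<in> A \<Longrightarrow> - f \<in> A"
  using const_mult_closed[of f "-1"] by (simp add: const_def single_uminus)

lemma diff_closed: "f \<in> A \<Longrightarrow> g \<in> A \<Longrightarrow> f - g \<in> A"
  using add_closed[of f "- g"] uminus_closed by simp

lemma sum_closed: "(\<And>i. i \<in> I \<Longrightarrow> f i \<in> A) \<Longrightarrow> (\<Sum>i\<in>I. f i) \<in> A"
  by (induction I rule: infinite_finite_induct) (auto simp: zero_closed add_closed)

lemma derivations_subspace: "endo.subspace (derivations A)"
proof (rule endo.subspaceI)
  show "0 \<in> derivations A" by (simp add: derivations_def zero_closed)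
  fix D E assume D: "D \<in> derivations A" and E: "E \<in> derivations A"
  show "D + E \<in> derivations A"
    unfolding derivations_def
    by (simp add: derivationD[OF D] derivationD[OF E] add_closed) (simp add: algebra_simps)
next
  fix c D assume D: "D \<in> derivations A"
  show "endo_scale c D \<in> derivations A"
    unfolding derivations_def
    by (simp add: endo_scale_def derivationD[OF D] const_mult_closed) (simp add: algebra_simps)
qed

lemma bracket_derivations:
  assumes D: "D \<in> derivations A" and E: "E \<in> derivations A"
  shows "bracket D E \<in> derivations A"
  unfolding derivations_def bracket_def
  by (simp add: derivationD[OF D] derivationD[OF E] add_closed mult_closed diff_closed const_mult_closed)
    (simp add: algebra_simps)

lemma lie_subalgebra_derivations: "lie_subalgebra A (derivations A)"
  by (simp add: lie_subalgebra_def derivations_subspace bracket_derivations)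

text \<open>Bilinearity of the bracket needs linear arguments, so it is available only inside
  \<open>derivations A\<close>; two inductions over spans then reduce the claim to
  generators.\<close>

lemma bracket_span:
  assumes D: "D \<in> endo.span S" and E: "E \<in> endo.span T"
    and gen: "\<And>x y. x \<in> S \<Longrightarrow> y \<in> T \<Longrightarrow> bracket x y \<in> endo.span U"
    and S: "S \<subseteq> derivations A" and T: "T \<subseteq> derivations A"
  shows "bracket D E \<in> endo.span U"
proof -
  have T': "x \<in> derivations A" if "x \<in> endo.span T" for x
    using endo.span_minimal[OF T derivations_subspace] that by blast
  have add: "bracket x (endo_scale c y + z) = endo_scale c (bracket x y) + bracket x z"
      "bracket (endo_scale c y + z) x = endo_scale c (bracket y x) + bracket z x"
    if "x \<in> derivations A" "y \<in> derivations A" "z \<in> derivations A" for x y z c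
    using that by (auto simp: bracket_def endo_scale_def fun_eq_iff derivationD const_mult_closed algebra_simps)
  have 1: "E \<in> derivations A \<and> bracket x E \<in> endo.span U" if x: "x \<in> S" for x
    using E
  proof (induction E rule: endo.span_induct_alt)
    case base
    have "bracket x 0 = 0" using S x by (auto simp: bracket_def fun_eq_iff derivationD)
    thus ?case by (simp only: endo.span_zero endo.subspace_0[OF derivations_subspace] simp_thms)
  next
    case (step c y w)
    have d: "x \<in> derivations A" "y \<in> derivations A" "w \<in> derivations A" using S T x step by auto
    hence "endo_scale c y + w \<in> derivations A"
      by (intro endo.subspace_add endo.subspace_scale derivations_subspace)
    thus ?case using gen[OF x step(1)] step.IH by (simp only: add[OF d] endo.span_add endo.span_scale simp_thms)
  qed
  have "D \<in> derivations A \<and> bracket D E \<in> endo.span U" using D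
  proof (induction D rule: endo.span_induct_alt)
    case base
    have "bracket 0 E = 0" using T'[OF E] by (auto simp: bracket_def fun_eq_iff derivationD)
    thus ?case by (simp only: endo.span_zero endo.subspace_0[OF derivations_subspace] simp_thms)
  next
    case (step c y w)
    have d: "E \<in> derivations A" "y \<in> derivations A" "w \<in> derivations A" using S T'[OF E] step by auto
    hence "endo_scale c y + w \<in> derivations A"
      by (intro endo.subspace_add endo.subspace_scale derivations_subspace)
    thus ?case using 1[OF step(1)] step.IH by (simp only: add[OF d] endo.span_add endo.span_scale simp_thms)
  qed
  thus ?thesis ..
qed

end

lemma lie_generated_least: "lie_subalgebra A V \<Longrightarrow> S \<subseteq> V \<Longrightarrow> lie_generated A S \<subseteq> V"
  unfolding lie_generated_def by (rule hull_minimal)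

lemma lie_generated_superset: "S \<subseteq> lie_generated A S"
  unfolding lie_generated_def by (rule hull_subset)

lemma lie_subalgebraD:
  fixes V :: "'k::field_char_0 endo set"
  assumes "lie_subalgebra A V"
  shows "V \<subseteq> derivations A" "endo.subspace V" "D \<in> V \<Longrightarrow> E \<in> V \<Longrightarrow> bracket D E \<in> V"
  using assms by (auto simp: lie_subalgebra_def)

text \<open>The hull is an intersection of subalgebras; \<open>U\<close> guarantees that it is not
  the empty intersection, which would be the whole type.\<close>

lemma lie_generated_subalgebra:
  fixes S :: "'k::field_char_0 endo set"
  assumes "lie_subalgebra A U" "S \<subseteq> U"
  shows "lie_subalgebra A (lie_generated A S)"
  unfolding lie_subalgebra_def
proof (intro conjI ballI)
  show "lie_generated A S \<subseteq> derivations A"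
    using lie_generated_least[OF assms] assms(1) by (auto simp only: lie_subalgebra_def)
  show "endo.subspace (lie_generated A S)"
    unfolding lie_generated_def hull_def by (rule endo.subspace_Inter) (auto simp: lie_subalgebra_def)
  fix D E assume "D \<in> lie_generated A S" "E \<in> lie_generated A S"
  thus "bracket D E \<in> lie_generated A S" by (auto simp: lie_generated_def hull_def lie_subalgebra_def)
qed

lemma lower_central_subspace:
  fixes V :: "'k::field_char_0 endo set"
  shows "endo.subspace V \<Longrightarrow> endo.subspace (lower_central V t)"
  by (cases t) (auto intro: endo.subspace_span)

lemma lower_central_bracket:
  fixes V :: "'k::field_char_0 endo set"
  shows "D \<in> V \<Longrightarrow> E \<in> lower_central V t \<Longrightarrow> bracket D E \<in> lower_central V (Suc t)"
  by (auto intro: endo.span_base)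

lemma lower_central_subset:
  fixes V :: "'k::field_char_0 endo set"
  shows "lie_subalgebra A V \<Longrightarrow> lower_central V t \<subseteq> V"
proof (induction t)
  case (Suc t)
  thus ?case unfolding lower_central.simps
    by (intro endo.span_minimal) (auto dest: lie_subalgebraD)
qed simp

lemma poly_mapping_as_sum: "f = (\<Sum>m\<in>Poly_Mapping.keys f. Poly_Mapping.single m (Poly_Mapping.lookup f m))"
proof (rule poly_mapping_eqI)
  fix x
  have "(\<Sum>m\<in>Poly_Mapping.keys f. Poly_Mapping.lookup (Poly_Mapping.single m (Poly_Mapping.lookup f m)) x)
    = (\<Sum>m\<in>Poly_Mapping.keys f. if m = x then Poly_Mapping.lookup f x else 0)"
    by (intro sum.cong) (auto simp: lookup_single when_def)
  thus "Poly_Mapping.lookup f x = Poly_Mapping.lookup (\<Sum>m\<in>Poly_Mapping.keys f. Poly_Mapping.single m (Poly_Mapping.lookup f m)) x"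
    by (simp add: lookup_sum in_keys_iff)
qed

text \<open>Of the cone only the ray inequalities and the point \<open>m0\<close> are retained. As
  \<open>m0\<close> satisfies all of them strictly, no root derivation kills its character.\<close>

locale toric =
  fixes n k :: nat and \<rho> :: "nat \<Rightarrow> nat \<Rightarrow> int" and A :: "'k::field_char_0 laurent set"
    and m0 :: "nat \<Rightarrow> int"
  assumes A_eq: "A = {f. Poly_Mapping.keys f \<subseteq> {m \<in> int_lattice n. \<forall>i\<in>{1..k}. 0 \<le> pairing n (\<rho> i) m}}"
    and m0_lattice: "m0 \<in> int_lattice n" and m0_pos: "\<And>i. i \<in> {1..k} \<Longrightarrow> 0 < pairing n (\<rho> i) m0"
begin

definition M :: "(nat \<Rightarrow> int) set" where
  "M = {m \<in> int_lattice n. \<forall>i\<in>{1..k}. 0 \<le> pairing n (\<rho> i) m}"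

abbreviation der :: "nat \<Rightarrow> (nat \<Rightarrow> int) \<Rightarrow> 'k endo" where
  "der i e \<equiv> root_derivation n A (\<rho> i) e"

abbreviation S :: "nat \<Rightarrow> (nat \<Rightarrow> int) set" where
  "S i \<equiv> demazure_roots n k \<rho> i"

abbreviation \<chi>0 :: "'k laurent" where "\<chi>0 \<equiv> Poly_Mapping.single m0 1"

lemma A_iff: "f \<in> A \<longleftrightarrow> Poly_Mapping.keys f \<subseteq> M"
  by (simp add: A_eq M_def)

lemma M_add: "x \<in> M \<Longrightarrow> y \<in> M \<Longrightarrow> x + y \<in> M"
  by (auto simp: M_def int_lattice_add pairing_add)

lemma M_0: "0 \<in> M" by (auto simp: M_def int_lattice_def pairing_0)

lemma m0_M: "m0 \<in> M" using m0_lattice m0_pos by (auto simp: M_def less_imp_le)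

lemma single_A: "m \<in> M \<Longrightarrow> Poly_Mapping.single m c \<in> A"
  by (simp add: A_iff)

lemma \<chi>0_A: "\<chi>0 \<in> A" by (rule single_A[OF m0_M])

lemma const_A: "const c \<in> A" unfolding const_def by (rule single_A[OF M_0])

sublocale laurent_subalgebra A
proof
  show "0 \<in> A" by (simp add: A_iff)
  fix f g assume "f \<in> A" "g \<in> A"
  thus "f + g \<in> A" using Poly_Mapping.keys_add[of f g] by (auto simp: A_iff)
  show "f * g \<in> A" using keys_mult[of f g] \<open>f \<in> A\<close> \<open>g \<in> A\<close> by (fastforce simp: A_iff intro: M_add)
next
  fix c f assume "f \<in> A"
  moreover have "Poly_Mapping.keys (const c * f) \<subseteq> Poly_Mapping.keys f"
    by (auto simp: in_keys_iff lookup_const_mult)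
  ultimately show "const c * f \<in> A" by (auto simp: A_iff)
qed

lemma root_derivation_add:
  "f \<in> A \<Longrightarrow> g \<in> A \<Longrightarrow> root_derivation n A u e (f + g) = root_derivation n A u e f + root_derivation n A u e g"
  by (rule poly_mapping_eqI) (simp add: lookup_root_derivation add_closed lookup_add algebra_simps)

lemma root_derivation_sum:
  "(\<And>i. i \<in> I \<Longrightarrow> f i \<in> A) \<Longrightarrow> root_derivation n A u e (\<Sum>i\<in>I. f i) = (\<Sum>i\<in>I. root_derivation n A u e (f i))"
  by (induction I rule: infinite_finite_induct)
    (simp_all add: root_derivation_add sum_closed, simp_all add: root_derivation_def)

lemma root_derivation_single:
  assumes "m \<in> M"
  shows "root_derivation n A u e (Poly_Mapping.single m c) = Poly_Mapping.single (m + e) (of_int (pairing n u m) * c)"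
  by (rule poly_mapping_eqI)
    (auto simp: lookup_root_derivation single_A[OF assms] lookup_single when_def eq_diff_eq)

text \<open>On a product of two characters the product rule is additivity of the pairing; the
  general case follows by expanding both factors.\<close>

lemma root_derivation_mult:
  assumes f: "f \<in> A" and g: "g \<in> A"
  shows "root_derivation n A u e (f * g) = root_derivation n A u e f * g + f * root_derivation n A u e g"
proof -
  let ?D = "root_derivation n A u e"
  define s where "s = (\<lambda>(h :: 'k laurent) m. Poly_Mapping.single m (Poly_Mapping.lookup h m))"
  have s: "h = (\<Sum>m\<in>Poly_Mapping.keys h. s h m)" for h unfolding s_def by (rule poly_mapping_as_sum)
  have sA: "s h m \<in> A" if "h \<in> A" "m \<in> Poly_Mapping.keys h" for h m
    using that unfolding s_def A_iff[of h] by (intro single_A) auto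
  have D: "?D h = (\<Sum>m\<in>Poly_Mapping.keys h. ?D (s h m))" if "h \<in> A" for h
    by (subst s) (rule root_derivation_sum[OF sA[OF that]])
  have fg: "f * g = (\<Sum>a\<in>Poly_Mapping.keys f. \<Sum>b\<in>Poly_Mapping.keys g. s f a * s g b)"
    by (subst s[of f], subst s[of g]) (simp add: sum_product)
  have "?D (f * g) = (\<Sum>a\<in>Poly_Mapping.keys f. \<Sum>b\<in>Poly_Mapping.keys g. ?D (s f a * s g b))"
    unfolding fg using f g by (simp add: root_derivation_sum sum_closed mult_closed sA)
  also have "\<dots> = (\<Sum>a\<in>Poly_Mapping.keys f. \<Sum>b\<in>Poly_Mapping.keys g. ?D (s f a) * s g b + s f a * ?D (s g b))"
  proof (intro sum.cong refl)
    fix a b assume "a \<in> Poly_Mapping.keys f" "b \<in> Poly_Mapping.keys g"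
    hence "a \<in> M" "b \<in> M" "a + b \<in> M" using f g by (auto simp: A_iff intro: M_add)
    thus "?D (s f a * s g b) = ?D (s f a) * s g b + s f a * ?D (s g b)"
      by (simp add: s_def mult_single root_derivation_single pairing_add algebra_simps flip: single_add)
  qed
  also have "\<dots> = ?D f * g + f * ?D g"
    unfolding D[OF f] D[OF g] by (subst (4) s[of f], subst (4) s[of g])
      (simp add: sum_product sum.distrib)
  finally show ?thesis .
qed

lemma root_derivation_derivation:
  assumes "\<And>f. f \<in> A \<Longrightarrow> root_derivation n A u e f \<in> A"
  shows "root_derivation n A u e \<in> derivations A"
proof -
  have "root_derivation n A u e (const c * f) = const c * root_derivation n A u e f" if "f \<in> A" for c f
    using that by (intro poly_mapping_eqI) (simp add: lookup_root_derivation const_mult_closed lookup_const_mult)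
  with assms show ?thesis
    by (auto simp: derivations_def root_derivation_outside root_derivation_add root_derivation_mult)
qed

lemma S_D:
  assumes "e \<in> S i"
  shows "e \<in> int_lattice n" "pairing n (\<rho> i) e = - 1"
    "j \<in> {1..k} \<Longrightarrow> j \<noteq> i \<Longrightarrow> 0 \<le> pairing n (\<rho> j) e"
  using assms by (auto simp: demazure_roots_def)

text \<open>The pairing with ray generator \<open>i\<close> is \<open>- 1\<close> on
  \<open>S i\<close> and nonnegative on every other \<open>S j\<close>. A root thus determines its
  ray, which allows group parameters to be indexed by roots alone.\<close>

lemma S_disjoint: "e \<in> S i \<Longrightarrow> e \<in> S j \<Longrightarrow> i \<in> {1..k} \<Longrightarrow> i = j"
  using S_D(3)[of e j i] S_D(2)[of e i] by fastforce

text \<open>The only pairing that decreases is the one with ray generator \<open>i\<close>, and it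
  starts from at least \<open>1\<close>. Characters for which it starts from \<open>0\<close> are
  killed by the coefficient in the root derivation.\<close>

lemma M_root_add:
  assumes e: "e \<in> S i" and i: "i \<in> {1..k}" and m: "m \<in> M" "pairing n (\<rho> i) m \<noteq> 0"
  shows "m + e \<in> M"
proof -
  have "0 \<le> pairing n (\<rho> j) (m + e)" if j: "j \<in> {1..k}" for j
    using m S_D[OF e] i j by (cases "j = i") (force simp: M_def pairing_add)+
  thus ?thesis using m(1) S_D(1)[OF e] by (auto simp: M_def int_lattice_add)
qed

lemma der_closed: "e \<in> S i \<Longrightarrow> i \<in> {1..k} \<Longrightarrow> f \<in> A \<Longrightarrow> der i e f \<in> A"
proof -
  assume e: "e \<in> S i" and i: "i \<in> {1..k}" and f: "f \<in> A"
  show "der i e f \<in> A" unfolding A_iff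
  proof
    fix x assume "x \<in> Poly_Mapping.keys (der i e f)"
    hence "pairing n (\<rho> i) (x - e) \<noteq> 0" "x - e \<in> Poly_Mapping.keys f"
      by (auto simp: in_keys_iff lookup_root_derivation[OF f])
    with M_root_add[OF e i, of "x - e"] f show "x \<in> M" by (auto simp: A_iff)
  qed
qed

lemma der_derivation: "e \<in> S i \<Longrightarrow> i \<in> {1..k} \<Longrightarrow> der i e \<in> derivations A"
  by (rule root_derivation_derivation) (rule der_closed)

lemma der_lookup_\<chi>0: "Poly_Mapping.lookup (der i e \<chi>0) (m0 + f) = (if f = e then of_int (pairing n (\<rho> i) m0) else 0)"
  by (auto simp: root_derivation_single[OF m0_M] lookup_single when_def)

lemma der_\<chi>0_nonzero: "i \<in> {1..k} \<Longrightarrow> der i e \<chi>0 \<noteq> 0"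
  using der_lookup_\<chi>0[of i e e] m0_pos[of i] by (auto simp del: One_nat_def)

definition ders :: "(nat \<times> (nat \<Rightarrow> int)) set \<Rightarrow> 'k endo set" where
  "ders Q = (\<lambda>(i, e). der i e) ` Q"

definition all_roots :: "(nat \<times> (nat \<Rightarrow> int)) set" where
  "all_roots = {(i, e). i \<in> {1..k} \<and> e \<in> S i}"

lemma ders_derivations: "Q \<subseteq> all_roots \<Longrightarrow> ders Q \<subseteq> derivations A"
  by (auto simp: ders_def all_roots_def intro!: der_derivation)

lemma span_ders_derivations: "Q \<subseteq> all_roots \<Longrightarrow> endo.span (ders Q) \<subseteq> derivations A"
  by (intro endo.span_minimal ders_derivations derivations_subspace)

text \<open>Linear independence of root derivations: the coefficient at \<open>m0 + e\<close> of the
  image of \<open>\<chi>0\<close> is a linear functional that vanishes on every root derivation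
  except the one at \<open>e\<close>.\<close>

lemma der_in_span:
  assumes "der i e \<in> endo.span (ders Q)" "Q \<subseteq> all_roots" "(i, e) \<in> all_roots"
  shows "(i, e) \<in> Q"
proof (rule ccontr)
  assume ne: "(i, e) \<notin> Q"
  define U where "U = {T :: 'k endo. Poly_Mapping.lookup (T \<chi>0) (m0 + e) = 0}"
  have "endo.subspace U"
    by (rule endo.subspaceI) (auto simp: U_def lookup_add endo_scale_def lookup_const_mult)
  moreover have "ders Q \<subseteq> U"
  proof
    fix T assume "T \<in> ders Q"
    then obtain j f where T: "T = der j f" and jf: "(j, f) \<in> Q" by (auto simp: ders_def)
    have "f \<noteq> e"
    proof
      assume "f = e"
      with jf assms(2,3) have "j = i" by (auto simp: all_roots_def dest: S_disjoint)
      with jf ne \<open>f = e\<close> show False by simp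
    qed
    thus "T \<in> U" by (simp add: U_def T der_lookup_\<chi>0)
  qed
  ultimately have "der i e \<in> U" using endo.span_minimal[of "ders Q" U] assms(1) by blast
  hence "of_int (pairing n (\<rho> i) m0) = (0::'k)" by (simp add: U_def der_lookup_\<chi>0)
  thus False using m0_pos[of i] assms(3) by (auto simp: all_roots_def)
qed

lemma bracket_der:
  assumes "(i, e) \<in> all_roots" "(j, f) \<in> all_roots" and f: "pairing n (\<rho> j) e = 0"
  shows "bracket (der i e) (der j f) = endo_scale (of_int (pairing n (\<rho> i) f)) (der j (e + f))"
  using assms(1,2) unfolding root_derivation_scale_left[symmetric]
  by (subst bracket_root_derivation) (auto simp: all_roots_def f intro: der_derivation)

lemma bracket_der_same:
  assumes "(i, e) \<in> all_roots" "(i, f) \<in> all_roots"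
  shows "bracket (der i e) (der i f) = 0"
proof -
  have "bracket (der i e) (der i f) = root_derivation n A (\<lambda>j. 0 * \<rho> i j) (e + f)"
    using assms by (subst bracket_root_derivation) (auto simp: all_roots_def S_D(2) intro: der_derivation)
  thus ?thesis unfolding root_derivation_scale_left by simp
qed

lemma bracket_antisym: "bracket D E = - bracket E D"
  by (auto simp: bracket_def fun_eq_iff)

lemma root_add_root:
  assumes "(i, e) \<in> all_roots" "(j, f) \<in> all_roots" "pairing n (\<rho> j) e = 0" "0 < pairing n (\<rho> i) f"
  shows "(j, e + f) \<in> all_roots"
proof -
  have ij: "i \<in> {1..k}" "e \<in> S i" "j \<in> {1..k}" "f \<in> S j" using assms(1,2) by (auto simp: all_roots_def)
  have "0 \<le> pairing n (\<rho> l) (e + f)" if "l \<in> {1..k}" "l \<noteq> j" for l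
    using S_D(2,3)[OF ij(2)] S_D(2,3)[OF ij(4)] that assms(4)
    by (cases "l = i") (force simp: pairing_add)+
  thus ?thesis using ij S_D(1,2)[OF ij(2)] S_D(1,2)[OF ij(4)] assms(3)
    by (auto simp: all_roots_def demazure_roots_def pairing_add int_lattice_add)
qed

section \<open>A 2-cycle obstructs nilpotency\<close>

text \<open>Let \<open>X = der i f\<close>, \<open>Y = der j e'\<close>, and let \<open>q\<close> be
  the pairing of \<open>\<rho> i\<close> with \<open>e'\<close>. Then
  \<open>ad(X) ^ (q + 1) Y\<close> is a nonzero multiple of \<open>der i (e' + (q + 1) f)\<close>:
  the pairing with \<open>\<rho> i\<close> has dropped from \<open>q\<close> to \<open>- 1\<close>,
  and the direction has become a multiple of \<open>\<rho> i\<close>. The new root pairs with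
  \<open>\<rho> j\<close> to at least \<open>- 1 + (q + 1) > 0\<close>, so the construction can be
  repeated.\<close>

lemma two_cycle_lower_central:
  assumes L: "lie_subalgebra A L" and cyc: "has_two_cycle n k \<rho> A L"
  shows "\<exists>i\<in>{1..k}. \<exists>f\<in>S i. der i f \<in> lower_central L t"
proof -
  from cyc obtain i j e e' where ij: "i \<in> {1..k}" "j \<in> {1..k}"
    and e: "e \<in> roots_in n k \<rho> A L i" and e': "e' \<in> roots_in n k \<rho> A L j"
    and p: "pairing n (\<rho> j) e > 0" and q0: "pairing n (\<rho> i) e' > 0"
    by (auto simp: has_two_cycle_def)
  define q where "q = nat (pairing n (\<rho> i) e')"
  have q: "pairing n (\<rho> i) e' = int q" "q > 0" using q0 by (auto simp: q_def)
  have e'S: "e' \<in> S j" and Y: "der j e' \<in> L" using e' by (auto simp: roots_in_def)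
  have jij: "j \<noteq> i" using p e S_D(2)[of e i] by (auto simp: roots_in_def)
  have "\<exists>f\<in>S i. 0 < pairing n (\<rho> j) f \<and> der i f \<in> lower_central L t"
  proof (induction t)
    case 0 show ?case using e p by (auto simp: roots_in_def)
  next
    case (Suc t)
    then obtain f where f: "f \<in> S i" "0 < pairing n (\<rho> j) f" "der i f \<in> lower_central L t" by blast
    have X: "der i f \<in> L" using f(3) lower_central_subset[OF L] by blast
    define g where "g = (\<lambda>m::nat. e' + (\<lambda>l. int m * f l))"
    have pg: "pairing n u (g m) = pairing n u e' + int m * pairing n u f" for u m
      by (simp add: g_def pairing_add pairing_scale)
    have gS: "f + g m = g (Suc m)" for m by (auto simp: g_def fun_eq_iff algebra_simps)
    \<comment> \<open>The direction of \<open>ad(X) ^ m Y\<close>, read off from the bracket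
      formula; the factor \<open>int q - int m\<close> is the pairing of \<open>\<rho> i\<close>
      with \<open>g m\<close>.\<close>
    define u where "u = rec_nat (\<rho> j) (\<lambda>m v l. (int q - int m) * v l - pairing n v f * \<rho> i l)"
    have u0: "u 0 = \<rho> j" and uS: "u (Suc m) = (\<lambda>l. (int q - int m) * u m l - pairing n (u m) f * \<rho> i l)" for m
      by (simp_all add: u_def)
    have up: "0 < pairing n (u m) f" if "m \<le> q" for m
      using that
    proof (induction m)
      case 0 show ?case using f(2) by (simp add: u0)
    next
      case (Suc m)
      have "pairing n (u (Suc m)) f = (int q - int m + 1) * pairing n (u m) f"
        unfolding uS pairing_left S_D(2)[OF f(1)] by (simp add: algebra_simps)
      with Suc show ?case by simp
    qed
    have ad: "(bracket (der i f) ^^ m) (der j e') = root_derivation n A (u m) (g m)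
        \<and> (bracket (der i f) ^^ m) (der j e') \<in> L" for m
    proof (induction m)
      case 0
      have "g 0 = e'" by (auto simp: g_def)
      thus ?case using Y by (simp add: u0)
    next
      case (Suc m)
      have L': "root_derivation n A (u m) (g m) \<in> L" using Suc by metis
      have "bracket (der i f) (root_derivation n A (u m) (g m)) = root_derivation n A (u (Suc m)) (g (Suc m))"
        using X L' lie_subalgebraD(1)[OF L]
        by (subst bracket_root_derivation) (auto simp: uS gS pg S_D(2)[OF f(1)] q)
      moreover have "bracket (der i f) (root_derivation n A (u m) (g m)) \<in> L"
        by (rule lie_subalgebraD(3)[OF L X L'])
      ultimately show ?case using Suc by simp
    qed
    \<comment> \<open>One bracket short of the goal: \<open>W\<close> lies in \<open>L\<close>, and
      the last bracket is taken with \<open>der i f\<close> as the element of the lower central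
      series, which raises the index by one.\<close>
    define W where "W = (bracket (der i f) ^^ q) (der j e')"
    define c where "c = pairing n (u q) f"
    have c: "c > 0" using up[of q] by (simp add: c_def)
    have "bracket (der i f) W = root_derivation n A (\<lambda>l. (- c) * \<rho> i l) (g (Suc q))"
      using ad[of "Suc q"] by (simp add: W_def uS c_def)
    hence "bracket W (der i f) = - endo_scale (of_int (- c)) (der i (g (Suc q)))"
      unfolding root_derivation_scale_left by (subst bracket_antisym) simp
    also have "\<dots> = endo_scale (of_int c) (der i (g (Suc q)))" by simp
    finally have Wb: "bracket W (der i f) = endo_scale (of_int c) (der i (g (Suc q)))" .
    have "W \<in> L" using ad[of q] W_def by metis
    hence "bracket W (der i f) \<in> lower_central L (Suc t)" by (rule lower_central_bracket[OF _ f(3)])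
    hence "endo_scale (inverse (of_int c)) (bracket W (der i f)) \<in> lower_central L (Suc t)"
      by (rule endo.subspace_scale[OF lower_central_subspace[OF lie_subalgebraD(2)[OF L]]])
    hence "der i (g (Suc q)) \<in> lower_central L (Suc t)" using c unfolding Wb by simp
    moreover have "g (Suc q) \<in> S i"
    proof -
      have "g (Suc q) \<in> int_lattice n"
        using S_D(1)[OF e'S] S_D(1)[OF f(1)] by (auto simp: g_def int_lattice_def)
      moreover have "pairing n (\<rho> i) (g (Suc q)) = - 1" by (simp add: pg q S_D(2)[OF f(1)])
      moreover have "0 \<le> pairing n (\<rho> l) (g (Suc q))" if l: "l \<in> {1..k}" "l \<noteq> i" for l
      proof (cases "l = j")
        case True
        have "1 \<le> int (Suc q) * pairing n (\<rho> j) f" using f(2) by (simp add: mult_pos_pos int_one_le_iff_zero_less)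
        thus ?thesis unfolding True pg S_D(2)[OF e'S] by simp
      next
        case False
        thus ?thesis unfolding pg using S_D(3)[OF e'S, of l] S_D(3)[OF f(1), of l] l by simp
      qed
      ultimately show ?thesis by (simp add: demazure_roots_def)
    qed
    moreover have "0 < pairing n (\<rho> j) (g (Suc q))"
    proof -
      have "int (Suc q) * 1 \<le> int (Suc q) * pairing n (\<rho> j) f" using f(2) by (intro mult_left_mono) auto
      moreover have "1 < int (Suc q) * 1" using q(2) by simp
      ultimately have "1 < int (Suc q) * pairing n (\<rho> j) f" by (rule less_le_trans[rotated])
      thus ?thesis unfolding pg S_D(2)[OF e'S] by simp
    qed
    ultimately show ?case by blast
  qed
  with ij(1) show ?thesis by blast
qed

lemma nilpotent_imp_no_two_cycle:
  assumes "lie_subalgebra A L" "lie_nilpotent L"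
  shows "\<not> has_two_cycle n k \<rho> A L"
proof
  assume cyc: "has_two_cycle n k \<rho> A L"
  from assms(2) obtain t where t: "lower_central L t = {0}" by (auto simp: lie_nilpotent_def)
  from two_cycle_lower_central[OF assms(1) cyc, of t] obtain i f where "i \<in> {1..k}" "der i f = 0"
    using t by auto
  with der_\<chi>0_nonzero[of i f] show False by simp
qed

end

section \<open>Lie algebras generated by root derivations\<close>

locale lie_roots = toric n k \<rho> A m0
  for n k :: nat and \<rho> :: "nat \<Rightarrow> nat \<Rightarrow> int" and A :: "'k::field_char_0 laurent set" and m0 +
  fixes s :: nat and a :: "nat \<Rightarrow> nat" and e :: "nat \<Rightarrow> nat \<Rightarrow> int" and L :: "'k endo set"
  assumes generators: "\<And>l. l \<in> {1..s} \<Longrightarrow> a l \<in> {1..k} \<and> e l \<in> demazure_roots n k \<rho> (a l)"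
    and L_eq: "L = lie_generated A ((\<lambda>l. root_derivation n A (\<rho> (a l)) (e l)) ` {1..s})"
begin

definition R :: "(nat \<times> (nat \<Rightarrow> int)) set" where
  "R = {(i, f). i \<in> {1..k} \<and> f \<in> roots_in n k \<rho> A L i}"

lemma R_iff: "(i, f) \<in> R \<longleftrightarrow> (i, f) \<in> all_roots \<and> der i f \<in> L"
  by (auto simp: R_def all_roots_def roots_in_def)

lemma R_all_roots: "R \<subseteq> all_roots"
  by (auto simp: R_def all_roots_def roots_in_def)

lemma generator_all_roots: "l \<in> {1..s} \<Longrightarrow> (a l, e l) \<in> all_roots"
  using generators by (auto simp: all_roots_def)

lemma L_subalgebra: "lie_subalgebra A L"
  unfolding L_eq using generators
  by (intro lie_generated_subalgebra[OF lie_subalgebra_derivations]) (auto intro!: der_derivation)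

lemma generator_R: "l \<in> {1..s} \<Longrightarrow> (a l, e l) \<in> R"
proof -
  assume l: "l \<in> {1..s}"
  have "der (a l) (e l) \<in> L" unfolding L_eq by (rule lie_generated_superset[THEN subsetD]) (use l in blast)
  thus ?thesis using generator_all_roots[OF l] by (simp add: R_iff)
qed

text \<open>The arcs of the graph, moved from subalgebras to ray indices; the first conjunct says
  that \<open>j\<close> is a vertex.\<close>

definition edge :: "nat \<Rightarrow> nat \<Rightarrow> bool" where
  "edge j i \<longleftrightarrow> (\<exists>g. (j, g) \<in> R) \<and> (\<exists>f. (i, f) \<in> R \<and> 0 < pairing n (\<rho> j) f)"

lemma two_cycle_iff: "has_two_cycle n k \<rho> A L \<longleftrightarrow> (\<exists>i j. edge i j \<and> edge j i)"
  unfolding has_two_cycle_def edge_def R_def by blast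

lemma R_D:
  assumes "(i, f) \<in> R"
  shows "i \<in> {1..k}" "f \<in> S i" "f \<in> int_lattice n" "pairing n (\<rho> i) f = - 1"
    "j \<in> {1..k} \<Longrightarrow> j \<noteq> i \<Longrightarrow> 0 \<le> pairing n (\<rho> j) f" "der i f \<in> L" "der i f \<in> derivations A"
  using assms S_D[of f i] der_derivation[of f i] by (auto simp: R_def roots_in_def)

lemma edge_irrefl: "\<not> edge i i"
  using R_D(4)[of i] by (auto simp: edge_def)

lemma lie_subalgebra_span_same:
  assumes "{i} \<times> F \<subseteq> all_roots"
  shows "lie_subalgebra A (endo.span (ders ({i} \<times> F)))"
  unfolding lie_subalgebra_def
proof (intro conjI ballI)
  fix D E assume "D \<in> endo.span (ders ({i} \<times> F))" "E \<in> endo.span (ders ({i} \<times> F))"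
  thus "bracket D E \<in> endo.span (ders ({i} \<times> F))"
  proof (rule bracket_span)
    fix x y assume "x \<in> ders ({i} \<times> F)" "y \<in> ders ({i} \<times> F)"
    then obtain f g where fg: "x = der i f" "y = der i g" "(i, f) \<in> all_roots" "(i, g) \<in> all_roots"
      using assms by (auto simp: ders_def)
    show "bracket x y \<in> endo.span (ders ({i} \<times> F))"
      unfolding fg(1,2) bracket_der_same[OF fg(3,4)] by (rule endo.span_zero)
  qed (rule ders_derivations[OF assms])+
qed (auto intro: endo.subspace_span span_ders_derivations[OF assms, THEN subsetD])

lemma root_subalgebra_bounds:
  assumes "i \<in> {1..k}"
  shows "f \<in> roots_in n k \<rho> A L i \<Longrightarrow> der i f \<in> root_subalgebra n k \<rho> A L i"
    and "root_subalgebra n k \<rho> A L i \<subseteq> endo.span (ders ({i} \<times> roots_in n k \<rho> A L i))"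
proof -
  show "f \<in> roots_in n k \<rho> A L i \<Longrightarrow> der i f \<in> root_subalgebra n k \<rho> A L i"
    unfolding root_subalgebra_def by (rule lie_generated_superset[THEN subsetD]) blast
  show "root_subalgebra n k \<rho> A L i \<subseteq> endo.span (ders ({i} \<times> roots_in n k \<rho> A L i))"
    unfolding root_subalgebra_def
    by (rule lie_generated_least[OF lie_subalgebra_span_same])
      (use assms in \<open>auto simp: all_roots_def roots_in_def ders_def intro!: endo.span_base\<close>)
qed

text \<open>The vertices of the graph are subalgebras, so arcs can be read on indices only if
  different indices give different subalgebras. Independence of the root derivations ensures
  this.\<close>

lemma root_subalgebra_inj:
  assumes "i \<in> {1..k}" "j \<in> {1..k}" "roots_in n k \<rho> A L i \<noteq> {}"
    and eq: "root_subalgebra n k \<rho> A L i = root_subalgebra n k \<rho> A L j"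
  shows "i = j"
proof -
  from assms(3) obtain f where f: "f \<in> roots_in n k \<rho> A L i" by blast
  have "der i f \<in> endo.span (ders ({j} \<times> roots_in n k \<rho> A L j))"
    using root_subalgebra_bounds(1)[OF assms(1) f] root_subalgebra_bounds(2)[OF assms(2)] eq by blast
  hence "(i, f) \<in> {j} \<times> roots_in n k \<rho> A L j"
    by (rule der_in_span) (use assms(1,2) f in \<open>auto simp: all_roots_def roots_in_def\<close>)
  thus ?thesis by simp
qed

end

section \<open>Roots of \<open>L\<close> in the absence of 2-cycles\<close>

locale acyclic_roots = lie_roots n k \<rho> A m0 s a e L
  for n k :: nat and \<rho> :: "nat \<Rightarrow> nat \<Rightarrow> int" and A :: "'k::field_char_0 laurent set" and m0 s a e L +
  assumes no_two_cycle: "\<not> has_two_cycle n k \<rho> A L"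
begin

lemma not_edge_both: "edge i j \<Longrightarrow> \<not> edge j i"
  using no_two_cycle two_cycle_iff by blast

text \<open>A positive value would give the reverse edge and thus a 2-cycle. Hence at most one of
  the two terms in the bracket of two root derivations survives.\<close>

lemma pairing_zero_if_pos:
  assumes "(i, f) \<in> R" "(j, g) \<in> R" "0 < pairing n (\<rho> i) g"
  shows "pairing n (\<rho> j) f = 0"
proof -
  have "j \<noteq> i" using R_D(4)[OF assms(2)] assms(3) by auto
  moreover have "edge i j" using assms by (auto simp: edge_def)
  ultimately show ?thesis
    using not_edge_both[of i j] R_D(5)[OF assms(1) R_D(1)[OF assms(2)]] assms(1,2)
    by (force simp: edge_def)
qed

lemma R_add:
  assumes "(i, f) \<in> R" "(j, g) \<in> R" "0 < pairing n (\<rho> i) g"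
  shows "(j, f + g) \<in> R"
    "bracket (der i f) (der j g) = endo_scale (of_int (pairing n (\<rho> i) g)) (der j (f + g))"
proof -
  note z = pairing_zero_if_pos[OF assms]
  have ar: "(i, f) \<in> all_roots" "(j, g) \<in> all_roots" using assms R_all_roots by auto
  show b: "bracket (der i f) (der j g) = endo_scale (of_int (pairing n (\<rho> i) g)) (der j (f + g))"
    by (rule bracket_der[OF ar z])
  have "bracket (der i f) (der j g) \<in> L" by (rule lie_subalgebraD(3)[OF L_subalgebra]) (use assms R_D in auto)
  hence "endo_scale (inverse (of_int (pairing n (\<rho> i) g))) (bracket (der i f) (der j g)) \<in> L"
    by (rule endo.subspace_scale[OF lie_subalgebraD(2)[OF L_subalgebra]])
  hence "der j (f + g) \<in> L" unfolding b using assms(3) by simp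
  thus "(j, f + g) \<in> R" using root_add_root[OF ar z assms(3)] by (simp add: R_iff)
qed

lemma bracket_R_commute:
  assumes "(i, f) \<in> R" "(j, g) \<in> R" "\<not> 0 < pairing n (\<rho> i) g" "\<not> 0 < pairing n (\<rho> j) f"
  shows "bracket (der i f) (der j g) = 0"
proof (cases "i = j")
  case True
  thus ?thesis using bracket_der_same[of i f g] assms R_all_roots by auto
next
  case False
  hence "pairing n (\<rho> i) g = 0" "pairing n (\<rho> j) f = 0"
    using R_D(5)[OF assms(2) R_D(1)[OF assms(1)]] R_D(5)[OF assms(1) R_D(1)[OF assms(2)]] assms(3,4) by auto
  thus ?thesis using bracket_der[of i f j g] assms R_all_roots by auto
qed

lemma bracket_R_cases:
  assumes "(i, f) \<in> R" "(j, g) \<in> R"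
  obtains "bracket (der i f) (der j g) = 0"
  | "0 < pairing n (\<rho> i) g" "(j, f + g) \<in> R" "bracket (der i f) (der j g) = endo_scale (of_int (pairing n (\<rho> i) g)) (der j (f + g))"
  | "0 < pairing n (\<rho> j) f" "(i, f + g) \<in> R" "bracket (der i f) (der j g) = endo_scale (- of_int (pairing n (\<rho> j) f)) (der i (f + g))"
proof -
  consider "0 < pairing n (\<rho> i) g" | "0 < pairing n (\<rho> j) f"
    | "\<not> 0 < pairing n (\<rho> i) g" "\<not> 0 < pairing n (\<rho> j) f" by blast
  thus thesis
  proof cases
    case 1 thus ?thesis using R_add[OF assms] that by blast
  next
    case 2
    have "bracket (der i f) (der j g) = endo_scale (- of_int (pairing n (\<rho> j) f)) (der i (f + g))"
      using R_add(2)[OF assms(2,1) 2] by (subst bracket_antisym) (simp add: add.commute)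
    thus ?thesis using 2 R_add(1)[OF assms(2,1) 2] that by (simp add: add.commute)
  next
    case 3 thus ?thesis using bracket_R_commute[OF assms] that by blast
  qed
qed

text \<open>The induction principle for \<open>R\<close>. By the bracket formula the span of
  \<open>ders Q\<close> is a subalgebra containing the generators, so it is all of \<open>L\<close>,
  and independence of the root derivations forces \<open>Q = R\<close>.\<close>

lemma root_closure:
  assumes Q: "Q \<subseteq> R" and gen: "\<And>l. l \<in> {1..s} \<Longrightarrow> (a l, e l) \<in> Q"
    and closed: "\<And>i f j g. (i, f) \<in> Q \<Longrightarrow> (j, g) \<in> Q \<Longrightarrow> 0 < pairing n (\<rho> i) g \<Longrightarrow> (j, f + g) \<in> Q"
  shows "L = endo.span (ders Q)" "Q = R"
proof -
  have QA: "Q \<subseteq> all_roots" using Q R_all_roots by blast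
  have "lie_subalgebra A (endo.span (ders Q))"
    unfolding lie_subalgebra_def
  proof (intro conjI ballI)
    fix D E assume "D \<in> endo.span (ders Q)" "E \<in> endo.span (ders Q)"
    thus "bracket D E \<in> endo.span (ders Q)"
    proof (rule bracket_span)
      fix x y assume "x \<in> ders Q" "y \<in> ders Q"
      then obtain i f j g where xy: "x = der i f" "y = der j g" "(i, f) \<in> Q" "(j, g) \<in> Q"
        by (auto simp: ders_def)
      hence "(i, f) \<in> R" "(j, g) \<in> R" using Q by auto
      thus "bracket x y \<in> endo.span (ders Q)"
      proof (cases rule: bracket_R_cases)
        case 1 thus ?thesis by (simp add: xy endo.span_zero)
      next
        case 2
        have "der j (f + g) \<in> ders Q" using closed[OF xy(3,4) 2(1)] by (force simp: ders_def)
        thus ?thesis unfolding xy 2(3) by (intro endo.span_scale endo.span_base)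
      next
        case 3
        have "der i (f + g) \<in> ders Q" using closed[OF xy(4,3) 3(1)] by (force simp: ders_def add.commute)
        thus ?thesis unfolding xy 3(3) by (intro endo.span_scale endo.span_base)
      qed
    qed (rule ders_derivations[OF QA])+
  qed (auto intro: endo.subspace_span span_ders_derivations[OF QA, THEN subsetD])
  hence "L \<subseteq> endo.span (ders Q)"
    unfolding L_eq by (rule lie_generated_least) (use gen in \<open>force simp: ders_def intro!: endo.span_base\<close>)
  moreover have "endo.span (ders Q) \<subseteq> L"
    using Q R_D(6) by (intro endo.span_minimal lie_subalgebraD(2)[OF L_subalgebra]) (auto simp: ders_def)
  ultimately show LQ: "L = endo.span (ders Q)" by blast
  have "R \<subseteq> Q"
  proof (rule subrelI)
    fix i f assume "(i, f) \<in> R"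
    hence "der i f \<in> L" "(i, f) \<in> all_roots" unfolding R_iff by auto
    hence "der i f \<in> endo.span (ders Q)" "(i, f) \<in> all_roots" using LQ by auto
    thus "(i, f) \<in> Q" using der_in_span[OF _ QA] by blast
  qed
  with Q show "Q = R" by blast
qed

lemma L_span: "L = endo.span (ders R)"
  by (rule root_closure(1)) (auto intro: generator_R R_add)

text \<open>If a root \<open>f\<close> at \<open>i\<close> and a root \<open>g\<close> at
  \<open>h\<close> witness the two edges, then \<open>f + g\<close> is a root at \<open>h\<close>
  and witnesses the composite edge. The case \<open>j = h\<close> would be a 2-cycle.\<close>

lemma edge_trans:
  assumes "edge j i" "edge i h"
  shows "edge j h"
proof -
  from assms obtain f g g' where f: "(i, f) \<in> R" "0 < pairing n (\<rho> j) f" and g: "(h, g) \<in> R" "0 < pairing n (\<rho> i) g"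
    and j: "(j, g') \<in> R" by (auto simp: edge_def)
  have "(h, f + g) \<in> R" by (rule R_add(1)[OF f(1) g])
  moreover have "j \<noteq> h" using pairing_zero_if_pos[OF f(1) g] f(2) by auto
  hence "0 < pairing n (\<rho> j) (f + g)"
    using R_D(5)[OF g(1) R_D(1)[OF j]] f(2) by (simp add: pairing_add)
  ultimately show ?thesis using j by (auto simp: edge_def)
qed

section \<open>Weights on the acyclic graph, finiteness of the set of roots and nilpotency\<close>

definition height :: "nat \<Rightarrow> nat" where
  "height i = card {j. edge j i}"

lemma height_less: assumes "edge j i" shows "height j < height i"
proof -
  have "{j. edge j i} \<subseteq> {1..k}" using R_D(1) by (auto simp: edge_def)
  hence "finite {j. edge j i}" by (rule finite_subset) simp
  moreover have "{l. edge l j} \<subset> {l. edge l i}"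
    using assms edge_trans[of _ j i] edge_irrefl[of j] by blast
  ultimately show ?thesis unfolding height_def by (rule psubset_card_mono)
qed

definition base :: int where
  "base = 1 + (\<Sum>l\<in>{1..s}. \<Sum>j\<in>{1..k}. \<bar>pairing n (\<rho> j) (e l)\<bar>)"

text \<open>Rays without a root in \<open>L\<close> get weight zero: a generator may pair positively
  with such a ray although no edge records it.\<close>

definition weight :: "nat \<Rightarrow> int" where
  "weight i = (if \<exists>f. (i, f) \<in> R then base ^ height i else 0)"

definition \<phi> :: "(nat \<Rightarrow> int) \<Rightarrow> int" where
  "\<phi> m = (\<Sum>j\<in>{1..k}. weight j * pairing n (\<rho> j) m)"

lemma base_pos: "1 \<le> base" by (auto simp: base_def intro!: sum_nonneg)

lemma weight_nonneg: "0 \<le> weight i" using base_pos by (simp add: weight_def)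

lemma \<phi>_add: "\<phi> (x + y) = \<phi> x + \<phi> y"
  by (simp add: \<phi>_def pairing_add algebra_simps sum.distrib)

lemma \<phi>_nonneg: "m \<in> M \<Longrightarrow> 0 \<le> \<phi> m"
  by (auto simp: \<phi>_def M_def intro!: sum_nonneg mult_nonneg_nonneg weight_nonneg)

text \<open>
  The weights grow so fast along the edges that the coefficient \<open>- 1\<close> of a generator at its own ray
  outweighs its coefficients at all other rays.
\<close>

lemma \<phi>_generator:
  assumes l: "l \<in> {1..s}"
  shows "\<phi> (e l) \<le> - 1"
proof -
  let ?i = "a l"
  have i: "?i \<in> {1..k}" "(?i, e l) \<in> R" using generators generator_R l by auto
  have wi: "weight ?i = base ^ height ?i" using i by (auto simp: weight_def)
  have "base * (weight j * pairing n (\<rho> j) (e l)) \<le> base ^ height ?i * \<bar>pairing n (\<rho> j) (e l)\<bar>"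
    if j: "j \<in> {1..k} - {?i}" for j
  proof (cases "edge j ?i")
    case True
    hence "Suc (height j) \<le> height ?i" using height_less[OF True] by simp
    hence "base ^ Suc (height j) \<le> base ^ height ?i" using base_pos by (intro power_increasing)
    moreover have "weight j = base ^ height j" using True by (auto simp: weight_def edge_def)
    ultimately have "base * weight j \<le> base ^ height ?i" by simp
    hence "base * weight j * \<bar>pairing n (\<rho> j) (e l)\<bar> \<le> base ^ height ?i * \<bar>pairing n (\<rho> j) (e l)\<bar>"
      by (intro mult_right_mono) auto
    moreover have "pairing n (\<rho> j) (e l) = \<bar>pairing n (\<rho> j) (e l)\<bar>"
      using R_D(5)[OF i(2), of j] j by auto
    ultimately show ?thesis by (simp add: mult.assoc)
  next
    case False
    hence "weight j = 0 \<or> pairing n (\<rho> j) (e l) = 0"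
      using i(2) R_D(5)[OF i(2), of j] j by (force simp: weight_def edge_def)
    moreover have "0 \<le> base ^ height ?i * \<bar>pairing n (\<rho> j) (e l)\<bar>" using base_pos by simp
    ultimately show ?thesis by auto
  qed
  hence "(\<Sum>j\<in>{1..k} - {?i}. base * (weight j * pairing n (\<rho> j) (e l)))
      \<le> (\<Sum>j\<in>{1..k} - {?i}. base ^ height ?i * \<bar>pairing n (\<rho> j) (e l)\<bar>)"
    by (rule sum_mono)
  hence "base * (\<Sum>j\<in>{1..k} - {?i}. weight j * pairing n (\<rho> j) (e l))
      \<le> base ^ height ?i * (\<Sum>j\<in>{1..k} - {?i}. \<bar>pairing n (\<rho> j) (e l)\<bar>)"
    by (simp only: sum_distrib_left)
  also have "\<dots> \<le> base ^ height ?i * (base - 1)"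
  proof (intro mult_left_mono)
    have "(\<Sum>j\<in>{1..k} - {?i}. \<bar>pairing n (\<rho> j) (e l)\<bar>) \<le> (\<Sum>j\<in>{1..k}. \<bar>pairing n (\<rho> j) (e l)\<bar>)"
      by (intro sum_mono2) auto
    also have "\<dots> \<le> (\<Sum>l\<in>{1..s}. \<Sum>j\<in>{1..k}. \<bar>pairing n (\<rho> j) (e l)\<bar>)"
      using l by (intro member_le_sum) (auto intro!: sum_nonneg)
    finally show "(\<Sum>j\<in>{1..k} - {?i}. \<bar>pairing n (\<rho> j) (e l)\<bar>) \<le> base - 1" by (simp add: base_def)
  qed (use base_pos in simp)
  also have "\<dots> < base * base ^ height ?i" using base_pos by (simp add: algebra_simps)
  finally have "(\<Sum>j\<in>{1..k} - {?i}. weight j * pairing n (\<rho> j) (e l)) < base ^ height ?i"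
    using base_pos by (simp add: mult_less_cancel_left_pos)
  moreover have "\<phi> (e l) = weight ?i * pairing n (\<rho> ?i) (e l) + (\<Sum>j\<in>{1..k} - {?i}. weight j * pairing n (\<rho> j) (e l))"
    unfolding \<phi>_def using i(1) by (intro sum.remove) auto
  ultimately show ?thesis by (simp add: R_D(4)[OF i(2)] wi)
qed

definition combos :: "(nat \<Rightarrow> int) set" where
  "combos = {\<Sum>l\<in>{1..s}. (\<lambda>j. int (c l) * e l j) | c. 1 \<le> (\<Sum>l\<in>{1..s}. c l)}"

lemma \<phi>_combo: "\<phi> (\<Sum>l\<in>{1..s}. (\<lambda>j. int (c l) * e l j)) \<le> - int (\<Sum>l\<in>{1..s}. c l)"
proof -
  have \<phi>_sum: "\<phi> (\<Sum>l\<in>I. x l) = (\<Sum>l\<in>I. \<phi> (x l))" for I :: "nat set" and x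
    unfolding \<phi>_def pairing_sum sum_distrib_left by (rule sum.swap)
  have "\<phi> (\<lambda>j. int (c l) * e l j) = int (c l) * \<phi> (e l)" for l
    by (simp add: \<phi>_def pairing_scale sum_distrib_left mult.left_commute)
  hence "\<phi> (\<Sum>l\<in>{1..s}. (\<lambda>j. int (c l) * e l j)) = (\<Sum>l\<in>{1..s}. int (c l) * \<phi> (e l))"
    by (simp only: \<phi>_sum)
  also have "\<dots> \<le> (\<Sum>l\<in>{1..s}. int (c l) * (- 1))"
    by (intro sum_mono mult_left_mono \<phi>_generator) auto
  finally show ?thesis by (simp add: sum_negf)
qed

lemma R_combos: "(i, f) \<in> R \<Longrightarrow> f \<in> combos"
proof -
  define Q where "Q = {(i, f) \<in> R. f \<in> combos}"
  have "Q = R"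
  proof (rule root_closure(2))
    fix l assume l: "l \<in> {1..s}"
    have "e l = (\<Sum>l'\<in>{1..s}. (\<lambda>j. int (if l' = l then 1 else 0) * e l' j))"
    proof
      fix j
      have "(\<Sum>l'\<in>{1..s}. int (if l' = l then 1 else 0) * e l' j) = (\<Sum>l'\<in>{1..s}. if l' = l then e l j else 0)"
        by (intro sum.cong) auto
      thus "e l j = (\<Sum>l'\<in>{1..s}. (\<lambda>j. int (if l' = l then 1 else 0) * e l' j)) j"
        using l by (simp add: sum_fun_apply)
    qed
    moreover have "1 \<le> (\<Sum>l'\<in>{1..s}. if l' = l then 1 else (0::nat))" using l by simp
    ultimately have "e l \<in> combos" unfolding combos_def by (intro CollectI exI conjI)
    thus "(a l, e l) \<in> Q" using generator_R[OF l] by (simp add: Q_def)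
  next
    fix i f j g assume Q: "(i, f) \<in> Q" "(j, g) \<in> Q" "0 < pairing n (\<rho> i) g"
    then obtain c d where c: "f = (\<Sum>l\<in>{1..s}. (\<lambda>j. int (c l) * e l j))" "1 \<le> (\<Sum>l\<in>{1..s}. c l)"
      and d: "g = (\<Sum>l\<in>{1..s}. (\<lambda>j. int (d l) * e l j))" "1 \<le> (\<Sum>l\<in>{1..s}. d l)"
      unfolding Q_def combos_def by blast
    have "f + g = (\<Sum>l\<in>{1..s}. (\<lambda>j. int (c l + d l) * e l j))"
      unfolding c(1) d(1) by (auto simp: fun_eq_iff sum_fun_apply algebra_simps sum.distrib)
    moreover have "1 \<le> (\<Sum>l\<in>{1..s}. c l + d l)" using c(2) by (simp add: sum.distrib)
    ultimately have "f + g \<in> combos" unfolding combos_def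
      by (intro CollectI exI[of _ "\<lambda>l. c l + d l"]) auto
    thus "(j, f + g) \<in> Q" using R_add(1)[of i f j g] Q by (auto simp: Q_def)
  qed (auto simp: Q_def)
  thus "(i, f) \<in> R \<Longrightarrow> f \<in> combos" by (auto simp: Q_def)
qed

lemma \<phi>_R: "(i, f) \<in> R \<Longrightarrow> \<phi> f \<le> - 1"
proof -
  assume "(i, f) \<in> R"
  then obtain c where f: "f = (\<Sum>l\<in>{1..s}. (\<lambda>j. int (c l) * e l j))" "1 \<le> (\<Sum>l\<in>{1..s}. c l)"
    using R_combos unfolding combos_def by blast
  moreover from this have "1 \<le> int (\<Sum>l\<in>{1..s}. c l)" by linarith
  ultimately show ?thesis using \<phi>_combo[of c] unfolding f by linarith
qed

definition max_weight :: nat where "max_weight = nat (\<Sum>j\<in>{1..k}. weight j)"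

text \<open>A root pairs with every ray generator to at least \<open>- 1\<close>.\<close>

lemma \<phi>_lower_bound: assumes "(i, f) \<in> R" shows "- int max_weight \<le> \<phi> f"
proof -
  have "- weight j \<le> weight j * pairing n (\<rho> j) f" if "j \<in> {1..k}" for j
  proof -
    have "weight j * (- 1) \<le> weight j * pairing n (\<rho> j) f"
      using R_D(4,5)[OF assms] that by (intro mult_left_mono weight_nonneg) (cases "j = i", force+)
    thus ?thesis by simp
  qed
  hence "(\<Sum>j\<in>{1..k}. - weight j) \<le> \<phi> f" unfolding \<phi>_def by (rule sum_mono)
  thus ?thesis by (simp add: max_weight_def sum_negf sum_nonneg weight_nonneg)
qed

text \<open>A root in \<open>L\<close> is a sum of generators, each of which lowers
  \<open>\<phi>\<close> by at least one, while \<open>\<phi>\<close> is at least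
  \<open>- max_weight\<close> on \<open>R\<close>; so every multiplicity is at most
  \<open>max_weight\<close>.\<close>

lemma finite_R: "finite R"
proof -
  define C where "C = PiE {1..s} (\<lambda>_. {..max_weight})"
  have "f \<in> (\<lambda>c. \<Sum>l\<in>{1..s}. (\<lambda>j. int (c l) * e l j)) ` C" if R: "(i, f) \<in> R" for i f
  proof -
    obtain c where c: "f = (\<Sum>l\<in>{1..s}. (\<lambda>j. int (c l) * e l j))"
      using R_combos[OF R] unfolding combos_def by blast
    have "int (\<Sum>l\<in>{1..s}. c l) \<le> int max_weight"
      using \<phi>_combo[of c] \<phi>_lower_bound[OF R] by (simp add: c)
    hence "c l \<le> max_weight" if "l \<in> {1..s}" for l
      using member_le_sum[of l "{1..s}" c] that unfolding of_nat_le_iff by force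
    hence "restrict c {1..s} \<in> C" unfolding C_def by (intro restrict_PiE_iff[THEN iffD2] ballI) simp
    moreover have "f = (\<Sum>l\<in>{1..s}. (\<lambda>j. int (restrict c {1..s} l) * e l j))"
      unfolding c by (intro sum.cong) auto
    ultimately show ?thesis by blast
  qed
  hence "R \<subseteq> {1..k} \<times> (\<lambda>c. \<Sum>l\<in>{1..s}. (\<lambda>j. int (c l) * e l j)) ` C" using R_D(1) by auto
  moreover have "finite C" unfolding C_def by (intro finite_PiE) auto
  ultimately show ?thesis by (meson finite_SigmaI finite_atLeastAtMost finite_imageI finite_subset)
qed

lemma finite_dimensional_L: "finite_dimensional L"
  unfolding finite_dimensional_def using L_span finite_R by (intro exI[of _ "ders R"]) (auto simp: ders_def)

text \<open>Roots add under the bracket, and each has \<open>\<phi>\<close> at most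
  \<open>- 1\<close>. The bound for term \<open>0\<close> is already \<open>- 1\<close>, whence
  \<open>Suc t\<close>.\<close>

lemma lower_central_span:
  "lower_central L t \<subseteq> endo.span (ders {(i, f) \<in> R. \<phi> f \<le> - int (Suc t)})"
proof (induction t)
  case 0
  have "{(i, f) \<in> R. \<phi> f \<le> - int (Suc 0)} = R" using \<phi>_R by auto
  thus ?case by (simp add: L_span[symmetric])
next
  case (Suc t)
  let ?Q = "\<lambda>t. {(i, f) \<in> R. \<phi> f \<le> - int (Suc t)}"
  have "bracket D E \<in> endo.span (ders (?Q (Suc t)))" if D: "D \<in> L" and E: "E \<in> lower_central L t" for D E
  proof (rule bracket_span)
    show "D \<in> endo.span (ders R)" using D L_span by simp
    show "E \<in> endo.span (ders (?Q t))" using E Suc by blast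
    fix x y assume "x \<in> ders R" "y \<in> ders (?Q t)"
    then obtain i f j g where xy: "x = der i f" "y = der j g" "(i, f) \<in> R" "(j, g) \<in> R" "\<phi> g \<le> - int (Suc t)"
      by (auto simp: ders_def)
    have \<phi>fg: "\<phi> (f + g) \<le> - int (Suc (Suc t))" using \<phi>_R[OF xy(3)] xy(5) by (simp add: \<phi>_add)
    from xy(3,4) show "bracket x y \<in> endo.span (ders (?Q (Suc t)))"
    proof (cases rule: bracket_R_cases)
      case 1 thus ?thesis by (simp add: xy endo.span_zero)
    next
      case 2
      have "der j (f + g) \<in> ders (?Q (Suc t))" using 2(2) \<phi>fg by (force simp: ders_def)
      thus ?thesis unfolding xy 2(3) by (intro endo.span_scale endo.span_base)
    next
      case 3
      have "der i (f + g) \<in> ders (?Q (Suc t))" using 3(2) \<phi>fg by (force simp: ders_def)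
      thus ?thesis unfolding xy 3(3) by (intro endo.span_scale endo.span_base)
    qed
  qed (use R_all_roots in \<open>auto intro!: ders_derivations\<close>)
  thus ?case unfolding lower_central.simps by (intro endo.span_minimal endo.subspace_span) blast
qed

lemma nilpotent_L: "lie_nilpotent L"
  unfolding lie_nilpotent_def
proof (intro exI equalityI)
  have "{(i, f) \<in> R. \<phi> f \<le> - int (Suc max_weight)} = {}" using \<phi>_lower_bound by force
  with lower_central_span[of max_weight] have "lower_central L max_weight \<subseteq> endo.span (ders {})" by (simp only:)
  thus "lower_central L max_weight \<subseteq> {0}" by (simp add: ders_def)
  show "{0} \<subseteq> lower_central L max_weight"
    using endo.subspace_0[OF lower_central_subspace[OF lie_subalgebraD(2)[OF L_subalgebra]]] by simp
qed

end

context lie_roots begin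

lemma nilpotent_iff_no_two_cycle:
  "\<not> has_two_cycle n k \<rho> A L \<longleftrightarrow> finite_dimensional L \<and> lie_nilpotent L"
proof
  assume "\<not> has_two_cycle n k \<rho> A L"
  then interpret acyclic_roots n k \<rho> A m0 s a e L by unfold_locales
  show "finite_dimensional L \<and> lie_nilpotent L" using finite_dimensional_L nilpotent_L by simp
next
  assume "finite_dimensional L \<and> lie_nilpotent L"
  thus "\<not> has_two_cycle n k \<rho> A L" using nilpotent_imp_no_two_cycle[OF L_subalgebra] by blast
qed

section \<open>The graph of root derivations\<close>

text \<open>Arcs correspond to edges between indices because the subalgebras are distinct. By
  transitivity a closed walk collapses to a loop, which irreflexivity excludes; conversely a 2-cycle
  is a bidirected edge.\<close>

lemma graph_iff_no_two_cycle:
  assumes r: "r \<le> k" "\<forall>i\<in>{1..k}. roots_in n k \<rho> A L i \<noteq> {} \<longleftrightarrow> i \<le> r"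
  shows "\<not> has_two_cycle n k \<rho> A L \<longleftrightarrow>
    \<not> has_oriented_cycle (root_graph n k r \<rho> A L) \<and> \<not> has_bidirected_edge (root_graph n k r \<rho> A L)"
proof -
  let ?G = "root_graph n k r \<rho> A L" and ?L = "root_subalgebra n k \<rho> A L"
  have vertex: "(\<exists>f. (i, f) \<in> R) \<longleftrightarrow> i \<in> {1..r}" for i
  proof -
    have "(\<exists>f. (i, f) \<in> R) \<longleftrightarrow> i \<in> {1..k} \<and> roots_in n k \<rho> A L i \<noteq> {}" by (auto simp: R_def)
    also have "\<dots> \<longleftrightarrow> i \<in> {1..k} \<and> i \<le> r" using r(2) by blast
    also have "\<dots> \<longleftrightarrow> i \<in> {1..r}" using r(1) by auto
    finally show ?thesis .
  qed
  have edge_iff: "edge j i \<longleftrightarrow> i \<in> {1..r} \<and> j \<in> {1..r} \<and> (\<exists>f\<in>roots_in n k \<rho> A L i. 0 < pairing n (\<rho> j) f)" for i j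
  proof -
    have "(\<exists>f. (i, f) \<in> R \<and> 0 < pairing n (\<rho> j) f) \<longleftrightarrow> i \<in> {1..r} \<and> (\<exists>f\<in>roots_in n k \<rho> A L i. 0 < pairing n (\<rho> j) f)"
      unfolding vertex[symmetric] by (auto simp: R_def)
    thus ?thesis unfolding edge_def vertex by blast
  qed
  have arc: "p \<in> arcs ?G \<longleftrightarrow> (\<exists>i j. p = (?L j, ?L i) \<and> edge j i)" for p
    unfolding edge_iff by (auto simp: root_graph_def)
  have inj: "i = j" if "?L i = ?L j" "i \<in> {1..r}" "j \<in> {1..r}" for i j
    using root_subalgebra_inj[OF _ _ _ that(1)] that(2,3) r by auto
  have edge_vertices: "i \<in> {1..r}" "j \<in> {1..r}" if "edge i j" for i j
    using that vertex[of i] vertex[of j] by (auto simp: edge_def)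
  show ?thesis
  proof (intro iffI conjI)
    assume "\<not> has_two_cycle n k \<rho> A L"
    then interpret acyclic_roots n k \<rho> A m0 s a e L by unfold_locales
    show "\<not> has_bidirected_edge ?G"
    proof
      assume "has_bidirected_edge ?G"
      then obtain i j i' j' where ij: "edge j i" "edge i' j'" "?L j = ?L j'" "?L i = ?L i'"
        unfolding has_bidirected_edge_def arc by blast
      hence "j = j'" "i = i'" using inj edge_vertices by metis+
      with ij show False using not_edge_both by blast
    qed
    have walk: "\<exists>i j. u = ?L i \<and> v = ?L j \<and> edge i j"
      if "pre_digraph.cas ?G u p v" "set p \<subseteq> arcs ?G" "p \<noteq> []" for u p v
      using that
    proof (induction p arbitrary: u)
      case (Cons q p)
      obtain i j where q: "q = (?L j, ?L i)" "edge j i" using Cons.prems(2) arc[of q] by auto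
      have u: "u = ?L j" and cas: "pre_digraph.cas ?G (?L i) p v"
        using Cons.prems(1) by (auto simp: pre_digraph.cas.simps root_graph_def q)
      show ?case
      proof (cases "p = []")
        case True
        with cas have "v = ?L i" by (simp add: pre_digraph.cas.simps)
        with u q(2) show ?thesis by blast
      next
        case False
        with Cons.IH[OF cas] Cons.prems(2) obtain i' j' where ij': "?L i = ?L i'" "v = ?L j'" "edge i' j'" by auto
        hence "i = i'" using inj edge_vertices q(2) by metis
        with ij' q(2) u edge_trans show ?thesis by blast
      qed
    qed simp
    show "\<not> has_oriented_cycle ?G"
    proof
      assume "has_oriented_cycle ?G"
      then obtain u p where "pre_digraph.cas ?G u p u" "set p \<subseteq> arcs ?G" "p \<noteq> []"
        by (auto simp: has_oriented_cycle_def pre_digraph.cycle_def pre_digraph.awalk_def)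
      from walk[OF this] obtain i j where "?L i = ?L j" "edge i j" by metis
      moreover from this have "i = j" using inj edge_vertices by metis
      ultimately show False using edge_irrefl by blast
    qed
  next
    assume nb: "\<not> has_oriented_cycle ?G \<and> \<not> has_bidirected_edge ?G"
    show "\<not> has_two_cycle n k \<rho> A L"
    proof
      assume "has_two_cycle n k \<rho> A L"
      then obtain i j where "edge i j" "edge j i" using two_cycle_iff by blast
      hence "has_bidirected_edge ?G" unfolding has_bidirected_edge_def arc by blast
      with nb show False by blast
    qed
  qed
qed

end

section \<open>Exponentials as automorphisms\<close>

lemma sum_apply_laurent: "(\<Sum>i\<in>I. T i) f = (\<Sum>i\<in>I. (T i :: 'k::field endo) f)"
  by (rule sum_fun_apply)

context toric begin

lemma BijGroup_group: "group (BijGroup A)"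
  by (rule group_BijGroup)

lemma algebra_autosD:
  assumes "g \<in> algebra_autos A"
  shows "g \<in> Bij A" "f \<in> A \<Longrightarrow> g f \<in> A" "f \<in> A \<Longrightarrow> h \<in> A \<Longrightarrow> g (f + h) = g f + g h"
    "f \<in> A \<Longrightarrow> h \<in> A \<Longrightarrow> g (f * h) = g f * g h" "g (const c) = const c"
    "f \<in> A \<Longrightarrow> g (const c * f) = const c * g f"
proof -
  have g: "g \<in> Bij A" "\<forall>f\<in>A. \<forall>h\<in>A. g (f + h) = g f + g h \<and> g (f * h) = g f * g h" "\<forall>c. g (const c) = const c"
    using assms unfolding algebra_autos_def by blast+
  show "g \<in> Bij A" "f \<in> A \<Longrightarrow> h \<in> A \<Longrightarrow> g (f + h) = g f + g h"
    "f \<in> A \<Longrightarrow> h \<in> A \<Longrightarrow> g (f * h) = g f * g h" "g (const c) = const c"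
    using g by auto
  show "f \<in> A \<Longrightarrow> g f \<in> A" using g(1) by (auto simp: Bij_def bij_betw_def)
  show "f \<in> A \<Longrightarrow> g (const c * f) = const c * g f" using g const_A by metis
qed

lemma algebra_autos_subgroup: "subgroup (algebra_autos A) (BijGroup A)"
proof (rule group.subgroupI[OF BijGroup_group])
  show "algebra_autos A \<subseteq> carrier (BijGroup A)"
    by (auto simp: BijGroup_def algebra_autos_def)
  have "(\<lambda>x\<in>A. x) \<in> algebra_autos A"
    by (auto simp: algebra_autos_def id_Bij add_closed mult_closed const_A)
  thus "algebra_autos A \<noteq> {}" by blast
  fix g assume g: "g \<in> algebra_autos A"
  note gD = algebra_autosD[OF g]
  have bij: "bij_betw g A A" using gD(1) by (simp add: Bij_def)
  let ?h = "inv_into A g"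
  have h: "?h f \<in> A" "g (?h f) = f" if "f \<in> A" for f
    using bij that by (auto simp: bij_betw_def inv_into_into f_inv_into_f)
  have hI: "?h f = f'" if "f' \<in> A" "g f' = f" for f f'
    using bij that by (auto simp: bij_betw_def inv_into_f_f)
  have "(\<lambda>x\<in>A. ?h x) \<in> algebra_autos A"
    unfolding algebra_autos_def
  proof (intro CollectI conjI ballI allI)
    show "(\<lambda>x\<in>A. ?h x) \<in> Bij A" by (rule restrict_inv_into_Bij[OF gD(1)])
    fix f f' assume f: "f \<in> A" "f' \<in> A"
    show "(\<lambda>x\<in>A. ?h x) (f + f') = (\<lambda>x\<in>A. ?h x) f + (\<lambda>x\<in>A. ?h x) f'"
      using f by (simp add: add_closed, intro hI) (auto simp: h gD add_closed)
    show "(\<lambda>x\<in>A. ?h x) (f * f') = (\<lambda>x\<in>A. ?h x) f * (\<lambda>x\<in>A. ?h x) f'"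
      using f by (simp add: mult_closed, intro hI) (auto simp: h gD mult_closed)
  next
    fix c show "(\<lambda>x\<in>A. ?h x) (const c) = const c" using hI[OF const_A gD(5)] const_A by simp
  qed
  thus "inv\<^bsub>BijGroup A\<^esub> g \<in> algebra_autos A" using inv_BijGroup[OF gD(1)] by simp
next
  fix g h assume "g \<in> algebra_autos A" "h \<in> algebra_autos A"
  note gD = algebra_autosD[OF this(1)] and hD = algebra_autosD[OF this(2)]
  have "compose A g h \<in> algebra_autos A"
    unfolding algebra_autos_def
    using compose_Bij[OF gD(1) hD(1)]
    by (auto simp: compose_def gD hD add_closed mult_closed const_A)
  thus "g \<otimes>\<^bsub>BijGroup A\<^esub> h \<in> algebra_autos A" using gD(1) hD(1) by (simp add: BijGroup_def)
qed

lemma aut_group_group: "group (aut_group A)"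
  unfolding aut_group_def by (rule group.subgroup_imp_group[OF BijGroup_group algebra_autos_subgroup])

lemma aut_group_carrier: "carrier (aut_group A) = algebra_autos A"
  by (simp add: aut_group_def)

lemma aut_group_mult:
  "g \<in> algebra_autos A \<Longrightarrow> h \<in> algebra_autos A \<Longrightarrow> g \<otimes>\<^bsub>aut_group A\<^esub> h = compose A g h"
  using algebra_autosD(1) by (simp add: aut_group_def BijGroup_def)

lemma aut_group_one: "\<one>\<^bsub>aut_group A\<^esub> = (\<lambda>f\<in>A. f)"
  by (simp add: aut_group_def BijGroup_def)

end

text \<open>An additive weight that is nonnegative on the characters of \<open>A\<close> filters
  \<open>A\<close>. Two choices occur: \<open>\<phi>\<close>, which is negative on all roots in
  \<open>L\<close> when there is no 2-cycle, and the pairing with one ray generator, which makes a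
  single root derivation exponentiable in general.\<close>

locale weighted_toric = toric n k \<rho> A m0
  for n k :: nat and \<rho> :: "nat \<Rightarrow> nat \<Rightarrow> int" and A :: "'k::field_char_0 laurent set" and m0 +
  fixes \<psi> :: "(nat \<Rightarrow> int) \<Rightarrow> int"
  assumes \<psi>_add: "\<psi> (x + y) = \<psi> x + \<psi> y" and \<psi>_nonneg: "x \<in> {m \<in> int_lattice n. \<forall>i\<in>{1..k}. 0 \<le> pairing n (\<rho> i) m} \<Longrightarrow> 0 \<le> \<psi> x"
begin

text \<open>The strict inequality makes \<open>Fil 0\<close> trivial.\<close>

definition Fil :: "nat \<Rightarrow> 'k laurent set" where
  "Fil c = {f \<in> A. \<forall>m\<in>Poly_Mapping.keys f. \<psi> m < int c}"

sublocale F: filtered_space "\<lambda>c f. const c * f :: 'k laurent" Fil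
proof
  show "laurent.subspace (Fil c)" for c
  proof (rule laurent.subspaceI)
    show "0 \<in> Fil c" by (simp add: Fil_def zero_closed)
    fix f g assume "f \<in> Fil c" "g \<in> Fil c"
    thus "f + g \<in> Fil c" using Poly_Mapping.keys_add[of f g] by (auto simp: Fil_def add_closed)
  next
    fix b f assume "f \<in> Fil c"
    thus "const b * f \<in> Fil c" by (auto simp: Fil_def const_mult_closed in_keys_iff lookup_const_mult)
  qed
  show "Fil 0 = {0}"
  proof -
    have "f = 0" if "f \<in> Fil 0" for f
    proof (rule ccontr)
      assume "f \<noteq> 0"
      then obtain m where m: "m \<in> Poly_Mapping.keys f" using keys_eq_empty by blast
      with that have "m \<in> M" "\<psi> m < 0" by (auto simp: Fil_def A_iff)
      thus False using \<psi>_nonneg[of m] by (simp add: M_def)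
    qed
    thus ?thesis by (auto simp: Fil_def zero_closed)
  qed
  show "Fil c \<subseteq> Fil (Suc c)" for c by (auto simp: Fil_def)
qed

lemma carr_eq: "F.carr = A"
proof
  show "F.carr \<subseteq> A" by (auto simp: F.carr_def Fil_def)
  show "A \<subseteq> F.carr"
  proof
    fix f assume f: "f \<in> A"
    define c where "c = nat (\<Sum>m\<in>Poly_Mapping.keys f. \<bar>\<psi> m\<bar> + 1)"
    have "\<psi> m < int c" if "m \<in> Poly_Mapping.keys f" for m
    proof -
      have "\<bar>\<psi> m\<bar> + 1 \<le> (\<Sum>m\<in>Poly_Mapping.keys f. \<bar>\<psi> m\<bar> + 1)" using that by (intro member_le_sum) auto
      thus ?thesis unfolding c_def by linarith
    qed
    with f have "f \<in> Fil c" by (simp add: Fil_def)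
    thus "f \<in> F.carr" by (rule F.V_carr)
  qed
qed

lemma der_lowering:
  assumes "i \<in> {1..k}" "e \<in> S i" "\<psi> e \<le> - int w"
  shows "der i e \<in> F.lowering w"
proof (rule F.loweringI)
  show "der i e f \<in> F.carr" if "f \<in> F.carr" for f using that der_closed[OF assms(2,1)] by (simp add: carr_eq)
  show "der i e (f + g) = der i e f + der i e g" if "f \<in> F.carr" "g \<in> F.carr" for f g
    using that by (simp add: carr_eq root_derivation_add)
  show "der i e (const c * f) = const c * der i e f" if "f \<in> F.carr" for c f
    using that derivationD(4)[OF der_derivation[OF assms(2,1)]] by (simp add: carr_eq)
  fix c f assume f: "f \<in> Fil (c + w)"
  hence fA: "f \<in> A" by (simp add: Fil_def)
  have "\<psi> x < int c" if "x \<in> Poly_Mapping.keys (der i e f)" for x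
  proof -
    have "x - e \<in> Poly_Mapping.keys f" using that by (auto simp: in_keys_iff lookup_root_derivation[OF fA])
    hence "\<psi> (x - e) < int (c + w)" using f by (auto simp: Fil_def)
    moreover have "\<psi> x = \<psi> (x - e) + \<psi> e" by (simp add: \<psi>_add[symmetric])
    ultimately show ?thesis using assms(3) by simp
  qed
  thus "der i e f \<in> Fil c" using der_closed[OF assms(2,1) fA] by (simp add: Fil_def)
qed

lemma lowering_subspace: "endo.subspace (F.lowering w)"
proof (rule endo.subspaceI)
  show "0 \<in> F.lowering w" using F.lowering_0[of w] by (simp add: zero_fun_def)
  fix S T :: "'k endo" assume "S \<in> F.lowering w" "T \<in> F.lowering w"
  thus "S + T \<in> F.lowering w" using F.lowering_add[of S w T] by (simp add: plus_fun_def)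
next
  fix c and T :: "'k endo" assume "T \<in> F.lowering w"
  thus "endo_scale c T \<in> F.lowering w" using F.lowering_scale[of T w c] by (simp add: endo_scale_def[abs_def])
qed

text \<open>Automorphisms are extensional on \<open>A\<close>, being elements of
  \<open>Bij A\<close>, whereas endomorphisms vanish outside \<open>A\<close>; hence the
  restriction.\<close>

definition Exp :: "'k endo \<Rightarrow> 'k endo" where
  "Exp D = restrict (laurent.op_exp D) A"

lemma Exp_apply: "f \<in> A \<Longrightarrow> Exp D f = laurent.op_exp D f" by (simp add: Exp_def)

text \<open>\<open>divided_leibniz\<close> applied to the product rule. With \<open>f\<close> in
  \<open>Fil b\<close> and \<open>g\<close> in \<open>Fil c\<close>, a term with
  \<open>i + j \<ge> b + c\<close> vanishes because one of its factors does.\<close>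

lemma op_exp_mult:
  assumes D: "D \<in> F.lowering 1" and der: "D \<in> derivations A" and f: "f \<in> A" and g: "g \<in> A"
  shows "laurent.op_exp D (f * g) = laurent.op_exp D f * laurent.op_exp D g"
proof -
  have carr: "f \<in> F.carr" "g \<in> F.carr" using f g by (simp_all only: carr_eq)
  obtain b where b: "f \<in> Fil b" by (rule F.carrE[OF carr(1)])
  obtain c where c: "g \<in> Fil c" by (rule F.carrE[OF carr(2)])
  note eD = F.lowering_endo[OF D]
  have "f * g \<in> Fil (b + c)"
  proof -
    have "\<psi> m < int (b + c)" if m: "m \<in> Poly_Mapping.keys (f * g)" for m
    proof -
      obtain x y where "m = x + y" "x \<in> Poly_Mapping.keys f" "y \<in> Poly_Mapping.keys g"
        using keys_mult[of f g] m by blast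
      moreover from this have "\<psi> x < int b" "\<psi> y < int c" using b c by (auto simp: Fil_def)
      ultimately show ?thesis by (simp add: \<psi>_add)
    qed
    thus ?thesis using mult_closed[OF f g] by (simp add: Fil_def)
  qed
  define p where "p = laurent.divided_power D"
  define x where "x = (\<lambda>i j. p i f * p j g)"
  have p0: "p 0 h = h" for h by (simp only: p_def laurent.divided_power_0)
  have pA: "p i h \<in> A" if "h \<in> A" for i h
    unfolding p_def using F.endo_onD(1)[OF F.lowering_endo[OF F.divided_power_lowering[OF D]]] that by (simp only: carr_eq)
  have xA: "x i j \<in> A" for i j unfolding x_def by (intro mult_closed pA f g)
  have pS: "const (of_nat (Suc i)) * p (Suc i) h = D (p i h)" if "h \<in> A" for i h
    unfolding p_def using F.divided_power_Suc[OF eD, of h i] that by (simp only: carr_eq)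
  have leib: "p q (f * g) = (\<Sum>i\<le>q. x i (q - i))" for q
  proof (rule laurent.divided_leibniz[where U = D])
    show "p 0 (f * g) = x 0 0" by (simp add: x_def p0)
    show "const (of_nat (Suc q)) * p (Suc q) (f * g) = D (p q (f * g))" for q
      by (rule pS[OF mult_closed[OF f g]])
    show "D (\<Sum>i\<le>q. x i (q - i)) = (\<Sum>i\<le>q. D (x i (q - i)))" for q
      by (rule F.endo_on_sum[OF eD]) (simp add: xA carr_eq)
    fix i j
    have "D (x i j) = D (p i f) * p j g + p i f * D (p j g)"
      unfolding x_def by (rule derivationD(5)[OF der pA[OF f] pA[OF g]])
    thus "D (x i j) = const (of_nat (Suc i)) * x (Suc i) j + const (of_nat (Suc j)) * x i (Suc j)"
      unfolding pS[OF f, symmetric] pS[OF g, symmetric] by (simp only: x_def ac_simps)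
  qed
  have z: "p i h = 0" if "h \<in> Fil a" "a \<le> i" for i h a
    unfolding p_def by (rule F.lowering_vanish[OF F.divided_power_lowering[OF D] that])
  have exp: "laurent.op_exp D h = (\<Sum>i<N. p i h)" if "h \<in> Fil a" "a \<le> N" for h a N
    unfolding p_def by (rule F.op_exp_sum[OF D that])
  have "laurent.op_exp D (f * g) = (\<Sum>q<b + c. p q (f * g))"
    by (rule exp[OF \<open>f * g \<in> Fil (b + c)\<close> le_refl])
  also have "\<dots> = (\<Sum>i<b + c. \<Sum>j<b + c. x i j)"
  proof (rule laurent.divided_leibniz_sum[OF leib])
    fix i j assume "b + c \<le> i + j"
    hence "b \<le> i \<or> c \<le> j" by linarith
    thus "x i j = 0" using z[OF b, of i] z[OF c, of j] by (auto simp: x_def)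
  qed
  also have "\<dots> = laurent.op_exp D f * laurent.op_exp D g"
    unfolding exp[OF b le_add1[of b c]] exp[OF c le_add2[of c b]] x_def by (simp add: sum_product)
  finally show ?thesis .
qed

lemma Exp_add:
  assumes E: "E \<in> F.lowering 1" and T: "T \<in> F.lowering 1" and comm: "bracket E T = 0" and f: "f \<in> A"
  shows "Exp (E + T) f = Exp E (Exp T f)"
proof -
  have "E (T g) = T (E g)" for g using fun_cong[OF comm, of g] by (simp add: bracket_def)
  hence "laurent.op_exp (\<lambda>f. E f + T f) f = laurent.op_exp E (laurent.op_exp T f)"
    using f by (intro F.op_exp_add[OF E T]) (auto simp: carr_eq)
  moreover have "laurent.op_exp T f \<in> A" using F.op_exp_carr[OF T] f by (simp add: carr_eq)
  ultimately show ?thesis using f by (simp add: Exp_def plus_fun_def)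
qed

lemma Exp_closed: "D \<in> F.lowering 1 \<Longrightarrow> f \<in> A \<Longrightarrow> Exp D f \<in> A"
  using F.op_exp_carr[of D f] by (simp add: Exp_apply carr_eq)

lemma Exp_0: "Exp 0 = (\<lambda>f\<in>A. f)"
  using F.op_exp_zero by (auto simp: Exp_def zero_fun_def)

lemma Exp_uminus:
  assumes D: "D \<in> F.lowering 1" and f: "f \<in> A"
  shows "Exp D (Exp (- D) f) = f" "Exp (- D) (Exp D f) = f"
proof -
  have D': "- D \<in> F.lowering 1" using endo.subspace_neg[OF lowering_subspace D] .
  have "D (- g) = - D g" if "g \<in> A" for g
    using F.endo_onD(3)[OF F.lowering_endo[OF D], of g "-1"] that by (simp add: carr_eq const_def single_uminus)
  hence c: "D ((- D) g) = (- D) (D g)" if "g \<in> A" for g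
    using that F.endo_onD(1)[OF F.lowering_endo[OF D], of g] by (simp add: carr_eq)
  have "laurent.op_exp (\<lambda>f. D f + (- D) f) f = laurent.op_exp D (laurent.op_exp (- D) f)"
    "laurent.op_exp (\<lambda>f. (- D) f + D f) f = laurent.op_exp (- D) (laurent.op_exp D f)"
    using f c by (intro F.op_exp_add[OF D D'] F.op_exp_add[OF D' D]; simp add: carr_eq)+
  moreover have "laurent.op_exp D f \<in> A" "laurent.op_exp (- D) f \<in> A"
    using F.op_exp_carr[OF D] F.op_exp_carr[OF D'] f by (simp_all add: carr_eq)
  ultimately show "Exp D (Exp (- D) f) = f" "Exp (- D) (Exp D f) = f"
    using f F.op_exp_zero by (simp_all add: Exp_def)
qed

lemma Exp_auto:
  assumes D: "D \<in> F.lowering 1" and der: "D \<in> derivations A"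
  shows "Exp D \<in> algebra_autos A"
  unfolding algebra_autos_def
proof (intro CollectI conjI ballI allI)
  have D': "- D \<in> F.lowering 1" using endo.subspace_neg[OF lowering_subspace D] .
  have "bij_betw (Exp D) A A"
    by (rule bij_betw_byWitness[where f' = "Exp (- D)"]) (auto simp: Exp_uminus[OF D] Exp_closed[OF D] Exp_closed[OF D'])
  thus "Exp D \<in> Bij A" by (simp add: Bij_def Exp_def)
  note eE = F.lowering_endo[OF F.op_exp_endo[OF D]]
  fix f g assume "f \<in> A" "g \<in> A"
  thus "Exp D (f + g) = Exp D f + Exp D g" "Exp D (f * g) = Exp D f * Exp D g"
    using F.endo_onD(2)[OF eE, of f g] op_exp_mult[OF D der]
    by (auto simp: Exp_def add_closed mult_closed carr_eq)
next
  fix c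
  have one: "(1 :: 'k laurent) \<in> A" using const_A[of 1] by (simp add: const_def)
  have "D (1 * 1) = D 1 * 1 + 1 * D 1" by (rule derivationD(5)[OF der one one])
  hence "D 1 = 0" by simp
  moreover have "D (const c * 1) = const c * D 1" by (rule derivationD(4)[OF der one])
  ultimately have Dc: "D (const c) = 0" by simp
  have "(D ^^ i) (const c) = 0" if "1 \<le> i" for i
  proof -
    have "(D ^^ Suc i) (const c) = 0" for i
      by (induction i) (auto simp: Dc derivationD(6)[OF der])
    thus ?thesis using that by (cases i) auto
  qed
  from laurent.op_exp_eq_sum[OF this, where N = 1]
  show "Exp D (const c) = const c"
    using const_A by (simp add: Exp_def laurent.divided_power_0)
qed

lemma Exp_mult:
  assumes "E \<in> F.lowering 1" "E \<in> derivations A" "T \<in> F.lowering 1" "T \<in> derivations A" "bracket E T = 0"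
  shows "Exp E \<otimes>\<^bsub>aut_group A\<^esub> Exp T = Exp (E + T)"
proof -
  have "compose A (Exp E) (Exp T) f = Exp (E + T) f" for f
    using Exp_add[OF assms(1,3,5), of f] by (cases "f \<in> A") (auto simp: compose_def Exp_def)
  thus ?thesis using aut_group_mult[OF Exp_auto[OF assms(1,2)] Exp_auto[OF assms(3,4)]] by auto
qed

lemma Exp_inv:
  assumes D: "D \<in> F.lowering 1" and der: "D \<in> derivations A"
  shows "inv\<^bsub>aut_group A\<^esub> (Exp D) = Exp (- D)"
proof -
  have D': "- D \<in> F.lowering 1" "- D \<in> derivations A"
    using endo.subspace_neg lowering_subspace derivations_subspace D der by blast+
  have "compose A (Exp (- D)) (Exp D) = (\<lambda>f\<in>A. f)"
    by (auto simp: compose_def Exp_uminus[OF D])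
  hence "Exp (- D) \<otimes>\<^bsub>aut_group A\<^esub> Exp D = \<one>\<^bsub>aut_group A\<^esub>"
    using aut_group_mult[OF Exp_auto[OF D'] Exp_auto[OF D der]] by (simp add: aut_group_one)
  thus ?thesis
    using group.inv_equality[OF aut_group_group _ Exp_auto[OF D der, folded aut_group_carrier] Exp_auto[OF D', folded aut_group_carrier]]
    by simp
qed

lemma exp_derivation_Exp:
  assumes D: "D \<in> derivations A"
  shows "exp_derivation A t D = Exp (endo_scale t D)"
proof
  fix f
  show "exp_derivation A t D f = Exp (endo_scale t D) f"
  proof (cases "f \<in> A")
    case True
    have pow: "(D ^^ i) f \<in> A \<and> (endo_scale t D ^^ i) f = const (t ^ i) * (D ^^ i) f" for i
    proof (induction i)
      case 0 thus ?case using True by (simp add: const_def)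
    next
      case (Suc i)
      have "const t * (const (t ^ i) * D ((D ^^ i) f)) = const (t * t ^ i) * D ((D ^^ i) f)"
        by (rule laurent.scale_scale)
      thus ?case using Suc derivationD(2,4)[OF D] by (simp add: endo_scale_def)
    qed
    have "const (t ^ i / fact i) * (D ^^ i) f = laurent.divided_power (endo_scale t D) i f" for i
    proof -
      have "laurent.divided_power (endo_scale t D) i f = const (inverse (fact i)) * (const (t ^ i) * (D ^^ i) f)"
        using pow by (simp only: laurent.divided_power_def)
      also have "\<dots> = const (inverse (fact i) * t ^ i) * (D ^^ i) f" by (rule laurent.scale_scale)
      finally show ?thesis by (simp only: divide_inverse mult.commute)
    qed
    thus ?thesis using True by (simp add: exp_derivation_def Exp_def laurent.op_exp_def)
  qed (simp add: exp_derivation_def Exp_def)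
qed

end

section \<open>The group generated by root subgroups\<close>

context acyclic_roots begin

sublocale weighted_toric n k \<rho> A m0 \<phi>
  by unfold_locales (auto simp: \<phi>_add M_def intro: \<phi>_nonneg)

lemma L_lowering: "D \<in> L \<Longrightarrow> D \<in> F.lowering 1"
proof -
  have "ders R \<subseteq> F.lowering 1"
  proof
    fix T assume "T \<in> ders R"
    then obtain i f where "T = der i f" "(i, f) \<in> R" by (auto simp: ders_def)
    with der_lowering[OF R_D(1) R_D(2), of i f f 1] \<phi>_R[of i f] show "T \<in> F.lowering 1" by simp
  qed
  hence "endo.span (ders R) \<subseteq> F.lowering 1" by (intro endo.span_minimal lowering_subspace)
  hence "L \<subseteq> F.lowering 1" using L_span by blast
  thus "D \<in> L \<Longrightarrow> D \<in> F.lowering 1" by blast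
qed

lemma L_derivations: "D \<in> L \<Longrightarrow> D \<in> derivations A"
  using lie_subalgebraD(1)[OF L_subalgebra] by blast

lemma L_subspace: "endo.subspace L"
  by (rule lie_subalgebraD(2)[OF L_subalgebra])

lemma Exp_L_auto: "D \<in> L \<Longrightarrow> Exp D \<in> algebra_autos A"
  by (rule Exp_auto[OF L_lowering L_derivations])

lemma commutator_eq_bracket: "F.commutator = bracket"
  by (auto simp: fun_eq_iff F.commutator_def bracket_def)

lemma bracket_pow_lower_central: "E \<in> L \<Longrightarrow> F \<in> L \<Longrightarrow> (bracket E ^^ t) F \<in> lower_central L t"
  by (induction t) (auto intro: endo.span_base)

lemma lower_central_zero: "max_weight \<le> t \<Longrightarrow> lower_central L t \<subseteq> {0}"
proof -
  assume "max_weight \<le> t"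
  hence "{(i, f) \<in> R. \<phi> f \<le> - int (Suc t)} = {}" using \<phi>_lower_bound by fastforce
  with lower_central_span[of t] have "lower_central L t \<subseteq> endo.span (ders {})" by (simp only:)
  thus ?thesis by (simp add: ders_def)
qed

text \<open>\<open>exp(ad E)\<close> applied to \<open>F\<close>. For \<open>E\<close> and
  \<open>F\<close> in \<open>L\<close> the iterated brackets descend along the lower central series,
  so all orders from \<open>max_weight\<close> on vanish and the finite sum is the full
  series.\<close>

definition adexp :: "'k endo \<Rightarrow> 'k endo \<Rightarrow> 'k endo" where
  "adexp E F = (\<Sum>m\<le>max_weight. endo_scale (inverse (fact m)) ((bracket E ^^ m) F))"

lemma Exp_conjugate:
  assumes E: "E \<in> L" and F: "F \<in> L" and E': "adexp E F \<in> L"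
  shows "Exp E \<otimes>\<^bsub>aut_group A\<^esub> Exp F = Exp (adexp E F) \<otimes>\<^bsub>aut_group A\<^esub> Exp E"
proof -
  have 0: "(bracket E ^^ i) F = 0" if "max_weight \<le> i" for i
    using bracket_pow_lower_central[OF E F, of i] lower_central_zero[OF that] by blast
  have conj: "F.conjugate (Suc max_weight) E F = adexp E F"
    by (auto simp: F.conjugate_def adexp_def fun_eq_iff sum_apply_laurent endo_scale_def commutator_eq_bracket
      lessThan_Suc_atMost)
  have "compose A (Exp E) (Exp F) f = compose A (Exp (adexp E F)) (Exp E) f" for f
  proof (cases "f \<in> A")
    case True
    have "laurent.op_exp E (laurent.op_exp F f) = laurent.op_exp (F.conjugate (Suc max_weight) E F) (laurent.op_exp E f)"
    proof (rule F.op_exp_conjugate[OF L_lowering[OF E] L_lowering[OF F]])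
      show "f \<in> F.carr" using True by (simp add: carr_eq)
      show "(F.commutator E ^^ i) F g = 0" if "Suc max_weight \<le> i" for i g
        using 0[of i] that by (simp add: commutator_eq_bracket)
    qed
    moreover have "laurent.op_exp F f \<in> A" "laurent.op_exp E f \<in> A"
      using Exp_closed[OF L_lowering[OF F] True] Exp_closed[OF L_lowering[OF E] True] True by (simp_all add: Exp_def)
    ultimately show ?thesis using True by (simp add: compose_def Exp_def conj)
  qed (simp add: compose_def)
  thus ?thesis
    using aut_group_mult[OF Exp_L_auto[OF E] Exp_L_auto[OF F]] aut_group_mult[OF Exp_L_auto[OF E'] Exp_L_auto[OF E]]
    by auto
qed

section \<open>The abelian blocks of \<open>L\<close> and their exponentials\<close>

definition block :: "nat \<Rightarrow> 'k endo set" where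
  "block i = endo.span (ders {(j, f) \<in> R. j = i})"

lemma block_subspace: "endo.subspace (block i)"
  by (simp add: block_def endo.subspace_span)

lemma block_L: "block i \<subseteq> L"
  unfolding block_def by (intro endo.span_minimal L_subspace) (auto simp: ders_def R_D(6))

lemma der_block: "(i, f) \<in> R \<Longrightarrow> der i f \<in> block i"
  unfolding block_def by (rule endo.span_base) (force simp: ders_def)

lemma block_commute: assumes "E \<in> block i" "F \<in> block i" shows "bracket E F = 0"
proof -
  have sub: "{(j, f) \<in> R. j = i} \<subseteq> all_roots" using R_all_roots by blast
  have "bracket E F \<in> endo.span {}"
  proof (rule bracket_span)
    show "E \<in> endo.span (ders {(j, f) \<in> R. j = i})" "F \<in> endo.span (ders {(j, f) \<in> R. j = i})"
      using assms by (simp_all add: block_def)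
    fix x y assume "x \<in> ders {(j, f) \<in> R. j = i}" "y \<in> ders {(j, f) \<in> R. j = i}"
    then obtain f g where "x = der i f" "y = der i g" "(i, f) \<in> R" "(i, g) \<in> R" by (auto simp: ders_def)
    thus "bracket x y \<in> endo.span {}" using bracket_der_same R_all_roots by (auto simp: subset_iff)
  qed (use sub in \<open>auto intro!: ders_derivations\<close>)
  thus ?thesis by simp
qed

text \<open>The bracket of a root at \<open>i\<close> with one at \<open>j\<close> can land at
  \<open>i\<close> only along an edge from \<open>j\<close> to \<open>i\<close>. Without that edge
  block \<open>i\<close> normalises block \<open>j\<close>, which permits reordering of
  exponentials.\<close>

lemma bracket_block:
  assumes "E \<in> block i" "F \<in> block j" "\<not> edge j i"
  shows "bracket E F \<in> block j"
  unfolding block_def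
proof (rule bracket_span)
  show "E \<in> endo.span (ders {(j, f) \<in> R. j = i})" "F \<in> endo.span (ders {(i, f) \<in> R. i = j})"
    using assms by (simp_all add: block_def)
  fix x y assume "x \<in> ders {(j, f) \<in> R. j = i}" "y \<in> ders {(i, f) \<in> R. i = j}"
  then obtain f g where xy: "x = der i f" "y = der j g" "(i, f) \<in> R" "(j, g) \<in> R" by (auto simp: ders_def)
  from xy(3,4) show "bracket x y \<in> endo.span (ders {(i, f) \<in> R. i = j})"
  proof (cases rule: bracket_R_cases)
    case 1 thus ?thesis by (simp add: xy endo.span_zero)
  next
    case 2
    from der_block[OF 2(2)] show ?thesis unfolding xy 2(3) block_def by (intro endo.span_scale)
  next
    case 3
    with xy assms(3) have False by (auto simp: edge_def)
    thus ?thesis ..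
  qed
qed (use R_all_roots in \<open>auto intro!: ders_derivations\<close>)

lemma bracket_pow_block: "E \<in> block i \<Longrightarrow> F \<in> block j \<Longrightarrow> \<not> edge j i \<Longrightarrow> (bracket E ^^ m) F \<in> block j"
  by (induction m) (auto intro: bracket_block)

lemma adexp_block: "E \<in> block i \<Longrightarrow> F \<in> block j \<Longrightarrow> \<not> edge j i \<Longrightarrow> adexp E F \<in> block j"
  unfolding adexp_def
  by (intro endo.subspace_sum[OF block_subspace] endo.subspace_scale[OF block_subspace] bracket_pow_block)

lemma Exp_add_block:
  assumes "E \<in> block i" "F \<in> block i"
  shows "Exp E \<otimes>\<^bsub>aut_group A\<^esub> Exp F = Exp (E + F)"
proof -
  have "E \<in> L" "F \<in> L" using assms block_L by auto
  thus ?thesis by (intro Exp_mult L_lowering L_derivations block_commute[OF assms])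
qed

lemma Exp_block_carrier: "E \<in> block i \<Longrightarrow> Exp E \<in> carrier (aut_group A)"
  using block_L Exp_L_auto by (auto simp: aut_group_carrier)

lemma Exp_inv_L: "E \<in> L \<Longrightarrow> inv\<^bsub>aut_group A\<^esub> (Exp E) = Exp (- E)"
  by (rule Exp_inv[OF L_lowering L_derivations])

end

locale acyclic_group = acyclic_roots n k \<rho> A m0 s a e L
  for n k :: nat and \<rho> :: "nat \<Rightarrow> nat \<Rightarrow> int" and A :: "'k::field_char_0 laurent set" and m0 s a e L +
  fixes G :: "'k endo set"
  assumes G_eq: "G = generate (aut_group A) (\<Union>l\<in>{1..s}. root_subgroup A (root_derivation n A (\<rho> (a l)) (e l)))"
begin

lemma root_subgroup_eq: "D \<in> derivations A \<Longrightarrow> root_subgroup A D = range (\<lambda>t. Exp (endo_scale t D))"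
  by (simp add: root_subgroup_def exp_derivation_Exp)

lemma scale_L: "D \<in> L \<Longrightarrow> endo_scale t D \<in> L"
  by (rule endo.subspace_scale[OF L_subspace])

lemma scale_block: "D \<in> block i \<Longrightarrow> endo_scale t D \<in> block i"
  by (rule endo.subspace_scale[OF block_subspace])

lemma root_subgroup_generator:
  "l \<in> {1..s} \<Longrightarrow> root_subgroup A (der (a l) (e l)) = range (\<lambda>t. Exp (endo_scale t (der (a l) (e l))))"
  using R_D(7)[OF generator_R] by (rule root_subgroup_eq)

lemma generators_carrier: "(\<Union>l\<in>{1..s}. root_subgroup A (der (a l) (e l))) \<subseteq> carrier (aut_group A)"
  using Exp_L_auto scale_L R_D(6)[OF generator_R] by (auto simp: root_subgroup_generator aut_group_carrier)

lemma G_subgroup: "subgroup G (aut_group A)"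
  unfolding G_eq by (rule group.generate_is_subgroup[OF aut_group_group generators_carrier])

lemma G_carrier: "g \<in> G \<Longrightarrow> g \<in> carrier (aut_group A)"
  using subgroup.subset[OF G_subgroup] by blast

lemma G_mult: "g \<in> G \<Longrightarrow> h \<in> G \<Longrightarrow> g \<otimes>\<^bsub>aut_group A\<^esub> h \<in> G"
  by (rule subgroup.m_closed[OF G_subgroup])

text \<open>The elements whose whole one-parameter group lies in \<open>G\<close>. Requiring all
  \<open>t\<close> makes this a linear subspace, to which interpolation in a parameter
  applies.\<close>

definition exp_block :: "nat \<Rightarrow> 'k endo set" where
  "exp_block j = {F \<in> block j. \<forall>t. Exp (endo_scale t F) \<in> G}"

lemma exp_block_subspace: "endo.subspace (exp_block j)"
proof (rule endo.subspaceI)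
  show "0 \<in> exp_block j"
    using subgroup.one_closed[OF G_subgroup] endo.subspace_0[OF block_subspace]
    by (auto simp: exp_block_def Exp_0 aut_group_one)
  fix E F assume EF: "E \<in> exp_block j" "F \<in> exp_block j"
  hence "Exp (endo_scale t (E + F)) = Exp (endo_scale t E) \<otimes>\<^bsub>aut_group A\<^esub> Exp (endo_scale t F)" for t
    by (subst Exp_add_block) (auto simp: exp_block_def endo.scale_right_distrib intro: scale_block)
  thus "E + F \<in> exp_block j"
    using EF G_mult endo.subspace_add[OF block_subspace] by (auto simp: exp_block_def)
next
  fix c F assume "F \<in> exp_block j"
  thus "endo_scale c F \<in> exp_block j" using scale_block by (auto simp: exp_block_def)
qed

text \<open>
  Conjugating \<open>exp (t F)\<close> by \<open>exp (s E)\<close> gives an exponential whose exponent is polynomial in \<open>s\<close>, with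
  linear coefficient \<open>t [E, F]\<close>.
\<close>

lemma exp_block_bracket:
  assumes E: "E \<in> exp_block i" and F: "F \<in> exp_block j" and ne: "\<not> edge j i" and mw: "1 \<le> max_weight"
  shows "bracket E F \<in> exp_block j"
proof -
  have EB: "E \<in> block i" and FB: "F \<in> block j" using E F by (auto simp: exp_block_def)
  define Fm where "Fm = (\<lambda>m. endo_scale (inverse (fact m)) ((bracket E ^^ m) F))"
  have bF: "bracket (endo_scale c X) Y = endo_scale c (bracket X Y)" "bracket X (endo_scale c Y) = endo_scale c (bracket X Y)"
    if "X \<in> L" "Y \<in> L" for c X Y
    using L_derivations[OF that(1)] L_derivations[OF that(2)]
    by (auto simp: bracket_def endo_scale_def fun_eq_iff derivationD algebra_simps)
  have pow: "(bracket (endo_scale b E) ^^ m) (endo_scale t F) = endo_scale (t * b ^ m) ((bracket E ^^ m) F)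
     \<and> (bracket E ^^ m) F \<in> block j" for b t m
  proof (induction m)
    case (Suc m)
    have "E \<in> L" "(bracket E ^^ m) F \<in> L" using EB Suc block_L by auto
    thus ?case using Suc bracket_block[OF EB _ ne, of "(bracket E ^^ m) F"]
      by (simp add: bF scale_L mult.left_commute)
  qed (use FB in simp)
  have conj: "adexp (endo_scale b E) (endo_scale t F) = endo_scale t (\<Sum>m\<le>max_weight. endo_scale (b ^ m) (Fm m))" for b t
    unfolding adexp_def using pow by (simp add: endo.scale_sum_right Fm_def ac_simps)
  have "(\<Sum>m\<le>max_weight. endo_scale (b ^ m) (Fm m)) \<in> exp_block j" for b
    unfolding exp_block_def
  proof (intro CollectI conjI allI)
    show "(\<Sum>m\<le>max_weight. endo_scale (b ^ m) (Fm m)) \<in> block j"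
      using pow by (intro endo.subspace_sum[OF block_subspace] scale_block) (auto simp: Fm_def intro: scale_block)
    fix t
    have B: "endo_scale b E \<in> block i" "endo_scale t F \<in> block j" using EB FB scale_block by auto
    have B': "adexp (endo_scale b E) (endo_scale t F) \<in> block j" by (rule adexp_block[OF B ne])
    have inL: "endo_scale b E \<in> L" "endo_scale t F \<in> L" "adexp (endo_scale b E) (endo_scale t F) \<in> L"
      using B B' block_L by auto
    have EG: "Exp (endo_scale b E) \<in> G" and FG: "Exp (endo_scale t F) \<in> G" using E F by (auto simp: exp_block_def)
    have "Exp (adexp (endo_scale b E) (endo_scale t F))
        = Exp (endo_scale b E) \<otimes>\<^bsub>aut_group A\<^esub> Exp (endo_scale t F) \<otimes>\<^bsub>aut_group A\<^esub> inv\<^bsub>aut_group A\<^esub> Exp (endo_scale b E)"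
      unfolding Exp_conjugate[OF inL]
      using group.inv_solve_right[OF aut_group_group] Exp_L_auto inL monoid.m_closed[OF group.is_monoid[OF aut_group_group]]
      by (metis aut_group_carrier)
    also have "\<dots> \<in> G" using EG FG by (intro G_mult subgroup.m_inv_closed[OF G_subgroup])
    finally show "Exp (endo_scale t (\<Sum>m\<le>max_weight. endo_scale (b ^ m) (Fm m))) \<in> G" by (simp only: conj)
  qed
  \<comment> \<open>All values of the polynomial in \<open>b\<close> lie in the subspace
    \<open>exp_block j\<close>, hence so does its linear coefficient \<open>[E, F]\<close>;
    \<open>mw\<close> ensures that the truncated series contains it.\<close>
  from endo.subspace_coefficients[OF exp_block_subspace this, of 1] mw have "Fm 1 \<in> exp_block j" by simp
  thus ?thesis by (simp add: Fm_def)
qed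

text \<open>Root induction: the derivation at a sum of roots is a bracket up to a nonzero scalar.
  The edge from \<open>i\<close> to \<open>j\<close> excludes the reverse edge, as
  \<open>exp_block_bracket\<close> requires.\<close>

lemma R_exp_block: "(i, f) \<in> R \<Longrightarrow> der i f \<in> exp_block i"
proof -
  define Q where "Q = {(i, f) \<in> R. der i f \<in> exp_block i}"
  have "Q = R"
  proof (rule root_closure(2))
    fix l assume l: "l \<in> {1..s}"
    have "Exp (endo_scale t (der (a l) (e l))) \<in> G" for t
      unfolding G_eq by (rule generate.incl) (use l root_subgroup_generator[OF l] in blast)
    thus "(a l, e l) \<in> Q" using der_block[OF generator_R[OF l]] generator_R[OF l]
      by (simp add: Q_def exp_block_def)
  next
    fix i f j g assume Q: "(i, f) \<in> Q" "(j, g) \<in> Q" "0 < pairing n (\<rho> i) g"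
    hence R: "(i, f) \<in> R" "(j, g) \<in> R" by (auto simp: Q_def)
    have "edge i j" using Q(3) R by (auto simp: edge_def)
    have mw: "1 \<le> max_weight" using \<phi>_R[OF R(1)] \<phi>_lower_bound[OF R(1)] by linarith
    have "bracket (der i f) (der j g) \<in> exp_block j"
      using Q not_edge_both[OF \<open>edge i j\<close>] by (intro exp_block_bracket[OF _ _ _ mw]) (auto simp: Q_def)
    hence "endo_scale (inverse (of_int (pairing n (\<rho> i) g))) (bracket (der i f) (der j g)) \<in> exp_block j"
      by (rule endo.subspace_scale[OF exp_block_subspace])
    hence "der j (f + g) \<in> exp_block j" unfolding R_add(2)[OF R Q(3)] using Q(3) by simp
    thus "(j, f + g) \<in> Q" using R_add(1)[OF R Q(3)] by (simp add: Q_def)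
  qed (auto simp: Q_def)
  thus "(i, f) \<in> R \<Longrightarrow> der i f \<in> exp_block i" by (auto simp: Q_def)
qed

lemma Exp_block_G: "E \<in> block i \<Longrightarrow> Exp E \<in> G"
proof -
  have "block i \<subseteq> exp_block i"
    unfolding block_def by (intro endo.span_minimal exp_block_subspace) (auto simp: ders_def R_exp_block)
  moreover assume "E \<in> block i"
  ultimately have "Exp (endo_scale 1 E) \<in> G" unfolding exp_block_def by blast
  thus ?thesis by simp
qed

section \<open>Ordered products of block exponentials\<close>

fun product_set :: "nat list \<Rightarrow> 'k endo set" where
  "product_set [] = {\<one>\<^bsub>aut_group A\<^esub>}"
| "product_set (i # is) = {Exp E \<otimes>\<^bsub>aut_group A\<^esub> y | E y. E \<in> block i \<and> y \<in> product_set is}"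

lemma product_set_G: "product_set is \<subseteq> G"
  by (induction "is") (auto intro: subgroup.one_closed[OF G_subgroup] G_mult Exp_block_G)

lemma product_set_one: "\<one>\<^bsub>aut_group A\<^esub> \<in> product_set is"
proof (induction "is")
  case (Cons i "is")
  have "\<one>\<^bsub>aut_group A\<^esub> = Exp 0 \<otimes>\<^bsub>aut_group A\<^esub> \<one>\<^bsub>aut_group A\<^esub>"
    using monoid.l_one[OF group.is_monoid[OF aut_group_group]] monoid.one_closed[OF group.is_monoid[OF aut_group_group]]
    by (simp add: Exp_0 aut_group_one)
  with Cons endo.subspace_0[OF block_subspace] show ?case by auto
qed simp

text \<open>Move \<open>Exp F\<close> to the right past each earlier factor \<open>Exp E\<close>:
  conjugation replaces \<open>F\<close> by \<open>exp(ad (- E)) F\<close>, which stays in block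
  \<open>j\<close> because the order admits no edge from \<open>j\<close> to an earlier ray. The
  factor of block \<open>j\<close> finally absorbs it, as that block is abelian.\<close>

lemma product_set_block_mult:
  assumes "sorted_wrt (\<lambda>i j. \<not> edge j i) is" "j \<in> set is" "F \<in> block j" "x \<in> product_set is"
  shows "Exp F \<otimes>\<^bsub>aut_group A\<^esub> x \<in> product_set is"
  using assms
proof (induction "is" arbitrary: F x)
  case (Cons i "is")
  interpret \<G>: group "aut_group A" by (rule aut_group_group)
  from Cons.prems(4) obtain E y where x: "x = Exp E \<otimes>\<^bsub>aut_group A\<^esub> y" "E \<in> block i" "y \<in> product_set is" by auto
  note car = Exp_block_carrier G_carrier[OF product_set_G[THEN subsetD, OF x(3)]]
  show ?case
  proof (cases "j = i")
    case True
    hence F: "F \<in> block i" using Cons.prems(3) by simp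
    have "Exp F \<otimes>\<^bsub>aut_group A\<^esub> x = Exp (F + E) \<otimes>\<^bsub>aut_group A\<^esub> y"
      unfolding x(1) \<G>.m_assoc[OF car(1)[OF F] car(1)[OF x(2)] car(2), symmetric] Exp_add_block[OF F x(2)] ..
    moreover have "F + E \<in> block i" by (rule endo.subspace_add[OF block_subspace F x(2)])
    ultimately show ?thesis using x(3) by (simp only: product_set.simps) blast
  next
    case False
    hence j: "j \<in> set is" "\<not> edge j i" using Cons.prems(1,2) by auto
    have mE: "- E \<in> block i" using x(2) endo.subspace_neg[OF block_subspace] by blast
    define F' where "F' = adexp (- E) F"
    have F': "F' \<in> block j" unfolding F'_def by (rule adexp_block[OF mE Cons.prems(3) j(2)])
    have inL: "- E \<in> L" "F \<in> L" "F' \<in> L" "E \<in> L" using mE F' Cons.prems(3) x(2) block_L by auto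
    have c: "Exp (- E) \<otimes>\<^bsub>aut_group A\<^esub> Exp F = Exp F' \<otimes>\<^bsub>aut_group A\<^esub> Exp (- E)"
      unfolding F'_def by (rule Exp_conjugate) (use inL in \<open>auto simp: F'_def\<close>)
    have "Exp F \<otimes>\<^bsub>aut_group A\<^esub> Exp E = Exp E \<otimes>\<^bsub>aut_group A\<^esub> Exp F'"
    proof -
      have inv: "inv\<^bsub>aut_group A\<^esub> (Exp E) = Exp (- E)" by (rule Exp_inv_L[OF inL(4)])
      note cE = car(1)[OF x(2)] and cF = car(1)[OF Cons.prems(3)] and cF' = car(1)[OF F']
      have "Exp F \<otimes>\<^bsub>aut_group A\<^esub> Exp E
        = Exp E \<otimes>\<^bsub>aut_group A\<^esub> ((inv\<^bsub>aut_group A\<^esub> Exp E \<otimes>\<^bsub>aut_group A\<^esub> Exp F) \<otimes>\<^bsub>aut_group A\<^esub> Exp E)"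
        using cE cF by (simp add: \<G>.m_assoc[symmetric])
      also have "\<dots> = Exp E \<otimes>\<^bsub>aut_group A\<^esub> Exp F'"
        unfolding inv c unfolding inv[symmetric] using cE cF' by (simp add: \<G>.m_assoc)
      finally show ?thesis .
    qed
    hence "Exp F \<otimes>\<^bsub>aut_group A\<^esub> x = Exp E \<otimes>\<^bsub>aut_group A\<^esub> (Exp F' \<otimes>\<^bsub>aut_group A\<^esub> y)"
      unfolding x(1) using car(1)[OF x(2)] car(1)[OF Cons.prems(3)] car(1)[OF F'] car(2)
      by (simp add: \<G>.m_assoc[symmetric])
    moreover have "Exp F' \<otimes>\<^bsub>aut_group A\<^esub> y \<in> product_set is"
      using Cons.IH[OF _ j(1) F' x(3)] Cons.prems(1) by simp
    ultimately show ?thesis using x(2) by auto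
  qed
qed simp

text \<open>Stability under left multiplication by block exponentials gives closure under products;
  a ray outside the list has trivial block and contributes only the identity.\<close>

lemma G_eq_product_set:
  assumes srt: "sorted_wrt (\<lambda>i j. \<not> edge j i) is" and set: "\<And>i f. (i, f) \<in> R \<Longrightarrow> i \<in> set is"
  shows "G = product_set is"
proof
  interpret \<G>: group "aut_group A" by (rule aut_group_group)
  have block0: "block i = {0}" if "i \<notin> set is" for i
  proof -
    have "{(j, f) \<in> R. j = i} = {}" using set that by auto
    thus ?thesis unfolding block_def by (simp only: ders_def image_empty endo.span_empty)
  qed
  have mult: "x \<otimes>\<^bsub>aut_group A\<^esub> y \<in> product_set is" if "x \<in> product_set js" "y \<in> product_set is" for js x y
    using that(1)
  proof (induction js arbitrary: x)
    case Nil thus ?case using that(2) G_carrier product_set_G[of "is"] by auto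
  next
    case (Cons j js)
    then obtain E z where x: "x = Exp E \<otimes>\<^bsub>aut_group A\<^esub> z" "E \<in> block j" "z \<in> product_set js" by auto
    have car: "Exp E \<in> carrier (aut_group A)" "z \<in> carrier (aut_group A)" "y \<in> carrier (aut_group A)"
      using Exp_block_carrier x(2,3) that(2) G_carrier product_set_G by blast+
    have zy: "z \<otimes>\<^bsub>aut_group A\<^esub> y \<in> product_set is" by (rule Cons.IH[OF x(3)])
    have "Exp E \<otimes>\<^bsub>aut_group A\<^esub> (z \<otimes>\<^bsub>aut_group A\<^esub> y) \<in> product_set is"
    proof (cases "j \<in> set is")
      case True thus ?thesis by (rule product_set_block_mult[OF srt _ x(2) zy])
    next
      case False
      hence "Exp E = \<one>\<^bsub>aut_group A\<^esub>" using x(2) block0 by (auto simp: Exp_0 aut_group_one)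
      thus ?thesis using zy car by simp
    qed
    thus ?case using x(1) car by (simp add: \<G>.m_assoc)
  qed
  have gen: "Exp (endo_scale t (der (a l) (e l))) \<in> product_set is" if l: "l \<in> {1..s}" for t l
  proof -
    have E: "endo_scale t (der (a l) (e l)) \<in> block (a l)" by (intro scale_block der_block generator_R l)
    have "Exp (endo_scale t (der (a l) (e l))) \<otimes>\<^bsub>aut_group A\<^esub> \<one>\<^bsub>aut_group A\<^esub> \<in> product_set is"
      by (rule product_set_block_mult[OF srt set[OF generator_R[OF l]] E product_set_one])
    thus ?thesis using Exp_block_carrier[OF E] by simp
  qed
  show "G \<subseteq> product_set is"
  proof
    fix g assume "g \<in> G"
    thus "g \<in> product_set is" unfolding G_eq
    proof (induction rule: generate.induct)
      case one show ?case by (rule product_set_one)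
    next
      case (incl h) thus ?case using root_subgroup_generator gen by auto
    next
      case (inv h)
      then obtain l t where l: "l \<in> {1..s}" "h = Exp (endo_scale t (der (a l) (e l)))"
        using root_subgroup_generator by auto
      have "inv\<^bsub>aut_group A\<^esub> h = Exp (endo_scale (- t) (der (a l) (e l)))"
        unfolding l(2) by (subst Exp_inv_L) (auto intro!: scale_L R_D(6) generator_R[OF l(1)])
      thus ?case using gen[OF l(1), of "- t"] by (simp only:)
    next
      case (eng h1 h2) thus ?case using mult by blast
    qed
  qed
  show "product_set is \<subseteq> G" by (rule product_set_G)
qed

end

section \<open>Coordinates on the group\<close>

text \<open>An abstract algebra of functions lets one argument serve for regular functions on
  \<open>GL d\<close>, for functions that agree with them on \<open>H\<close>, and for constants on
  a two-point set.\<close>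

definition function_algebra :: "('p \<Rightarrow> 'k::field_char_0) set \<Rightarrow> bool" where
  "function_algebra \<R> \<longleftrightarrow> (\<forall>c. (\<lambda>_. c) \<in> \<R>) \<and>
     (\<forall>b\<in>\<R>. \<forall>c\<in>\<R>. (\<lambda>p. b p + c p) \<in> \<R> \<and> (\<lambda>p. b p * c p) \<in> \<R>)"

lemma function_algebraD:
  assumes "function_algebra \<R>"
  shows "(\<lambda>_. c) \<in> \<R>" "b \<in> \<R> \<Longrightarrow> d \<in> \<R> \<Longrightarrow> (\<lambda>p. b p + d p) \<in> \<R>"
    "b \<in> \<R> \<Longrightarrow> d \<in> \<R> \<Longrightarrow> (\<lambda>p. b p * d p) \<in> \<R>"
  using assms by (auto simp: function_algebra_def)

lemma function_algebra_sum:
  "function_algebra \<R> \<Longrightarrow> (\<And>i. i \<in> I \<Longrightarrow> b i \<in> \<R>) \<Longrightarrow> (\<lambda>p. \<Sum>i\<in>I. b i p) \<in> \<R>"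
  by (induction I rule: infinite_finite_induct) (auto intro: function_algebraD)

text \<open>Families of elements of \<open>A\<close> given by elements of \<open>\<R> \<otimes> A\<close>.\<close>

inductive_set family :: "('p \<Rightarrow> 'k::field) set \<Rightarrow> 'k laurent set \<Rightarrow> ('p \<Rightarrow> 'k laurent) set" for \<R> A where
  zero: "(\<lambda>_. 0) \<in> family \<R> A"
| monomial: "c \<in> \<R> \<Longrightarrow> g \<in> A \<Longrightarrow> (\<lambda>p. const (c p) * g) \<in> family \<R> A"
| add: "F \<in> family \<R> A \<Longrightarrow> F' \<in> family \<R> A \<Longrightarrow> (\<lambda>p. F p + F' p) \<in> family \<R> A"

lemma family_sum: "(\<And>i. i \<in> I \<Longrightarrow> F i \<in> family \<R> A) \<Longrightarrow> (\<lambda>p. \<Sum>i\<in>I. F i p) \<in> family \<R> A"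
  by (induction I rule: infinite_finite_induct) (auto intro: family.intros)

lemma sum_lessThan_add: "(\<Sum>l<N + N'. x l) = (\<Sum>l<N. x l) + (\<Sum>l<N'. x (N + l :: nat) :: 'c::comm_monoid_add)"
  by (induction N') (auto simp: add.assoc)

lemma family_expansion:
  "F \<in> family \<R> A \<Longrightarrow> \<exists>(N::nat) c g. (\<forall>l<N. c l \<in> \<R> \<and> g l \<in> A) \<and> (\<forall>p. F p = (\<Sum>l<N. const (c l p) * g l))"
proof (induction rule: family.induct)
  case zero show ?case by (intro exI[of _ 0]) simp
next
  case (monomial c g)
  thus ?case by (intro exI[of _ 1] exI[of _ "\<lambda>_. c"] exI[of _ "\<lambda>_. g"]) simp
next
  case (add F F')
  then obtain N N' :: nat and c g c' g' where
    F: "\<forall>l<N. c l \<in> \<R> \<and> g l \<in> A" "\<And>p. F p = (\<Sum>l<N. const (c l p) * g l)" and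
    F': "\<forall>l<N'. c' l \<in> \<R> \<and> g' l \<in> A" "\<And>p. F' p = (\<Sum>l<N'. const (c' l p) * g' l)" by blast
  show ?case
    by (intro exI[of _ "N + N'"] exI[of _ "\<lambda>l. if l < N then c l else c' (l - N)"]
        exI[of _ "\<lambda>l. if l < N then g l else g' (l - N)"])
      (use F(1) F'(1) in \<open>auto simp: F(2) F'(2) sum_lessThan_add\<close>)
qed

lemma family_lookup:
  assumes \<R>: "function_algebra \<R>" and F: "F \<in> family \<R> A"
  shows "(\<lambda>p. Poly_Mapping.lookup (F p) m) \<in> \<R>"
  using F by induction (auto simp: lookup_const_mult lookup_add intro: function_algebraD[OF \<R>])

lemma family_scale:
  assumes \<R>: "function_algebra \<R>" and F: "F \<in> family \<R> A" and b: "b \<in> \<R>"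
  shows "(\<lambda>p. const (b p) * F p) \<in> family \<R> A"
  using F
proof induction
  case zero show ?case by (simp add: family.zero)
next
  case (add F F')
  show ?case unfolding distrib_left by (rule family.add[OF add.IH])
next
  case (monomial c g)
  have "(\<lambda>p. const (b p * c p) * g) \<in> family \<R> A"
    by (intro family.monomial function_algebraD(3)[OF \<R>] b monomial)
  moreover have "const (b p * c p) * g = const (b p) * (const (c p) * g)" for p
    by (rule laurent.scale_scale[symmetric])
  ultimately show ?case by (simp only:)
qed

context laurent_subalgebra begin

lemma family_closed: "F \<in> family \<R> A \<Longrightarrow> F p \<in> A"
  by (induction rule: family.induct) (auto intro: zero_closed add_closed const_mult_closed)

lemma family_derivation:
  assumes D: "D \<in> derivations A" and F: "F \<in> family \<R> A"
  shows "(\<lambda>p. D (F p)) \<in> family \<R> A"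
  using F
  by induction (auto simp: derivationD[OF D] family_closed intro: family.intros derivationD(2)[OF D])

end

context acyclic_roots begin

text \<open>A family involves finitely many elements of \<open>A\<close>, so one filtration step
  contains all its values and exponential series can be cut off independently of the
  parameter.\<close>

lemma family_bounded: "F \<in> family \<R> A \<Longrightarrow> \<exists>c. \<forall>p. F p \<in> Fil c"
proof (induction rule: family.induct)
  case zero show ?case using laurent.subspace_0[OF F.V_subspace] by blast
next
  case (monomial b g)
  hence "g \<in> F.carr" by (simp add: carr_eq)
  then obtain c where "g \<in> Fil c" by (rule F.carrE)
  thus ?case using laurent.subspace_scale[OF F.V_subspace] by blast
next
  case (add F1 F2)
  then obtain c d where cd: "\<forall>p. F1 p \<in> Fil c" "\<forall>p. F2 p \<in> Fil d" by blast
  have "F1 p + F2 p \<in> Fil (max c d)" for p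
    using cd F.V_mono[of c "max c d"] F.V_mono[of d "max c d"]
    by (intro laurent.subspace_add[OF F.V_subspace]) auto
  thus ?case by blast
qed

text \<open>The parameter depends on the root alone: a root belongs to one ray only, so a single
  \<open>t\<close> parametrises all blocks at once.\<close>

definition comb :: "((nat \<Rightarrow> int) \<Rightarrow> 'k) \<Rightarrow> nat \<Rightarrow> 'k endo" where
  "comb t i = (\<Sum>f | (i, f) \<in> R. endo_scale (t f) (der i f))"

lemma finite_roots: "finite {f. (i, f) \<in> R}"
proof -
  have "{f. (i, f) \<in> R} \<subseteq> snd ` R" by force
  thus ?thesis using finite_R finite_subset by blast
qed

lemma comb_block: "comb t i \<in> block i"
  unfolding comb_def
  by (intro endo.subspace_sum[OF block_subspace] endo.subspace_scale[OF block_subspace] der_block) simp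

lemma comb_L: "comb t i \<in> L" using comb_block block_L by blast

lemma comb_lowering: "comb t i \<in> F.lowering 1" by (rule L_lowering[OF comb_L])

lemma comb_add: "comb (\<lambda>f. t f + u f) i = comb t i + comb u i"
  by (simp add: comb_def endo.scale_left_distrib sum.distrib)

lemma comb_apply: "comb t i h = (\<Sum>f | (i, f) \<in> R. const (t f) * der i f h)"
  by (simp add: comb_def sum_apply_laurent endo_scale_def)

lemma block_comb: "E \<in> block i \<Longrightarrow> \<exists>t. E = comb t i"
proof -
  have "endo.subspace (range (\<lambda>t. comb t i))"
  proof (rule endo.subspaceI)
    have "comb (\<lambda>_. 0) i = 0" by (simp add: comb_def)
    thus "0 \<in> range (\<lambda>t. comb t i)" by (metis rangeI)
  next
    fix x y assume "x \<in> range (\<lambda>t. comb t i)" "y \<in> range (\<lambda>t. comb t i)"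
    thus "x + y \<in> range (\<lambda>t. comb t i)" by (auto simp: comb_add[symmetric])
  next
    fix c x assume "x \<in> range (\<lambda>t. comb t i)"
    then obtain t where "x = comb t i" by blast
    hence "endo_scale c x = comb (\<lambda>f. c * t f) i" by (simp add: comb_def endo.scale_sum_right)
    thus "endo_scale c x \<in> range (\<lambda>t. comb t i)" by blast
  qed
  moreover have "ders {(j, f) \<in> R. j = i} \<subseteq> range (\<lambda>t. comb t i)"
  proof
    fix x assume "x \<in> ders {(j, f) \<in> R. j = i}"
    then obtain f where f: "x = der i f" "(i, f) \<in> R" by (auto simp: ders_def)
    have "comb (\<lambda>g. if g = f then 1 else 0) i = (\<Sum>g | (i, g) \<in> R. if g = f then der i g else 0)"
      unfolding comb_def by (intro sum.cong) auto
    also have "\<dots> = der i f" using f(2) finite_roots by (simp add: sum.delta)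
    finally show "x \<in> range (\<lambda>t. comb t i)" using f(1) by (metis rangeI)
  qed
  ultimately have "block i \<subseteq> range (\<lambda>t. comb t i)" unfolding block_def by (intro endo.span_minimal)
  thus "E \<in> block i \<Longrightarrow> \<exists>t. E = comb t i" by blast
qed

fun opr :: "nat list \<Rightarrow> ((nat \<Rightarrow> int) \<Rightarrow> 'k) \<Rightarrow> 'k endo" where
  "opr [] t h = h"
| "opr (i # is) t h = laurent.op_exp (comb t i) (opr is t h)"

lemma opr_lowering_0: "opr is t \<in> F.lowering 0"
proof (induction "is")
  case Nil show ?case by (rule F.loweringI) auto
next
  case (Cons i "is")
  from F.lowering_comp[OF F.op_exp_endo[OF comb_lowering] Cons] show ?case by simp
qed

lemma opr_closed: "h \<in> A \<Longrightarrow> opr is t h \<in> A"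
  using F.endo_onD(1)[OF F.lowering_endo[OF opr_lowering_0]] by (simp add: carr_eq)

lemma opr_cong: "(\<And>i f. i \<in> set is \<Longrightarrow> (i, f) \<in> R \<Longrightarrow> t f = t' f) \<Longrightarrow> opr is t h = opr is t' h"
proof (induction "is")
  case (Cons i "is")
  have "t f = t' f" if "(i, f) \<in> R" for f using Cons.prems[of i f] that by simp
  hence "comb t i = comb t' i" unfolding comb_def by (intro sum.cong) auto
  moreover have "opr is t h = opr is t' h" by (rule Cons.IH, rule Cons.prems) auto
  ultimately show ?case by simp
qed simp

lemma family_op_exp:
  assumes \<R>: "function_algebra \<R>" and t: "\<And>f. (i, f) \<in> R \<Longrightarrow> (\<lambda>p. t p f) \<in> \<R>" and F: "F \<in> family \<R> A"
  shows "(\<lambda>p. laurent.op_exp (comb (t p) i) (F p)) \<in> family \<R> A"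
proof -
  have step: "(\<lambda>p. comb (t p) i (F' p)) \<in> family \<R> A" if "F' \<in> family \<R> A" for F'
    unfolding comb_apply using that
    by (intro family_sum family_scale[OF \<R> family_derivation] t R_D(7)) auto
  have pow: "(\<lambda>p. (comb (t p) i ^^ m) (F p)) \<in> family \<R> A" for m
    by (induction m) (auto intro: F step)
  obtain c where c: "\<And>p. F p \<in> Fil c" using family_bounded[OF F] by blast
  have "laurent.op_exp (comb (t p) i) (F p) = (\<Sum>m<c. const (inverse (fact m)) * (comb (t p) i ^^ m) (F p))" for p
    unfolding F.op_exp_sum[OF comb_lowering c le_refl] laurent.divided_power_def ..
  moreover have "(\<lambda>p. \<Sum>m<c. const (inverse (fact m)) * (comb (t p) i ^^ m) (F p)) \<in> family \<R> A"
    by (intro family_sum family_scale[OF \<R> pow] function_algebraD(1)[OF \<R>])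
  ultimately show ?thesis by simp
qed

lemma family_opr:
  assumes \<R>: "function_algebra \<R>" and t: "\<And>i f. (i, f) \<in> R \<Longrightarrow> (\<lambda>p. t p f) \<in> \<R>" and h: "h \<in> A"
  shows "(\<lambda>p. opr is (t p) h) \<in> family \<R> A"
proof (induction "is")
  case Nil
  have "(\<lambda>p. const ((\<lambda>_. 1) p) * h) \<in> family \<R> A"
    by (intro family.monomial h function_algebraD(1)[OF \<R>])
  thus ?case by (simp add: const_def)
next
  case (Cons i "is")
  from family_op_exp[OF \<R> t Cons] show ?case by simp
qed

lemma op_exp_minus_id: "T \<in> F.lowering 1 \<Longrightarrow> (\<lambda>f. laurent.op_exp T f - f) \<in> F.lowering 1"
proof -
  assume T: "T \<in> F.lowering 1"
  have "(\<lambda>f. (laurent.op_exp T f - f - T f) + T f) \<in> F.lowering 1"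
    by (intro F.lowering_add T F.lowering_mono[OF F.op_exp_tail[OF T]]) auto
  thus ?thesis by simp
qed

lemma opr_minus_id: "(\<lambda>f. opr is t f - f) \<in> F.lowering 1"
proof (induction "is")
  case Nil thus ?case using F.lowering_0 by simp
next
  case (Cons i "is")
  have "(\<lambda>f. (laurent.op_exp (comb t i) (opr is t f) - opr is t f) + (opr is t f - f)) \<in> F.lowering 1"
    using F.lowering_comp[OF op_exp_minus_id[OF comb_lowering[of t i]] opr_lowering_0[of "is" t]]
    by (intro F.lowering_add Cons) simp_all
  thus ?case by simp
qed

lemma lowering_additive: "T \<in> F.lowering w \<Longrightarrow> f \<in> A \<Longrightarrow> g \<in> A \<Longrightarrow> T (f - g) = T f - T g"
  using F.endo_onD(2)[OF F.lowering_endo, of T w "f - g" g] by (simp add: carr_eq diff_closed)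

lemma lowering_cong:
  assumes T: "T \<in> F.lowering w" and eq: "\<And>f. f \<in> A \<Longrightarrow> T' f = T f"
  shows "T' \<in> F.lowering w"
proof (rule F.loweringI)
  fix c f assume f: "f \<in> Fil (c + w)"
  hence "T' f = T f" by (intro eq) (simp add: Fil_def)
  thus "T' f \<in> Fil c" using F.lowering_V[OF T f] by simp
qed (use F.endo_onD[OF F.lowering_endo[OF T]] in \<open>auto simp: carr_eq eq add_closed const_mult_closed\<close>)

text \<open>First-order expansion of the ordered product. Each exponential factor is the identity
  modulo \<open>lowering 1\<close>, so every term that mixes it with the perturbation, which lowers
  by \<open>w\<close>, lowers by \<open>w + 1\<close> and may be discarded.\<close>

lemma opr_perturb:
  assumes "1 \<le> w" "\<And>i. i \<in> set is \<Longrightarrow> comb d i \<in> F.lowering w" "distinct is"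
  shows "(\<lambda>f. opr is (\<lambda>f. t f + d f) f - opr is t f - (\<Sum>i\<in>set is. comb d i f)) \<in> F.lowering (w + 1)"
  using assms(2,3)
proof (induction "is")
  case Nil show ?case using F.lowering_0 by simp
next
  case (Cons i "is")
  define B where "B = laurent.op_exp (comb t i)"
  define C where "C = laurent.op_exp (comb d i)"
  define P where "P = opr is (\<lambda>f. t f + d f)"
  define P' where "P' = opr is t"
  define \<Delta> where "\<Delta> = (\<lambda>f. \<Sum>i\<in>set is. comb d i f)"
  define \<delta> where "\<delta> = (\<lambda>f. P f - P' f - \<Delta> f)"
  have di: "comb d i \<in> F.lowering w" using Cons.prems by simp
  have \<Delta>: "\<Delta> \<in> F.lowering w" unfolding \<Delta>_def using Cons.prems by (intro F.lowering_sum) auto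
  have \<delta>: "\<delta> \<in> F.lowering (w + 1)" unfolding \<delta>_def \<Delta>_def P_def P'_def using Cons by simp
  have B: "B \<in> F.lowering 0" "C \<in> F.lowering 0" "P \<in> F.lowering 0" "P' \<in> F.lowering 0"
    unfolding B_def C_def P_def P'_def by (intro F.op_exp_endo comb_lowering opr_lowering_0)+
  have cl: "B f \<in> A" "C f \<in> A" "P f \<in> A" "P' f \<in> A" "\<Delta> f \<in> A" "\<delta> f \<in> A" "comb d i f \<in> A" if "f \<in> A" for f
    using that F.endo_onD(1)[OF F.lowering_endo] B \<Delta> \<delta> di by (metis carr_eq)+
  have split: "laurent.op_exp (comb (\<lambda>f. t f + d f) i) f = B (C f)" if "f \<in> A" for f
  proof -
    have "bracket (comb t i) (comb d i) = 0" by (rule block_commute[OF comb_block comb_block])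
    from Exp_add[OF comb_lowering comb_lowering this that] that cl(2)[OF that]
    show ?thesis by (simp add: Exp_def B_def C_def comb_add)
  qed
  have lin: "B (f + g) = B f + B g" if "f \<in> A" "g \<in> A" for f g
    using that F.endo_onD(2)[OF F.lowering_endo[OF B(1)]] by (simp add: carr_eq)
  have 1: "(\<lambda>f. B (C (P f) - P f - comb d i (P f))) \<in> F.lowering (w + 1)"
    using F.lowering_comp[OF B(1) F.lowering_comp[OF F.op_exp_tail[OF di assms(1)] B(3)]] by (simp add: C_def)
  have 2: "(\<lambda>f. B (\<delta> f)) \<in> F.lowering (w + 1)" using F.lowering_comp[OF B(1) \<delta>] by simp
  have B1: "(\<lambda>f. B f - f) \<in> F.lowering 1" unfolding B_def by (rule op_exp_minus_id[OF comb_lowering])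
  have 3: "(\<lambda>f. B (\<Delta> f) - \<Delta> f) \<in> F.lowering (w + 1)" using F.lowering_comp[OF B1 \<Delta>] by (simp add: add.commute)
  have 4: "(\<lambda>f. B (comb d i (P f)) - comb d i (P f)) \<in> F.lowering (w + 1)"
    using F.lowering_comp[OF B1 F.lowering_comp[OF di B(3)]] by (simp add: add.commute)
  have P1: "(\<lambda>f. P f - f) \<in> F.lowering 1" unfolding P_def by (rule opr_minus_id)
  have 5: "(\<lambda>f. comb d i (P f - f)) \<in> F.lowering (w + 1)" by (rule F.lowering_comp[OF di P1])
  \<comment> \<open>The error, split into the tail of the exponential of the perturbation, the error
    of the remaining factors, and three corrections for replacing \<open>B\<close> and
    \<open>P\<close> by the identity.\<close>
  have "(\<lambda>f. B (C (P f) - P f - comb d i (P f)) + B (\<delta> f) + (B (\<Delta> f) - \<Delta> f)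
      + (B (comb d i (P f)) - comb d i (P f)) + comb d i (P f - f)) \<in> F.lowering (w + 1)"
    by (intro F.lowering_add 1 2 3 4 5)
  thus ?case
  proof (rule lowering_cong)
    fix f assume f: "f \<in> A"
    note c = cl[OF f] cl(2)[OF cl(3)[OF f]] cl(7)[OF cl(3)[OF f]]
    have "C (P f) = (C (P f) - P f - comb d i (P f)) + (P' f + (\<Delta> f + (\<delta> f + comb d i (P f))))"
      by (simp add: \<delta>_def)
    hence "B (C (P f)) = B (C (P f) - P f - comb d i (P f)) + (B (P' f) + (B (\<Delta> f) + (B (\<delta> f) + B (comb d i (P f)))))"
      using c by (metis lin add_closed diff_closed)
    moreover have "comb d i (P f - f) = comb d i (P f) - comb d i f" by (rule lowering_additive[OF di c(3) f])
    moreover have "opr (i # is) (\<lambda>f. t f + d f) f = B (C (P f))"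
      using split[OF c(3)] by (simp add: P_def)
    moreover have "opr (i # is) t f = B (P' f)" by (simp add: B_def P'_def)
    moreover have "(\<Sum>j\<in>set (i # is). comb d j f) = comb d i f + \<Delta> f"
      using Cons.prems(2) by (simp add: \<Delta>_def)
    ultimately show "opr (i # is) (\<lambda>f. t f + d f) f - opr (i # is) t f - (\<Sum>j\<in>set (i # is). comb d j f)
      = B (C (P f) - P f - comb d i (P f)) + B (\<delta> f) + (B (\<Delta> f) - \<Delta> f)
      + (B (comb d i (P f)) - comb d i (P f)) + comb d i (P f - f)" by simp
  qed
qed

text \<open>Heights increase along edges, so sorting by height leaves no edge from a later to an
  earlier ray.\<close>

definition ray_order :: "nat list" where
  "ray_order = sort_key height [1..<Suc k]"

lemma ray_order: "distinct ray_order" "set ray_order = {1..k}" "sorted_wrt (\<lambda>i j. \<not> edge j i) ray_order"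
proof -
  show "distinct ray_order" "set ray_order = {1..k}" by (auto simp: ray_order_def)
  have "sorted_wrt (\<lambda>i j. height i \<le> height j) ray_order"
    using sorted_sort_key[of height "[1..<Suc k]"] by (simp add: ray_order_def sorted_map)
  thus "sorted_wrt (\<lambda>i j. \<not> edge j i) ray_order"
    by (rule sorted_wrt_mono_rel[rotated]) (meson height_less leD)
qed

definition act :: "((nat \<Rightarrow> int) \<Rightarrow> 'k) \<Rightarrow> 'k endo" where
  "act t = opr ray_order t"

definition coord :: "((nat \<Rightarrow> int) \<Rightarrow> 'k) \<Rightarrow> (nat \<Rightarrow> int) \<Rightarrow> 'k" where
  "coord t f = Poly_Mapping.lookup (act t \<chi>0) (m0 + f)"

lemma root_unique: "(i, f) \<in> R \<Longrightarrow> (j, f) \<in> R \<Longrightarrow> i = j"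
  using R_D(1,2) S_disjoint by metis

text \<open>
  The coefficient of \<open>\<chi>\<^bsup>m\<^sub>0 + f\<^esup>\<close> in \<open>g \<chi>\<^bsup>m\<^sub>0\<^esup>\<close> determines \<open>t f\<close> in terms of the parameters of smaller weight.
\<close>

lemma coord_triangular:
  assumes f: "(i, f) \<in> R"
  shows "coord t f = of_int (pairing n (\<rho> i) m0) * t f + coord (\<lambda>g. if \<phi> f < \<phi> g then t g else 0) f"
proof -
  define w where "w = nat (- \<phi> f)"
  have w: "1 \<le> w" "\<phi> f = - int w" using \<phi>_R[OF f] by (auto simp: w_def)
  \<comment> \<open>\<open>t'\<close> keeps the parameters of the roots with larger value of
    \<open>\<phi>\<close> than \<open>f\<close>. What remains lowers the filtration by at least
    \<open>w\<close>, so \<open>opr_perturb\<close> applies with first-order term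
    \<open>comb d\<close>.\<close>
  define t' where "t' = (\<lambda>g. if \<phi> f < \<phi> g then t g else 0)"
  define d where "d = (\<lambda>g. if \<phi> f < \<phi> g then 0 else t g)"
  have tt: "t = (\<lambda>g. t' g + d g)" by (auto simp: t'_def d_def)
  have d: "comb d j \<in> F.lowering w" for j
    unfolding comb_def
  proof (intro endo.subspace_sum[OF lowering_subspace])
    fix g assume "g \<in> {g. (j, g) \<in> R}"
    hence g: "(j, g) \<in> R" by simp
    show "endo_scale (d g) (der j g) \<in> F.lowering w"
    proof (cases "\<phi> f < \<phi> g")
      case True thus ?thesis using endo.subspace_0[OF lowering_subspace] by (simp add: d_def)
    next
      case False
      with w(2) have "\<phi> g \<le> - int w" by simp
      thus ?thesis by (intro endo.subspace_scale[OF lowering_subspace] der_lowering R_D(1,2)[OF g])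
    qed
  qed
  define E where "E = (\<lambda>h. act t h - act t' h - (\<Sum>j\<in>{1..k}. comb d j h))"
  have "E \<in> F.lowering (w + 1)"
    using opr_perturb[OF w(1) d ray_order(1), of t'] unfolding E_def act_def tt[symmetric] ray_order(2) .
  have mf: "m0 + f \<in> M" using M_root_add[OF R_D(2,1)[OF f] m0_M] m0_pos[OF R_D(1)[OF f]] by simp
  \<comment> \<open>The inequality in \<open>Fil\<close> is strict, so \<open>E \<chi>0\<close>
    involves only characters of weight below that of \<open>m0 + f\<close> and has coefficient zero
    there.\<close>
  have "\<chi>0 \<in> Fil (nat (\<phi> m0) + 1)" using \<chi>0_A \<phi>_nonneg[OF m0_M] by (auto simp: Fil_def)
  hence "E \<chi>0 \<in> Fil (nat (\<phi> (m0 + f)))"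
    by (rule F.lowering_V[OF \<open>E \<in> F.lowering (w + 1)\<close>]) (use \<phi>_nonneg[OF mf] \<phi>_nonneg[OF m0_M] w in \<open>simp add: \<phi>_add\<close>)
  hence "m0 + f \<notin> Poly_Mapping.keys (E \<chi>0)" using \<phi>_nonneg[OF mf] by (auto simp: Fil_def)
  hence "Poly_Mapping.lookup (E \<chi>0) (m0 + f) = 0" by (simp add: in_keys_iff)
  hence "coord t f - coord t' f = (\<Sum>j\<in>{1..k}. Poly_Mapping.lookup (comb d j \<chi>0) (m0 + f))"
    by (simp add: E_def coord_def lookup_minus lookup_sum)
  also have "\<dots> = (\<Sum>j\<in>{1..k}. if j = i then t f * of_int (pairing n (\<rho> i) m0) else 0)"
  proof (intro sum.cong refl)
    fix j
    have "Poly_Mapping.lookup (comb d j \<chi>0) (m0 + f)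
        = (\<Sum>g | (j, g) \<in> R. if g = f then d f * of_int (pairing n (\<rho> j) m0) else 0)"
      unfolding comb_apply lookup_sum lookup_const_mult der_lookup_\<chi>0 by (intro sum.cong) auto
    also have "\<dots> = (if (j, f) \<in> R then d f * of_int (pairing n (\<rho> j) m0) else 0)"
      using finite_roots by (simp add: sum.delta)
    also have "\<dots> = (if j = i then t f * of_int (pairing n (\<rho> i) m0) else 0)"
    proof (cases "j = i")
      case True thus ?thesis using f by (simp add: d_def)
    next
      case False
      hence "(j, f) \<notin> R" using root_unique[OF f] by blast
      with False show ?thesis by simp
    qed
    finally show "Poly_Mapping.lookup (comb d j \<chi>0) (m0 + f) = (if j = i then t f * of_int (pairing n (\<rho> i) m0) else 0)" .
  qed
  also have "\<dots> = t f * of_int (pairing n (\<rho> i) m0)" using R_D(1)[OF f] by simp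
  finally show ?thesis by (simp add: t'_def algebra_simps)
qed

text \<open>The triangular system is solved by induction on \<open>- \<phi> f\<close>. The
  correction term involves only parameters already known to lie in the algebra, and the diagonal
  entry is nonzero because \<open>m0\<close> pairs positively with the ray generator.\<close>

lemma coord_determines:
  assumes \<R>: "function_algebra \<R>" and u: "\<And>i f. (i, f) \<in> R \<Longrightarrow> (\<lambda>p. coord (t p) f) \<in> \<R>"
  shows "(i, f) \<in> R \<Longrightarrow> (\<lambda>p. t p f) \<in> \<R>"
proof (induction "nat (- \<phi> f)" arbitrary: i f rule: less_induct)
  case less
  define t' where "t' = (\<lambda>p g. if \<phi> f < \<phi> g then t p g else 0)"
  have t': "(\<lambda>p. t' p g) \<in> \<R>" if g: "(j, g) \<in> R" for j g
  proof (cases "\<phi> f < \<phi> g")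
    case True
    hence "nat (- \<phi> g) < nat (- \<phi> f)" using \<phi>_R[OF g] by simp
    with less.hyps g True show ?thesis by (simp add: t'_def)
  next
    case False thus ?thesis using function_algebraD(1)[OF \<R>] by (simp add: t'_def)
  qed
  have "(\<lambda>p. coord (t' p) f) \<in> \<R>"
    unfolding coord_def act_def by (rule family_lookup[OF \<R> family_opr[OF \<R> t' \<chi>0_A]])
  define c where "c = (of_int (pairing n (\<rho> i) m0) :: 'k)"
  have c: "c \<noteq> 0" using m0_pos[OF R_D(1)[OF less.prems]] by (simp add: c_def)
  have "t p f = inverse c * (coord (t p) f + (- 1) * coord (t' p) f)" for p
    using coord_triangular[OF less.prems, of "t p"] c by (simp add: t'_def c_def field_simps)
  moreover have "(\<lambda>p. inverse c * (coord (t p) f + (- 1) * coord (t' p) f)) \<in> \<R>"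
    using u[OF less.prems] \<open>(\<lambda>p. coord (t' p) f) \<in> \<R>\<close>
    by (intro function_algebraD[OF \<R>])
  ultimately show ?case by simp
qed

lemma coord_inj:
  assumes "\<And>i f. (i, f) \<in> R \<Longrightarrow> coord t f = coord t' f" "(i, f) \<in> R"
  shows "t f = t' f"
proof -
  \<comment> \<open>The two parameter functions form one family over \<open>bool\<close>; relative
    to the algebra of constants, equal coordinates force a constant parameter.\<close>
  have "(\<lambda>p. (if p then t else t') f) \<in> range (\<lambda>c (p::bool). c)"
  proof (rule coord_determines[OF _ _ assms(2)])
    show "function_algebra (range (\<lambda>c (p::bool). c :: 'k))" by (auto simp: function_algebra_def)
    fix j g assume "(j, g) \<in> R"
    with assms(1) have "(\<lambda>p. coord (if p then t else t') g) = (\<lambda>p. coord t g)" by auto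
    thus "(\<lambda>p. coord (if p then t else t') g) \<in> range (\<lambda>c (p::bool). c)" by (auto simp: image_iff)
  qed
  then obtain c where "\<And>p. (if p then t else t') f = c" by (auto simp: fun_eq_iff)
  from this[of True] this[of False] show ?thesis by simp
qed

end

context acyclic_group begin

text \<open>Parameters for the first block and for the remaining ones can be merged into one
  function, since no root belongs to two rays.\<close>

lemma product_set_opr:
  assumes "distinct is"
  shows "product_set is = range (\<lambda>t. restrict (opr is t) A)"
  using assms
proof (induction "is")
  case Nil
  have "(\<lambda>t. restrict (opr [] t) A) = (\<lambda>_. \<one>\<^bsub>aut_group A\<^esub>)" by (auto simp: aut_group_one fun_eq_iff)
  thus ?case by (simp only: product_set.simps image_constant_conv UNIV_not_empty if_False)
next
  case (Cons i "is")
  have mult: "Exp (comb u i) \<otimes>\<^bsub>aut_group A\<^esub> restrict (opr is t) A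
      = restrict (opr (i # is) (\<lambda>f. if (i, f) \<in> R then u f else t f)) A"
    if "restrict (opr is t) A \<in> product_set is" for u t
  proof -
    let ?t = "\<lambda>f. if (i, f) \<in> R then u f else t f"
    have 1: "opr is ?t h = opr is t h" for h
      using Cons.prems by (intro opr_cong) (auto dest: root_unique)
    have 2: "comb ?t i = comb u i" unfolding comb_def by (intro sum.cong) auto
    have "restrict (opr is t) A \<in> algebra_autos A"
      using that product_set_G G_carrier by (auto simp: aut_group_carrier)
    from aut_group_mult[OF Exp_L_auto[OF comb_L] this]
    show ?thesis by (auto simp: compose_def restrict_def Exp_def 1 2 opr_closed)
  qed
  have IH: "product_set is = range (\<lambda>t. restrict (opr is t) A)"
    by (rule Cons.IH) (use Cons.prems in auto)
  show ?case
  proof (intro equalityI subsetI)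
    fix x assume "x \<in> product_set (i # is)"
    then obtain E y where x: "x = Exp E \<otimes>\<^bsub>aut_group A\<^esub> y" "E \<in> block i" "y \<in> product_set is" by auto
    obtain u where u: "E = comb u i" using block_comb[OF x(2)] by blast
    obtain t where t: "y = restrict (opr is t) A" using x(3) IH by blast
    show "x \<in> range (\<lambda>t. restrict (opr (i # is) t) A)"
      unfolding x(1) u t mult[OF x(3)[unfolded t]] by blast
  next
    fix x assume "x \<in> range (\<lambda>t. restrict (opr (i # is) t) A)"
    then obtain t where x: "x = restrict (opr (i # is) t) A" by blast
    have y: "restrict (opr is t) A \<in> product_set is" using IH by blast
    have "x = Exp (comb t i) \<otimes>\<^bsub>aut_group A\<^esub> restrict (opr is t) A"
      unfolding x mult[OF y] by (simp only: if_cancel)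
    thus "x \<in> product_set (i # is)" using y comb_block by (simp only: product_set.simps) blast
  qed
qed

lemma G_act: "G = range (\<lambda>t. restrict (act t) A)"
  unfolding act_def product_set_opr[OF ray_order(1), symmetric]
  by (rule G_eq_product_set[OF ray_order(3)]) (unfold ray_order(2), rule R_D(1))

end

section \<open>Realisation of the group by unipotent matrices\<close>

lemma regular_function_algebra: "function_algebra (regular_functions d)"
  unfolding function_algebra_def by (auto intro: regular_functions.intros)

text \<open>Agreement is asked on \<open>H\<close> only, because the parameters of a group element
  are chosen functions without control elsewhere.\<close>

definition regular_on :: "nat \<Rightarrow> 'k::field mat set \<Rightarrow> ('k mat \<Rightarrow> 'k) set" where
  "regular_on d H = {c. \<exists>p\<in>regular_functions d. \<forall>h\<in>H. c h = p h}"

lemma regular_on_algebra: "function_algebra (regular_on d H)"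
  unfolding function_algebra_def regular_on_def
proof (intro conjI allI ballI CollectI)
  fix c :: 'a show "\<exists>p\<in>regular_functions d. \<forall>h\<in>H. c = p h" by (auto intro: regular_functions.intros)
next
  fix b c :: "'a mat \<Rightarrow> 'a"
  assume "b \<in> {c. \<exists>p\<in>regular_functions d. \<forall>h\<in>H. c h = p h}" "c \<in> {c. \<exists>p\<in>regular_functions d. \<forall>h\<in>H. c h = p h}"
  then obtain p q where pq: "p \<in> regular_functions d" "q \<in> regular_functions d" "\<forall>h\<in>H. b h = p h" "\<forall>h\<in>H. c h = q h" by blast
  show "\<exists>p\<in>regular_functions d. \<forall>h\<in>H. b h + c h = p h"
    using pq(3,4) by (intro bexI[OF _ regular_functions.add[OF pq(1,2)]]) simp
  show "\<exists>p\<in>regular_functions d. \<forall>h\<in>H. b h * c h = p h"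
    using pq(3,4) by (intro bexI[OF _ regular_functions.mult[OF pq(1,2)]]) simp
qed

lemma regular_onI: "p \<in> regular_functions d \<Longrightarrow> (\<And>h. h \<in> H \<Longrightarrow> c h = p h) \<Longrightarrow> c \<in> regular_on d H"
  by (auto simp: regular_on_def)

lemma GL_group: "group (GL d :: 'k::field mat monoid)"
  unfolding GL_def by (rule monoid.units_group) (rule ring.is_monoid[OF ring_mat])

lemma GL_carrier: "h \<in> carrier (GL d) \<Longrightarrow> h \<in> carrier_mat d d"
  by (auto simp: GL_def units_of_def Units_def ring_mat_def)

lemma GL_mult: "g \<otimes>\<^bsub>GL d\<^esub> h = g * h" by (simp add: GL_def units_of_def ring_mat_def)

lemma GL_one: "\<one>\<^bsub>GL d\<^esub> = 1\<^sub>m d" by (simp add: GL_def units_of_def ring_mat_def)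

lemma GL_I: "g \<in> carrier_mat d d \<Longrightarrow> h \<in> carrier_mat d d \<Longrightarrow> g * h = 1\<^sub>m d \<Longrightarrow> h * g = 1\<^sub>m d \<Longrightarrow> g \<in> carrier (GL d)"
  by (auto simp: GL_def units_of_def Units_def ring_mat_def)

context acyclic_roots begin

section \<open>A finite-dimensional \<open>G\<close>-stable space containing
  \<open>\<chi>0\<close>\<close>

fun level :: "nat \<Rightarrow> (nat \<Rightarrow> int) set" where
  "level 0 = {m0}"
| "level (Suc c) = (\<lambda>(m, f). m + f) ` (level c \<times> snd ` R)"

text \<open>\<open>\<phi>\<close> drops with each added root and is nonnegative on \<open>M\<close>,
  so no character in \<open>M\<close> needs more than \<open>\<phi> m0\<close> steps; the cut-off
  there keeps the set finite without spoiling stability.\<close>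

definition \<Omega> :: "(nat \<Rightarrow> int) set" where
  "\<Omega> = (\<Union>c\<le>nat (\<phi> m0). level c) \<inter> M"

lemma level_\<phi>: "m \<in> level c \<Longrightarrow> \<phi> m \<le> \<phi> m0 - int c"
proof (induction c arbitrary: m)
  case (Suc c)
  then obtain m' i f where m: "m = m' + f" "m' \<in> level c" "(i, f) \<in> R" by auto
  have "\<phi> m = \<phi> m' + \<phi> f" unfolding m(1) by (rule \<phi>_add)
  with Suc.IH[OF m(2)] \<phi>_R[OF m(3)] show ?case by simp
qed simp

lemma finite_\<Omega>: "finite \<Omega>"
proof -
  have "finite (level c)" for c by (induction c) (auto simp: finite_R)
  thus ?thesis by (simp add: \<Omega>_def)
qed

lemma m0_\<Omega>: "m0 \<in> \<Omega>" using m0_M by (auto simp: \<Omega>_def intro: bexI[of _ 0])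

lemma \<Omega>_M: "m \<in> \<Omega> \<Longrightarrow> m \<in> M" by (simp add: \<Omega>_def)

lemma \<Omega>_closed:
  assumes "m \<in> \<Omega>" "(i, f) \<in> R" "m + f \<in> M"
  shows "m + f \<in> \<Omega>"
proof -
  from assms(1) obtain c where c: "m \<in> level c" by (auto simp: \<Omega>_def)
  hence l: "m + f \<in> level (Suc c)" using assms(2) by force
  have "int (Suc c) \<le> \<phi> m0" using level_\<phi>[OF l] \<phi>_nonneg[OF assms(3)] by linarith
  hence "Suc c \<le> nat (\<phi> m0)" by linarith
  thus ?thesis using l assms(3) by (auto simp: \<Omega>_def simp del: level.simps)
qed

lemma \<Omega>_\<phi>: "m \<in> \<Omega> \<Longrightarrow> \<phi> m \<le> \<phi> m0"
  using level_\<phi> by (force simp: \<Omega>_def)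

definition W :: "'k laurent set" where "W = {f. Poly_Mapping.keys f \<subseteq> \<Omega>}"

lemma W_A: "f \<in> W \<Longrightarrow> f \<in> A" using \<Omega>_M by (auto simp: W_def A_iff)

lemma W_subspace: "laurent.subspace W"
proof (rule laurent.subspaceI)
  fix f g assume "f \<in> W" "g \<in> W"
  thus "f + g \<in> W" using Poly_Mapping.keys_add[of f g] by (auto simp: W_def)
next
  fix c f assume "f \<in> W" thus "const c * f \<in> W" by (auto simp: W_def in_keys_iff lookup_const_mult)
qed (simp add: W_def)

lemma der_W: assumes "(i, f) \<in> R" "h \<in> W" shows "der i f h \<in> W"
  unfolding W_def
proof (intro CollectI subsetI)
  fix x assume x: "x \<in> Poly_Mapping.keys (der i f h)"
  hence "x - f \<in> \<Omega>" using assms(2) by (auto simp: in_keys_iff lookup_root_derivation[OF W_A[OF assms(2)]] W_def)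
  moreover have "x \<in> M" using x der_closed[OF R_D(2,1)[OF assms(1)] W_A[OF assms(2)]] by (auto simp: A_iff)
  ultimately show "x \<in> \<Omega>" using \<Omega>_closed[of "x - f" i f] assms(1) by simp
qed

lemma comb_W: "h \<in> W \<Longrightarrow> comb t i h \<in> W"
  unfolding comb_apply
  by (intro laurent.subspace_sum[OF W_subspace] laurent.subspace_scale[OF W_subspace] der_W) auto

lemma op_exp_W: assumes h: "h \<in> W" shows "laurent.op_exp (comb t i) h \<in> W"
proof -
  have pow: "(comb t i ^^ m) h \<in> W" for m by (induction m) (auto intro: h comb_W)
  have "h \<in> F.carr" using W_A[OF h] by (simp add: carr_eq)
  then obtain c where "h \<in> Fil c" by (rule F.carrE)
  from F.op_exp_sum[OF comb_lowering this le_refl]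
  show ?thesis unfolding laurent.divided_power_def
    by (auto intro!: laurent.subspace_sum[OF W_subspace] laurent.subspace_scale[OF W_subspace] pow)
qed

lemma act_W: "h \<in> W \<Longrightarrow> act t h \<in> W"
proof -
  have "h \<in> W \<Longrightarrow> opr is t h \<in> W" for "is" by (induction "is") (auto intro: op_exp_W)
  thus "h \<in> W \<Longrightarrow> act t h \<in> W" by (simp add: act_def)
qed

lemma act_lowering_0: "act t \<in> F.lowering 0" unfolding act_def by (rule opr_lowering_0)

lemma act_cong: "(\<And>i f. (i, f) \<in> R \<Longrightarrow> t f = t' f) \<Longrightarrow> act t h = act t' h"
  unfolding act_def by (rule opr_cong)

end

locale unipotent_realisation = acyclic_group n k \<rho> A m0 s a e L G
  for n k :: nat and \<rho> :: "nat \<Rightarrow> nat \<Rightarrow> int" and A :: "'k::field_char_0 laurent set" and m0 s a e L G +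
  fixes d :: nat and \<omega> :: "nat \<Rightarrow> nat \<Rightarrow> int"
  assumes \<omega>_bij: "bij_betw \<omega> {0..<d} \<Omega>"
begin

definition basis_vec :: "nat \<Rightarrow> 'k laurent" where "basis_vec j = Poly_Mapping.single (\<omega> j) 1"

definition matr :: "'k endo \<Rightarrow> 'k mat" where
  "matr T = mat d d (\<lambda>(i, j). Poly_Mapping.lookup (T (basis_vec j)) (\<omega> i))"

definition W_endo :: "'k endo \<Rightarrow> bool" where
  "W_endo T \<longleftrightarrow> (\<forall>f\<in>W. T f \<in> W) \<and> (\<forall>f\<in>W. \<forall>g\<in>W. T (f + g) = T f + T g) \<and> (\<forall>c. \<forall>f\<in>W. T (const c * f) = const c * T f)"

lemma matr_carrier[simp]: "matr T \<in> carrier_mat d d" by (simp add: matr_def)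

lemma \<omega>_\<Omega>: "i < d \<Longrightarrow> \<omega> i \<in> \<Omega>" using \<omega>_bij by (auto simp: bij_betw_def)

lemma \<omega>_inj: "i < d \<Longrightarrow> j < d \<Longrightarrow> \<omega> i = \<omega> j \<longleftrightarrow> i = j"
  using \<omega>_bij by (auto simp: bij_betw_def inj_on_def)

lemma basis_vec_W: "j < d \<Longrightarrow> basis_vec j \<in> W" using \<omega>_\<Omega> by (auto simp: W_def basis_vec_def)

lemma W_expand: assumes "f \<in> W" shows "f = (\<Sum>i<d. const (Poly_Mapping.lookup f (\<omega> i)) * basis_vec i)"
proof (rule poly_mapping_eqI)
  fix x
  have "Poly_Mapping.lookup (\<Sum>i<d. const (Poly_Mapping.lookup f (\<omega> i)) * basis_vec i) x
    = (\<Sum>i\<in>{0..<d}. (\<lambda>m. if m = x then Poly_Mapping.lookup f x else 0) (\<omega> i))"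
    by (auto simp: lookup_sum lookup_const_mult basis_vec_def lookup_single when_def atLeast0LessThan intro!: sum.cong)
  also have "\<dots> = (\<Sum>m\<in>\<Omega>. if m = x then Poly_Mapping.lookup f x else 0)"
    by (rule sum.reindex_bij_betw[OF \<omega>_bij])
  also have "\<dots> = Poly_Mapping.lookup f x"
    using finite_\<Omega> assms by (auto simp: sum.delta W_def in_keys_iff)
  finally show "Poly_Mapping.lookup f x = Poly_Mapping.lookup (\<Sum>i<d. const (Poly_Mapping.lookup f (\<omega> i)) * basis_vec i) x" ..
qed

lemma W_endo_sum:
  assumes "W_endo T" "\<And>i. i \<in> I \<Longrightarrow> x i \<in> W"
  shows "T (\<Sum>i\<in>I. const (c i) * x i) = (\<Sum>i\<in>I. const (c i) * T (x i))"
proof -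
  have T0: "T 0 = 0"
  proof -
    have "T (const 0 * 0) = const 0 * T 0" using assms(1) laurent.subspace_0[OF W_subspace] unfolding W_endo_def by blast
    thus ?thesis by (simp add: const_def)
  qed
  show ?thesis using assms(2)
  proof (induction I rule: infinite_finite_induct)
    case (insert i I)
    have "(\<Sum>i\<in>I. const (c i) * x i) \<in> W" "const (c i) * x i \<in> W"
      using insert.prems by (auto intro!: laurent.subspace_sum[OF W_subspace] laurent.subspace_scale[OF W_subspace])
    thus ?case using insert assms(1) by (simp add: W_endo_def)
  qed (simp_all add: T0)
qed

lemma matr_mult:
  assumes T: "W_endo T" and U: "W_endo U"
  shows "matr (\<lambda>f. T (U f)) = matr T * matr U"
proof (rule eq_matI)
  fix i j assume "i < dim_row (matr T * matr U)" "j < dim_col (matr T * matr U)"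
  hence ij: "i < d" "j < d" by (simp_all add: matr_def)
  have "U (basis_vec j) \<in> W" using U basis_vec_W[OF ij(2)] by (simp add: W_endo_def)
  hence "T (U (basis_vec j)) = T (\<Sum>l<d. const (Poly_Mapping.lookup (U (basis_vec j)) (\<omega> l)) * basis_vec l)"
    using W_expand by simp
  also have "\<dots> = (\<Sum>l<d. const (Poly_Mapping.lookup (U (basis_vec j)) (\<omega> l)) * T (basis_vec l))"
    by (rule W_endo_sum[OF T]) (simp add: basis_vec_W)
  finally have "Poly_Mapping.lookup (T (U (basis_vec j))) (\<omega> i)
      = (\<Sum>l<d. Poly_Mapping.lookup (T (basis_vec l)) (\<omega> i) * Poly_Mapping.lookup (U (basis_vec j)) (\<omega> l))"
    by (simp only: lookup_sum lookup_const_mult mult.commute[of _ "Poly_Mapping.lookup (U (basis_vec j)) _"])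
  thus "matr (\<lambda>f. T (U f)) $$ (i, j) = (matr T * matr U) $$ (i, j)"
    using ij by (simp add: matr_def scalar_prod_def atLeast0LessThan)
qed (simp_all add: matr_def)

lemma matr_cong: "(\<And>f. f \<in> W \<Longrightarrow> T f = T' f) \<Longrightarrow> matr T = matr T'"
  unfolding matr_def by (intro cong_mat) (auto simp: basis_vec_W)

lemma matr_id: "matr (\<lambda>f. f) = 1\<^sub>m d"
  by (rule eq_matI) (auto simp: matr_def basis_vec_def lookup_single when_def \<omega>_inj)

lemma lowering_W_endo: "T \<in> F.lowering w \<Longrightarrow> (\<And>f. f \<in> W \<Longrightarrow> T f \<in> W) \<Longrightarrow> W_endo T"
  using F.endo_onD[OF F.lowering_endo, of T w] by (auto simp: W_endo_def carr_eq W_A)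

lemma act_W_endo: "W_endo (act t)"
  by (rule lowering_W_endo[OF act_lowering_0 act_W])

lemma matr_restrict: "matr (restrict T A) = matr T"
  by (rule matr_cong) (simp add: W_A)

lemma G_W_endo: "g \<in> G \<Longrightarrow> W_endo g"
  using act_W_endo unfolding G_act W_endo_def
  by (auto simp: W_A laurent.subspace_add[OF W_subspace] laurent.subspace_scale[OF W_subspace])

lemma matr_G_mult: assumes "g \<in> G" "g' \<in> G" shows "matr (g \<otimes>\<^bsub>aut_group A\<^esub> g') = matr g * matr g'"
proof -
  have "g \<otimes>\<^bsub>aut_group A\<^esub> g' = compose A g g'"
    using assms G_carrier by (intro aut_group_mult) (auto simp: aut_group_carrier)
  moreover have "matr (compose A g g') = matr (\<lambda>f. g (g' f))" by (rule matr_cong) (simp add: compose_def W_A)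
  ultimately show ?thesis by (simp add: matr_mult[OF G_W_endo G_W_endo] assms)
qed

lemma matr_G_one: "matr \<one>\<^bsub>aut_group A\<^esub> = 1\<^sub>m d"
  unfolding aut_group_one matr_restrict by (rule matr_id)

definition idx :: "(nat \<Rightarrow> int) \<Rightarrow> nat" where "idx m = inv_into {0..<d} \<omega> m"

lemma idx: "m \<in> \<Omega> \<Longrightarrow> idx m < d" "m \<in> \<Omega> \<Longrightarrow> \<omega> (idx m) = m"
  using \<omega>_bij inv_into_into[of m \<omega> "{0..<d}"] f_inv_into_f[of m \<omega> "{0..<d}"]
  by (auto simp: idx_def bij_betw_def)

lemma coord_matr: assumes "(i, f) \<in> R" shows "coord t f = matr (act t) $$ (idx (m0 + f), idx m0)"
proof -
  have "m0 + f \<in> M" using M_root_add[OF R_D(2,1)[OF assms] m0_M] m0_pos[OF R_D(1)[OF assms]] by simp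
  hence "m0 + f \<in> \<Omega>" by (rule \<Omega>_closed[OF m0_\<Omega> assms])
  thus ?thesis using idx m0_\<Omega> by (simp add: matr_def coord_def basis_vec_def)
qed

text \<open>The column of \<open>\<chi>0\<close> contains all coordinates, these determine the
  parameters at the roots in \<open>L\<close>, and those parameters determine the group
  element.\<close>

lemma matr_inj: "inj_on matr G"
proof (rule inj_onI)
  fix g g' assume "g \<in> G" "g' \<in> G" and eq: "matr g = matr g'"
  then obtain t t' where t: "g = restrict (act t) A" "g' = restrict (act t') A" unfolding G_act by blast
  have eq': "matr (act t) = matr (act t')" using eq unfolding t matr_restrict .
  have "t f = t' f" if "(i, f) \<in> R" for i f
    by (rule coord_inj[OF _ that]) (simp only: coord_matr eq')
  hence "act t h = act t' h" for h by (rule act_cong)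
  thus "g = g'" unfolding t by auto
qed

definition H :: "'k mat set" where "H = matr ` G"

text \<open>For \<open>h\<close> in \<open>H\<close> the choice affects only values outside the
  roots in \<open>L\<close>: at those roots the matrix determines the parameter.\<close>

definition param :: "'k mat \<Rightarrow> (nat \<Rightarrow> int) \<Rightarrow> 'k" where
  "param h = (SOME t. matr (act t) = h)"

definition realise :: "'k mat \<Rightarrow> 'k endo" where "realise h = inv_into G matr h"

lemma param: assumes "h \<in> H" shows "matr (act (param h)) = h" "realise h = restrict (act (param h)) A"
proof -
  from assms obtain g where g: "g \<in> G" "h = matr g" by (auto simp: H_def)
  then obtain t where "g = restrict (act t) A" using G_act by blast
  hence "matr (act t) = h" using g(2) matr_restrict by metis
  thus 1: "matr (act (param h)) = h" unfolding param_def by (rule someI[of "\<lambda>t. matr (act t) = h"])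
  have "restrict (act (param h)) A \<in> G" using G_act by blast
  moreover have "matr (restrict (act (param h)) A) = h" by (simp only: matr_restrict 1)
  ultimately show "realise h = restrict (act (param h)) A"
    unfolding realise_def using inv_into_f_f[OF matr_inj] by metis
qed

lemma H_GL: "H \<subseteq> carrier (GL d)"
proof
  interpret \<G>: group "aut_group A" by (rule aut_group_group)
  fix h assume "h \<in> H"
  then obtain g where g: "g \<in> G" "h = matr g" by (auto simp: H_def)
  have i: "inv\<^bsub>aut_group A\<^esub> g \<in> G" by (rule subgroup.m_inv_closed[OF G_subgroup g(1)])
  show "h \<in> carrier (GL d)" unfolding g(2)
    by (rule GL_I[of _ _ "matr (inv\<^bsub>aut_group A\<^esub> g)"])
      (use g i G_carrier in \<open>auto simp: matr_G_mult[symmetric] matr_G_one\<close>)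
qed

lemma H_subgroup: "subgroup H (GL d)"
proof (rule group.subgroupI[OF GL_group H_GL])
  interpret \<G>: group "aut_group A" by (rule aut_group_group)
  show "H \<noteq> {}" using subgroup.one_closed[OF G_subgroup] by (auto simp: H_def)
  fix h assume "h \<in> H"
  then obtain g where g: "g \<in> G" "h = matr g" by (auto simp: H_def)
  have i: "inv\<^bsub>aut_group A\<^esub> g \<in> G" by (rule subgroup.m_inv_closed[OF G_subgroup g(1)])
  have "inv\<^bsub>GL d\<^esub> h = matr (inv\<^bsub>aut_group A\<^esub> g)"
  proof (rule group.inv_equality[OF GL_group])
    show "matr (inv\<^bsub>aut_group A\<^esub> g) \<otimes>\<^bsub>GL d\<^esub> h = \<one>\<^bsub>GL d\<^esub>"
      using g i G_carrier by (simp add: GL_mult GL_one matr_G_mult[symmetric] matr_G_one)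
    show "h \<in> carrier (GL d)" "matr (inv\<^bsub>aut_group A\<^esub> g) \<in> carrier (GL d)"
      using g i H_GL by (auto simp: H_def)
  qed
  thus "inv\<^bsub>GL d\<^esub> h \<in> H" using i by (simp add: H_def)
  fix h' assume "h' \<in> H"
  then obtain g' where g': "g' \<in> G" "h' = matr g'" by (auto simp: H_def)
  have "h \<otimes>\<^bsub>GL d\<^esub> h' = matr (g \<otimes>\<^bsub>aut_group A\<^esub> g')" using g g' by (simp add: GL_mult matr_G_mult)
  thus "h \<otimes>\<^bsub>GL d\<^esub> h' \<in> H" using G_mult[OF g(1) g'(1)] by (simp add: H_def)
qed

text \<open>The coordinates are matrix entries, so the triangular system expresses the parameters by
  regular functions. \<open>\<tau>\<close> extends them from \<open>H\<close> to all matrices, as is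
  needed for equations that cut out \<open>H\<close>.\<close>

lemma param_regular:
  obtains \<tau> where "\<And>f i. (i, f) \<in> R \<Longrightarrow> (\<lambda>h. \<tau> h f) \<in> regular_functions d"
    "\<And>h f i. h \<in> H \<Longrightarrow> (i, f) \<in> R \<Longrightarrow> \<tau> h f = param h f"
proof -
  have "(\<lambda>h. param h f) \<in> regular_on d H" if "(i, f) \<in> R" for i f
  proof (rule coord_determines[OF regular_on_algebra _ that])
    fix j g assume jg: "(j, g) \<in> R"
    have "m0 + g \<in> M" using M_root_add[OF R_D(2,1)[OF jg] m0_M] m0_pos[OF R_D(1)[OF jg]] by simp
    hence "m0 + g \<in> \<Omega>" by (rule \<Omega>_closed[OF m0_\<Omega> jg])
    thus "(\<lambda>h. coord (param h) g) \<in> regular_on d H"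
      by (intro regular_onI[OF regular_functions.coordinate[of "idx (m0 + g)" d "idx m0"]])
        (simp_all add: idx m0_\<Omega> coord_matr[OF jg] param)
  qed
  hence ex: "\<exists>p. p \<in> regular_functions d \<and> (\<forall>h\<in>H. param h f = p h)" if "(i, f) \<in> R" for i f
    unfolding regular_on_def using that by (simp only: mem_Collect_eq) blast
  define p where "p = (\<lambda>f. SOME p. p \<in> regular_functions d \<and> (\<forall>h\<in>H. param h f = p h))"
  have p: "p f \<in> regular_functions d \<and> (\<forall>h\<in>H. param h f = p f h)" if "(i, f) \<in> R" for i f
    unfolding p_def by (rule someI_ex[OF ex[OF that]])
  show thesis
  proof (rule that[of "\<lambda>h f. p f h"])
    show "(\<lambda>h. p f h) \<in> regular_functions d" if "(i, f) \<in> R" for f i using p[OF that] by simp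
    show "p f h = param h f" if "h \<in> H" "(i, f) \<in> R" for h f i using p[OF that(2)] that(1) by simp
  qed
qed

text \<open>\<open>h \<mapsto> matr (act (\<tau> h))\<close> is a regular map into \<open>H\<close>
  that fixes \<open>H\<close> pointwise, so \<open>H\<close> is the zero set of the entries of
  \<open>h - matr (act (\<tau> h))\<close>.\<close>

lemma H_algebraic: "linear_algebraic_group d H"
  unfolding linear_algebraic_group_def
proof (intro conjI H_subgroup)
  obtain \<tau> where \<tau>: "\<And>f i. (i, f) \<in> R \<Longrightarrow> (\<lambda>h. \<tau> h f) \<in> regular_functions d"
    "\<And>h f i. h \<in> H \<Longrightarrow> (i, f) \<in> R \<Longrightarrow> \<tau> h f = param h f" by (rule param_regular) blast
  define q where "q = (\<lambda>i j h. h $$ (i, j) + (- 1) * Poly_Mapping.lookup (act (\<tau> h) (basis_vec j)) (\<omega> i))"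
  have q: "q i j \<in> regular_functions d" if "i < d" "j < d" for i j
  proof -
    have "(\<lambda>h. act (\<tau> h) (basis_vec j)) \<in> family (regular_functions d) A"
      unfolding act_def by (rule family_opr[OF regular_function_algebra \<tau>(1) W_A[OF basis_vec_W[OF that(2)]]])
    hence "(\<lambda>h. Poly_Mapping.lookup (act (\<tau> h) (basis_vec j)) (\<omega> i)) \<in> regular_functions d"
      by (rule family_lookup[OF regular_function_algebra])
    thus ?thesis unfolding q_def
      by (intro regular_functions.add regular_functions.coordinate that regular_functions.mult regular_functions.scalar)
  qed
  show "\<exists>P\<subseteq>regular_functions d. H = {h \<in> carrier (GL d). \<forall>p\<in>P. p h = 0}"
  proof (intro exI[of _ "{q i j | i j. i < d \<and> j < d}"] conjI equalityI subsetI)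
    fix p assume "p \<in> {q i j | i j. i < d \<and> j < d}" thus "p \<in> regular_functions d" using q by auto
  next
    fix h assume h: "h \<in> H"
    have "act (\<tau> h) f = act (param h) f" for f by (rule act_cong) (rule \<tau>(2)[OF h])
    hence "q i j h = 0" if "i < d" "j < d" for i j
      using that param(1)[OF h] unfolding q_def by (metis (no_types, lifting) add.right_inverse index_mat(1) matr_def mult_minus1 split_conv)
    thus "h \<in> {h \<in> carrier (GL d). \<forall>p\<in>{q i j | i j. i < d \<and> j < d}. p h = 0}" using h H_GL by auto
  next
    fix h assume h: "h \<in> {h \<in> carrier (GL d). \<forall>p\<in>{q i j | i j. i < d \<and> j < d}. p h = 0}"
    hence hc: "h \<in> carrier_mat d d" and z: "\<And>i j. i < d \<Longrightarrow> j < d \<Longrightarrow> q i j h = 0" using GL_carrier by blast+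
    have "h = matr (act (\<tau> h))"
      using hc z by (intro eq_matI) (auto simp: matr_def q_def)
    also have "\<dots> = matr (restrict (act (\<tau> h)) A)" by (rule matr_restrict[symmetric])
    finally have "h = matr (restrict (act (\<tau> h)) A)" .
    moreover have "restrict (act (\<tau> h)) A \<in> G" using G_act by blast
    ultimately show "h \<in> H" unfolding H_def by blast
  qed
qed

text \<open>\<open>act t - id\<close> lowers the filtration by \<open>\<phi>\<close>, and the
  characters in \<open>W\<close> have weight at most \<open>\<phi> m0\<close>; hence its power
  \<open>\<phi> m0 + 1\<close> vanishes on \<open>W\<close>.\<close>

lemma H_unipotent: "unipotent_group d H"
  unfolding unipotent_group_def
proof (intro conjI H_algebraic ballI)
  fix h assume h: "h \<in> H"
  define t where "t = param h"
  define N where "N = (\<lambda>f. act t f - f)"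
  have N1: "N \<in> F.lowering 1" unfolding N_def act_def by (rule opr_minus_id)
  have NW: "W_endo N" by (rule lowering_W_endo[OF N1]) (auto simp: N_def intro!: laurent.subspace_diff[OF W_subspace] act_W)
  have hN: "h - 1\<^sub>m d = matr N"
  proof (rule eq_matI)
    fix i j assume "i < dim_row (matr N)" "j < dim_col (matr N)"
    hence ij: "i < d" "j < d" by (simp_all add: matr_def)
    have "h $$ (i, j) = matr (act t) $$ (i, j)" using param(1)[OF h] by (simp add: t_def)
    thus "(h - 1\<^sub>m d) $$ (i, j) = matr N $$ (i, j)"
      using ij \<omega>_inj[of i j] by (auto simp: matr_def N_def lookup_minus basis_vec_def lookup_single when_def)
  qed (simp_all add: matr_def)
  have pow: "matr N ^\<^sub>m c = matr (N ^^ c) \<and> W_endo (N ^^ c)" for c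
  proof (induction c)
    case 0
    have "W_endo (N ^^ 0)" by (simp add: W_endo_def)
    moreover have "matr (N ^^ 0) = matr (\<lambda>f. f)" by (rule matr_cong) simp
    ultimately show ?case using matr_id matr_carrier[of N] by (simp only: pow_mat.simps carrier_matD simp_thms)
  next
    case (Suc c)
    have "N ^^ Suc c = (\<lambda>f. (N ^^ c) (N f))" by (simp add: funpow_Suc_right comp_def del: funpow.simps)
    thus ?case using Suc NW matr_mult[of "N ^^ c" N] by (auto simp: W_endo_def simp del: funpow.simps)
  qed
  have "(N ^^ (nat (\<phi> m0) + 1)) (basis_vec j) = 0" if "j < d" for j
  proof (rule F.lowering_pow_vanish[OF N1 _ le_refl])
    show "basis_vec j \<in> Fil (nat (\<phi> m0) + 1)"
      using \<Omega>_\<phi>[OF \<omega>_\<Omega>[OF that]] \<phi>_nonneg[OF m0_M] W_A[OF basis_vec_W[OF that]] by (auto simp: Fil_def basis_vec_def)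
  qed
  hence "matr (N ^^ (nat (\<phi> m0) + 1)) = 0\<^sub>m d d" by (intro eq_matI) (simp_all add: matr_def del: funpow.simps)
  hence "(h - 1\<^sub>m d) ^\<^sub>m (nat (\<phi> m0) + 1) = 0\<^sub>m d d" using pow unfolding hN by metis
  thus "\<exists>c. (h - 1\<^sub>m d) ^\<^sub>m c = 0\<^sub>m d d" by blast
qed

lemma realise_iso: "realise \<in> iso (GL d \<lparr>carrier := H\<rparr>) (aut_group A \<lparr>carrier := G\<rparr>)"
  unfolding iso_def hom_def
proof (intro CollectI conjI)
  have bij: "bij_betw matr G H" using matr_inj by (simp add: bij_betw_def H_def)
  hence bij': "bij_betw realise H G" unfolding realise_def by (rule bij_betw_inv_into)
  thus "bij_betw realise (carrier (GL d\<lparr>carrier := H\<rparr>)) (carrier (aut_group A\<lparr>carrier := G\<rparr>))" by simp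
  from bij' show "realise \<in> carrier (GL d\<lparr>carrier := H\<rparr>) \<rightarrow> carrier (aut_group A\<lparr>carrier := G\<rparr>)"
    by (auto simp: bij_betw_def)
  have "realise (h * h') = realise h \<otimes>\<^bsub>aut_group A\<^esub> realise h'" if "h \<in> H" "h' \<in> H" for h h'
  proof -
    have m: "realise h \<in> G" "realise h' \<in> G" "matr (realise h) = h" "matr (realise h') = h'"
      using that bij' bij by (auto simp: realise_def bij_betw_def inv_into_into f_inv_into_f)
    have "matr (realise h \<otimes>\<^bsub>aut_group A\<^esub> realise h') = h * h'" by (simp add: matr_G_mult m)
    thus ?thesis using inv_into_f_f[OF matr_inj G_mult[OF m(1,2)]] unfolding realise_def by simp
  qed
  thus "\<forall>x\<in>carrier (GL d\<lparr>carrier := H\<rparr>). \<forall>y\<in>carrier (GL d\<lparr>carrier := H\<rparr>).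
      realise (x \<otimes>\<^bsub>GL d\<lparr>carrier := H\<rparr>\<^esub> y) = realise x \<otimes>\<^bsub>aut_group A\<lparr>carrier := G\<rparr>\<^esub> realise y"
    by (simp add: GL_mult)
qed

lemma realise_regular: "regular_action d H realise A"
  unfolding regular_action_def
proof
  fix f assume f: "f \<in> A"
  obtain \<tau> where \<tau>: "\<And>f i. (i, f) \<in> R \<Longrightarrow> (\<lambda>h. \<tau> h f) \<in> regular_functions d"
    "\<And>h f i. h \<in> H \<Longrightarrow> (i, f) \<in> R \<Longrightarrow> \<tau> h f = param h f" by (rule param_regular) blast
  have "(\<lambda>h. act (\<tau> h) f) \<in> family (regular_functions d) A"
    unfolding act_def by (rule family_opr[OF regular_function_algebra \<tau>(1) f])
  from family_expansion[OF this] obtain N :: nat and c g where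
    e: "(\<forall>l<N. c l \<in> regular_functions d \<and> g l \<in> A) \<and> (\<forall>h. act (\<tau> h) f = (\<Sum>l<N. const (c l h) * g l))"
    by (elim exE)
  have r: "realise h f = act (\<tau> h) f" if "h \<in> H" for h
    using param(2)[OF that] f act_cong[of "\<tau> h" "param h" f] \<tau>(2)[OF that] by simp
  show "\<exists>N c g. coaction_expansion d H realise A f N c g"
    unfolding coaction_expansion_def
    by (intro exI[of _ N] exI[of _ c] exI[of _ g] conjI ballI) (use e r in auto)
qed

end

context acyclic_group begin

lemma exists_unipotent_structure: "\<exists>d H \<theta>. unipotent_structure d H \<theta> A G"
proof -
  from ex_bij_betw_nat_finite[OF finite_\<Omega>] obtain \<omega> where "bij_betw \<omega> {0..<card \<Omega>} \<Omega>" by blast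
  then interpret unipotent_realisation n k \<rho> A m0 s a e L G "card \<Omega>" \<omega> by unfold_locales
  have "unipotent_structure (card \<Omega>) H realise A G"
    unfolding unipotent_structure_def using H_unipotent realise_iso realise_regular by blast
  thus ?thesis by blast
qed

end

section \<open>Unipotent structures exclude 2-cycles\<close>

context unipotent_matrices begin

text \<open>Polynomials on the group: \<open>c\<close> has degree below \<open>N\<close> in the
  sense of iterated differences under left translation.\<close>

fun vanishes :: "nat \<Rightarrow> ('a mat \<Rightarrow> 'a) \<Rightarrow> bool" where
  "vanishes 0 c \<longleftrightarrow> (\<forall>h\<in>H. c h = 0)"
| "vanishes (Suc N) c \<longleftrightarrow> (\<forall>g\<in>H. vanishes N (\<lambda>h. c (g * h) - c h))"

lemma vanishes_cong: "(\<And>h. h \<in> H \<Longrightarrow> b h = c h) \<Longrightarrow> vanishes N b \<longleftrightarrow> vanishes N c"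
proof (induction N arbitrary: b c)
  case (Suc N)
  have "vanishes N (\<lambda>h. b (g * h) - b h) \<longleftrightarrow> vanishes N (\<lambda>h. c (g * h) - c h)" if "g \<in> H" for g
    by (rule Suc.IH) (simp add: Suc.prems H_mult that)
  thus ?case by simp
qed simp

lemma vanishes_zero: "vanishes N (\<lambda>_. 0)"
  by (induction N) simp_all

lemma vanishes_add: "vanishes N b \<Longrightarrow> vanishes N c \<Longrightarrow> vanishes N (\<lambda>h. b h + c h)"
proof (induction N arbitrary: b c)
  case (Suc N)
  have "vanishes N (\<lambda>h. (b (g * h) - b h) + (c (g * h) - c h))" if "g \<in> H" for g
    using Suc that by simp
  moreover have "(\<lambda>h. (b (g * h) - b h) + (c (g * h) - c h)) = (\<lambda>h. b (g * h) + c (g * h) - (b h + c h))" for g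
    by (auto simp: algebra_simps)
  ultimately show ?case by simp
qed simp

lemma vanishes_Suc: "vanishes N c \<Longrightarrow> vanishes (Suc N) c"
proof (induction N arbitrary: c)
  case 0 thus ?case by (simp add: H_mult)
next
  case (Suc N)
  have "vanishes (Suc N) (\<lambda>h. c (g * h) - c h)" if "g \<in> H" for g
    using Suc.prems that by (intro Suc.IH) simp
  thus ?case by (simp only: vanishes.simps(2)[of "Suc N" c]) blast
qed

lemma vanishes_mono: "vanishes N c \<Longrightarrow> N \<le> N' \<Longrightarrow> vanishes N' c"
  by (induction N' rule: nat_induct) (auto simp: le_Suc_eq simp del: vanishes.simps intro: vanishes_Suc)

text \<open>Discrete product rule: if translation changes \<open>b\<close> by \<open>x\<close> and
  \<open>b'\<close> by \<open>y\<close>, then it changes the product by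
  \<open>x b' + b y + x y\<close>, and each of these terms needs one difference fewer.\<close>

lemma vanishes_mult: "vanishes a b \<Longrightarrow> vanishes a' b' \<Longrightarrow> vanishes (a + a') (\<lambda>h. b h * b' h)"
proof (induction "a + a'" arbitrary: a a' b b')
  case 0 thus ?case by simp
next
  case (Suc N)
  show ?case
  proof (cases "a = 0 \<or> a' = 0")
    case True
    hence "vanishes (a + a') (\<lambda>h. b h * b' h) \<longleftrightarrow> vanishes (a + a') (\<lambda>h. 0)"
      using Suc.prems by (intro vanishes_cong) auto
    thus ?thesis by (simp add: vanishes_zero)
  next
    case False
    then obtain x y where xy: "a = Suc x" "a' = Suc y" by (cases a; cases a') auto
    have "vanishes N (\<lambda>h. b (g * h) * b' (g * h) - b h * b' h)" if g: "g \<in> H" for g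
    proof -
      have d: "vanishes x (\<lambda>h. b (g * h) - b h)" "vanishes y (\<lambda>h. b' (g * h) - b' h)"
        using Suc.prems g by (simp_all add: xy)
      have N: "N = x + a'" "N = a + y" "N = Suc (x + y)" using Suc.hyps(2) by (simp_all add: xy)
      have "vanishes N (\<lambda>h. (b (g * h) - b h) * b' h)"
        using Suc.hyps(1)[OF N(1) d(1) Suc.prems(2)] N(1) by simp
      moreover have "vanishes N (\<lambda>h. b h * (b' (g * h) - b' h))"
        using Suc.hyps(1)[OF N(2) Suc.prems(1) d(2)] N(2) by simp
      moreover have "vanishes N (\<lambda>h. (b (g * h) - b h) * (b' (g * h) - b' h))"
        using Suc.hyps(1)[OF N(1) d(1) vanishes_Suc[OF d(2), folded xy(2)]] N(1) by simp
      ultimately have "vanishes N (\<lambda>h. ((b (g * h) - b h) * b' h + b h * (b' (g * h) - b' h))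
          + (b (g * h) - b h) * (b' (g * h) - b' h))"
        by (intro vanishes_add)
      moreover have "(\<lambda>h. ((b (g * h) - b h) * b' h + b h * (b' (g * h) - b' h))
          + (b (g * h) - b h) * (b' (g * h) - b' h)) = (\<lambda>h. b (g * h) * b' (g * h) - b h * b' h)"
        by (auto simp: algebra_simps)
      ultimately show ?thesis by simp
    qed
    hence "vanishes (Suc N) (\<lambda>h. b h * b' h)" by simp
    thus ?thesis using Suc.hyps(2) by (simp del: vanishes.simps)
  qed
qed

text \<open>A difference by \<open>g\<close> inserts the factor \<open>g - 1\<close> in front of the
  column of \<open>h\<close>. The list \<open>as\<close> records the factors inserted so far; once
  there are \<open>d\<close> of them, Kolchin's theorem applies.\<close>

lemma vanishes_entry:
  assumes ij: "i < d" "j < d" and as: "set as \<subseteq> J" "length as + N = d"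
  shows "vanishes N (\<lambda>h. foldr (*\<^sub>v) as (col h j) $ i)"
  using as
proof (induction N arbitrary: as)
  case 0
  have "foldr (*\<^sub>v) as (col h j) = 0\<^sub>v d" if "h \<in> H" for h
    using that H_carrier 0 by (intro kolchin col_carrier_vec[of _ d]) (auto simp: ij)
  thus ?case using ij by simp
next
  case (Suc N)
  have car: "foldr (*\<^sub>v) as v \<in> carrier_vec d" if "v \<in> carrier_vec d" for v
    using Suc.prems(1) that by (induction as) (auto intro!: mult_mat_vec_carrier J_carrier)
  have lin: "foldr (*\<^sub>v) as (u - v) = foldr (*\<^sub>v) as u - foldr (*\<^sub>v) as v"
    if uv: "u \<in> carrier_vec d" "v \<in> carrier_vec d" for u v
    using Suc.prems(1)
  proof (induction as)
    case (Cons b as)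
    have "foldr (*\<^sub>v) as w \<in> carrier_vec d" if "w \<in> carrier_vec d" for w
      using Cons.prems that by (induction as) (auto intro!: mult_mat_vec_carrier J_carrier)
    with Cons uv show ?case by (simp add: mult_minus_distrib_mat_vec[OF J_carrier])
  qed simp
  have "vanishes N (\<lambda>h. foldr (*\<^sub>v) as (col (g * h) j) $ i - foldr (*\<^sub>v) as (col h j) $ i)" if g: "g \<in> H" for g
  proof -
    have "foldr (*\<^sub>v) (as @ [g - 1\<^sub>m d]) (col h j) $ i
        = foldr (*\<^sub>v) as (col (g * h) j) $ i - foldr (*\<^sub>v) as (col h j) $ i" (is "?a h = ?b h") if h: "h \<in> H" for h
    proof -
      have gh: "g \<in> carrier_mat d d" "h \<in> carrier_mat d d" using g h H_carrier by auto
      have c: "col h j \<in> carrier_vec d" "col (g * h) j \<in> carrier_vec d" using gh ij by auto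
      have "(g - 1\<^sub>m d) *\<^sub>v col h j = col (g * h) j - col h j"
        using gh c ij by (simp add: minus_mult_distrib_mat_vec[of _ d d] col_mult2[of _ d d])
      thus ?thesis using lin[OF c(2,1)] car[OF c(1)] ij by simp
    qed
    hence "vanishes N ?a \<longleftrightarrow> vanishes N ?b" by (rule vanishes_cong)
    moreover have "vanishes N ?a"
      using Suc.prems g by (intro Suc.IH) (auto intro: unipotent_algebra.gen)
    ultimately show ?thesis by blast
  qed
  thus ?case by simp
qed

lemma H_det: "h \<in> H \<Longrightarrow> det h = 1"
  using H_unipotent[of h] H_carrier det_unipotent(1)[of h d] by blast

lemma regular_vanishes: "p \<in> regular_functions d \<Longrightarrow> \<exists>N. vanishes N p"
proof (induction rule: regular_functions.induct)
  case (scalar c)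
  show ?case by (intro exI[of _ 1]) simp
next
  case (coordinate i j)
  have "vanishes d (\<lambda>h. foldr (*\<^sub>v) [] (col h j) $ i)" by (rule vanishes_entry[OF coordinate]) simp_all
  moreover have "vanishes d (\<lambda>h. foldr (*\<^sub>v) [] (col h j) $ i) \<longleftrightarrow> vanishes d (\<lambda>h. h $$ (i, j))"
    by (rule vanishes_cong) (use H_carrier coordinate in auto)
  ultimately show ?case by blast
next
  case inverse_det
  have "vanishes 1 (\<lambda>h. inverse (det h)) \<longleftrightarrow> vanishes 1 (\<lambda>h. 1)" by (rule vanishes_cong) (simp add: H_det)
  moreover have "vanishes 1 (\<lambda>h. 1)" by simp
  ultimately show ?case by blast
next
  case (add p q)
  then obtain N N' where "vanishes N p" "vanishes N' q" by blast
  hence "vanishes (max N N') p" "vanishes (max N N') q" by (auto intro: vanishes_mono)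
  thus ?case using vanishes_add by blast
next
  case (mult p q)
  thus ?case using vanishes_mult by blast
qed

fun differences :: "'a mat list \<Rightarrow> ('a mat \<Rightarrow> 'a) \<Rightarrow> 'a mat \<Rightarrow> 'a" where
  "differences [] c = c"
| "differences (g # gs) c = differences gs (\<lambda>h. c (g * h) - c h)"

lemma differences_snoc: "differences (gs @ [g]) c h = differences gs c (g * h) - differences gs c h"
  by (induction gs arbitrary: c) auto

lemma vanishes_differences:
  "vanishes (length gs) c \<Longrightarrow> set gs \<subseteq> H \<Longrightarrow> h \<in> H \<Longrightarrow> differences gs c h = 0"
  by (induction gs arbitrary: c) auto

end

context toric begin

lemma weighted_ray: "i \<in> {1..k} \<Longrightarrow> weighted_toric n k \<rho> A m0 (pairing n (\<rho> i))"
  by unfold_locales (auto simp: pairing_add)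

lemma exp_der_auto: assumes "i \<in> {1..k}" "f \<in> S i" shows "exp_derivation A t (der i f) \<in> algebra_autos A"
proof -
  interpret weighted_toric n k \<rho> A m0 "pairing n (\<rho> i)" by (rule weighted_ray[OF assms(1)])
  have "der i f \<in> F.lowering 1" by (rule der_lowering[OF assms]) (simp add: S_D(2)[OF assms(2)])
  moreover have "der i f \<in> derivations A" by (rule der_derivation[OF assms(2,1)])
  ultimately show ?thesis
    unfolding exp_derivation_Exp[OF \<open>der i f \<in> derivations A\<close>]
    by (intro Exp_auto endo.subspace_scale lowering_subspace derivations_subspace)
qed

text \<open>The bound \<open>c \<ge> 1\<close> guarantees that the linear coefficient, the
  derivation itself, occurs in the sum.\<close>

lemma exp_der_sum:
  assumes "i \<in> {1..k}" "f \<in> S i" "h \<in> A"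
  shows "\<exists>c\<ge>1. \<forall>t. exp_derivation A t (der i f) h = (\<Sum>m\<le>c. const (t ^ m) * (const (inverse (fact m)) * (der i f ^^ m) h))"
proof -
  interpret weighted_toric n k \<rho> A m0 "pairing n (\<rho> i)" by (rule weighted_ray[OF assms(1)])
  have low: "der i f \<in> F.lowering 1" by (rule der_lowering[OF assms(1,2)]) (simp add: S_D(2)[OF assms(2)])
  have "h \<in> F.carr" using assms(3) by (simp only: carr_eq)
  then obtain c where c: "h \<in> Fil c" by (rule F.carrE)
  have z: "(der i f ^^ m) h = 0" if "c \<le> m" for m
    by (rule F.lowering_pow_vanish[OF low c that])
  have "exp_derivation A t (der i f) h = (\<Sum>m\<le>Suc c. const (t ^ m) * (const (inverse (fact m)) * (der i f ^^ m) h))" for t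
  proof -
    have "exp_derivation A t (der i f) h = Sum_any (\<lambda>m. const (t ^ m / fact m) * (der i f ^^ m) h)"
      using assms(3) by (simp add: exp_derivation_def)
    also have "\<dots> = (\<Sum>m\<le>Suc c. const (t ^ m / fact m) * (der i f ^^ m) h)"
      using z by (intro Sum_any.expand_superset) (auto, metis not_less_eq_eq le_SucI nat_le_linear)
    also have "\<dots> = (\<Sum>m\<le>Suc c. const (t ^ m) * (const (inverse (fact m)) * (der i f ^^ m) h))"
      by (intro sum.cong refl) (simp only: laurent.scale_scale divide_inverse)
    finally show ?thesis .
  qed
  moreover have "1 \<le> Suc c" by simp
  ultimately show ?thesis by blast
qed

end

section \<open>The filtration of the coordinate ring by the group action\<close>

locale root_group = lie_roots n k \<rho> A m0 s a e L
  for n k :: nat and \<rho> :: "nat \<Rightarrow> nat \<Rightarrow> int" and A :: "'k::field_char_0 laurent set" and m0 s a e L +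
  fixes G :: "'k endo set"
  assumes G_generated: "G = generate (aut_group A) (\<Union>l\<in>{1..s}. root_subgroup A (root_derivation n A (\<rho> (a l)) (e l)))"
begin

lemma G_autos: "G \<subseteq> algebra_autos A"
proof -
  have "(\<Union>l\<in>{1..s}. root_subgroup A (der (a l) (e l))) \<subseteq> carrier (aut_group A)"
    using exp_der_auto generators by (auto simp: root_subgroup_def aut_group_carrier)
  from group.generate_is_subgroup[OF aut_group_group this] show ?thesis
    unfolding G_generated[symmetric] using subgroup.subset aut_group_carrier by metis
qed

lemma exp_generator_G: "l \<in> {1..s} \<Longrightarrow> exp_derivation A t (der (a l) (e l)) \<in> G"
  unfolding G_generated by (rule generate.incl) (unfold root_subgroup_def, blast)

text \<open>Step one consists of the \<open>G\<close>-invariants in \<open>A\<close>, and step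
  \<open>Suc N\<close> is the preimage of the invariants modulo step \<open>N\<close>.\<close>

fun killed :: "nat \<Rightarrow> 'k laurent set" where
  "killed 0 = {0}"
| "killed (Suc N) = {f \<in> A. \<forall>g\<in>G. g f - f \<in> killed N}"

lemma G_D:
  assumes "g \<in> G"
  shows "f \<in> A \<Longrightarrow> g f \<in> A" "f \<in> A \<Longrightarrow> h \<in> A \<Longrightarrow> g (f + h) = g f + g h"
    "f \<in> A \<Longrightarrow> g (const c * f) = const c * g f" "g 0 = 0" "f \<in> A \<Longrightarrow> h \<in> A \<Longrightarrow> g (f - h) = g f - g h"
proof -
  have g: "g \<in> algebra_autos A" using assms G_autos by blast
  note gD = algebra_autosD[OF g]
  show "f \<in> A \<Longrightarrow> g f \<in> A" "f \<in> A \<Longrightarrow> h \<in> A \<Longrightarrow> g (f + h) = g f + g h"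
    "f \<in> A \<Longrightarrow> g (const c * f) = const c * g f" using gD by auto
  show "g 0 = 0" using gD(5)[of 0] by (simp add: const_def)
  show "f \<in> A \<Longrightarrow> h \<in> A \<Longrightarrow> g (f - h) = g f - g h"
    using gD(3)[of "f - h" h] by (simp add: diff_closed)
qed

lemma killed_subspace: "laurent.subspace (killed N)"
proof (induction N)
  case 0 show ?case by (simp add: laurent.subspace_def)
next
  case (Suc N)
  show ?case
  proof (rule laurent.subspaceI)
    show "0 \<in> killed (Suc N)" using laurent.subspace_0[OF Suc] by (simp add: zero_closed G_D)
    fix x y assume xy: "x \<in> killed (Suc N)" "y \<in> killed (Suc N)"
    have "g (x + y) - (x + y) = (g x - x) + (g y - y)" if "g \<in> G" for g
      using xy that by (simp add: G_D)
    moreover have "(g x - x) + (g y - y) \<in> killed N" if "g \<in> G" for g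
      using xy that by (intro laurent.subspace_add[OF Suc]) auto
    ultimately have "g (x + y) - (x + y) \<in> killed N" if "g \<in> G" for g using that by (simp only:)
    thus "x + y \<in> killed (Suc N)" using xy by (simp only: killed.simps mem_Collect_eq add_closed) blast
  next
    fix c x assume x: "x \<in> killed (Suc N)"
    have "g (const c * x) - const c * x = const c * (g x - x)" if "g \<in> G" for g
      using x that by (simp add: G_D right_diff_distrib)
    moreover have "const c * (g x - x) \<in> killed N" if "g \<in> G" for g
      using x that by (intro laurent.subspace_scale[OF Suc]) auto
    ultimately have "g (const c * x) - const c * x \<in> killed N" if "g \<in> G" for g using that by (simp only:)
    thus "const c * x \<in> killed (Suc N)" using x by (simp only: killed.simps mem_Collect_eq const_mult_closed) blast
  qed
qed

lemma killed_A: "killed N \<subseteq> A" by (cases N) (auto simp: zero_closed)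

lemma killed_Suc: "killed N \<subseteq> killed (Suc N)"
proof (induction N)
  case 0 show ?case by (auto simp: zero_closed G_D)
next
  case (Suc N)
  show ?case
  proof
    fix f assume f: "f \<in> killed (Suc N)"
    hence "g f - f \<in> killed (Suc N)" if "g \<in> G" for g using Suc.IH that by (simp only: killed.simps) blast
    with f killed_A show "f \<in> killed (Suc (Suc N))" by (simp only: killed.simps(2)[of "Suc N"]) blast
  qed
qed

lemma killed_mono: "N \<le> N' \<Longrightarrow> killed N \<subseteq> killed N'"
  by (rule lift_Suc_mono_le[of killed]) (use killed_Suc in auto)

definition shifting :: "nat \<Rightarrow> 'k endo set" where
  "shifting j = {D. \<forall>N. \<forall>f\<in>killed (N + j). D f \<in> killed N}"

lemma shiftingD: "D \<in> shifting j \<Longrightarrow> f \<in> killed N' \<Longrightarrow> N' \<le> N + j \<Longrightarrow> D f \<in> killed N"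
  using killed_mono[of N' "N + j"] by (auto simp: shifting_def)

lemma shifting_subspace: "endo.subspace (shifting j)"
  by (rule endo.subspaceI)
    (auto simp: shifting_def endo_scale_def laurent.subspace_0[OF killed_subspace]
      laurent.subspace_add[OF killed_subspace] laurent.subspace_scale[OF killed_subspace])

lemma shifting_bracket: "D \<in> shifting i \<Longrightarrow> E \<in> shifting j \<Longrightarrow> bracket D E \<in> shifting (i + j)"
  unfolding shifting_def[of "i + j"] bracket_def
proof (intro CollectI allI ballI laurent.subspace_diff[OF killed_subspace])
  fix N f assume D: "D \<in> shifting i" and E: "E \<in> shifting j" and f: "f \<in> killed (N + (i + j))"
  show "D (E f) \<in> killed N" by (rule shiftingD[OF D shiftingD[OF E f, of "N + i"]]) simp_all
  show "E (D f) \<in> killed N" by (rule shiftingD[OF E shiftingD[OF D f, of "N + j"]]) simp_all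
qed

text \<open>For \<open>f\<close> in \<open>killed (N + 1)\<close> the polynomial
  \<open>exp(t D) f - f\<close> in \<open>t\<close> takes all its values in \<open>killed N\<close>,
  so its linear coefficient \<open>D f\<close> lies there.\<close>

lemma generator_shifting: assumes l: "l \<in> {1..s}" shows "der (a l) (e l) \<in> shifting 1"
  unfolding shifting_def
proof (intro CollectI allI ballI)
  fix N f assume f: "f \<in> killed (N + 1)"
  let ?D = "der (a l) (e l)"
  have fA: "f \<in> A" using f killed_A by blast
  obtain c where c1: "1 \<le> c" and c: "\<And>t. exp_derivation A t ?D f = (\<Sum>m\<le>c. const (t ^ m) * (const (inverse (fact m)) * (?D ^^ m) f))"
    using exp_der_sum[OF _ _ fA] generators[OF l] by blast
  define Fm where "Fm = (\<lambda>m. if m = 0 then 0 else const (inverse (fact m)) * (?D ^^ m) f)"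
  have "(\<Sum>m\<le>c. const (t ^ m) * Fm m) \<in> killed N" for t
  proof -
    have "(\<Sum>m\<le>c. const (t ^ m) * Fm m) = exp_derivation A t ?D f - f"
    proof -
      have "(\<Sum>m\<le>c. const (t ^ m) * (const (inverse (fact m)) * (?D ^^ m) f))
        = f + (\<Sum>m\<in>{..c} - {0}. const (t ^ m) * (const (inverse (fact m)) * (?D ^^ m) f))"
        by (subst sum.remove[of _ 0]) (auto simp: const_def)
      moreover have "(\<Sum>m\<le>c. const (t ^ m) * Fm m) = (\<Sum>m\<in>{..c} - {0}. const (t ^ m) * Fm m)"
        by (subst sum.remove[of _ 0]) (auto simp: Fm_def)
      moreover have "(\<Sum>m\<in>{..c} - {0}. const (t ^ m) * Fm m)
        = (\<Sum>m\<in>{..c} - {0}. const (t ^ m) * (const (inverse (fact m)) * (?D ^^ m) f))"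
        by (intro sum.cong refl) (simp add: Fm_def)
      ultimately show ?thesis by (simp only: c) simp
    qed
    thus ?thesis using f exp_generator_G[OF l, of t] by simp
  qed
  from laurent.subspace_coefficients[OF killed_subspace this c1]
  show "?D f \<in> killed N" by (simp add: Fm_def const_def)
qed

text \<open>The derivations that shift by one form a Lie subalgebra, as their brackets even shift by
  two; so the generators suffice.\<close>

lemma L_shifting: "D \<in> L \<Longrightarrow> D \<in> shifting 1"
proof -
  have "lie_subalgebra A (shifting 1 \<inter> derivations A)"
    unfolding lie_subalgebra_def
  proof (intro conjI ballI)
    show "endo.subspace (shifting 1 \<inter> derivations A)"
      by (intro endo.subspace_inter shifting_subspace derivations_subspace)
    fix D E assume DE: "D \<in> shifting 1 \<inter> derivations A" "E \<in> shifting 1 \<inter> derivations A"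
    have "bracket D E \<in> shifting (1 + 1)" using DE by (intro shifting_bracket) auto
    from shiftingD[OF this] have "bracket D E f \<in> killed N" if "f \<in> killed (N + 1)" for N f
      using that by (meson add_left_mono le_add1)
    hence "bracket D E \<in> shifting 1" by (simp only: shifting_def mem_Collect_eq) blast
    thus "bracket D E \<in> shifting 1 \<inter> derivations A" using DE bracket_derivations by blast
  qed auto
  moreover have "(\<lambda>l. der (a l) (e l)) ` {1..s} \<subseteq> shifting 1 \<inter> derivations A"
    using generator_shifting generators der_derivation by blast
  ultimately have "L \<subseteq> shifting 1 \<inter> derivations A" unfolding L_eq by (rule lie_generated_least)
  thus "D \<in> L \<Longrightarrow> D \<in> shifting 1" by blast
qed

lemma lower_central_shifting: "D \<in> lower_central L t \<Longrightarrow> D \<in> shifting (Suc t)"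
proof (induction t arbitrary: D)
  case 0 thus ?case using L_shifting by simp
next
  case (Suc t)
  have "{bracket D E | D E. D \<in> L \<and> E \<in> lower_central L t} \<subseteq> shifting (Suc (Suc t))"
    using shifting_bracket[OF L_shifting Suc.IH] by auto
  hence "lower_central L (Suc t) \<subseteq> shifting (Suc (Suc t))"
    unfolding lower_central.simps by (intro endo.span_minimal shifting_subspace)
  thus ?case using Suc.prems by blast
qed

fun diff_op :: "'k endo list \<Rightarrow> 'k endo" where
  "diff_op [] f = f"
| "diff_op (g # gs) f = g (diff_op gs f) - diff_op gs f"

lemma diff_op_closed: "set gs \<subseteq> G \<Longrightarrow> f \<in> A \<Longrightarrow> diff_op gs f \<in> A"
  by (induction gs) (auto simp: G_D diff_closed)

lemma diff_op_diff: "set gs \<subseteq> G \<Longrightarrow> f \<in> A \<Longrightarrow> h \<in> A \<Longrightarrow> diff_op gs (f - h) = diff_op gs f - diff_op gs h"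
  by (induction gs) (auto simp: G_D diff_op_closed)

lemma diff_op_snoc: "diff_op (gs @ [g]) f = diff_op gs (g f - f)"
  by (induction gs) auto

lemma killed_if_diff_op_zero:
  assumes "f \<in> A" "\<And>gs. set gs \<subseteq> G \<Longrightarrow> length gs = N \<Longrightarrow> diff_op gs f = 0"
  shows "f \<in> killed N"
  using assms
proof (induction N arbitrary: f)
  case 0 thus ?case using "0.prems"(2)[of "[]"] by simp
next
  case (Suc N)
  have "g f - f \<in> killed N" if g: "g \<in> G" for g
  proof (rule Suc.IH)
    show "g f - f \<in> A" using Suc.prems(1) g by (simp add: G_D diff_closed)
    fix gs assume "set gs \<subseteq> G" "length gs = N"
    thus "diff_op gs (g f - f) = 0" using Suc.prems(2)[of "gs @ [g]"] g by (simp add: diff_op_snoc)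
  qed
  thus ?case using Suc.prems(1) by simp
qed

end

locale structured_group = root_group n k \<rho> A m0 s a e L G
  for n k :: nat and \<rho> :: "nat \<Rightarrow> nat \<Rightarrow> int" and A :: "'k::field_char_0 laurent set" and m0 s a e L G +
  fixes d :: nat and H :: "'k mat set" and \<theta> :: "'k mat \<Rightarrow> 'k endo"
  assumes structure_G: "unipotent_structure d H \<theta> A G"
begin

lemma H_linear: "linear_algebraic_group d H" and H_unip: "h \<in> H \<Longrightarrow> \<exists>i. (h - 1\<^sub>m d) ^\<^sub>m i = 0\<^sub>m d d"
  using structure_G by (auto simp: unipotent_structure_def unipotent_group_def)

lemma H_sub: "subgroup H (GL d)" using H_linear by (simp add: linear_algebraic_group_def)

lemma H_mat: "H \<subseteq> carrier_mat d d" using subgroup.subset[OF H_sub] GL_carrier by blast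

sublocale unipotent_matrices d H
  using H_mat H_unip subgroup.m_closed[OF H_sub] by unfold_locales (auto simp: GL_mult)

lemma \<theta>_iso: "\<theta> \<in> iso (GL d \<lparr>carrier := H\<rparr>) (aut_group A \<lparr>carrier := G\<rparr>)"
  using structure_G by (simp add: unipotent_structure_def)

lemma \<theta>_bij: "bij_betw \<theta> H G" using \<theta>_iso by (simp add: iso_def)

lemma \<theta>_G: "h \<in> H \<Longrightarrow> \<theta> h \<in> G" using \<theta>_bij by (auto simp: bij_betw_def)

lemma \<theta>_mult: "g \<in> H \<Longrightarrow> h \<in> H \<Longrightarrow> \<theta> (g * h) = \<theta> g \<otimes>\<^bsub>aut_group A\<^esub> \<theta> h"
  using \<theta>_iso by (auto simp: iso_def hom_def GL_mult)

lemma \<theta>_mult_apply: "g \<in> H \<Longrightarrow> h \<in> H \<Longrightarrow> f \<in> A \<Longrightarrow> \<theta> (g * h) f = \<theta> g (\<theta> h f)"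
  using \<theta>_G G_autos aut_group_mult[of "\<theta> g" "\<theta> h"] by (simp add: \<theta>_mult compose_def subset_iff)

lemma one_H: "1\<^sub>m d \<in> H" using subgroup.one_closed[OF H_sub] by (simp add: GL_one)

lemma \<theta>_one: assumes f: "f \<in> A" shows "\<theta> (1\<^sub>m d) f = f"
proof -
  have g: "\<theta> (1\<^sub>m d) \<in> algebra_autos A" using \<theta>_G[OF one_H] G_autos by blast
  have "\<theta> (1\<^sub>m d) (\<theta> (1\<^sub>m d) f) = \<theta> (1\<^sub>m d) f"
    using \<theta>_mult_apply[OF one_H one_H f] by simp
  moreover have "bij_betw (\<theta> (1\<^sub>m d)) A A" using algebra_autosD(1)[OF g] by (simp add: Bij_def)
  ultimately show ?thesis using f algebra_autosD(2)[OF g f] by (metis bij_betw_inv_into_left)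
qed

lemma coaction: "f \<in> A \<Longrightarrow> \<exists>N c g. coaction_expansion d H \<theta> A f N c g"
  using structure_G by (simp add: unipotent_structure_def regular_action_def)

text \<open>Since \<open>\<theta> b (\<theta> h f) = \<theta> (b * h) f\<close>, applying
  \<open>\<theta> b - 1\<close> amounts to taking differences of the coefficient functions by
  \<open>b\<close>. Differences in \<open>A\<close> thus become differences of regular functions on
  \<open>H\<close>.\<close>

lemma diff_op_expansion:
  assumes ex: "coaction_expansion d H \<theta> A f N c g" and f: "f \<in> A"
  shows "set hs \<subseteq> H \<Longrightarrow> h \<in> H \<Longrightarrow> diff_op (map \<theta> hs) (\<theta> h f) = (\<Sum>l<N. const (differences hs (c l) h) * g l)"
proof (induction hs arbitrary: h rule: rev_induct)
  case Nil
  thus ?case using ex by (simp add: coaction_expansion_def)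
next
  case (snoc b hs)
  have b: "b \<in> H" "b * h \<in> H" using snoc.prems H_mult by auto
  have gs: "set (map \<theta> hs) \<subseteq> G" using snoc.prems(1) \<theta>_G by auto
  have hA: "\<theta> h f \<in> A" "\<theta> (b * h) f \<in> A" using G_D(1)[OF \<theta>_G f] b snoc.prems(2) by auto
  have "diff_op (map \<theta> (hs @ [b])) (\<theta> h f) = diff_op (map \<theta> hs) (\<theta> (b * h) f) - diff_op (map \<theta> hs) (\<theta> h f)"
    using diff_op_diff[OF gs hA(2,1)] \<theta>_mult_apply[OF b(1) snoc.prems(2) f] by (simp add: diff_op_snoc)
  also have "\<dots> = (\<Sum>l<N. const (differences hs (c l) (b * h)) * g l) - (\<Sum>l<N. const (differences hs (c l) h) * g l)"
    using snoc.IH[of "b * h"] snoc.IH[of h] b snoc.prems by simp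
  also have "\<dots> = (\<Sum>l<N. const (differences (hs @ [b]) (c l) h) * g l)"
    unfolding sum_subtractf[symmetric] differences_snoc
    by (intro sum.cong refl) (rule laurent.scale_left_diff_distrib[symmetric])
  finally show ?case .
qed

text \<open>The orbit map of \<open>f\<close> involves finitely many coefficient functions, and one
  number of differences annihilates them all; the claim is the value at the identity.\<close>

lemma killed_exists: assumes f: "f \<in> A" shows "\<exists>N. f \<in> killed N"
proof -
  from coaction[OF f] obtain N c g where ex: "coaction_expansion d H \<theta> A f N c g" by blast
  hence "\<forall>l<N. \<exists>b. vanishes b (c l)" using regular_vanishes by (auto simp: coaction_expansion_def)
  then obtain b where b: "\<And>l. l < N \<Longrightarrow> vanishes (b l) (c l)" by metis
  define B where "B = (\<Sum>l<N. b l)"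
  have van: "vanishes B (c l)" if "l < N" for l
    using vanishes_mono[OF b[OF that]] member_le_sum[of l "{..<N}" b] that by (simp add: B_def)
  have "f \<in> killed B"
  proof (rule killed_if_diff_op_zero[OF f])
    fix gs assume gs: "set gs \<subseteq> G" "length gs = B"
    define hs where "hs = map (inv_into H \<theta>) gs"
    have hs: "set hs \<subseteq> H" "map \<theta> hs = gs" "length hs = B"
      using gs \<theta>_bij by (auto simp: hs_def bij_betw_def inv_into_into f_inv_into_f intro!: map_idI)
    have "diff_op gs f = (\<Sum>l<N. const (differences hs (c l) (1\<^sub>m d)) * g l)"
      using diff_op_expansion[OF ex f hs(1) one_H] hs(2) \<theta>_one[OF f] by simp
    also have "\<dots> = 0"
      using vanishes_differences[of hs] van hs one_H by (intro sum.neutral) (auto simp: const_def)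
    finally show "diff_op gs f = 0" .
  qed
  thus ?thesis by blast
qed

theorem no_two_cycle_if_unipotent: "\<not> has_two_cycle n k \<rho> A L"
proof
  assume cyc: "has_two_cycle n k \<rho> A L"
  obtain N where N: "\<chi>0 \<in> killed N" using killed_exists[OF \<chi>0_A] by blast
  from two_cycle_lower_central[OF L_subalgebra cyc, of N] obtain i f where
    i: "i \<in> {1..k}" "der i f \<in> lower_central L N" by blast
  have "der i f \<chi>0 \<in> killed 0" by (rule shiftingD[OF lower_central_shifting[OF i(2)] N]) simp
  with der_\<chi>0_nonzero[OF i(1), of f] show False by simp
qed

end

section \<open>The Lie algebra of the group\<close>

lemma poly_eq_if_nat_values_eq:
  fixes p q :: "'k::field_char_0 poly"
  assumes "\<And>N. poly p (of_nat N) = poly q (of_nat N)"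
  shows "p = q"
proof -
  have "range (of_nat :: nat \<Rightarrow> 'k) \<subseteq> {x. poly (p - q) x = 0}" using assms by auto
  moreover have "infinite (range (of_nat :: nat \<Rightarrow> 'k))" by (rule range_inj_infinite) (simp add: inj_def)
  ultimately have "infinite {x. poly (p - q) x = 0}" using infinite_super by blast
  thus ?thesis using poly_roots_finite[of "p - q"] by auto
qed

definition choose_poly :: "nat \<Rightarrow> 'k::field_char_0 poly" where
  "choose_poly m = smult (inverse (fact m)) (\<Prod>i<m. [:- of_nat i, 1:])"

lemma poly_choose_poly: "poly (choose_poly m) (of_nat N) = of_nat (N choose m)"
  by (simp add: choose_poly_def poly_prod binomial_gbinomial gbinomial_prod_rev atLeast0LessThan field_simps)

section \<open>Tangent vectors and one-parameter groups\<close>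

locale tangent = fixes d :: nat and H :: "'k::field_char_0 mat set" and v
  assumes tangent: "tangent_vector d H v"
begin

abbreviation reg :: "('k mat \<Rightarrow> 'k) set" where "reg \<equiv> regular_functions d"

lemma
  assumes "p \<in> reg" "q \<in> reg"
  shows v_add: "v (\<lambda>h. p h + q h) = v p + v q"
    and v_mult: "v (\<lambda>h. p h * q h) = p (1\<^sub>m d) * v q + v p * q (1\<^sub>m d)"
  using tangent assms by (auto simp: tangent_vector_def)

lemma v_scale: "p \<in> reg \<Longrightarrow> v (\<lambda>h. c * p h) = c * v p"
  using tangent by (auto simp: tangent_vector_def)

lemma v_const: "v (\<lambda>_. c) = 0"
proof -
  have 1: "(\<lambda>_. 1) \<in> reg" by (rule regular_functions.scalar)
  have "v (\<lambda>_. 1) = 0" using v_mult[OF 1 1] by simp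
  thus ?thesis using v_scale[OF 1, of c] by simp
qed

lemma v_cong: assumes "p \<in> reg" "q \<in> reg" "\<And>h. h \<in> H \<Longrightarrow> p h = q h" shows "v p = v q"
proof -
  have n: "(\<lambda>h. (- 1) * q h) \<in> reg" by (intro regular_functions.mult regular_functions.scalar assms)
  have "(\<lambda>h. p h + (- 1) * q h) \<in> reg" by (rule regular_functions.add[OF assms(1) n])
  hence "v (\<lambda>h. p h + (- 1) * q h) = 0" using tangent assms(3) by (simp add: tangent_vector_def)
  thus ?thesis using v_add[OF assms(1) n] v_scale[OF assms(2), of "- 1"] by simp
qed

end

text \<open>
  The value at the identity, in the direction of \<open>v\<close>, of the differential of a family of elements of \<open>A\<close>.
\<close>

definition (in tangent) differential :: "'k laurent set \<Rightarrow> ('k mat \<Rightarrow> 'k laurent) \<Rightarrow> 'k laurent \<Rightarrow> bool" where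
  "differential A F x \<longleftrightarrow> F \<in> family reg A \<and> x \<in> A \<and>
     (\<forall>m. v (\<lambda>h. Poly_Mapping.lookup (F h) m) = Poly_Mapping.lookup x m)"

context structured_group begin

definition powers :: "'k mat \<Rightarrow> nat \<Rightarrow> 'k mat" where "powers h N = ((*) h ^^ N) (1\<^sub>m d)"

lemma powers_H: "h \<in> H \<Longrightarrow> powers h N \<in> H"
  by (induction N) (auto simp: powers_def one_H H_mult)

text \<open>Newton's forward difference formula along the sequence of powers of
  \<open>h\<close>.\<close>

lemma vanishes_powers:
  assumes h: "h \<in> H"
  shows "vanishes N c \<Longrightarrow> \<exists>b. \<forall>M. c (powers h M) = (\<Sum>m<N. b m * of_nat (M choose m))"
proof (induction N arbitrary: c)
  case 0 thus ?case using powers_H[OF h] by simp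
next
  case (Suc N)
  hence "vanishes N (\<lambda>x. c (h * x) - c x)" using h by simp
  from Suc.IH[OF this] obtain b where
    b: "\<And>M. c (h * powers h M) - c (powers h M) = (\<Sum>m<N. b m * of_nat (M choose m))" by blast
  define b' where "b' = (\<lambda>m. case m of 0 \<Rightarrow> c (powers h 0) | Suc m \<Rightarrow> b m)"
  have shift: "(\<Sum>m<Suc N. b' m * of_nat (M choose m)) = c (powers h 0) + (\<Sum>m<N. b m * of_nat (M choose Suc m))" for M
    by (simp add: sum.lessThan_Suc_shift b'_def del: sum.lessThan_Suc)
  have "c (powers h M) = (\<Sum>m<Suc N. b' m * of_nat (M choose m))" for M
  proof (induction M)
    case 0 show ?case unfolding shift by simp
  next
    case (Suc M)
    have "powers h (Suc M) = h * powers h M" by (simp add: powers_def)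
    thus ?case using Suc.IH b[of M] unfolding shift
      by (simp add: algebra_simps sum.distrib)
  qed
  thus ?case by blast
qed

lemma regular_powers:
  assumes "h \<in> H" "p \<in> regular_functions d"
  shows "\<exists>q. \<forall>N. p (powers h N) = poly q (of_nat N)"
proof -
  from regular_vanishes[OF assms(2)] obtain B where "vanishes B p" by blast
  from vanishes_powers[OF assms(1) this] obtain b where
    b: "\<And>N. p (powers h N) = (\<Sum>m<B. b m * of_nat (N choose m))" by blast
  have "p (powers h N) = poly (\<Sum>m<B. smult (b m) (choose_poly m)) (of_nat N)" for N
    by (simp add: b poly_sum poly_choose_poly)
  thus ?thesis by blast
qed

text \<open>The polynomial \<open>t \<mapsto> p (h ^ t)\<close>. For \<open>h\<close> in
  \<open>H\<close> a regular function depends polynomially on the exponent, which stands in for the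
  one-parameter group through \<open>h\<close>.\<close>

definition power_poly :: "'k mat \<Rightarrow> ('k mat \<Rightarrow> 'k) \<Rightarrow> 'k poly" where
  "power_poly h p = (THE q. \<forall>N. p (powers h N) = poly q (of_nat N))"

lemma power_poly_eqI:
  assumes "\<And>N. p (powers h N) = poly q (of_nat N)" shows "power_poly h p = q"
  unfolding power_poly_def
proof (rule the_equality)
  show "\<forall>N. p (powers h N) = poly q (of_nat N)" using assms by simp
  fix q' assume "\<forall>N. p (powers h N) = poly q' (of_nat N)"
  thus "q' = q" using assms by (intro poly_eq_if_nat_values_eq) simp
qed

lemma power_poly:
  assumes "h \<in> H" "p \<in> regular_functions d"
  shows "p (powers h N) = poly (power_poly h p) (of_nat N)"
proof -
  from regular_powers[OF assms] obtain q where "\<And>N. p (powers h N) = poly q (of_nat N)" by blast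
  thus ?thesis using power_poly_eqI by metis
qed

text \<open>The derivative of \<open>p (h ^ t)\<close> at \<open>t = 0\<close>, that is, the tangent
  vector given by the logarithm of \<open>h\<close>.\<close>

definition velocity :: "'k mat \<Rightarrow> ('k mat \<Rightarrow> 'k) \<Rightarrow> 'k" where
  "velocity h p = coeff (power_poly h p) 1"

lemma velocity_tangent: assumes h: "h \<in> H" shows "tangent_vector d H (velocity h)"
  unfolding tangent_vector_def
proof (intro conjI ballI allI impI)
  note pp = power_poly[OF h]
  fix p :: "'k mat \<Rightarrow> 'k" assume p: "p \<in> regular_functions d"
  have one: "p (1\<^sub>m d) = coeff (power_poly h p) 0" if "p \<in> regular_functions d" for p :: "'k mat \<Rightarrow> 'k"
    using pp[OF that, of 0] by (simp add: powers_def poly_0_coeff_0)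
  have "power_poly h (\<lambda>h. c * p h) = smult c (power_poly h p)" for c
    by (rule power_poly_eqI) (simp add: pp p)
  thus "velocity h (\<lambda>h. c * p h) = c * velocity h p" for c by (simp add: velocity_def)
  have "power_poly h p = 0" if "\<forall>h\<in>H. p h = 0"
    by (rule power_poly_eqI) (simp add: that powers_H h)
  thus "velocity h p = 0" if "\<forall>h\<in>H. p h = 0" using that by (simp add: velocity_def)
  fix q :: "'k mat \<Rightarrow> 'k" assume q: "q \<in> regular_functions d"
  have "power_poly h (\<lambda>h. p h + q h) = power_poly h p + power_poly h q"
    by (rule power_poly_eqI) (simp add: pp p q)
  thus "velocity h (\<lambda>h. p h + q h) = velocity h p + velocity h q" by (simp add: velocity_def)
  have "power_poly h (\<lambda>h. p h * q h) = power_poly h p * power_poly h q"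
    by (rule power_poly_eqI) (simp add: pp p q)
  thus "velocity h (\<lambda>h. p h * q h) = p (1\<^sub>m d) * velocity h q + velocity h p * q (1\<^sub>m d)"
    by (simp add: velocity_def coeff_mult one p q)
qed

lemma lie_of_actionE:
  assumes "D \<in> lie_of_action d H \<theta> A"
  obtains v where "tangent_vector d H v" "\<And>f. f \<notin> A \<Longrightarrow> D f = 0"
    "\<And>f N c g. f \<in> A \<Longrightarrow> coaction_expansion d H \<theta> A f N c g \<Longrightarrow> D f = (\<Sum>l<N. const (v (c l)) * g l)"
  using assms unfolding lie_of_action_def by (simp only: mem_Collect_eq) (elim conjE exE, simp)

lemma lie_of_action_subspace: "endo.subspace (lie_of_action d H \<theta> A)"
proof (rule endo.subspaceI)
  have "tangent_vector d H (\<lambda>_. 0)" by (simp add: tangent_vector_def)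
  thus "0 \<in> lie_of_action d H \<theta> A" unfolding lie_of_action_def by (auto simp: const_def intro!: exI[of _ "\<lambda>_. 0"])
next
  fix x y assume xy: "x \<in> lie_of_action d H \<theta> A" "y \<in> lie_of_action d H \<theta> A"
  from xy(1) obtain v where v: "tangent_vector d H v" "\<And>f. f \<notin> A \<Longrightarrow> x f = 0"
      "\<And>f N c g. f \<in> A \<Longrightarrow> coaction_expansion d H \<theta> A f N c g \<Longrightarrow> x f = (\<Sum>l<N. const (v (c l)) * g l)"
    by (rule lie_of_actionE) blast
  from xy(2) obtain w where w: "tangent_vector d H w" "\<And>f. f \<notin> A \<Longrightarrow> y f = 0"
      "\<And>f N c g. f \<in> A \<Longrightarrow> coaction_expansion d H \<theta> A f N c g \<Longrightarrow> y f = (\<Sum>l<N. const (w (c l)) * g l)"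
    by (rule lie_of_actionE) blast
  have "tangent_vector d H (\<lambda>p. v p + w p)" using v(1) w(1) by (simp add: tangent_vector_def algebra_simps)
  thus "x + y \<in> lie_of_action d H \<theta> A"
    unfolding lie_of_action_def
    by (auto simp: v(2) w(2) v(3) w(3) laurent.scale_left_distrib sum.distrib intro!: exI[of _ "\<lambda>p. v p + w p"])
next
  fix b x assume "x \<in> lie_of_action d H \<theta> A"
  then obtain v where v: "tangent_vector d H v" "\<And>f. f \<notin> A \<Longrightarrow> x f = 0"
      "\<And>f N c g. f \<in> A \<Longrightarrow> coaction_expansion d H \<theta> A f N c g \<Longrightarrow> x f = (\<Sum>l<N. const (v (c l)) * g l)"
    by (rule lie_of_actionE) blast
  have "tangent_vector d H (\<lambda>p. b * v p)" using v(1) by (simp add: tangent_vector_def algebra_simps)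
  moreover have "const b * (\<Sum>l<N. const (v (c l)) * g l) = (\<Sum>l<N. const (b * v (c l)) * g l)" for N c g
    by (simp only: laurent.scale_sum_right laurent.scale_scale)
  ultimately show "endo_scale b x \<in> lie_of_action d H \<theta> A"
    unfolding lie_of_action_def endo_scale_def
    by (auto simp: v(2,3) intro!: exI[of _ "\<lambda>p. b * v p"])
qed

end

locale structured_acyclic = structured_group n k \<rho> A m0 s a e L G d H \<theta> + acyclic_group n k \<rho> A m0 s a e L G
  for n k :: nat and \<rho> :: "nat \<Rightarrow> nat \<Rightarrow> int" and A :: "'k::field_char_0 laurent set" and m0 s a e L G d H \<theta>
begin

lemma \<theta>_powers:
  assumes h: "h \<in> H" and D: "D \<in> block i" and hD: "\<theta> h = Exp D" and f: "f \<in> A"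
  shows "\<theta> (powers h N) f = Exp (endo_scale (of_nat N) D) f"
proof (induction N)
  case 0
  have "Exp (endo_scale (of_nat 0) D) = Exp 0" by (simp only: of_nat_0 endo.scale_zero_left)
  hence "Exp (endo_scale (of_nat 0) D) f = f" using f by (simp only: Exp_0) simp
  thus ?case using \<theta>_one[OF f] by (simp only: powers_def funpow.simps id_apply)
next
  case (Suc N)
  have comm: "bracket D (endo_scale (of_nat N) D) = 0" by (rule block_commute[OF D scale_block[OF D]])
  have "\<theta> (powers h (Suc N)) f = Exp D (Exp (endo_scale (of_nat N) D) f)"
    using \<theta>_mult_apply[OF h powers_H[OF h] f] Suc by (simp add: powers_def hD)
  also have "\<dots> = Exp (D + endo_scale (of_nat N) D) f"
    by (rule Exp_add[symmetric]) (intro L_lowering scale_L subsetD[OF block_L D] comm f)+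
  also have "D + endo_scale (of_nat N) D = endo_scale (of_nat (Suc N)) D"
    by (simp add: endo.scale_left_distrib)
  finally show ?case .
qed

text \<open>Choose \<open>h\<close> with \<open>\<theta> h = Exp (der i f)\<close>. Then
  \<open>h ^ M\<close> acts as the exponential of \<open>M\<close> times \<open>der i f\<close> for
  all natural \<open>M\<close>. Coefficientwise both sides are polynomial in \<open>M\<close>, and
  comparing linear terms identifies \<open>der i f\<close> with the action of
  \<open>velocity h\<close>.\<close>

lemma der_lie_of_action: assumes r: "(i, f) \<in> R" shows "der i f \<in> lie_of_action d H \<theta> A"
proof -
  have "Exp (der i f) \<in> G" by (rule Exp_block_G[OF der_block[OF r]])
  then obtain h where h: "h \<in> H" "\<theta> h = Exp (der i f)" using \<theta>_bij by (auto simp: bij_betw_def)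
  have "der i f x = (\<Sum>l<N. const (velocity h (c l)) * g l)"
    if x: "x \<in> A" and ex: "coaction_expansion d H \<theta> A x N c g" for x N c g
  proof (rule poly_mapping_eqI)
    fix m
    have c: "c l \<in> regular_functions d" if "l < N" for l using ex that by (simp add: coaction_expansion_def)
    from exp_der_sum[OF R_D(1,2)[OF r] x] obtain b where b: "1 \<le> b"
      "\<And>t. exp_derivation A t (der i f) x = (\<Sum>m\<le>b. const (t ^ m) * (const (inverse (fact m)) * (der i f ^^ m) x))" by blast
    define y where "y = (\<lambda>j. Poly_Mapping.lookup (const (inverse (fact j)) * (der i f ^^ j) x) m)"
    have "(\<Sum>l<N. smult (Poly_Mapping.lookup (g l) m) (power_poly h (c l))) = (\<Sum>j\<le>b. monom (y j) j)"
    proof (rule poly_eq_if_nat_values_eq)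
      fix M
      have "(\<Sum>l<N. const (c l (powers h M)) * g l) = \<theta> (powers h M) x"
        using ex powers_H[OF h(1)] by (simp add: coaction_expansion_def)
      also have "\<dots> = exp_derivation A (of_nat M) (der i f) x"
        using \<theta>_powers[OF h(1) der_block[OF r] h(2) x] exp_derivation_Exp[OF R_D(7)[OF r]] by simp
      finally have "Poly_Mapping.lookup (\<Sum>l<N. const (c l (powers h M)) * g l) m
        = Poly_Mapping.lookup (exp_derivation A (of_nat M) (der i f) x) m" by simp
      thus "poly (\<Sum>l<N. smult (Poly_Mapping.lookup (g l) m) (power_poly h (c l))) (of_nat M)
          = poly (\<Sum>j\<le>b. monom (y j) j) (of_nat M)"
        unfolding b(2) lookup_sum poly_sum y_def lookup_const_mult
        by (simp add: power_poly[OF h(1) c] poly_monom mult_ac cong: sum.cong_simp)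
    qed
    hence "coeff (\<Sum>l<N. smult (Poly_Mapping.lookup (g l) m) (power_poly h (c l))) 1 = coeff (\<Sum>j\<le>b. monom (y j) j) 1" by simp
    also have "\<dots> = (\<Sum>j\<le>b. if j = 1 then y 1 else 0)" unfolding coeff_sum by (intro sum.cong) auto
    also have "\<dots> = Poly_Mapping.lookup (der i f x) m" using b(1) by (simp add: y_def const_def)
    finally show "Poly_Mapping.lookup (der i f x) m = Poly_Mapping.lookup (\<Sum>l<N. const (velocity h (c l)) * g l) m"
      unfolding lookup_sum lookup_const_mult velocity_def coeff_sum coeff_smult
      by (simp only: mult.commute)
  qed
  thus ?thesis using velocity_tangent[OF h(1)] unfolding lie_of_action_def
    by (intro CollectI conjI exI[of _ "velocity h"]) (auto simp: root_derivation_outside)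
qed

lemma L_subset_lie_of_action: "L \<subseteq> lie_of_action d H \<theta> A"
proof -
  have "endo.span (ders R) \<subseteq> lie_of_action d H \<theta> A"
    by (rule endo.span_minimal[OF _ lie_of_action_subspace]) (auto simp: ders_def der_lie_of_action)
  thus ?thesis using L_span by blast
qed

end

section \<open>Differentiating the action along a tangent vector\<close>

locale tangent_acyclic = structured_acyclic n k \<rho> A m0 s a e L G d H \<theta> + tangent d H v
  for n k :: nat and \<rho> :: "nat \<Rightarrow> nat \<Rightarrow> int" and A :: "'k::field_char_0 laurent set" and m0 s a e L G d H \<theta> v
begin

text \<open>A tangent vector sees only values on \<open>H\<close>, so a coaction expansion may be
  replaced by another family that agrees with it there.\<close>

lemma differential_unique:
  assumes "differential A F x" "differential A F' x'" "\<And>h. h \<in> H \<Longrightarrow> F h = F' h"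
  shows "x = x'"
proof (rule poly_mapping_eqI)
  fix m
  have "v (\<lambda>h. Poly_Mapping.lookup (F h) m) = v (\<lambda>h. Poly_Mapping.lookup (F' h) m)"
    using assms by (intro v_cong family_lookup[OF regular_function_algebra]) (auto simp: differential_def)
  thus "Poly_Mapping.lookup x m = Poly_Mapping.lookup x' m" using assms(1,2) by (simp add: differential_def)
qed

lemma differential_zero: "differential A (\<lambda>_. 0) 0"
  by (simp add: differential_def family.zero zero_closed v_const)

lemma differential_add:
  assumes "differential A F x" "differential A F' x'"
  shows "differential A (\<lambda>h. F h + F' h) (x + x')"
  using assms family_lookup[OF regular_function_algebra, of F d A] family_lookup[OF regular_function_algebra, of F' d A]
  by (auto simp: differential_def lookup_add add_closed v_add intro: family.add)

lemma differential_sum: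
  "(\<And>i. i \<in> I \<Longrightarrow> differential A (F i) (x i)) \<Longrightarrow> differential A (\<lambda>h. \<Sum>i\<in>I. F i h) (\<Sum>i\<in>I. x i)"
  by (induction I rule: infinite_finite_induct) (auto intro: differential_zero differential_add)

lemma differential_scale:
  assumes F: "differential A F x" and b: "b \<in> reg"
  shows "differential A (\<lambda>h. const (b h) * F h) (const (b (1\<^sub>m d)) * x + const (v b) * F (1\<^sub>m d))"
  unfolding differential_def
proof (intro conjI allI)
  have F': "F \<in> family reg A" "x \<in> A" using F by (auto simp: differential_def)
  show "(\<lambda>h. const (b h) * F h) \<in> family reg A" by (rule family_scale[OF regular_function_algebra F'(1) b])
  show "const (b (1\<^sub>m d)) * x + const (v b) * F (1\<^sub>m d) \<in> A"
    by (intro add_closed const_mult_closed F' family_closed[OF F'(1)])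
  fix m
  show "v (\<lambda>h. Poly_Mapping.lookup (const (b h) * F h) m)
      = Poly_Mapping.lookup (const (b (1\<^sub>m d)) * x + const (v b) * F (1\<^sub>m d)) m"
    using F by (simp add: lookup_const_mult lookup_add differential_def
        v_mult[OF b family_lookup[OF regular_function_algebra F'(1)]])
qed

lemma differential_const: assumes "f \<in> A" shows "differential A (\<lambda>_. f) 0"
proof -
  have "(\<lambda>_::'k mat. const 1 * f) \<in> family reg A" by (rule family.monomial[OF regular_functions.scalar assms])
  thus ?thesis by (simp add: const_def differential_def zero_closed v_const)
qed

lemma differential_der:
  assumes r: "(i, f) \<in> R" and F: "differential A F x"
  shows "differential A (\<lambda>h. der i f (F h)) (der i f x)"
  unfolding differential_def
proof (intro conjI allI)
  have F': "F \<in> family reg A" "x \<in> A" using F by (auto simp: differential_def)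
  show "(\<lambda>h. der i f (F h)) \<in> family reg A" by (rule family_derivation[OF R_D(7)[OF r] F'(1)])
  show "der i f x \<in> A" by (rule derivationD(2)[OF R_D(7)[OF r] F'(2)])
  fix m
  show "v (\<lambda>h. Poly_Mapping.lookup (der i f (F h)) m) = Poly_Mapping.lookup (der i f x) m"
    using F by (simp add: lookup_root_derivation[OF family_closed[OF F'(1)]] lookup_root_derivation[OF F'(2)]
        v_scale[OF family_lookup[OF regular_function_algebra F'(1)]] differential_def)
qed

lemma comb_zero: "(\<And>f. (i, f) \<in> R \<Longrightarrow> t f = 0) \<Longrightarrow> comb t i = 0"
  unfolding comb_def by (intro sum.neutral) auto

context
  fixes \<tau> :: "'k mat \<Rightarrow> (nat \<Rightarrow> int) \<Rightarrow> 'k"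
  assumes \<tau>_reg: "\<And>i f. (i, f) \<in> R \<Longrightarrow> (\<lambda>h. \<tau> h f) \<in> reg"
    and \<tau>_one: "\<And>i f. (i, f) \<in> R \<Longrightarrow> \<tau> (1\<^sub>m d) f = 0"
begin

definition dparam :: "(nat \<Rightarrow> int) \<Rightarrow> 'k" where "dparam f = v (\<lambda>h. \<tau> h f)"

lemma comb_one: "comb (\<tau> (1\<^sub>m d)) i = 0" by (rule comb_zero) (rule \<tau>_one)

lemma differential_comb:
  assumes F: "differential A F x"
  shows "differential A (\<lambda>h. comb (\<tau> h) i (F h)) (comb dparam i (F (1\<^sub>m d)))"
  unfolding comb_apply
proof (rule differential_sum)
  fix f assume "f \<in> {f. (i, f) \<in> R}"
  hence r: "(i, f) \<in> R" by simp
  from differential_scale[OF differential_der[OF r F] \<tau>_reg[OF r]]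
  show "differential A (\<lambda>h. const (\<tau> h f) * der i f (F h)) (const (dparam f) * der i f (F (1\<^sub>m d)))"
    by (simp add: \<tau>_one[OF r] dparam_def const_def)
qed

text \<open>The parameters vanish at the identity, so powers of \<open>comb (\<tau> h) i\<close>
  beyond the first have zero differential there; the linear term contributes
  \<open>comb dparam i\<close> at the value of \<open>F\<close>.\<close>

lemma differential_op_exp:
  assumes F: "differential A F x"
  shows "differential A (\<lambda>h. laurent.op_exp (comb (\<tau> h) i) (F h)) (x + comb dparam i (F (1\<^sub>m d)))"
proof -
  have F': "F \<in> family reg A" using F by (simp add: differential_def)
  obtain c0 where "\<And>h. F h \<in> Fil c0" using family_bounded[OF F'] by blast
  \<comment> \<open>Two extra steps, so that the orders zero and one always occur in the truncated
    series.\<close>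
  hence c: "F h \<in> Fil (Suc (Suc c0))" for h using F.V_mono[of c0 "Suc (Suc c0)"] by auto
  define y where "y = (\<lambda>m::nat. if m = 0 then x else if m = 1 then comb dparam i (F (1\<^sub>m d)) else 0)"
  have pow: "differential A (\<lambda>h. (comb (\<tau> h) i ^^ m) (F h)) (y m)" for m
  proof (induction m)
    case 0 thus ?case using F by (simp add: y_def)
  next
    case (Suc m)
    have "comb dparam i 0 = 0" by (simp add: comb_apply root_derivation_def zero_closed)
    hence "comb dparam i ((comb (\<tau> (1\<^sub>m d)) i ^^ m) (F (1\<^sub>m d))) = y (Suc m)"
      by (cases m) (simp_all add: y_def comb_one)
    with differential_comb[OF Suc, of i] show ?case by simp
  qed
  have "differential A (\<lambda>h. const (inverse (fact m)) * (comb (\<tau> h) i ^^ m) (F h)) (const (inverse (fact m)) * y m)" for m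
    using differential_scale[OF pow[of m] regular_functions.scalar[of "inverse (fact m)"]]
    by (simp add: v_const)
  hence "differential A (\<lambda>h. \<Sum>m<Suc (Suc c0). const (inverse (fact m)) * (comb (\<tau> h) i ^^ m) (F h))
      (\<Sum>m<Suc (Suc c0). const (inverse (fact m)) * y m)" by (rule differential_sum)
  moreover have "(\<Sum>m<Suc (Suc c0). const (inverse (fact m)) * y m) = x + comb dparam i (F (1\<^sub>m d))"
    by (simp add: sum.lessThan_Suc_shift y_def const_def del: sum.lessThan_Suc)
  moreover have "laurent.op_exp (comb (\<tau> h) i) (F h) = (\<Sum>m<Suc (Suc c0). const (inverse (fact m)) * (comb (\<tau> h) i ^^ m) (F h))" for h
    unfolding F.op_exp_sum[OF comb_lowering c le_refl] laurent.divided_power_def ..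
  ultimately show ?thesis by (simp only:)
qed

lemma opr_one: "opr is (\<tau> (1\<^sub>m d)) f = f"
  by (induction "is") (simp_all add: comb_one zero_fun_def F.op_exp_zero)

lemma differential_opr:
  assumes f: "f \<in> A"
  shows "distinct is \<Longrightarrow> differential A (\<lambda>h. opr is (\<tau> h) f) (\<Sum>i\<in>set is. comb dparam i f)"
proof (induction "is")
  case Nil show ?case by (simp add: differential_const f)
next
  case (Cons i "is")
  hence "differential A (\<lambda>h. opr is (\<tau> h) f) (\<Sum>i\<in>set is. comb dparam i f)" by simp
  from differential_op_exp[OF this, of i] show ?case using Cons.prems by (simp add: opr_one add.commute)
qed

end

text \<open>For an arbitrary structure the coordinates are regular because the coaction expands
  \<open>\<theta> h \<chi>0\<close> with regular coefficients. At the identity they equal the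
  coordinates of the zero parameters, so injectivity forces the parameters to vanish.\<close>

lemma param_regular:
  obtains \<tau> where "\<And>i f. (i, f) \<in> R \<Longrightarrow> (\<lambda>h. \<tau> h f) \<in> reg" "\<And>i f. (i, f) \<in> R \<Longrightarrow> \<tau> (1\<^sub>m d) f = 0"
    "\<And>h f. h \<in> H \<Longrightarrow> f \<in> A \<Longrightarrow> \<theta> h f = act (\<tau> h) f"
proof -
  have "\<exists>t. \<theta> h = restrict (act t) A" if "h \<in> H" for h using \<theta>_G[OF that] G_act by blast
  then obtain t where t: "\<And>h. h \<in> H \<Longrightarrow> \<theta> h = restrict (act (t h)) A" by metis
  from coaction[OF \<chi>0_A] obtain N c g where "coaction_expansion d H \<theta> A \<chi>0 N c g" by blast
  hence c: "\<And>l. l < N \<Longrightarrow> c l \<in> reg" "\<And>h. h \<in> H \<Longrightarrow> \<theta> h \<chi>0 = (\<Sum>l<N. const (c l h) * g l)"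
    by (simp_all add: coaction_expansion_def)
  have "(\<lambda>h. t h f) \<in> regular_on d H" if "(i, f) \<in> R" for i f
  proof (rule coord_determines[OF regular_on_algebra _ that])
    fix j f'
    show "(\<lambda>h. coord (t h) f') \<in> regular_on d H"
    proof (rule regular_onI)
      show "(\<lambda>h. \<Sum>l<N. c l h * Poly_Mapping.lookup (g l) (m0 + f')) \<in> reg"
        by (intro function_algebra_sum[OF regular_function_algebra] regular_functions.mult regular_functions.scalar c) simp
      fix h assume h: "h \<in> H"
      have "act (t h) \<chi>0 = (\<Sum>l<N. const (c l h) * g l)" using c(2)[OF h] t[OF h] \<chi>0_A by simp
      thus "coord (t h) f' = (\<Sum>l<N. c l h * Poly_Mapping.lookup (g l) (m0 + f'))"
        by (simp add: coord_def lookup_sum lookup_const_mult)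
    qed
  qed
  hence ex: "\<exists>p. p \<in> reg \<and> (\<forall>h\<in>H. t h f = p h)" if "(i, f) \<in> R" for i f
    unfolding regular_on_def using that by (simp only: mem_Collect_eq) blast
  define p where "p = (\<lambda>f. SOME p. p \<in> reg \<and> (\<forall>h\<in>H. t h f = p h))"
  have p: "p f \<in> reg \<and> (\<forall>h\<in>H. t h f = p f h)" if "(i, f) \<in> R" for i f
    unfolding p_def by (rule someI_ex[OF ex[OF that]])
  have pt: "p f h = t h f" if "h \<in> H" "(i, f) \<in> R" for h i f using p[OF that(2)] that(1) by simp
  have act0: "act (\<lambda>_. 0) \<chi>0 = \<chi>0"
  proof -
    have "comb (\<lambda>_. 0) i = 0" for i by (rule comb_zero) simp
    hence "opr is (\<lambda>_. 0) \<chi>0 = \<chi>0" for "is" by (induction "is") (simp_all add: zero_fun_def F.op_exp_zero)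
    thus ?thesis by (simp add: act_def)
  qed
  have act1: "act (t (1\<^sub>m d)) \<chi>0 = \<chi>0" using \<theta>_one[OF \<chi>0_A] t[OF one_H] \<chi>0_A by simp
  show thesis
  proof (rule that[of "\<lambda>h f. p f h"])
    show "(\<lambda>h. p f h) \<in> reg" if "(i, f) \<in> R" for i f using p[OF that] by simp
    show "p f (1\<^sub>m d) = 0" if "(i, f) \<in> R" for i f
    proof -
      have "t (1\<^sub>m d) f = (\<lambda>_. 0) f" by (rule coord_inj[OF _ that]) (simp only: coord_def act0 act1)
      thus ?thesis using pt[OF one_H that] by simp
    qed
    show "\<theta> h f = act (\<lambda>f. p f h) f" if "h \<in> H" "f \<in> A" for h f
      using t[OF that(1)] that(2) act_cong[of "\<lambda>f. p f h" "t h" f] pt[OF that(1)] by simp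
  qed
qed

lemma differential_of_expansion:
  assumes "\<And>l. l < N \<Longrightarrow> c l \<in> reg \<and> g l \<in> A"
  shows "differential A (\<lambda>h. \<Sum>l<N. const (c l h) * g l) (\<Sum>l<N. const (v (c l)) * g l)"
proof (rule differential_sum)
  fix l assume "l \<in> {..<N}"
  hence l: "c l \<in> reg" "g l \<in> A" using assms by auto
  from differential_scale[OF differential_const[OF l(2)] l(1)]
  show "differential A (\<lambda>h. const (c l h) * g l) (const (v (c l)) * g l)" by simp
qed

text \<open>The coaction expansion of \<open>f\<close> and the family
  \<open>act (\<tau> h) f\<close> agree on \<open>H\<close>, so their differentials agree. Hence
  \<open>D f\<close> is the sum of the \<open>comb (dparam \<tau>) i f\<close>, whose coefficients
  do not depend on \<open>f\<close>, and \<open>D\<close> is a combination of root derivations in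
  \<open>L\<close>.\<close>

lemma lie_of_action_L:
  assumes D: "\<And>f. f \<notin> A \<Longrightarrow> D f = 0"
    "\<And>f N c g. f \<in> A \<Longrightarrow> coaction_expansion d H \<theta> A f N c g \<Longrightarrow> D f = (\<Sum>l<N. const (v (c l)) * g l)"
  shows "D \<in> L"
proof -
  obtain \<tau> where \<tau>: "\<And>i f. (i, f) \<in> R \<Longrightarrow> (\<lambda>h. \<tau> h f) \<in> reg" "\<And>i f. (i, f) \<in> R \<Longrightarrow> \<tau> (1\<^sub>m d) f = 0"
    "\<And>h f. h \<in> H \<Longrightarrow> f \<in> A \<Longrightarrow> \<theta> h f = act (\<tau> h) f" by (rule param_regular) blast
  have "D f = (\<Sum>i\<in>{1..k}. comb (dparam \<tau>) i) f" for f
  proof (cases "f \<in> A")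
    case False
    thus ?thesis by (simp add: D(1) sum_apply_laurent comb_apply root_derivation_outside)
  next
    case True
    from coaction[OF True] obtain N c g where ex: "coaction_expansion d H \<theta> A f N c g" by blast
    have "differential A (\<lambda>h. \<Sum>l<N. const (c l h) * g l) (D f)"
      unfolding D(2)[OF True ex] using ex by (intro differential_of_expansion) (simp add: coaction_expansion_def)
    moreover have "differential A (\<lambda>h. act (\<tau> h) f) (\<Sum>i\<in>{1..k}. comb (dparam \<tau>) i f)"
      unfolding act_def ray_order(2)[symmetric] by (rule differential_opr[OF \<tau>(1,2) True ray_order(1)])
    moreover have "(\<Sum>l<N. const (c l h) * g l) = act (\<tau> h) f" if "h \<in> H" for h
      using ex \<tau>(3)[OF that True] that by (simp add: coaction_expansion_def)
    ultimately show ?thesis unfolding sum_apply_laurent by (rule differential_unique)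
  qed
  hence "D = (\<Sum>i\<in>{1..k}. comb (dparam \<tau>) i)" by (rule ext)
  thus ?thesis using endo.subspace_sum[OF L_subspace comb_L] by simp
qed

end

context structured_acyclic begin

theorem lie_of_action_eq: "lie_of_action d H \<theta> A = L"
proof (intro equalityI L_subset_lie_of_action subsetI)
  fix D assume "D \<in> lie_of_action d H \<theta> A"
  then obtain v where v: "tangent_vector d H v" and D: "\<And>f. f \<notin> A \<Longrightarrow> D f = 0"
      "\<And>f N c g. f \<in> A \<Longrightarrow> coaction_expansion d H \<theta> A f N c g \<Longrightarrow> D f = (\<Sum>l<N. const (v (c l)) * g l)"
    by (rule lie_of_actionE) blast
  interpret tangent_acyclic n k \<rho> A m0 s a e L G d H \<theta> v by unfold_locales (rule v)
  show "D \<in> L" by (rule lie_of_action_L[OF D])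
qed

end

theorem proposition4p8:
  fixes n k r s :: nat
    and \<Delta> :: "(nat \<Rightarrow> rat) set"
    and \<rho> :: "nat \<Rightarrow> nat \<Rightarrow> int"
    and a :: "nat \<Rightarrow> nat"
    and e :: "nat \<Rightarrow> nat \<Rightarrow> int"
    and A :: "'k::{alg_closed_field, field_char_0} laurent set"
    and D :: "nat \<Rightarrow> 'k endo"
    and L G :: "'k endo set"
  assumes cone: "rational_polyhedral_cone n \<Delta>" "pointed \<Delta>"
    and no_torus_factor: "full_dimensional n \<Delta>"
    and rays: "bij_betw \<rho> {1..k} (ray_generators n \<Delta>)"
    and ring: "A = toric_ring n \<Delta>"
    and roots: "\<forall>i\<in>{1..s}. a i \<in> {1..k} \<and> e i \<in> demazure_roots n k \<rho> (a i)"
    and derivs: "\<forall>i\<in>{1..s}. D i = root_derivation n A (\<rho> (a i)) (e i)"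
    and group: "G = generate (aut_group A) (\<Union>i\<in>{1..s}. root_subgroup A (D i))"
    and liealg: "L = lie_generated A (D ` {1..s})"
    and numbering: "r \<le> k" "\<forall>i\<in>{1..k}. roots_in n k \<rho> A L i \<noteq> {} \<longleftrightarrow> i \<le> r"
  shows
    "(\<not> has_two_cycle n k \<rho> A L \<longleftrightarrow>
        \<not> has_oriented_cycle (root_graph n k r \<rho> A L) \<and>
        \<not> has_bidirected_edge (root_graph n k r \<rho> A L)) \<and>
     (\<not> has_two_cycle n k \<rho> A L \<longleftrightarrow> finite_dimensional L \<and> lie_nilpotent L) \<and>
     (\<not> has_two_cycle n k \<rho> A L \<longleftrightarrow> (\<exists>d H \<phi>. unipotent_structure d H \<phi> A G)) \<and>
     (\<forall>d H \<phi>. unipotent_structure d H \<phi> A G \<longrightarrow> lie_of_action d H \<phi> A = L)"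
proof -
  interpret pointed_cone n \<Delta> by unfold_locales (fact cone)+
  have rays': "\<rho> ` {1..k} = ray_generators n \<Delta>" using rays by (simp add: bij_betw_def)
  obtain m0 where m0: "m0 \<in> int_lattice n" "\<And>i. i \<in> {1..k} \<Longrightarrow> 0 < pairing n (\<rho> i) m0"
    using interior_dual_point[of "{1..k}" \<rho>] rays' by auto
  have "A = {f. Poly_Mapping.keys f \<subseteq> {m \<in> int_lattice n. \<forall>i\<in>{1..k}. 0 \<le> pairing n (\<rho> i) m}}"
    unfolding ring toric_ring_def dual_lattice_points_eq rays'[symmetric] by simp
  then interpret toric n k \<rho> A m0 by unfold_locales (use m0 in auto)
  have D: "D ` {1..s} = (\<lambda>l. root_derivation n A (\<rho> (a l)) (e l)) ` {1..s}"
    using derivs by (intro image_cong) auto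
  have L': "L = lie_generated A ((\<lambda>l. root_derivation n A (\<rho> (a l)) (e l)) ` {1..s})"
    using liealg unfolding D .
  have G': "G = generate (aut_group A) (\<Union>l\<in>{1..s}. root_subgroup A (root_derivation n A (\<rho> (a l)) (e l)))"
    unfolding group using derivs by (intro arg_cong[of _ _ "generate (aut_group A)"] SUP_cong) auto
  interpret root_group n k \<rho> A m0 s a e L G
    by unfold_locales (use roots in blast, fact L', fact G')
  have group_iff: "\<not> has_two_cycle n k \<rho> A L \<longleftrightarrow> (\<exists>d H \<phi>. unipotent_structure d H \<phi> A G)"
  proof
    assume acyclic: "\<not> has_two_cycle n k \<rho> A L"
    interpret acyclic_group n k \<rho> A m0 s a e L G by unfold_locales (fact acyclic, fact G')
    show "\<exists>d H \<phi>. unipotent_structure d H \<phi> A G" by (rule exists_unipotent_structure)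
  next
    assume "\<exists>d H \<phi>. unipotent_structure d H \<phi> A G"
    then obtain d H \<phi> where "unipotent_structure d H \<phi> A G" by blast
    then interpret structured_group n k \<rho> A m0 s a e L G d H \<phi> by unfold_locales
    show "\<not> has_two_cycle n k \<rho> A L" by (rule no_two_cycle_if_unipotent)
  qed
  have lie: "lie_of_action d H \<phi> A = L" if "unipotent_structure d H \<phi> A G" for d H \<phi>
  proof -
    interpret structured_group n k \<rho> A m0 s a e L G d H \<phi> by unfold_locales (rule that)
    interpret structured_acyclic n k \<rho> A m0 s a e L G d H \<phi>
      by unfold_locales (fact no_two_cycle_if_unipotent, fact G')
    show ?thesis by (rule lie_of_action_eq)
  qed
  show ?thesis
    using graph_iff_no_two_cycle[OF numbering] nilpotent_iff_no_two_cycle group_iff lie by blast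
qed

end
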